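(* There exist constants $C,c,\alpha_0>0$ such that for all $\alpha\in\mathbb{R}$ with $|\alpha|\ge\alpha_0$ the semigroup $\{e^{tL_\alpha}\}_{t\ge0}$ generated by $L_\alpha$ in $L^2_0(\mathbb{T}^2)$ satisfies, for every $l\in\mathbb{Z}\setminus\{0\}$ and $f\in L^2_0(\mathbb{T}^2)$, $$\|\mathbb{Q}\mathcal{P}_le^{tL_\alpha}f\|_{L^2(\mathbb{T}^2)}\le\begin{cases}2e^{-\frac12(2l^2-1)t}\,\|\mathbb{Q}\mathcal{P}_lf\|_{L^2(\mathbb{T}^2)}, & t>0,\\ C e^{-c|\alpha l|^{1/2}t}\,\|\mathbb{Q}\mathcal{P}_lf\|_{L^2(\mathbb{T}^2)}, & t\ge|\alpha l|^{-1/2},\end{cases}$$ while for $|l|=1$ and all $t>0$, $$\|(I-\mathbb{Q})\mathcal{P}_le^{tL_\alpha}f\|_{L^2(\mathbb{T}^2)}\le C|\alpha|^{1/3}\,\big|\log|\alpha|\big|\,e^{-t/2}\,\|\mathbb{Q}\mathcal{P}_lf\|_{L^2(\mathbb{T}^2)}+e^{-t}\,\|(I-\mathbb{Q})\mathcal{P}_lf\|_{L^2(\mathbb{T}^2)}.$$ Here $C$ and $c$ are independent of $\alpha$, $l$, $f$ (and $t$).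
   Context: $\mathbb{T}=\mathbb{R}/2\pi\mathbb{Z}$, with coordinates $(x,y)\in\mathbb{T}^2$. $L^2_0(\mathbb{T}^2)=\{\omega\in L^2(\mathbb{T}^2):\int_0^{2\pi}\omega(x,y)\,dx=0\ \text{for a.e. }y\}$ (complex valued). $A=\Delta=\partial_x^2+\partial_y^2$ in $L^2_0(\mathbb{T}^2)$ with domain $W^{2,2}(\mathbb{T}^2)\cap L^2_0(\mathbb{T}^2)$. $M_{\sin y}$ is multiplication by $\sin y$, and $\hat\Lambda=-i\partial_xM_{\sin y}(I+A^{-1})$ in $L^2_0(\mathbb{T}^2)$ with domain $\{\omega\in L^2_0(\mathbb{T}^2):\partial_xM_{\sin y}\omega\in L^2_0(\mathbb{T}^2)\}$. For $\alpha\in\mathbb{R}$, $L_\alpha=A-i\alpha\hat\Lambda$ with domain $D(A)$. $(\mathcal{P}_l\omega)(x,y)=\frac1{2\pi}\int_0^{2\pi}\omega(s,y)e^{-ils}\,ds\;e^{ilx}$ for $l\in\mathbb{Z}$. $Y=\{\omega\in L^2_0(\mathbb{T}^2):\int_0^{2\pi}(\mathcal{P}_l\omega)(x,y)\,dy=0\text{ for }|l|=1\text{ and all }x\in\mathbb{T}\}$, i.e. the orthogonal complement of $\{a\cos x+b\sin x:a,b\in\mathbb{C}\}$ in $L^2_0(\mathbb{T}^2)$; $\mathbb{Q}$ is the orthogonal projection of $L^2_0(\mathbb{T}^2)$ onto $Y$. *)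

theory Defs
  imports "HOL-Analysis.Analysis"
begin

text \<open>
  The torus is modelled by its fundamental domain \<open>[0, 2\<pi>)\<^sup>2\<close>. Elements of
  \<open>L\<^sup>2\<close> are represented by Borel functions, identified up to equality almost everywhere; every
  notion below is invariant under this identification. Unbounded operators are given by their
  graphs, again closed under almost everywhere equality in both components.
\<close>

type_synonym fn = "real \<times> real \<Rightarrow> complex"

definition circle :: "real measure" where
  "circle = restrict_space lborel {0..<2 * pi}"

definition torus :: "(real \<times> real) measure" where
  "torus = circle \<Otimes>\<^sub>M circle"

definition ae_eq :: "fn \<Rightarrow> fn \<Rightarrow> bool" (infix "\<approx>" 50) where
  "f \<approx> g \<longleftrightarrow> (AE p in torus. f p = g p)"

definition L2 :: "fn set" where
  "L2 = {f \<in> borel_measurable torus. integrable torus (\<lambda>p. (cmod (f p))\<^sup>2)}"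

definition l2norm :: "fn \<Rightarrow> real" where
  "l2norm f = sqrt (LINT p|torus. (cmod (f p))\<^sup>2)"

definition l2inner :: "fn \<Rightarrow> fn \<Rightarrow> complex" where
  "l2inner f g = (LINT p|torus. f p * cnj (g p))"

definition L20 :: "fn set" where
  "L20 = {f \<in> L2. AE y in circle. (LINT x|circle. f (x, y)) = 0}"

text \<open>
  \<open>test_jet D\<close>: the function \<open>D 0 0\<close> is smooth and \<open>2\<pi>\<close>-periodic in both variables on the plane,
  and \<open>D m n\<close> is its partial derivative of order \<open>m\<close> in \<open>x\<close> and \<open>n\<close> in \<open>y\<close>.
\<close>

definition test_jet :: "(nat \<Rightarrow> nat \<Rightarrow> fn) \<Rightarrow> bool" where
  "test_jet D \<longleftrightarrow>
     (\<forall>x y. D 0 0 (x + 2 * pi, y) = D 0 0 (x, y) \<and> D 0 0 (x, y + 2 * pi) = D 0 0 (x, y)) \<and>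
     (\<forall>m n. continuous_on UNIV (D m n)) \<and>
     (\<forall>m n x y. ((\<lambda>s. D m n (s, y)) has_vector_derivative D (Suc m) n (x, y)) (at x)) \<and>
     (\<forall>m n x y. ((\<lambda>s. D m n (x, s)) has_vector_derivative D m (Suc n) (x, y)) (at y))"

text \<open>\<open>weak_deriv m n f g\<close>: \<open>\<partial>\<^sub>x\<^sup>m \<partial>\<^sub>y\<^sup>n f = g\<close> in the sense of distributions on the torus,
  with \<open>f\<close> and \<open>g\<close> in \<open>L\<^sup>2\<close>.\<close>

definition weak_deriv :: "nat \<Rightarrow> nat \<Rightarrow> fn \<Rightarrow> fn \<Rightarrow> bool" where
  "weak_deriv m n f g \<longleftrightarrow> f \<in> L2 \<and> g \<in> L2 \<and>
     (\<forall>D. test_jet D \<longrightarrow>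
        (LINT p|torus. f p * D m n p) = (-1) ^ (m + n) * (LINT p|torus. g p * D 0 0 p))"

definition W22 :: "fn set" where
  "W22 = {f \<in> L2. \<forall>m n. m + n \<le> 2 \<longrightarrow> (\<exists>g. weak_deriv m n f g)}"

definition opA :: "(fn \<times> fn) set" where
  "opA = {(f, g). f \<in> W22 \<inter> L20 \<and> g \<in> L20 \<and>
     (\<exists>fxx fyy. weak_deriv 2 0 f fxx \<and> weak_deriv 0 2 f fyy \<and> g \<approx> (\<lambda>p. fxx p + fyy p))}"

definition Msin :: "fn \<Rightarrow> fn" where
  "Msin f = (\<lambda>(x, y). of_real (sin y) * f (x, y))"

definition dom_Lambda :: "fn set" where
  "dom_Lambda = {f \<in> L20. \<exists>h \<in> L20. weak_deriv 1 0 (Msin f) h}"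

definition opLambda :: "(fn \<times> fn) set" where
  "opLambda = {(f, g). f \<in> dom_Lambda \<and> g \<in> L20 \<and>
     (\<exists>\<psi> h. (f, \<psi>) \<in> opA\<inverse> \<and> weak_deriv 1 0 (Msin (\<lambda>p. f p + \<psi> p)) h \<and>
            g \<approx> (\<lambda>p. - \<i> * h p))}"

definition opL :: "real \<Rightarrow> (fn \<times> fn) set" where
  "opL \<alpha> = {(f, g). g \<in> L20 \<and>
     (\<exists>a b. (f, a) \<in> opA \<and> (f, b) \<in> opLambda \<and> g \<approx> (\<lambda>p. a p - \<i> * of_real \<alpha> * b p))}"

text \<open>Strongly continuous semigroups of bounded linear operators on \<open>L20\<close>. Linearity together
  with boundedness makes each \<open>S t\<close> compatible with almost everywhere equality.\<close>

definition C0_semigroup :: "(real \<Rightarrow> fn \<Rightarrow> fn) \<Rightarrow> bool" where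
  "C0_semigroup S \<longleftrightarrow>
     (\<forall>t\<ge>0. \<forall>f\<in>L20. S t f \<in> L20) \<and>
     (\<forall>t\<ge>0. \<forall>f\<in>L20. \<forall>g\<in>L20. \<forall>a b.
        S t (\<lambda>p. a * f p + b * g p) \<approx> (\<lambda>p. a * S t f p + b * S t g p)) \<and>
     (\<forall>t\<ge>0. \<exists>K. \<forall>f\<in>L20. l2norm (S t f) \<le> K * l2norm f) \<and>
     (\<forall>f\<in>L20. S 0 f \<approx> f) \<and>
     (\<forall>s\<ge>0. \<forall>t\<ge>0. \<forall>f\<in>L20. S (s + t) f \<approx> S s (S t f)) \<and>
     (\<forall>f\<in>L20. ((\<lambda>t. l2norm (\<lambda>p. S t f p - f p)) \<longlongrightarrow> 0) (at_right 0))"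

definition generator :: "(real \<Rightarrow> fn \<Rightarrow> fn) \<Rightarrow> (fn \<times> fn) set" where
  "generator S = {(f, g). f \<in> L20 \<and> g \<in> L20 \<and>
     ((\<lambda>t. l2norm (\<lambda>p. (S t f p - f p) / of_real t - g p)) \<longlongrightarrow> 0) (at_right 0)}"

definition generates :: "(fn \<times> fn) set \<Rightarrow> (real \<Rightarrow> fn \<Rightarrow> fn) \<Rightarrow> bool" where
  "generates G S \<longleftrightarrow> C0_semigroup S \<and> generator S = G"

definition P :: "int \<Rightarrow> fn \<Rightarrow> fn" where
  "P l f = (\<lambda>(x, y). 1 / (2 * of_real pi)
     * (LINT s|circle. f (s, y) * exp (- \<i> * of_int l * of_real s)) * exp (\<i> * of_int l * of_real x))"

definition Y :: "fn set" where
  "Y = {f \<in> L20. \<forall>l x. \<bar>l\<bar> = 1 \<longrightarrow> (LINT y|circle. P l f (x, y)) = 0}"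

text \<open>A representative of the orthogonal projection of \<open>f\<close> onto \<open>V\<close>; for a closed subspace \<open>V\<close> it is
  unique up to almost everywhere equality.\<close>

definition orth_proj :: "fn set \<Rightarrow> fn \<Rightarrow> fn" where
  "orth_proj V f = (SOME g. g \<in> V \<and> (\<forall>h\<in>V. l2inner (\<lambda>p. f p - g p) h = 0))"

definition Q :: "fn \<Rightarrow> fn" where
  "Q = orth_proj Y"

end

theory Submission
  imports Defs
begin

text \<open>
  In Fourier variables the mode \<open>l\<close> of \<open>L\<^sub>\<alpha>\<close> is the tridiagonal system \<open>lat l (\<alpha> l)\<close> on sequences
  indexed by \<open>k\<close>. The decay estimates are obtained there: first for rapidly decreasing data, where
  the energy weighted by \<open>1 - 1/(l\<^sup>2 + k\<^sup>2)\<close> annihilates the nonlocal transport term and a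
  hypocoercive Lyapunov functional built from commutators with \<open>cos y\<close> gives the rate
  \<open>\<bar>\<alpha> l\<bar>\<^sup>1\<^sup>/\<^sup>2\<close>, then for square summable data by truncation. A domain element of any semigroup
  generated by \<open>L\<^sub>\<alpha>\<close> has Fourier coefficients that solve this system, whose bounded solutions are
  unique, so that every such semigroup is the one defined by the system.
\<close>

text \<open>For l \<noteq> 0 the weight 1 - 1/(l^2 + k^2) vanishes exactly at |l| = 1, k = 0. The
  energy therefore controls only the part seen by Q, for which the estimates close, while the
  coefficient at k = 0 is merely driven by that part through a coupling of size |b|. Bounding it
  with a loss of only |\<alpha>| to the power 1/3 needs its own argument, and the boundedness of the
  constructed semigroup on all of \<open>L20\<close> rests on it too, so that even existence is
  shown for large |\<alpha>|. The nonlocal factor I + A^{-1} disturbs the usual computation in which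
  the commutator with the transport yields the norm of cos y v: here it yields the form
  \<open>Zf\<close> of H^{-1} type, whose coercivity has to be proved. The exponent 1/2 comes from
  the critical points of sin y, where cos y v gives no control and has to be traded against the
  y-derivative (\<open>norm_le_cos_deriv\<close>). An arbitrary generated semigroup comes with a
  bound for each separate time only, so a bound uniform over small times must precede any
  differentiation of its orbits.\<close>

lemma summable_on_int_inverse_square:
  "(\<lambda>k::int. 1 / (1 + \<bar>real_of_int k\<bar>)\<^sup>2) summable_on UNIV"
proof -
  have s: "summable (\<lambda>n. 1 / (1 + real n)\<^sup>2)"
    using inverse_squares_sums by (auto simp: sums_iff add.commute)
  have n: "(\<lambda>n::nat. 1 / (1 + real n)\<^sup>2) summable_on UNIV"
    using s by (intro norm_summable_imp_summable_on) simp
  have pos: "(\<lambda>k::int. 1 / (1 + \<bar>real_of_int k\<bar>)\<^sup>2) summable_on range int"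
    using n by (subst summable_on_reindex) (auto simp: o_def inj_on_def)
  have neg: "(\<lambda>k::int. 1 / (1 + \<bar>real_of_int k\<bar>)\<^sup>2) summable_on range (\<lambda>n. - int n)"
    using n by (subst summable_on_reindex) (auto simp: o_def inj_on_def)
  have "k \<in> range int \<union> range (\<lambda>n. - int n)" for k :: int
    by (cases k rule: int_cases2) auto
  then have "(UNIV :: int set) = range int \<union> range (\<lambda>n. - int n)"
    by blast
  with summable_on_union[OF pos neg] show ?thesis by simp
qed

section \<open>Rapidly decreasing sequences as a real inner product space\<close>

definition rapid :: "(int \<Rightarrow> complex) \<Rightarrow> bool" where
  "rapid u \<longleftrightarrow> (\<forall>p::nat. \<exists>K. \<forall>k. (1 + \<bar>real_of_int k\<bar>) ^ p * cmod (u k) \<le> K)"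

lemma rapidD:
  assumes "rapid u"
  obtains K where "K \<ge> 0" "\<And>k. (1 + \<bar>real_of_int k\<bar>) ^ p * cmod (u k) \<le> K"
proof -
  from assms obtain K where K: "\<And>k. (1 + \<bar>real_of_int k\<bar>) ^ p * cmod (u k) \<le> K"
    unfolding rapid_def by blast
  have "0 \<le> (1 + \<bar>real_of_int 0\<bar>) ^ p * cmod (u 0)" by simp
  also have "\<dots> \<le> K" by (rule K)
  finally show ?thesis using K that by blast
qed

lemma rapid_zero: "rapid (\<lambda>k. 0)"
  unfolding rapid_def by auto

lemma rapid_add:
  assumes "rapid u" "rapid v" shows "rapid (\<lambda>k. u k + v k)"
  unfolding rapid_def
proof
  fix p
  obtain K where K: "\<And>k. (1 + \<bar>real_of_int k\<bar>) ^ p * cmod (u k) \<le> K"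
    using rapidD[OF assms(1)] by metis
  obtain K' where K': "\<And>k. (1 + \<bar>real_of_int k\<bar>) ^ p * cmod (v k) \<le> K'"
    using rapidD[OF assms(2)] by metis
  have "(1 + \<bar>real_of_int k\<bar>) ^ p * cmod (u k + v k) \<le> K + K'" for k
  proof -
    have "(1 + \<bar>real_of_int k\<bar>) ^ p * cmod (u k + v k)
      \<le> (1 + \<bar>real_of_int k\<bar>) ^ p * (cmod (u k) + cmod (v k))"
      by (intro mult_left_mono norm_triangle_ineq) auto
    with K[of k] K'[of k] show ?thesis by (simp add: distrib_left)
  qed
  then show "\<exists>K. \<forall>k. (1 + \<bar>real_of_int k\<bar>) ^ p * cmod (u k + v k) \<le> K" by blast
qed

lemma rapid_mult:
  assumes "rapid u" and b: "\<And>k. cmod (a k) \<le> M * (1 + \<bar>real_of_int k\<bar>) ^ q"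
  shows "rapid (\<lambda>k. a k * u k)"
  unfolding rapid_def
proof
  fix p
  obtain K where K: "\<And>k. (1 + \<bar>real_of_int k\<bar>) ^ (p + q) * cmod (u k) \<le> K"
    using rapidD[OF assms(1)] by metis
  have "0 \<le> cmod (a 0)" by simp
  also have "\<dots> \<le> M * (1 + \<bar>real_of_int 0\<bar>) ^ q" by (rule b)
  finally have M: "M \<ge> 0" by simp
  have "(1 + \<bar>real_of_int k\<bar>) ^ p * cmod (a k * u k) \<le> M * K" for k
  proof -
    have "(1 + \<bar>real_of_int k\<bar>) ^ p * cmod (a k * u k)
      \<le> (1 + \<bar>real_of_int k\<bar>) ^ p * (M * (1 + \<bar>real_of_int k\<bar>) ^ q * cmod (u k))"
      unfolding norm_mult by (intro mult_left_mono mult_right_mono b) auto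
    also have "\<dots> = M * ((1 + \<bar>real_of_int k\<bar>) ^ (p + q) * cmod (u k))"
      by (simp add: power_add algebra_simps)
    also have "\<dots> \<le> M * K" by (intro mult_left_mono K M)
    finally show ?thesis .
  qed
  then show "\<exists>K. \<forall>k. (1 + \<bar>real_of_int k\<bar>) ^ p * cmod (a k * u k) \<le> K" by blast
qed

lemma rapid_cmult: "rapid u \<Longrightarrow> rapid (\<lambda>k. a * u k)"
  by (rule rapid_mult[where M = "cmod a" and q = 0]) auto

lemma rapid_shift:
  assumes "rapid u" shows "rapid (\<lambda>k. u (k + j))"
  unfolding rapid_def
proof
  fix p
  obtain K where K: "K \<ge> 0" "\<And>k. (1 + \<bar>real_of_int k\<bar>) ^ p * cmod (u k) \<le> K"
    using rapidD[OF assms(1)] by metis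
  have "(1 + \<bar>real_of_int k\<bar>) ^ p * cmod (u (k + j)) \<le> (1 + \<bar>real_of_int j\<bar>) ^ p * K" for k
  proof -
    have "1 + \<bar>real_of_int k\<bar> \<le> (1 + \<bar>real_of_int j\<bar>) * (1 + \<bar>real_of_int (k + j)\<bar>)"
    proof -
      have "\<bar>real_of_int k\<bar> \<le> \<bar>real_of_int (k + j)\<bar> + \<bar>real_of_int j\<bar>" by simp
      moreover have "0 \<le> \<bar>real_of_int j\<bar> * \<bar>real_of_int (k + j)\<bar>" by simp
      ultimately show ?thesis unfolding distrib_left distrib_right by linarith
    qed
    then have "(1 + \<bar>real_of_int k\<bar>) ^ p \<le> ((1 + \<bar>real_of_int j\<bar>) * (1 + \<bar>real_of_int (k + j)\<bar>)) ^ p"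
      by (intro power_mono) auto
    then have "(1 + \<bar>real_of_int k\<bar>) ^ p * cmod (u (k + j))
      \<le> ((1 + \<bar>real_of_int j\<bar>) * (1 + \<bar>real_of_int (k + j)\<bar>)) ^ p * cmod (u (k + j))"
      by (intro mult_right_mono) auto
    also have "\<dots> = (1 + \<bar>real_of_int j\<bar>) ^ p * ((1 + \<bar>real_of_int (k + j)\<bar>) ^ p * cmod (u (k + j)))"
      by (simp add: power_mult_distrib)
    also have "\<dots> \<le> (1 + \<bar>real_of_int j\<bar>) ^ p * K"
      by (intro mult_left_mono K) auto
    finally show ?thesis .
  qed
  then show "\<exists>K. \<forall>k. (1 + \<bar>real_of_int k\<bar>) ^ p * cmod (u (k + j)) \<le> K" by blast
qed

lemma rapid_product_summable:
  assumes "rapid u" "rapid v" shows "(\<lambda>k. u k * cnj (v k)) summable_on UNIV"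
proof -
  obtain K where K: "K \<ge> 0" "\<And>k. (1 + \<bar>real_of_int k\<bar>) ^ 1 * cmod (u k) \<le> K"
    using rapidD[OF assms(1)] by metis
  obtain K' where K': "K' \<ge> 0" "\<And>k. (1 + \<bar>real_of_int k\<bar>) ^ 1 * cmod (v k) \<le> K'"
    using rapidD[OF assms(2)] by metis
  have b: "norm (u k * cnj (v k)) \<le> K * K' * (1 / (1 + \<bar>real_of_int k\<bar>)\<^sup>2)" for k
  proof -
    have "((1 + \<bar>real_of_int k\<bar>) * cmod (u k)) * ((1 + \<bar>real_of_int k\<bar>) * cmod (v k)) \<le> K * K'"
      using K(2)[of k] K'(2)[of k] K(1) by (intro mult_mono) auto
    then have "norm (u k * cnj (v k)) * (1 + \<bar>real_of_int k\<bar>)\<^sup>2 \<le> K * K'"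
      unfolding norm_mult power2_eq_square complex_mod_cnj by (simp only: mult_ac)
    moreover have "(1 + \<bar>real_of_int k\<bar>)\<^sup>2 > 0" by (intro zero_less_power) auto
    ultimately show ?thesis by (simp add: pos_le_divide_eq del: zero_less_power2)
  qed
  have "(\<lambda>k. K * K' * (1 / (1 + \<bar>real_of_int k\<bar>)\<^sup>2)) summable_on UNIV"
    by (intro summable_on_cmult_right summable_on_int_inverse_square)
  then have "(\<lambda>k. norm (u k * cnj (v k))) summable_on UNIV"
    by (rule Infinite_Sum.abs_summable_on_comparison_test') (rule b)
  then show ?thesis by (rule Infinite_Sum.abs_summable_summable)
qed

text \<open>These are the Fourier coefficients of smooth functions of y, a class on which d/dy and
  all polynomial multipliers act without domain questions. As a type in class
  \<open>real_inner\<close> it gives access to Cauchy-Schwarz and vector derivatives; the inner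
  product is the real part of the complex one, so that multiplication by the imaginary unit becomes
  an operator of its own, \<open>opJ\<close>.\<close>

typedef rseq = "{u :: int \<Rightarrow> complex. rapid u}"
  morphisms cf Abs_rseq
  using rapid_zero by blast

setup_lifting type_definition_rseq

lemma rapid_cf [simp]: "rapid (cf u)"
  using cf by simp

lemma rseq_eqI: "(\<And>k. cf u k = cf v k) \<Longrightarrow> u = v"
  by transfer auto

instantiation rseq :: real_vector
begin

lift_definition zero_rseq :: rseq is "\<lambda>k. 0" by (rule rapid_zero)
lift_definition plus_rseq :: "rseq \<Rightarrow> rseq \<Rightarrow> rseq" is "\<lambda>u v k. u k + v k" by (rule rapid_add)
lift_definition uminus_rseq :: "rseq \<Rightarrow> rseq" is "\<lambda>u k. - u k"
  using rapid_cmult[where a = "-1"] by simp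
lift_definition minus_rseq :: "rseq \<Rightarrow> rseq \<Rightarrow> rseq" is "\<lambda>u v k. u k - v k"
  using rapid_add[OF _ rapid_cmult[where a = "-1"]] by simp
lift_definition scaleR_rseq :: "real \<Rightarrow> rseq \<Rightarrow> rseq" is "\<lambda>r u k. of_real r * u k"
  by (rule rapid_cmult)

instance
  by standard (transfer; simp add: algebra_simps)+

end

lemma cf_simps [simp]:
  "cf 0 k = 0" "cf (u + v) k = cf u k + cf v k" "cf (- u) k = - cf u k"
  "cf (u - v) k = cf u k - cf v k" "cf (r *\<^sub>R u) k = of_real r * cf u k"
  by (transfer, simp)+

lemma rseq_summable: "(\<lambda>k. Re (cf u k * cnj (cf v k))) summable_on UNIV"
  by (intro summable_on_Re rapid_product_summable) auto

instantiation rseq :: real_inner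
begin

definition inner_rseq :: "rseq \<Rightarrow> rseq \<Rightarrow> real" where
  "inner_rseq u v = (\<Sum>\<^sub>\<infinity>k. Re (cf u k * cnj (cf v k)))"
definition norm_rseq :: "rseq \<Rightarrow> real" where "norm_rseq u = sqrt (inner u u)"
definition sgn_rseq :: "rseq \<Rightarrow> rseq" where "sgn_rseq u = u /\<^sub>R norm u"
definition dist_rseq :: "rseq \<Rightarrow> rseq \<Rightarrow> real" where "dist_rseq u v = norm (u - v)"
definition uniformity_rseq :: "(rseq \<times> rseq) filter" where
  "uniformity_rseq = (INF e\<in>{0<..}. principal {(x, y). dist x y < e})"
definition open_rseq :: "rseq set \<Rightarrow> bool" where
  "open_rseq U = (\<forall>x\<in>U. eventually (\<lambda>(x', y). x' = x \<longrightarrow> y \<in> U) uniformity)"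

instance
proof
  fix x y z :: rseq and r :: real
  show "inner x y = inner y x"
    unfolding inner_rseq_def by (rule infsum_cong) (simp add: mult.commute)
  show "inner (x + y) z = inner x z + inner y z"
    unfolding inner_rseq_def
    by (subst infsum_add[symmetric, OF rseq_summable rseq_summable]) (simp add: distrib_right)
  show "inner (r *\<^sub>R x) y = r * inner x y"
  proof -
    have "inner (r *\<^sub>R x) y = (\<Sum>\<^sub>\<infinity>k. r * Re (cf x k * cnj (cf y k)))"
      unfolding inner_rseq_def by (rule infsum_cong) (simp add: distrib_left right_diff_distrib)
    also have "\<dots> = r * inner x y"
      unfolding inner_rseq_def by (rule infsum_cmult_right) (rule rseq_summable)
    finally show ?thesis .
  qed
  show p: "0 \<le> inner x x"
    unfolding inner_rseq_def by (intro infsum_nonneg) simp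
  show "(inner x x = 0) = (x = 0)"
  proof
    assume "inner x x = 0"
    then have "Re (cf x k * cnj (cf x k)) = 0" for k
      unfolding inner_rseq_def
      using nonneg_infsum_le_0D[of "\<lambda>k. Re (cf x k * cnj (cf x k))" UNIV k] rseq_summable[of x x]
      by auto
    then have "cmod (cf x k) = 0" for k
      by (metis cmod_power2 complex_mult_cnj Re_complex_of_real power_eq_0_iff)
    then show "x = 0" by (intro rseq_eqI) simp
  qed (simp add: inner_rseq_def)
  show "norm x = sqrt (inner x x)" by (simp add: norm_rseq_def)
qed (simp_all add: dist_rseq_def sgn_rseq_def uniformity_rseq_def open_rseq_def)

end

lemma inner_rseq_mono:
  assumes "\<And>k. Re (cf a k * cnj (cf b k)) \<le> Re (cf c k * cnj (cf d k))"
  shows "inner a b \<le> inner c d"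
  unfolding inner_rseq_def by (intro infsum_mono rseq_summable assms)

lemma inner_rseq_cong:
  assumes "\<And>k. cf a k * cnj (cf b k) = cf c k * cnj (cf d k)"
  shows "inner a b = inner c d"
  unfolding inner_rseq_def by (simp add: assms)

lemma inner_rseq_shift:
  assumes "\<And>k. cf a (k + j) * cnj (cf b (k + j)) = cf c k * cnj (cf d k)"
  shows "inner a b = inner c d"
proof -
  have "inner a b = (\<Sum>\<^sub>\<infinity>k\<in>range (\<lambda>k. k + j). Re (cf a k * cnj (cf b k)))"
    unfolding inner_rseq_def by (simp add: surj_plus_right)
  also have "\<dots> = (\<Sum>\<^sub>\<infinity>k. Re (cf a (k + j) * cnj (cf b (k + j))))"
    by (subst infsum_reindex) (auto simp: o_def inj_on_def)
  finally show ?thesis by (simp add: inner_rseq_def assms)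
qed

section \<open>Multipliers, shifts and their algebra\<close>

lift_definition opJ :: "rseq \<Rightarrow> rseq" is "\<lambda>u k. \<i> * u k" by (rule rapid_cmult)
lift_definition opD :: "rseq \<Rightarrow> rseq" is "\<lambda>u k. \<i> * of_int k * u k"
  by (rule rapid_mult[where M = 1 and q = 1]) (auto simp: norm_mult)
text \<open>The inverse of l^2 - d^2/dy^2, that is minus A^{-1} on mode l. At l = k = 0 the
  convention 1/0 = 0 keeps it total.\<close>

lift_definition opG :: "int \<Rightarrow> rseq \<Rightarrow> rseq" is "\<lambda>l u k. of_real (1 / real_of_int (l\<^sup>2 + k\<^sup>2)) * u k"
proof -
  fix l :: int and u :: "int \<Rightarrow> complex" assume "rapid u"
  have "cmod (of_real (1 / real_of_int (l\<^sup>2 + k\<^sup>2))) \<le> 1 * (1 + \<bar>real_of_int k\<bar>) ^ 0" for k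
  proof (cases "l\<^sup>2 + k\<^sup>2 = 0")
    case False
    then have "l\<^sup>2 + k\<^sup>2 \<ge> 1"
      by (smt (verit) zero_le_power2)
    then have "real_of_int (l\<^sup>2 + k\<^sup>2) \<ge> 1" by linarith
    then show ?thesis by (simp only: norm_of_real) (simp del: of_int_add of_int_power)
  qed simp
  then show "rapid (\<lambda>k. of_real (1 / real_of_int (l\<^sup>2 + k\<^sup>2)) * u k)"
    by (intro rapid_mult[where M = 1 and q = 0] \<open>rapid u\<close>) (simp only:)
qed
lift_definition opT :: "int \<Rightarrow> rseq \<Rightarrow> rseq" is "\<lambda>j u k. u (k + j)"
proof -
  fix j and u :: "int \<Rightarrow> complex" assume "rapid u"
  then show "rapid (\<lambda>k. u (k + j))" using rapid_shift[of u j] by simp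
qed

lemma cf_op [simp]:
  "cf (opJ u) k = \<i> * cf u k" "cf (opD u) k = \<i> * of_int k * cf u k"
  "cf (opG l u) k = of_real (1 / real_of_int (l\<^sup>2 + k\<^sup>2)) * cf u k" "cf (opT j u) k = cf u (k + j)"
  by (simp_all only: opJ.rep_eq opD.rep_eq opG.rep_eq opT.rep_eq)

text \<open>Multiplication by cos y and sin y, since \<open>opT j\<close> is multiplication by exp
  (- i j y).\<close>

definition opC :: "rseq \<Rightarrow> rseq" where "opC u = (1/2) *\<^sub>R (opT (-1) u + opT 1 u)"
definition opS :: "rseq \<Rightarrow> rseq" where "opS u = (1/2) *\<^sub>R (opJ (opT 1 u - opT (-1) u))"

lemma cf_opC: "cf (opC u) k = (cf u (k - 1) + cf u (k + 1)) / 2"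
  by (simp add: opC_def)

lemma cf_opS: "cf (opS u) k = (cf u (k - 1) - cf u (k + 1)) / (2 * \<i>)"
  by (simp add: opS_def field_simps)

lemma op_linear: "linear opJ" "linear opD" "linear (opG l)" "linear (opT j)" "linear opC" "linear opS"
proof -
  show "linear (opG l)"
    by (rule linearI; rule rseq_eqI; simp add: add_divide_distrib distrib_left)
qed (rule linearI; rule rseq_eqI; simp add: cf_opC cf_opS field_simps)+

lemmas op_linear_simps =
  op_linear[THEN linear_add] op_linear[THEN linear_diff] op_linear[THEN linear_neg]
  op_linear[THEN linear_scale] op_linear[THEN linear_0]

lemma op_commute:
  "opC (opJ u) = opJ (opC u)" "opS (opJ u) = opJ (opS u)" "opD (opJ u) = opJ (opD u)"
  "opG l (opJ u) = opJ (opG l u)" "opD (opG l u) = opG l (opD u)" "opC (opS u) = opS (opC u)"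
  "opD (opC u) = opC (opD u) - opS u" "opD (opS u) = opS (opD u) + opC u" "opJ (opJ u) = - u"
  by (rule rseq_eqI; simp add: cf_opC cf_opS field_simps)+

lemma op_pythagoras: "opC (opC u) + opS (opS u) = u"
  by (rule rseq_eqI) (simp add: cf_opC cf_opS field_simps)

lemma opG_inverse:
  assumes "l \<noteq> 0" shows "(real_of_int l)\<^sup>2 *\<^sub>R opG l u - opD (opD (opG l u)) = u"
proof (rule rseq_eqI)
  fix k :: int
  have "real_of_int (l\<^sup>2 + k\<^sup>2) > 0"
    using assms by (simp add: add_pos_nonneg)
  then have n: "of_int l ^ 2 + of_int k ^ 2 \<noteq> (0::complex)"
    by (metis of_int_add of_int_eq_0_iff of_int_power order_less_irrefl of_int_0)
  show "cf ((real_of_int l)\<^sup>2 *\<^sub>R opG l u - opD (opD (opG l u))) k = cf u k"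
    using n by (simp add: divide_simps) (simp add: algebra_simps power2_eq_square)
qed

lemma op_adjoint:
  "inner (opJ u) v = - inner u (opJ v)" "inner (opD u) v = - inner u (opD v)"
  "inner (opG l u) v = inner u (opG l v)"
  unfolding inner_minus_right[symmetric] by (rule inner_rseq_cong; simp)+

lemma opT_adjoint: "inner (opT j u) v = inner u (opT (- j) v)"
  by (rule inner_rseq_shift[where j = "- j"]) simp

lemma opT_opJ: "opT j (opJ u) = opJ (opT j u)"
  by (rule rseq_eqI) simp

lemma opC_adjoint: "inner (opC u) v = inner u (opC v)"
  unfolding opC_def by (simp add: inner_simps opT_adjoint)

lemma opS_adjoint: "inner (opS u) v = inner u (opS v)"
  unfolding opS_def by (simp add: op_linear_simps inner_simps opT_adjoint op_adjoint(1) opT_opJ)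

text \<open>\<open>opLap l\<close> is A and \<open>opH l\<close> is I + A^{-1} on mode l, because
  A^{-1} acts as \<open>- opG l\<close>. The symbol of \<open>opH l\<close> is nonnegative for l
  \<noteq> 0, with a kernel only for |l| = 1, spanned by k = 0.\<close>

definition opLap :: "int \<Rightarrow> rseq \<Rightarrow> rseq" where
  "opLap l u = opD (opD u) - (real_of_int l)\<^sup>2 *\<^sub>R u"
definition opH :: "int \<Rightarrow> rseq \<Rightarrow> rseq" where
  "opH l u = u - opG l u"

abbreviation nn :: "int \<Rightarrow> int \<Rightarrow> real" where
  "nn l k \<equiv> (real_of_int l)\<^sup>2 + (real_of_int k)\<^sup>2"

lemma nn_cases:
  assumes "l \<noteq> 0"
  shows "nn l k = 1 \<or> nn l k \<ge> 2" and "nn l k \<ge> 1" and "nn l k > 0"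
    and "nn l k \<ge> 1 + (real_of_int k)\<^sup>2" and "nn l k \<ge> (real_of_int l)\<^sup>2" and "(real_of_int l)\<^sup>2 \<ge> 1"
proof -
  have "l\<^sup>2 \<ge> 1" using assms by (smt (verit) zero_less_power2)
  then have "l\<^sup>2 + k\<^sup>2 \<ge> 1" by (smt (verit) zero_le_power2)
  then have "l\<^sup>2 + k\<^sup>2 = 1 \<or> l\<^sup>2 + k\<^sup>2 \<ge> 2" by linarith
  moreover have e: "nn l k = real_of_int (l\<^sup>2 + k\<^sup>2)" by simp
  ultimately show "nn l k = 1 \<or> nn l k \<ge> 2" by linarith
  show "nn l k \<ge> 1" unfolding e using \<open>l\<^sup>2 + k\<^sup>2 \<ge> 1\<close> by linarith
  then show "nn l k > 0" by linarith
  have "real_of_int (l\<^sup>2) \<ge> 1" using \<open>l\<^sup>2 \<ge> 1\<close> by linarith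
  then show "(real_of_int l)\<^sup>2 \<ge> 1" by simp
  then show "nn l k \<ge> 1 + (real_of_int k)\<^sup>2" by simp
  show "nn l k \<ge> (real_of_int l)\<^sup>2" by simp
qed

lemma cf_opLap: "cf (opLap l u) k = of_real (- nn l k) * cf u k"
  by (simp add: opLap_def algebra_simps power2_eq_square)

lemma cf_opH: "cf (opH l u) k = of_real (1 - 1 / nn l k) * cf u k"
  by (simp add: opH_def algebra_simps)

lemma cf_opG': "cf (opG l u) k = of_real (1 / nn l k) * cf u k"
  by simp

text \<open>All four vectors are real multiples of one and the same \<open>u\<close>, coefficient by
  coefficient, so that a comparison of quadratic forms reduces to one of symbols.\<close>

lemma inner_multiplier_mono:
  assumes "\<And>k. cf a k = of_real (\<alpha> k) * cf u k" "\<And>k. cf b k = of_real (\<beta> k) * cf u k"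
    and "\<And>k. cf c k = of_real (\<gamma> k) * cf u k" "\<And>k. cf d k = of_real (\<delta> k) * cf u k"
    and "\<And>k. \<alpha> k * \<beta> k \<le> \<gamma> k * \<delta> k"
  shows "inner a b \<le> inner c d"
proof (rule inner_rseq_mono)
  fix k
  have e: "Re (of_real r * z * cnj (of_real s * z)) = r * s * (cmod z)\<^sup>2" for r s z
    by (subst cmod_power2) (simp add: power2_eq_square algebra_simps)
  show "Re (cf a k * cnj (cf b k)) \<le> Re (cf c k * cnj (cf d k))"
    unfolding assms(1-4) e by (intro mult_right_mono assms) auto
qed

lemma opLap_H_linear: "linear (opLap l)" "linear (opH l)"
  unfolding opLap_def[abs_def] opH_def[abs_def]
  by (intro linear_compose_sub linear_compose_scale_right linear_ident op_linear
    linear_compose[of opD opD, unfolded o_def])+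

lemmas opLapH_linear_simps = op_linear_simps
  opLap_H_linear[THEN linear_add] opLap_H_linear[THEN linear_diff] opLap_H_linear[THEN linear_neg]
  opLap_H_linear[THEN linear_scale] opLap_H_linear[THEN linear_0]

lemma opH_adjoint: "inner (opH l u) v = inner u (opH l v)"
  by (simp add: opH_def inner_simps op_adjoint)

lemma opH_commute: "opH l (opJ u) = opJ (opH l u)" "opD (opH l u) = opH l (opD u)"
  by (simp_all add: opH_def op_commute op_linear_simps)

lemma opLap_adjoint: "inner (opLap l u) v = inner u (opLap l v)"
  by (simp add: opLap_def inner_simps op_adjoint)

lemma opG_opLap: assumes "l \<noteq> 0" shows "opG l (opLap l u) = - u" "opLap l (opG l u) = - u"
  using opG_inverse[OF assms, of u] by (simp_all add: opLap_def op_linear_simps op_commute algebra_simps)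

text \<open>A (I + A^{-1}) = A + I: composing with the Laplacian removes the nonlocal part.\<close>

lemma opH_opLap: assumes "l \<noteq> 0" shows "opLap l (opH l u) = opLap l u + u" "opH l (opLap l u) = opLap l u + u"
  using opG_opLap[OF assms, of u] by (simp_all add: opH_def opLapH_linear_simps)

lemma opJ_isometry: "inner (opJ u) (opJ v) = inner u v"
  by (simp add: op_adjoint op_commute)

text \<open>Multiplication by i sin y is skew for the real inner product. This is the source of
  every cancellation of the transport term.\<close>

lemma opJS_skew: "inner (opJ (opS u)) u = 0" "inner u (opJ (opS u)) = 0"
proof -
  have "inner (opJ (opS u)) u = - inner (opJ (opS u)) u"
    using op_adjoint(1)[of "opS u" u] opS_adjoint[of u "opJ u"]
    by (simp add: op_commute inner_commute)
  then show "inner (opJ (opS u)) u = 0" "inner u (opJ (opS u)) = 0" by (simp_all add: inner_commute)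
qed

lemma pythagoras_inner: "inner (opC u) (opC u) + inner (opS u) (opS u) = inner u u"
proof -
  have "inner (opC (opC u) + opS (opS u)) u = inner u u" by (simp only: op_pythagoras)
  then show ?thesis by (simp add: inner_simps opC_adjoint opS_adjoint)
qed

text \<open>This is \<open>\<integral> cos y sin y (|u|\<^sup>2)' / 2 = - \<integral> (cos\<^sup>2 y - sin\<^sup>2 y) |u|\<^sup>2 / 2\<close>.\<close>

lemma sin_cos_by_parts:
  "2 * inner (opS u) (opC (opD u)) = inner (opS u) (opS u) - inner (opC u) (opC u)"
proof -
  have "inner (opS u) (opC (opD u)) = inner (opC (opS u)) (opD u)" by (simp add: opC_adjoint)
  also have "\<dots> = - inner (opD (opC (opS u))) u" by (simp add: op_adjoint)
  also have "opD (opC (opS u)) = opC (opS (opD u)) + opC (opC u) - opS (opS u)"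
    by (simp add: op_commute op_linear_simps)
  finally show ?thesis
    by (simp add: inner_simps opC_adjoint opS_adjoint op_commute inner_commute)
qed

section \<open>Norms of order 1 and -1, and the coercive form\<close>

definition h1 :: "int \<Rightarrow> rseq \<Rightarrow> real" where
  "h1 l u = inner (opD u) (opD u) + (real_of_int l)\<^sup>2 * inner u u"
text \<open>The squared H^{-1} norm of a mode, dual to the squared H^1 norm \<open>h1\<close>: by
  \<open>hm1_h1\<close> it is the \<open>h1\<close> norm of \<open>opG l u\<close>.\<close>

definition hm1 :: "int \<Rightarrow> rseq \<Rightarrow> real" where
  "hm1 l u = inner (opG l u) u"

lemma h1_nonneg: "h1 l u \<ge> 0"
  by (simp add: h1_def)

lemma h1_opLap: "h1 l u = - inner (opLap l u) u"
  by (simp add: h1_def opLap_def inner_simps op_adjoint)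

lemma hm1_h1: "l \<noteq> 0 \<Longrightarrow> hm1 l u = h1 l (opG l u)"
  by (simp add: h1_opLap hm1_def opG_opLap inner_commute)

lemma hm1_nonneg: "l \<noteq> 0 \<Longrightarrow> hm1 l u \<ge> 0"
  by (simp add: hm1_h1 h1_nonneg)

text \<open>Expand \<open>h1\<close> of \<open>\<epsilon> *\<^sub>R x - opG l f\<close>, which is
  nonnegative: \<open>opLap l\<close> undoes \<open>opG l\<close> up to sign, so the mixed term is
  the plain inner product of \<open>f\<close> and \<open>x\<close>.\<close>

lemma hm1_duality:
  assumes "l \<noteq> 0" "\<epsilon> > 0"
  shows "2 * inner f x \<le> \<epsilon> * h1 l x + hm1 l f / \<epsilon>"
proof -
  have "0 \<le> h1 l (\<epsilon> *\<^sub>R x - opG l f)" by (rule h1_nonneg)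
  have *: "inner (opG l f) (opLap l x) = - inner f x" "inner (opLap l x) (opG l f) = - inner f x"
    using opLap_adjoint[of l "opG l f" x] by (simp_all add: opG_opLap[OF assms(1)] inner_commute)
  note \<open>0 \<le> h1 l (\<epsilon> *\<^sub>R x - opG l f)\<close>
  also have "h1 l (\<epsilon> *\<^sub>R x - opG l f) = \<epsilon>\<^sup>2 * h1 l x - 2 * \<epsilon> * inner f x + hm1 l f"
    by (simp add: h1_opLap opLapH_linear_simps inner_simps opG_opLap[OF assms(1)] hm1_def power2_eq_square
        * algebra_simps) (simp add: inner_commute)
  finally have "2 * inner f x * \<epsilon> \<le> \<epsilon>\<^sup>2 * h1 l x + hm1 l f" by (simp add: algebra_simps)
  then have "2 * inner f x \<le> (\<epsilon>\<^sup>2 * h1 l x + hm1 l f) / \<epsilon>"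
    using assms(2) by (simp add: pos_le_divide_eq)
  then show ?thesis using assms(2) by (simp add: add_divide_distrib power2_eq_square)
qed

lemma inner_sum_le: "inner (x + y) (x + y :: 'a :: real_inner) \<le> 2 * inner x x + 2 * inner y y"
proof -
  have "0 \<le> inner (x - y) (x - y)" by simp
  then show ?thesis by (simp add: inner_simps inner_commute)
qed

text \<open>The product rule creates one term without derivative. It is absorbed into the part of
  \<open>h1\<close> weighted by l^2, because l^2 \<ge> 1.\<close>

lemma h1_opS: "l \<noteq> 0 \<Longrightarrow> h1 l (opS u) \<le> 3 * h1 l u"
  and h1_opC: "l \<noteq> 0 \<Longrightarrow> h1 l (opC u) \<le> 3 * h1 l u"
proof -
  assume l: "l \<noteq> 0"
  let ?L = "(real_of_int l)\<^sup>2"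
  have L: "?L \<ge> 1" by (rule nn_cases[OF l])
  have P: "inner (opC x) (opC x) \<le> inner x x" "inner (opS x) (opS x) \<le> inner x x" for x
    using pythagoras_inner[of x] inner_ge_zero[of "opC x"] inner_ge_zero[of "opS x"] by linarith+
  have LL: "inner u u \<le> ?L * inner u u"
    using L mult_right_mono[of 1 ?L "inner u u"] by simp
  have "inner (opD (opS u)) (opD (opS u)) \<le> 2 * inner (opD u) (opD u) + 2 * inner u u"
    using inner_sum_le[of "opS (opD u)" "opC u"] P[of "opD u"] P[of u] by (simp add: op_commute)
  moreover have "?L * inner (opS u) (opS u) \<le> ?L * inner u u"
    by (intro mult_left_mono P) auto
  ultimately show "h1 l (opS u) \<le> 3 * h1 l u"
    unfolding h1_def distrib_left using LL inner_ge_zero[of "opD u"] by linarith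
  have "inner (opD (opC u)) (opD (opC u)) \<le> 2 * inner (opD u) (opD u) + 2 * inner u u"
    using inner_sum_le[of "opC (opD u)" "- opS u"] P[of "opD u"] P[of u] by (simp add: op_commute)
  moreover have "?L * inner (opC u) (opC u) \<le> ?L * inner u u"
    by (intro mult_left_mono P) auto
  ultimately show "h1 l (opC u) \<le> 3 * h1 l u"
    unfolding h1_def distrib_left using LL inner_ge_zero[of "opD u"] by linarith
qed

text \<open>The quadratic form produced by the commutator of the transport term with the cross term.\<close>

definition Zf :: "int \<Rightarrow> rseq \<Rightarrow> real" where
  "Zf l v = hm1 l (opC (opD v)) + (real_of_int l)\<^sup>2 * hm1 l (opC v)"

text \<open>Insert the identity in the form (l^2 - d^2/dy^2) G and integrate by parts once.\<close>

lemma norm_hm1_split: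
  assumes "l \<noteq> 0"
  shows "inner p p = hm1 l (opD p) + (real_of_int l)\<^sup>2 * hm1 l p"
proof -
  have "inner p p = inner ((real_of_int l)\<^sup>2 *\<^sub>R opG l p - opD (opD (opG l p))) p"
    by (simp only: opG_inverse[OF assms])
  also have "\<dots> = hm1 l (opD p) + (real_of_int l)\<^sup>2 * hm1 l p"
    by (simp add: hm1_def inner_simps op_adjoint op_commute)
  finally show ?thesis .
qed

lemma hm1_sum_le: "l \<noteq> 0 \<Longrightarrow> hm1 l (x + y) \<le> 2 * hm1 l x + 2 * hm1 l y"
proof -
  assume "l \<noteq> 0"
  have "0 \<le> hm1 l (x - y)" using \<open>l \<noteq> 0\<close> by (rule hm1_nonneg)
  then show ?thesis
    by (simp add: hm1_def op_linear_simps inner_simps op_adjoint inner_commute)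
qed

text \<open>Dual to \<open>h1_opS\<close>: pair \<open>v\<close> with
  \<open>opS (opG l (opS v))\<close>. The weight 1/3 makes the resulting \<open>h1\<close> term at
  most \<open>hm1 l (opS v)\<close>, half of the left-hand side.\<close>

lemma hm1_opS: assumes "l \<noteq> 0" shows "hm1 l (opS v) \<le> 3 * hm1 l v"
proof -
  have "2 * inner v (opS (opG l (opS v))) \<le> (1/3) * h1 l (opS (opG l (opS v))) + hm1 l v / (1/3)"
    by (rule hm1_duality) (use assms in auto)
  moreover have "inner v (opS (opG l (opS v))) = hm1 l (opS v)"
    by (simp add: hm1_def opS_adjoint inner_commute)
  moreover have "h1 l (opS (opG l (opS v))) \<le> 3 * hm1 l (opS v)"
    using h1_opS[OF assms] hm1_h1[OF assms] by metis
  ultimately show ?thesis by simp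
qed

text \<open>Coercivity of \<open>Zf\<close>: with \<open>\<psi> = G v\<close>, write \<open>\<psi> = - (cos y sin y \<psi>)' + 2 cos\<^sup>2 y \<psi> + cos y sin y \<psi>'\<close>
  and pair with \<open>v = L \<psi> - \<psi>''\<close>; the last term is absorbed because
  \<open>\<langle>v, cos y sin y \<psi>'\<rangle> = \<integral> (cos\<^sup>2 y - sin\<^sup>2 y) (|\<psi>'|\<^sup>2 - L |\<psi>|\<^sup>2) / 2\<close>.\<close>

lemma Zf_coercive:
  assumes l: "l \<noteq> 0" shows "hm1 l v \<le> 96 * Zf l v"
proof -
  let ?L = "(real_of_int l)\<^sup>2"
  define \<psi> where "\<psi> = opG l v"
  have L: "?L \<ge> 1" by (rule nn_cases[OF l])
  have v: "v = ?L *\<^sub>R \<psi> - opD (opD \<psi>)" unfolding \<psi>_def opG_inverse[OF l] ..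
  have N: "hm1 l v = h1 l \<psi>" unfolding \<psi>_def by (rule hm1_h1[OF l])
  have dec: "\<psi> = - opD (opC (opS \<psi>)) + 2 *\<^sub>R opC (opC \<psi>) + opC (opS (opD \<psi>))"
    using op_pythagoras[of \<psi>] by (simp add: op_commute op_linear_simps algebra_simps scaleR_2)
  have "hm1 l v = inner v \<psi>" by (simp add: hm1_def \<psi>_def inner_commute)
  also have "\<dots> = inner v (- opD (opC (opS \<psi>)) + 2 *\<^sub>R opC (opC \<psi>) + opC (opS (opD \<psi>)))"
    using dec by simp
  also have "\<dots> = inner (opC (opD v)) (opS \<psi>) + 2 * inner (opC v) (opC \<psi>) + inner v (opC (opS (opD \<psi>)))"
    by (simp add: inner_simps op_adjoint opC_adjoint)
  finally have 1: "hm1 l v = inner (opC (opD v)) (opS \<psi>) + 2 * inner (opC v) (opC \<psi>)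
    + inner v (opC (opS (opD \<psi>)))" .
  have q: "inner y (opC (opS (opD y))) = (inner (opS y) (opS y) - inner (opC y) (opC y)) / 2" for y
    using sin_cos_by_parts[of y] by (simp add: opC_adjoint opS_adjoint op_commute)
  have "inner v (opC (opS (opD \<psi>)))
    = ?L * inner \<psi> (opC (opS (opD \<psi>))) + inner (opD \<psi>) (opD (opC (opS (opD \<psi>))))"
    by (subst v) (simp add: inner_simps op_adjoint)
  also have "inner (opD \<psi>) (opD (opC (opS (opD \<psi>)))) = inner (opD \<psi>) (opC (opS (opD (opD \<psi>))))
     + inner (opC (opD \<psi>)) (opC (opD \<psi>)) - inner (opS (opD \<psi>)) (opS (opD \<psi>))"
    by (simp add: op_commute op_linear_simps inner_simps opC_adjoint opS_adjoint)
  also have "inner (opD \<psi>) (opC (opS (opD (opD \<psi>)))) = (inner (opS (opD \<psi>)) (opS (opD \<psi>)) - inner (opC (opD \<psi>)) (opC (opD \<psi>))) / 2"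
    by (rule q)
  also have "inner \<psi> (opC (opS (opD \<psi>))) = (inner (opS \<psi>) (opS \<psi>) - inner (opC \<psi>) (opC \<psi>)) / 2"
    by (rule q)
  finally have 2: "inner v (opC (opS (opD \<psi>))) =
      ?L * ((inner (opS \<psi>) (opS \<psi>) - inner (opC \<psi>) (opC \<psi>)) / 2)
      + (inner (opC (opD \<psi>)) (opC (opD \<psi>)) - inner (opS (opD \<psi>)) (opS (opD \<psi>))) / 2"
    by (simp add: field_simps)
  have "?L * ((inner (opS \<psi>) (opS \<psi>) - inner (opC \<psi>) (opC \<psi>)) / 2) \<le> ?L * (inner \<psi> \<psi> / 2)"
  proof (rule mult_left_mono)
    show "(inner (opS \<psi>) (opS \<psi>) - inner (opC \<psi>) (opC \<psi>)) / 2 \<le> inner \<psi> \<psi> / 2"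
      using pythagoras_inner[of \<psi>] inner_ge_zero[of "opC \<psi>"] by argo
  qed simp
  moreover have "inner (opC (opD \<psi>)) (opC (opD \<psi>)) - inner (opS (opD \<psi>)) (opS (opD \<psi>)) \<le> inner (opD \<psi>) (opD \<psi>)"
    using pythagoras_inner[of "opD \<psi>"] inner_ge_zero[of "opS (opD \<psi>)"] by linarith
  ultimately have 3: "inner v (opC (opS (opD \<psi>))) \<le> h1 l \<psi> / 2"
    unfolding 2 h1_def by (simp add: field_simps)
  \<comment> \<open>The weights 1/12 and 1/24 are such that, after the factor 3 of
    \<open>h1_opS\<close> and \<open>h1_opC\<close>, each product costs one eighth of
    \<open>h1 l \<psi>\<close>. With the half from the preceding bound a quarter remains on the
    left, and 96 = 4 * 24.\<close>
  have 4: "2 * inner (opC (opD v)) (opS \<psi>) \<le> (1/12) * h1 l (opS \<psi>) + hm1 l (opC (opD v)) / (1/12)"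
    by (rule hm1_duality) (use l in auto)
  have 5: "2 * inner (opC v) (opC \<psi>) \<le> (1/24) * h1 l (opC \<psi>) + hm1 l (opC v) / (1/24)"
    by (rule hm1_duality) (use l in auto)
  have 6: "hm1 l (opC v) \<le> ?L * hm1 l (opC v)"
    using L mult_right_mono[of 1 ?L "hm1 l (opC v)"] hm1_nonneg[OF l] by simp
  show ?thesis
    using 1 3 4 5 6 h1_opS[OF l, of \<psi>] h1_opC[OF l, of \<psi>] hm1_nonneg[OF l, of "opC (opD v)"] N
    unfolding Zf_def by simp
qed

text \<open>Split the norm by \<open>norm_hm1_split\<close> and commute \<open>opD\<close> past
  \<open>opC\<close>; the commutator \<open>opS v\<close> is paid for by coercivity, which gives 2 +
  6 * 96 = 578.\<close>

lemma Zf_bounds: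
  assumes l: "l \<noteq> 0"
  shows "inner (opC v) (opC v) \<le> 578 * Zf l v" "Zf l v \<ge> 0"
proof -
  show "Zf l v \<ge> 0" unfolding Zf_def using hm1_nonneg[OF l] by simp
  have "opD (opC v) = opC (opD v) + (- opS v)" by (simp add: op_commute)
  then have "hm1 l (opD (opC v)) \<le> 2 * hm1 l (opC (opD v)) + 2 * hm1 l (- opS v)"
    by (metis hm1_sum_le[OF l])
  moreover have "hm1 l (- opS v) = hm1 l (opS v)" by (simp add: hm1_def op_linear_simps)
  moreover have "0 \<le> (real_of_int l)\<^sup>2 * hm1 l (opC v)" using hm1_nonneg[OF l] by simp
  ultimately show "inner (opC v) (opC v) \<le> 578 * Zf l v"
    using hm1_opS[OF l, of v] Zf_coercive[OF l, of v]
    unfolding norm_hm1_split[OF l, of "opC v"] Zf_def distrib_left by linarith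
qed

section \<open>The energy functionals and their derivatives along the flow\<close>

definition flow :: "int \<Rightarrow> real \<Rightarrow> rseq \<Rightarrow> rseq" where
  "flow l b u = opLap l u - b *\<^sub>R opJ (opS (opH l u))"

text \<open>\<open>D0f\<close> is the dissipation of \<open>E0f\<close>, and \<open>D1f\<close> the
  diffusive dissipation of \<open>D0f / 2\<close>. The product \<open>Xf\<close>, always taken at v
  = \<open>opH l u\<close>, is the hypocoercive cross term that the transport leaves behind when
  \<open>D0f\<close> is differentiated.\<close>

definition E0f :: "int \<Rightarrow> rseq \<Rightarrow> real" where "E0f l u = inner u (opH l u) / 2"
definition D0f :: "int \<Rightarrow> rseq \<Rightarrow> real" where
  "D0f l u = inner (opD u) (opD u) + ((real_of_int l)\<^sup>2 - 1) * inner u u"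
definition D1f :: "int \<Rightarrow> rseq \<Rightarrow> real" where "D1f l u = inner (opLap l u) (opLap l u + u)"
definition Xf :: "rseq \<Rightarrow> real" where "Xf v = inner (opJ (opC v)) (opD v)"
text \<open>A substitute for the squared norm of cos y v with v = \<open>opH l u\<close>. It is a
  difference of two quadratic forms each of which is conserved by the transport alone, so that its
  derivative carries no factor \<open>b\<close>; \<open>Wf_eq\<close> shows how it compares with the
  norm it replaces.\<close>

definition Wf :: "int \<Rightarrow> rseq \<Rightarrow> real" where
  "Wf l u = inner u (opH l u) - inner (opH l (opS (opH l u))) (opS (opH l u))"

text \<open>Directional derivatives of the functionals, so that the algebra can be carried out at a
  fixed element. In \<open>dXf\<close> both base point and direction live on the side of v =
  \<open>opH l u\<close>.\<close>

definition dE0 where "dE0 l u w = inner w (opH l u)"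
definition dD0 where "dD0 l u w = 2 * (inner (opD u) (opD w) + ((real_of_int l)\<^sup>2 - 1) * inner u w)"
definition dXf where "dXf v w = inner (opJ (opC w)) (opD v) + inner (opJ (opC v)) (opD w)"
definition dWf where
  "dWf l u w = 2 * inner w (opH l u) - 2 * inner (opH l (opS (opH l u))) (opS (opH l w))"

lemma D0f_opLap: "D0f l u = - inner (opLap l u + u) u"
  by (simp add: D0f_def opLap_def inner_simps op_adjoint algebra_simps)

lemma opLap_opH_inner: "l \<noteq> 0 \<Longrightarrow> inner (opLap l u) (opH l u) = - D0f l u"
  by (simp add: D0f_opLap opH_opLap flip: opH_adjoint)

lemma dE0_flow: "l \<noteq> 0 \<Longrightarrow> dE0 l u (flow l b u) = - D0f l u"
  by (simp add: dE0_def flow_def inner_simps opLap_opH_inner opJS_skew)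

text \<open>\<open>opLap l\<close> applied to v removes \<open>opH\<close>, and i sin y is skew also
  against the derivative of v. What survives of the transport is the commutator of d/dy with sin y,
  and it is exactly \<open>b * Xf\<close>.\<close>

lemma dD0_flow:
  assumes "l \<noteq> 0" shows "dD0 l u (flow l b u) / 2 = - D1f l u - b * Xf (opH l u)"
proof -
  let ?v = "opH l u"
  have "dD0 l u w = - 2 * inner (opLap l ?v) w" for w
    unfolding opH_opLap[OF assms] by (simp add: dD0_def opLap_def inner_simps op_adjoint algebra_simps)
  then have "dD0 l u (flow l b u) = - 2 * inner (opLap l ?v) (flow l b u)" .
  also have "\<dots> = - 2 * inner (opLap l u + u) (opLap l u) + 2 * b * inner (opLap l ?v) (opJ (opS ?v))"
    by (simp add: flow_def inner_simps opH_opLap[OF assms] algebra_simps)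
  finally have "dD0 l u (flow l b u) = - 2 * inner (opLap l u + u) (opLap l u)
    + 2 * b * inner (opLap l ?v) (opJ (opS ?v))" .
  moreover have "inner (opLap l ?v) (opJ (opS ?v)) = inner (opD (opD ?v)) (opJ (opS ?v))"
    by (simp add: opLap_def inner_simps opJS_skew)
  moreover have "\<dots> = - inner (opD ?v) (opJ (opS (opD ?v))) - inner (opD ?v) (opJ (opC ?v))"
    by (simp add: op_adjoint(2)[of "opD ?v"] op_commute op_linear_simps inner_simps)
  ultimately show ?thesis
    by (simp add: D1f_def Xf_def opJS_skew inner_commute algebra_simps)
qed

lemma dXf_eq: "dXf v w = - inner w (opJ (2 *\<^sub>R opC (opD v) - opS v))"
proof -
  have "inner (opJ (opC w)) (opD v) = - inner w (opC (opJ (opD v)))"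
    by (simp add: op_adjoint opC_adjoint)
  moreover have "inner (opJ (opC v)) (opD w) = - inner w (opD (opJ (opC v)))"
    by (simp add: inner_commute[of _ "opD w"] op_adjoint)
  ultimately show ?thesis
    by (simp add: dXf_def op_commute op_linear_simps inner_simps)
qed

text \<open>Without the nonlocal part the outcome would be the squared norm of cos y v. Splitting
  that norm by \<open>norm_hm1_split\<close>, the corrections containing \<open>opG\<close> cancel
  precisely the mixed term and the square of \<open>opS v\<close> in the expansion of the H^{-1}
  norm, and the nonnegative form \<open>Zf\<close> remains.\<close>

lemma dXf_transport:
  assumes l: "l \<noteq> 0"
  shows "dXf v (opH l (opJ (opS v))) = Zf l v"
proof -
  define q x p where "q = opS v" and "x = opC (opD v)" and "p = opC v"
  have "dXf v (opH l (opJ (opS v))) = - inner (opH l q) (2 *\<^sub>R x - q)"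
    by (simp add: dXf_eq opH_commute opJ_isometry q_def x_def)
  also have "\<dots> = - (2 * inner q x) + inner q q + 2 * inner (opG l q) x - inner (opG l q) q"
    by (simp add: opH_def inner_simps algebra_simps)
  also have "2 * inner q x = inner q q - inner p p"
    unfolding q_def x_def p_def by (rule sin_cos_by_parts)
  also have "inner p p = hm1 l (opD p) + (real_of_int l)\<^sup>2 * hm1 l p"
    by (rule norm_hm1_split[OF l])
  also have "opD p = x - q" by (simp add: p_def x_def q_def op_commute)
  also have "hm1 l (x - q) = hm1 l x - 2 * inner (opG l q) x + inner (opG l q) q"
    by (simp add: hm1_def op_linear_simps inner_simps) (metis op_adjoint(3) inner_commute)
  finally show ?thesis by (simp add: Zf_def x_def p_def)
qed

text \<open>The good term is \<open>- b * Zf\<close>. Diffusion adds a product of v'' with cos y v',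
  which the dissipations of \<open>D0f\<close> and \<open>Wf\<close> share, and multiples of the
  cross term itself.\<close>

lemma dXf_flow:
  fixes u :: rseq
  assumes l: "l \<noteq> 0"
  defines "v \<equiv> opH l u"
  shows "dXf v (opH l (flow l b u)) = - b * Zf l v - 2 * inner (opD (opD v)) (opJ (opC (opD v)))
     - (2 * (real_of_int l)\<^sup>2 + 1) * Xf v"
proof -
  let ?L = "(real_of_int l)\<^sup>2"
  have "opH l (flow l b u) = opD (opD v) - ?L *\<^sub>R v - b *\<^sub>R opH l (opJ (opS v))"
    by (simp add: flow_def opLapH_linear_simps opH_opLap[OF l] v_def flip: opH_opLap[OF l])
      (simp add: opH_opLap[OF l] opLap_def opLapH_linear_simps opH_commute)
  moreover have "dXf v (x - r *\<^sub>R y - s *\<^sub>R z) = dXf v x - r * dXf v y - s * dXf v z" for x y z r s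
    by (simp add: dXf_eq inner_simps algebra_simps)
  ultimately have "dXf v (opH l (flow l b u)) = dXf v (opD (opD v)) - ?L * dXf v v - b * dXf v (opH l (opJ (opS v)))"
    by simp
  moreover have "dXf v v = 2 * Xf v"
    by (simp add: dXf_def Xf_def)
  moreover have "dXf v (opD (opD v)) = - 2 * inner (opD (opD v)) (opJ (opC (opD v)))
     + inner (opD (opD v)) (opJ (opS v))"
    by (simp add: dXf_eq inner_simps op_linear_simps)
  moreover have "inner (opD (opD v)) (opJ (opS v)) = - Xf v"
    by (simp add: op_adjoint(2)[of "opD v"] op_commute op_linear_simps inner_simps opJS_skew Xf_def
        inner_commute)
  ultimately show ?thesis
    by (simp add: dXf_transport[OF l] algebra_simps)
qed

section \<open>Inequalities between the functionals\<close>

lemma opG_le: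
  assumes "l \<noteq> 0"
  shows "inner (opG l x) (opG l x) \<le> inner x x" "inner (opG l x) x \<le> inner x x"
proof -
  have "1 / nn l k \<le> 1" for k using nn_cases(2)[OF assms, of k] by (simp add: divide_le_eq_1)
  then have "1 / nn l k * (1 / nn l k) \<le> 1 * 1" for k
    by (intro mult_mono) (use nn_cases(3)[OF assms] in \<open>auto simp: less_imp_le\<close>)
  then show "inner (opG l x) (opG l x) \<le> inner x x"
    by (intro inner_multiplier_mono[OF cf_opG' cf_opG', where \<gamma> = "\<lambda>_. 1" and \<delta> = "\<lambda>_. 1"]) auto
  show "inner (opG l x) x \<le> inner x x"
    by (rule inner_multiplier_mono[OF cf_opG', where \<beta> = "\<lambda>_. 1" and \<gamma> = "\<lambda>_. 1" and \<delta> = "\<lambda>_. 1"])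
      (use \<open>\<And>k. 1 / nn l k \<le> 1\<close> in auto)
qed

text \<open>Only these facts about n = l^2 + k^2 enter the symbol estimates: it is an integer, hence
  takes no value strictly between 1 and 2, and it is at least 1 + k^2. The gap makes 1 - 1/n either
  zero or at least 1/2.\<close>

lemma multiplier_inequality:
  assumes "l \<noteq> 0"
    and "\<And>n k. n > 0 \<Longrightarrow> n = 1 \<or> n \<ge> 2 \<Longrightarrow> n \<ge> 1 + k\<^sup>2 \<Longrightarrow> \<alpha> n k * \<beta> n k \<le> \<gamma> n k * \<delta> n k"
    and "\<And>k. cf a k = of_real (\<alpha> (nn l k) (real_of_int k)) * cf u k"
    and "\<And>k. cf b k = of_real (\<beta> (nn l k) (real_of_int k)) * cf u k"
    and "\<And>k. cf c k = of_real (\<gamma> (nn l k) (real_of_int k)) * cf u k"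
    and "\<And>k. cf d k = of_real (\<delta> (nn l k) (real_of_int k)) * cf u k"
  shows "inner a b \<le> inner c d"
  by (rule inner_multiplier_mono[OF assms(3-6)]) (intro assms(2) nn_cases[OF assms(1)])

text \<open>On symbols: (n + 1) (1 - 1/n)^2 \<le> n - 1, which after cancelling n - 1 is n^2 - 1
  \<le> n^2.\<close>

lemma D0f_ge:
  fixes u :: rseq
  assumes l: "l \<noteq> 0"
  defines "v \<equiv> opH l u"
  shows "inner (opD v) (opD v) + ((real_of_int l)\<^sup>2 + 1) * inner v v \<le> D0f l u"
proof -
  have e: "of_real m * c - of_real (- n) * (of_real m * c) = of_real (m * (1 + n)) * c"
    for m n and c :: complex by (simp add: algebra_simps)
  have "inner (v - opLap l v) v \<le> inner (- (opLap l u + u)) u"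
  proof (rule multiplier_inequality[OF l, where u = u])
    fix n k :: real assume n: "n > 0" "n = 1 \<or> n \<ge> 2"
    show "((1 - 1/n) * (1 + n)) * (1 - 1/n) \<le> (n - 1) * 1"
      using n by (auto simp: field_simps power2_eq_square)
  next
    show "cf (v - opLap l v) k = of_real ((1 - 1/nn l k) * (1 + nn l k)) * cf u k" for k
      by (simp only: v_def cf_simps cf_opLap cf_opH e)
    show "cf v k = of_real (1 - 1/nn l k) * cf u k" for k
      by (simp only: v_def cf_opH)
  qed (simp_all add: cf_opLap algebra_simps)
  then show ?thesis
    by (simp add: D0f_opLap opLap_def inner_simps op_adjoint algebra_simps)
qed

text \<open>On symbols the left-hand side is k^2 n (1 - 1/n)^2, and k^2 (1 - 1/n) \<le> n - 1 while
  n (1 - 1/n) \<le> n.\<close>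

lemma D1f_ge:
  fixes u :: rseq
  assumes l: "l \<noteq> 0"
  defines "v \<equiv> opH l u"
  shows "inner (opD (opD v)) (opD (opD v)) + (real_of_int l)\<^sup>2 * inner (opD v) (opD v) \<le> D1f l u"
proof -
  have "inner (opD (opD v)) (opLap l v) \<le> inner (opLap l u) (opLap l u + u)"
  proof (rule multiplier_inequality[OF l, where u = u])
    fix n k :: real assume n: "n > 0" "n = 1 \<or> n \<ge> 2" "n \<ge> 1 + k\<^sup>2"
    have "k\<^sup>2 * (1 - 1/n) * (n * (1 - 1/n)) \<le> (n - 1) * 1 * (n * 1)"
    proof -
      have "n \<ge> 1" using n(2) by auto
      then show ?thesis using n by (intro mult_mono) (auto simp: field_simps)
    qed
    then show "(- (k\<^sup>2) * (1 - 1/n)) * (- n * (1 - 1/n)) \<le> (- n) * (1 - n)"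
      by (simp add: algebra_simps)
  qed (simp_all add: v_def cf_opLap cf_opH algebra_simps power2_eq_square)
  then show ?thesis
    by (simp add: D1f_def opLap_def inner_simps op_adjoint algebra_simps)
qed

text \<open>The factors 2 in the comparisons with v reflect 1 - 1/n \<ge> 1/2 off the kernel of
  \<open>opH\<close>. The bound by \<open>D0f\<close> is the spectral gap: n - 1 = n (1 - 1/n) \<ge>
  l^2 (1 - 1/n).\<close>

lemma E0f_bounds:
  assumes l: "l \<noteq> 0"
  shows "E0f l u \<le> inner (opH l u) (opH l u)" "E0f l u \<ge> 0" "2 * (real_of_int l)\<^sup>2 * E0f l u \<le> D0f l u"
    and "inner (opG l u) (opH l u) \<le> 2 * hm1 l (opH l u)" "inner (opG l u) (opH l u) \<ge> 0"
proof -
  have "inner u (opH l u) \<le> inner (2 *\<^sub>R opH l u) (opH l u)"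
  proof (rule multiplier_inequality[OF l, where u = u])
    fix n k :: real assume n: "n > 0" "n = 1 \<or> n \<ge> 2"
    from n(2) show "1 * (1 - 1/n) \<le> (2 * (1 - 1/n)) * (1 - 1/n)"
    proof
      assume "n \<ge> 2"
      then show ?thesis by (intro mult_right_mono) (auto simp: field_simps)
    qed simp
  qed (simp_all add: cf_opH)
  then show "E0f l u \<le> inner (opH l u) (opH l u)" by (simp add: E0f_def)
  have "inner 0 u \<le> inner u (opH l u)"
    by (rule multiplier_inequality[OF l, where u = u and \<alpha> = "\<lambda>n k. 0" and \<beta> = "\<lambda>n k. 1"
        and \<gamma> = "\<lambda>n k. 1" and \<delta> = "\<lambda>n k. 1 - 1/n"]) (auto simp: cf_opH)
  then show "E0f l u \<ge> 0" by (simp add: E0f_def)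
  have "inner ((real_of_int l)\<^sup>2 *\<^sub>R u) (opH l u) \<le> inner (- (opLap l u + u)) u"
  proof (rule inner_multiplier_mono)
    show "cf ((real_of_int l)\<^sup>2 *\<^sub>R u) k = of_real ((real_of_int l)\<^sup>2) * cf u k"
      "cf (opH l u) k = of_real (1 - 1/nn l k) * cf u k" 
      "cf (- (opLap l u + u)) k = of_real (nn l k - 1) * cf u k" "cf u k = of_real 1 * cf u k" for k
      by (simp_all add: cf_opLap cf_opH algebra_simps)
    fix k
    have "(real_of_int l)\<^sup>2 * (1 - 1/nn l k) \<le> nn l k * (1 - 1/nn l k)"
    proof (rule mult_right_mono)
      show "0 \<le> 1 - 1/nn l k" using nn_cases(2)[OF l, of k] by (simp add: divide_le_eq_1)
    qed simp
    also have "\<dots> = (nn l k - 1) * 1" using nn_cases(3)[OF l, of k] by (simp add: right_diff_distrib l)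
    finally show "(real_of_int l)\<^sup>2 * (1 - 1/nn l k) \<le> (nn l k - 1) * 1" .
  qed
  then show "2 * (real_of_int l)\<^sup>2 * E0f l u \<le> D0f l u"
    by (simp add: E0f_def D0f_opLap inner_simps)
  have "inner (opG l u) (opH l u) \<le> inner (2 *\<^sub>R opG l (opH l u)) (opH l u)"
  proof (rule multiplier_inequality[OF l, where u = u])
    fix n k :: real assume n: "n > 0" "n = 1 \<or> n \<ge> 2"
    then have "1 \<le> 2 * (1 - 1/n) \<or> 1 - 1/n = 0" by (auto simp: field_simps)
    then show "(1/n) * (1 - 1/n) \<le> (2 * (1/n) * (1 - 1/n)) * (1 - 1/n)"
    proof
      assume "1 \<le> 2 * (1 - 1/n)"
      then have "((1/n) * (1 - 1/n)) * 1 \<le> ((1/n) * (1 - 1/n)) * (2 * (1 - 1/n))"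
        using n by (intro mult_left_mono) auto
      then show ?thesis by (simp only: mult_ac mult_1)
    qed simp
  qed (simp_all add: cf_opH)
  then show "inner (opG l u) (opH l u) \<le> 2 * hm1 l (opH l u)" by (simp add: hm1_def)
  have "inner 0 u \<le> inner (opG l u) (opH l u)"
    by (rule multiplier_inequality[OF l, where u = u and \<alpha> = "\<lambda>n k. 0" and \<beta> = "\<lambda>n k. 1"
        and \<gamma> = "\<lambda>n k. 1/n" and \<delta> = "\<lambda>n k. 1 - 1/n"]) (auto simp: cf_opH)
  then show "inner (opG l u) (opH l u) \<ge> 0" by simp
qed

text \<open>Write u = v + G u and split the norm of v by cos^2 + sin^2 = 1. The difference that
  defines \<open>Wf\<close> thereby becomes a sum of terms that are nonnegative for l \<noteq>
  0.\<close>

lemma Wf_eq: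
  "Wf l u = inner (opC (opH l u)) (opC (opH l u)) + inner (opG l u) (opH l u) + hm1 l (opS (opH l u))"
proof -
  have "inner u (opH l u) = inner (opH l u) (opH l u) + inner (opG l u) (opH l u)"
    by (simp add: opH_def inner_simps)
  then show ?thesis
    using pythagoras_inner[of "opH l u"]
    by (simp add: Wf_def hm1_def opH_def[of l "opS (opH l u)"] inner_simps)
qed

text \<open>The three terms of \<open>Wf_eq\<close> are at most 578, 2 * 96 and 3 * 96 times
  \<open>Zf\<close>, in total 1058.\<close>

lemma Wf_bounds:
  assumes l: "l \<noteq> 0"
  shows "inner (opC (opH l u)) (opC (opH l u)) \<le> Wf l u" "Wf l u \<le> 1100 * Zf l (opH l u)"
  using E0f_bounds[OF l, of u] Zf_bounds[OF l, of "opH l u"] Zf_coercive[OF l, of "opH l u"]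
    hm1_opS[OF l, of "opH l u"] hm1_nonneg[OF l, of "opS (opH l u)"]
  unfolding Wf_eq by linarith+

text \<open>An interpolation inequality: near the zeros of cos y, where cos y v says nothing about
  v, the derivative has to help. Integration by parts against sin y cos y supplies the mixed term,
  and the cosine is then moved to the factor without derivative.\<close>

lemma norm_le_cos_deriv:
  "inner v v \<le> 2 * inner (opC v) (opC v) + 2 * norm (opC v) * norm (opD v)"
proof -
  have "inner v v = 2 * inner (opC v) (opC v) + 2 * inner (opS v) (opC (opD v))"
    using sin_cos_by_parts[of v] pythagoras_inner[of v] by simp
  also have "inner (opS v) (opC (opD v)) = inner (opS (opC v)) (opD v)"
    by (simp add: op_commute(6) flip: opC_adjoint)
  also have "\<dots> \<le> norm (opS (opC v)) * norm (opD v)" by (rule norm_cauchy_schwarz)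
  also have "norm (opS (opC v)) \<le> norm (opC v)"
    unfolding norm_eq_sqrt_inner
    by (intro real_sqrt_le_mono) (use pythagoras_inner[of "opC v"] inner_ge_zero[of "opC (opC v)"] in linarith)
  finally show ?thesis by (simp add: mult_right_mono)
qed

text \<open>\<open>opH l\<close> applied to the flow has transport part i H (sin y v). Its pairing
  with H (sin y v) after multiplication by sin y is zero by skewness, as is the transport part of
  the derivative of the first form, so no \<open>b\<close> is left. The comparison of
  \<open>D0f\<close> at u and at sin y v then leaves the dissipation of cos y v' and cos y
  v.\<close>

lemma dWf_flow:
  fixes u :: rseq
  assumes l: "l \<noteq> 0"
  defines "v \<equiv> opH l u"
  shows "dWf l u (flow l b u) \<le> - inner (opC (opD v)) (opC (opD v))
     - 2 * (real_of_int l)\<^sup>2 * inner (opC v) (opC v) + 4 * inner v v"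
proof -
  let ?L = "(real_of_int l)\<^sup>2"
  define q where "q = opS v"
  have H: "opH l (flow l b u) = opLap l v - b *\<^sub>R opJ (opH l q)"
    by (simp add: flow_def opLapH_linear_simps opH_opLap[OF l] v_def q_def opH_commute)
  have "opS (opH l (flow l b u)) = opS (opLap l v) - b *\<^sub>R opJ (opS (opH l q))"
    unfolding H by (simp add: op_linear_simps op_commute)
  then have "dWf l u (flow l b u) = 2 * inner (opLap l u - b *\<^sub>R opJ (opS v)) v
     - 2 * inner (opH l q) (opS (opLap l v) - b *\<^sub>R opJ (opS (opH l q)))"
    unfolding dWf_def v_def[symmetric] q_def[symmetric] by (simp add: flow_def v_def q_def)
  then have "dWf l u (flow l b u) = - 2 * D0f l u - 2 * inner (opH l q) (opS (opLap l v))"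
    by (simp add: inner_simps opJS_skew) (simp add: opLap_opH_inner[OF l] v_def)
  also have "opS (opLap l v) = opLap l q - 2 *\<^sub>R opC (opD v) + q"
    by (simp add: opLap_def q_def op_linear_simps op_commute scaleR_2)
  also have "inner (opH l q) (opLap l q - 2 *\<^sub>R opC (opD v) + q)
     = - D0f l q - 2 * inner q (opC (opD v)) + 2 * inner (opG l q) (opC (opD v)) + inner q q - hm1 l q"
    using opLap_opH_inner[OF l, of q]
    by (simp add: inner_simps inner_commute[of "opLap l q"]) (simp add: opH_def hm1_def inner_simps)
  also have "2 * inner q (opC (opD v)) = inner q q - inner (opC v) (opC v)"
    unfolding q_def by (rule sin_cos_by_parts)
  finally have 1: "dWf l u (flow l b u) = - 2 * D0f l u + 2 * D0f l q - 2 * inner (opC v) (opC v)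
     - 4 * inner (opG l q) (opC (opD v)) + 2 * hm1 l q" by simp
  have "inner (opD q) (opD q) = inner (opS (opD v)) (opS (opD v)) + 2 * inner (opS (opD v)) (opC v) + inner (opC v) (opC v)"
    by (simp add: q_def op_commute inner_simps inner_commute)
  moreover have "inner (opS (opD v)) (opC v) = inner (opS v) (opC (opD v))"
    by (metis opC_adjoint opS_adjoint op_commute(6) inner_commute)
  moreover note pythagoras_inner[of "opD v"] sin_cos_by_parts[of v]
  ultimately have 2: "inner (opD q) (opD q) = inner (opD v) (opD v) - inner (opC (opD v)) (opC (opD v)) + inner q q"
    by (simp add: q_def)
  have 3: "- 4 * inner (opG l q) (opC (opD v)) \<le> inner (opC (opD v)) (opC (opD v)) + 4 * inner (opG l q) (opG l q)"
    using inner_ge_zero[of "opC (opD v) + 2 *\<^sub>R opG l q"]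
    by (simp add: inner_simps inner_commute)
  have 4: "?L * inner q q = ?L * inner v v - ?L * inner (opC v) (opC v)"
    using pythagoras_inner[of v] by (simp add: q_def right_diff_distrib[symmetric])
  have "D0f l q = inner (opD v) (opD v) - inner (opC (opD v)) (opC (opD v)) + ?L * inner v v - ?L * inner (opC v) (opC v)"
    using 2 4 by (simp add: D0f_def left_diff_distrib)
  moreover have "D0f l u \<ge> inner (opD v) (opD v) + ?L * inner v v + inner v v"
    using D0f_ge[OF l, of u] by (simp add: v_def distrib_right)
  ultimately show ?thesis
    using 1 3 opG_le[OF l, of q] pythagoras_inner[of v] inner_ge_zero[of "opC v"] unfolding q_def[symmetric] hm1_def mult.assoc
    by linarith
qed

text \<open>The weights of the Lyapunov functional
  \<open>E0 + lya \<tau>/B E1 \<plusminus> lyb \<tau>\<^sup>2 X + lyc \<tau>\<^sup>3 B W\<close> with \<open>B = |b|\<^sup>1\<^sup>/\<^sup>2\<close>, \<open>E1 = D0 / 2\<close> and \<open>\<tau> = min 1 (B t)\<close>,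
  where the powers of the rescaled time make it finite on \<open>L\<^sup>2\<close> data.\<close>

definition lya :: real where "lya = 1 / 2420000000"
definition lyb :: real where "lyb = 8800 * lya\<^sup>2"
definition lyc :: real where "lyc = lya\<^sup>2 / 8"

text \<open>With \<open>lyb\<close> and \<open>lyc\<close> proportional to the square of
  \<open>lya\<close>, the constraints that bound \<open>lyb\<^sup>2 / lya\<close> by
  \<open>lyc\<close> compare a cube of \<open>lya\<close> with a square, so a small
  \<open>lya\<close> suffices. The tightest is
  \<open>9 * lyb\<^sup>2 / (2 * lya) \<le> 2 * lyc\<close>, which holds as soon as
  \<open>lya\<close> is at most 1/1393920000.\<close>

lemma ly_bounds:
  "lya > 0" "lyb > 0" "lyc > 0" "lya \<le> 1/2" "lyb \<le> 1" "lyc \<le> 1"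
  "2 * lyb\<^sup>2 / lya \<le> lyc" "9 * lyb\<^sup>2 / (2 * lya) \<le> 2 * lyc" "lyb\<^sup>2 / (2 * lya) \<le> lyc"
  "1100 * (2 * lya\<^sup>2 + 8 * lyc + 128 * lyc\<^sup>2) \<le> lyb / 2" "1100 * (4 * lyb\<^sup>2 + 3 * lyc) \<le> lyb / 2"
  by (simp_all add: lya_def lyb_def lyc_def power2_eq_square)

section \<open>The scalar inequalities of the hypocoercivity argument\<close>

lemma young_weighted:
  fixes x y :: real assumes "s > 0" shows "2 * r * x * y \<le> s * x\<^sup>2 + r\<^sup>2 / s * y\<^sup>2"
proof -
  have "0 \<le> s * (x - r / s * y)\<^sup>2" using assms by simp
  also have "\<dots> = s * x\<^sup>2 - 2 * r * x * y + r\<^sup>2 / s * y\<^sup>2"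
    using assms by (simp add: power2_diff field_simps power2_eq_square)
  finally show ?thesis by simp
qed

text \<open>Everything the Lyapunov argument needs to know, as inequalities between real numbers.
  With v = \<open>opH l u\<close>: L = l^2, B = |b|^{1/2}, p, y, m, h are the norms of cos y v, v',
  cos y v', v'', \<open>vv\<close> is the squared norm of v, \<sigma> the sign of b, \<tau> the
  rescaled time; \<open>dX\<close>, \<open>dW\<close>, \<open>dE1\<close> are derivatives along the
  flow.\<close>

locale lyapunov_data =
  fixes L B p y m h D0 D1 Z X W E0 dX dW dE1 vv \<sigma> \<tau> b :: real
  assumes L: "L \<ge> 1" and B: "B \<ge> 1" and nonneg: "p \<ge> 0" "y \<ge> 0" "m \<ge> 0" "h \<ge> 0"
    and sgn: "\<bar>\<sigma>\<bar> = 1" "\<sigma> * b = B\<^sup>2" and \<tau>: "0 \<le> \<tau>" "\<tau> \<le> 1"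
    and pZ: "p\<^sup>2 \<le> 1100 * Z" and yD: "y\<^sup>2 \<le> D0" and X: "\<bar>X\<bar> \<le> p * y"
    and D1: "h\<^sup>2 + L * y\<^sup>2 \<le> D1" and vv: "vv \<le> 2 * p\<^sup>2 + 2 * p * y"
    and dX: "\<bar>dX + b * Z\<bar> \<le> 2 * h * m + (2 * L + 1) * \<bar>X\<bar>"
    and dW: "dW \<le> - m\<^sup>2 - 2 * L * p\<^sup>2 + 4 * vv" and dE1: "dE1 = - D1 - b * X"
    and W: "W \<le> 1100 * Z" "p\<^sup>2 \<le> W" and E0: "E0 \<le> vv"
begin

lemma babs: "\<bar>b\<bar> = B\<^sup>2"
  using sgn by (metis abs_mult abs_of_nonneg mult_1 zero_le_power2)

lemma Z_nonneg: "Z \<ge> 0"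
  using pZ by (smt (verit) zero_le_power2)

lemma sigma_le: "\<sigma> * z \<le> \<bar>z\<bar>" "- \<bar>z\<bar> \<le> \<sigma> * z"
  using sgn(1) by (auto simp: abs_if split: if_splits)

lemma tau_powers: "\<tau> ^ 3 * B \<le> \<tau>\<^sup>2 * B\<^sup>2" "(\<tau> ^ 3 * B)\<^sup>2 \<le> \<tau>\<^sup>2 * B\<^sup>2" "0 \<le> \<tau> ^ 3 * B"
proof -
  have t: "\<tau> ^ 3 \<le> \<tau>\<^sup>2" using \<tau> by (intro power_decreasing) auto
  have Bs: "B \<le> B\<^sup>2" using B by (simp add: self_le_power)
  show "\<tau> ^ 3 * B \<le> \<tau>\<^sup>2 * B\<^sup>2" using t Bs B \<tau> by (intro mult_mono) auto
  show "0 \<le> \<tau> ^ 3 * B" using \<tau> B by simp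
  have "(\<tau> ^ 3)\<^sup>2 \<le> \<tau>\<^sup>2"
    using \<tau> power_decreasing[of 2 6 \<tau>] by (simp add: power_mult[symmetric])
  then show "(\<tau> ^ 3 * B)\<^sup>2 \<le> \<tau>\<^sup>2 * B\<^sup>2" by (simp add: power_mult_distrib mult_right_mono)
qed

text \<open>The derivative of the functional with its weights held fixed. Each indefinite product is
  divided by Young's inequality between two dissipations: h m between h^2 and m^2, L p y between L
  y^2 and L p^2, the remaining p y between y^2 and p^2. All leftover multiples of p^2 go into half
  of the term with \<open>Z\<close>; the other half and half of \<open>D0\<close> are kept.\<close>

lemma dissipation:
  "- D0 + (lya * \<tau> / B) * dE1 + \<sigma> * (lyb * \<tau>\<^sup>2) * dX + lyc * (\<tau> ^ 3 * B) * dW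
    \<le> - D0 / 2 - lyb / 2 * (\<tau>\<^sup>2 * B\<^sup>2 * Z)"
proof (cases "\<tau> = 0")
  case True
  have "D0 \<ge> 0" by (rule order_trans[OF _ yD]) simp
  then show ?thesis using True by simp
next
  case False
  then have t: "\<tau> > 0" using \<tau> by simp
  define T where "T = \<tau>\<^sup>2 * B\<^sup>2"
  define s where "s = lya * \<tau> / B"
  define c where "c = \<tau> ^ 3 * B"
  have s: "s > 0" using t B ly_bounds by (simp add: s_def)
  have c: "c \<ge> 0" "c \<le> T" "c\<^sup>2 \<le> T" using tau_powers by (simp_all add: c_def T_def)
  have T: "T \<ge> 0" by (simp add: T_def)
  have 1: "s * dE1 \<le> - s * h\<^sup>2 - s * (L * y\<^sup>2) + lya * \<tau> * B * (p * y)"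
  proof -
    have "\<bar>b * X\<bar> \<le> B\<^sup>2 * (p * y)"
      unfolding abs_mult babs using X by (intro mult_left_mono) auto
    then have "- b * X \<le> B\<^sup>2 * (p * y)" by linarith
    then have "dE1 \<le> - h\<^sup>2 - L * y\<^sup>2 + B\<^sup>2 * (p * y)" using dE1 D1 by linarith
    then have "s * dE1 \<le> s * (- h\<^sup>2 - L * y\<^sup>2 + B\<^sup>2 * (p * y))" using s by (intro mult_left_mono) auto
    also have "s * B\<^sup>2 = lya * \<tau> * B" using B by (simp add: s_def power2_eq_square)
    then have "s * (- h\<^sup>2 - L * y\<^sup>2 + B\<^sup>2 * (p * y)) = - s * h\<^sup>2 - s * (L * y\<^sup>2) + lya * \<tau> * B * (p * y)"
      by (simp add: distrib_left right_diff_distrib flip: mult.assoc)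
    finally show ?thesis .
  qed
  have 2: "lya * \<tau> * B * (p * y) \<le> y\<^sup>2 / 8 + 2 * lya\<^sup>2 * (T * p\<^sup>2)"
    using young_weighted[of "1/8" "lya * \<tau> * B / 2" y p]
    by (simp add: T_def power_mult_distrib power2_eq_square algebra_simps)
  have 3: "\<sigma> * (lyb * \<tau>\<^sup>2) * dX \<le> - (lyb * (T * Z)) + lyb * \<tau>\<^sup>2 * (2 * h * m) + lyb * \<tau>\<^sup>2 * (3 * L * (p * y))"
  proof -
    have "\<sigma> * (dX + b * Z) \<le> 2 * h * m + (2 * L + 1) * \<bar>X\<bar>"
      using sigma_le(1)[of "dX + b * Z"] dX by linarith
    moreover have "\<sigma> * (b * Z) = B\<^sup>2 * Z" using sgn(2) by (simp flip: mult.assoc)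
    moreover have "(2 * L + 1) * \<bar>X\<bar> \<le> 3 * L * (p * y)"
      using L X nonneg by (intro mult_mono) auto
    ultimately have "\<sigma> * dX \<le> - (B\<^sup>2 * Z) + 2 * h * m + 3 * L * (p * y)"
      by (simp add: distrib_left)
    then have "lyb * \<tau>\<^sup>2 * (\<sigma> * dX) \<le> lyb * \<tau>\<^sup>2 * (- (B\<^sup>2 * Z) + 2 * h * m + 3 * L * (p * y))"
      using ly_bounds by (intro mult_left_mono) auto
    then show ?thesis by (simp add: T_def algebra_simps)
  qed
  \<comment> \<open>The powers of \<tau> and B in the three weights form a geometric progression, so
    Young's inequality for the cross term, with the first weight given, produces exactly the
    third.\<close>
  have q: "(lyb * \<tau>\<^sup>2)\<^sup>2 / (s / 2) = (2 * lyb\<^sup>2 / lya) * c"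
    using t B ly_bounds by (simp add: s_def c_def field_simps power2_eq_square power3_eq_cube)
  have 4: "lyb * \<tau>\<^sup>2 * (2 * h * m) \<le> s / 2 * h\<^sup>2 + lyc * (c * m\<^sup>2)"
  proof -
    have "lyb * \<tau>\<^sup>2 * (2 * h * m) = 2 * (lyb * \<tau>\<^sup>2) * h * m" by simp
    also have "\<dots> \<le> s / 2 * h\<^sup>2 + (lyb * \<tau>\<^sup>2)\<^sup>2 / (s / 2) * m\<^sup>2"
      using s by (intro young_weighted) auto
    also have "(lyb * \<tau>\<^sup>2)\<^sup>2 / (s / 2) * m\<^sup>2 = (2 * lyb\<^sup>2 / lya) * (c * m\<^sup>2)" unfolding q by simp
    also have "\<dots> \<le> lyc * (c * m\<^sup>2)" using c by (intro mult_right_mono ly_bounds) auto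
    finally show ?thesis by simp
  qed
  have 5: "lyb * \<tau>\<^sup>2 * (3 * L * (p * y)) \<le> s / 2 * (L * y\<^sup>2) + 2 * lyc * (c * (L * p\<^sup>2))"
  proof -
    have "2 * (3/2 * (lyb * \<tau>\<^sup>2)) * y * p \<le> s / 2 * y\<^sup>2 + (3/2 * (lyb * \<tau>\<^sup>2))\<^sup>2 / (s / 2) * p\<^sup>2"
      using s by (intro young_weighted) auto
    also have "(3/2 * (lyb * \<tau>\<^sup>2))\<^sup>2 / (s / 2) = (9 * lyb\<^sup>2 / (2 * lya)) * c"
    proof -
      have "(3/2 * x)\<^sup>2 / (s / 2) = 9/4 * (x\<^sup>2 / (s / 2))" for x
        by (simp add: power2_eq_square)
      then have "(3/2 * (lyb * \<tau>\<^sup>2))\<^sup>2 / (s / 2) = 9/4 * ((2 * lyb\<^sup>2 / lya) * c)"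
        by (simp only: q)
      then show ?thesis by simp
    qed
    also have "(9 * lyb\<^sup>2 / (2 * lya)) * c * p\<^sup>2 \<le> 2 * lyc * c * p\<^sup>2"
      using c by (intro mult_right_mono ly_bounds) auto
    finally have "L * (2 * (3/2 * (lyb * \<tau>\<^sup>2)) * y * p) \<le> L * (s / 2 * y\<^sup>2 + 2 * lyc * c * p\<^sup>2)"
      using L by (intro mult_left_mono) auto
    then show ?thesis by (simp add: algebra_simps)
  qed
  have 6: "lyc * c * dW \<le> - lyc * (c * m\<^sup>2) - 2 * lyc * (c * (L * p\<^sup>2)) + 8 * lyc * (T * p\<^sup>2) + 8 * lyc * c * (p * y)"
  proof -
    have "dW \<le> - m\<^sup>2 - 2 * L * p\<^sup>2 + 8 * p\<^sup>2 + 8 * (p * y)" using dW vv by simp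
    then have "lyc * c * dW \<le> lyc * c * (- m\<^sup>2 - 2 * L * p\<^sup>2 + 8 * p\<^sup>2 + 8 * (p * y))"
      using ly_bounds c by (intro mult_left_mono) auto
    moreover have "8 * lyc * (c * p\<^sup>2) \<le> 8 * lyc * (T * p\<^sup>2)"
      using ly_bounds c by (intro mult_left_mono mult_right_mono) auto
    ultimately show ?thesis by (simp add: algebra_simps)
  qed
  have 7: "8 * lyc * c * (p * y) \<le> y\<^sup>2 / 8 + 128 * lyc\<^sup>2 * (T * p\<^sup>2)"
  proof -
    have "8 * lyc * c * (p * y) \<le> y\<^sup>2 / 8 + 128 * lyc\<^sup>2 * (c\<^sup>2 * p\<^sup>2)"
      using young_weighted[of "1/8" "4 * lyc * c" y p]
      by (simp add: power_mult_distrib algebra_simps)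
    moreover have "128 * lyc\<^sup>2 * (c\<^sup>2 * p\<^sup>2) \<le> 128 * lyc\<^sup>2 * (T * p\<^sup>2)"
      using c by (intro mult_left_mono mult_right_mono) auto
    ultimately show ?thesis by linarith
  qed
  have 8: "(2 * lya\<^sup>2 + 8 * lyc + 128 * lyc\<^sup>2) * (T * p\<^sup>2) \<le> lyb / 2 * (T * Z)"
  proof -
    have "(2 * lya\<^sup>2 + 8 * lyc + 128 * lyc\<^sup>2) * (T * p\<^sup>2) \<le> (2 * lya\<^sup>2 + 8 * lyc + 128 * lyc\<^sup>2) * (T * (1100 * Z))"
      using ly_bounds T pZ by (intro mult_left_mono) auto
    also have "\<dots> = 1100 * (2 * lya\<^sup>2 + 8 * lyc + 128 * lyc\<^sup>2) * (T * Z)" by simp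
    also have "\<dots> \<le> lyb / 2 * (T * Z)"
      using T Z_nonneg by (intro mult_right_mono ly_bounds) auto
    finally show ?thesis .
  qed
  have s01: "0 \<le> s * h\<^sup>2" "0 \<le> s * (L * y\<^sup>2)" using s L by auto
  have "- D0 + s * dE1 + \<sigma> * (lyb * \<tau>\<^sup>2) * dX + lyc * c * dW
    \<le> - D0 / 2 - lyb / 2 * (T * Z)"
    using 1 2 3 4 5 6 7 8[unfolded distrib_right] yD order_trans[OF zero_le_power2 yD] s01 by linarith
  then show ?thesis by (simp add: s_def c_def T_def)
qed

text \<open>The price of time-dependent weights: differentiating powers of \<tau> = B t gives the
  coefficients on the left, and they fit into the half of the dissipation kept in reserve by
  \<open>dissipation\<close>.\<close>

lemma weight_growth:
  "lya * (D0 / 2) + \<sigma> * (2 * lyb * \<tau> * B) * X + 3 * lyc * (\<tau>\<^sup>2 * B\<^sup>2) * W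
    \<le> D0 / 2 + lyb / 2 * (\<tau>\<^sup>2 * B\<^sup>2 * Z)"
proof -
  define T where "T = \<tau>\<^sup>2 * B\<^sup>2"
  have T: "T \<ge> 0" by (simp add: T_def)
  have D0: "D0 \<ge> 0" using yD by (smt (verit) zero_le_power2)
  have 1: "lya * (D0 / 2) \<le> D0 / 4" using ly_bounds(4) D0 mult_right_mono[of lya "1/2" "D0/2"] by simp
  have "\<sigma> * (2 * lyb * \<tau> * B) * X = (2 * lyb * \<tau> * B) * (\<sigma> * X)" by simp
  also have "\<dots> \<le> (2 * lyb * \<tau> * B) * (p * y)"
    using sigma_le(1)[of X] X ly_bounds \<tau> B by (intro mult_left_mono) auto
  also have "\<dots> \<le> y\<^sup>2 / 4 + 4 * lyb\<^sup>2 * (T * p\<^sup>2)"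
    using young_weighted[of "1/4" "lyb * \<tau> * B" y p]
    by (simp add: T_def power_mult_distrib algebra_simps)
  also have "4 * lyb\<^sup>2 * (T * p\<^sup>2) \<le> 4 * lyb\<^sup>2 * (T * (1100 * Z))"
    using T pZ by (intro mult_left_mono) auto
  finally have 2: "\<sigma> * (2 * lyb * \<tau> * B) * X \<le> y\<^sup>2 / 4 + 1100 * (4 * lyb\<^sup>2) * (T * Z)" by simp
  have "3 * lyc * T * W \<le> 3 * lyc * T * (1100 * Z)"
    using T W ly_bounds by (intro mult_left_mono) auto
  then have 3: "3 * lyc * T * W \<le> 1100 * (3 * lyc) * (T * Z)" by simp
  have "1100 * (4 * lyb\<^sup>2 + 3 * lyc) * (T * Z) \<le> lyb / 2 * (T * Z)"
    using T Z_nonneg by (intro mult_right_mono ly_bounds) auto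
  then show ?thesis using 1 2 3 yD unfolding T_def[symmetric] by (simp add: algebra_simps)
qed

text \<open>|X| \<le> p y is dominated by the neighbouring terms, y^2 through \<open>D0\<close> and
  p^2 through \<open>W\<close>, so the whole functional stays above \<open>E0\<close>.\<close>

lemma positivity: "0 \<le> (lya * \<tau> / B) * (D0 / 2) + \<sigma> * (lyb * \<tau>\<^sup>2) * X + lyc * (\<tau> ^ 3 * B) * W"
proof (cases "\<tau> = 0")
  case False
  then have t: "\<tau> > 0" using \<tau> by simp
  define s where "s = lya * \<tau> / B"
  define c where "c = \<tau> ^ 3 * B"
  have s: "s > 0" using t B ly_bounds by (simp add: s_def)
  have c: "c \<ge> 0" using tau_powers by (simp add: c_def)
  have "- (\<sigma> * X) \<le> p * y" using sigma_le(2)[of X] X by linarith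
  then have "lyb * \<tau>\<^sup>2 * (- (\<sigma> * X)) \<le> lyb * \<tau>\<^sup>2 * (p * y)"
    using ly_bounds by (intro mult_left_mono) auto
  also have "\<dots> = 2 * (lyb * \<tau>\<^sup>2 / 2) * y * p" by simp
  also have "\<dots> \<le> s / 2 * y\<^sup>2 + (lyb * \<tau>\<^sup>2 / 2)\<^sup>2 / (s / 2) * p\<^sup>2"
    using s by (intro young_weighted) auto
  also have "(lyb * \<tau>\<^sup>2 / 2)\<^sup>2 / (s / 2) = lyb\<^sup>2 / (2 * lya) * c"
    using t B ly_bounds by (simp add: s_def c_def field_simps power2_eq_square power3_eq_cube)
  also have "lyb\<^sup>2 / (2 * lya) * c * p\<^sup>2 \<le> lyc * c * p\<^sup>2"
    using c by (intro mult_right_mono ly_bounds) auto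
  also have "lyc * c * p\<^sup>2 \<le> lyc * c * W"
    using c W ly_bounds by (intro mult_left_mono) auto
  also have "s / 2 * y\<^sup>2 \<le> s / 2 * D0" using s yD by (intro mult_left_mono) auto
  finally show ?thesis unfolding s_def[symmetric] c_def[symmetric] by (simp add: algebra_simps)
qed simp

text \<open>This decides the rate. At \<tau> = 1 the functional times B is at most 3
  \<open>D0\<close> + 5500 B^2 \<open>Z\<close>, because B times the squared norm of v is bounded
  through B p^2 and B p y. Matching 5500 with the available lyb/2 gives the factor
  lyb/11000.\<close>

lemma energy_control:
  "lyb / 11000 * B * (E0 + (lya / B) * (D0 / 2) + \<sigma> * lyb * X + lyc * B * W)
     \<le> D0 / 2 + lyb / 2 * (B\<^sup>2 * Z)"
proof -
  have Bs: "B \<le> B\<^sup>2" using B by (simp add: self_le_power)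
  have D0: "D0 \<ge> 0" using yD by (smt (verit) zero_le_power2)
  have P: "B\<^sup>2 * p\<^sup>2 \<le> 1100 * (B\<^sup>2 * Z)" using pZ mult_left_mono[OF pZ, of "B\<^sup>2"] by simp
  have Bp: "2 * (B * (p * y)) \<le> y\<^sup>2 + B\<^sup>2 * p\<^sup>2"
    using young_weighted[of 1 B y p] by (simp add: algebra_simps)
  have 1: "B * E0 \<le> 2 * (B\<^sup>2 * p\<^sup>2) + 2 * (B * (p * y))"
  proof -
    have "B * E0 \<le> B * (2 * p\<^sup>2 + 2 * p * y)" using E0 vv B by (intro mult_left_mono) auto
    moreover have "B * p\<^sup>2 \<le> B\<^sup>2 * p\<^sup>2" using Bs by (intro mult_right_mono) auto
    ultimately show ?thesis by (simp add: algebra_simps)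
  qed
  have 2: "lya * (D0 / 2) \<le> D0"
  proof -
    have "lya * (D0 / 2) \<le> 1 * (D0 / 2)" by (rule mult_right_mono) (use ly_bounds(4) D0 in simp_all)
    then show ?thesis using D0 by linarith
  qed
  have 3: "B * (\<sigma> * lyb * X) \<le> B * (p * y)"
  proof -
    have "\<sigma> * X \<le> p * y" using sigma_le(1)[of X] X by linarith
    then have "lyb * (\<sigma> * X) \<le> lyb * (p * y)" using ly_bounds by (intro mult_left_mono) auto
    also have "\<dots> \<le> 1 * (p * y)" using ly_bounds nonneg by (intro mult_right_mono) auto
    finally show ?thesis using B by (simp add: mult_ac)
  qed
  have 4: "lyc * (B\<^sup>2 * W) \<le> 1100 * (B\<^sup>2 * Z)"
  proof -
    have "lyc * (B\<^sup>2 * W) \<le> lyc * (B\<^sup>2 * (1100 * Z))"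
      using W ly_bounds by (intro mult_left_mono) auto
    also have "\<dots> \<le> 1 * (B\<^sup>2 * (1100 * Z))" using ly_bounds Z_nonneg by (intro mult_right_mono) auto
    finally show ?thesis by simp
  qed
  have "B * (E0 + (lya / B) * (D0 / 2) + \<sigma> * lyb * X + lyc * B * W)
    = B * E0 + lya * (D0 / 2) + B * (\<sigma> * lyb * X) + lyc * (B\<^sup>2 * W)"
    using B by (simp add: algebra_simps power2_eq_square)
  also have "\<dots> \<le> 3 * D0 + 5500 * (B\<^sup>2 * Z)" using 1 2 3 4 P Bp yD D0 mult_nonneg_nonneg[OF zero_le_power2[of B] Z_nonneg] by linarith
  finally have *: "B * (E0 + (lya / B) * (D0 / 2) + \<sigma> * lyb * X + lyc * B * W)
    \<le> 3 * D0 + 5500 * (B\<^sup>2 * Z)" .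
  have "lyb / 11000 * B * (E0 + (lya / B) * (D0 / 2) + \<sigma> * lyb * X + lyc * B * W)
     = lyb / 11000 * (B * (E0 + (lya / B) * (D0 / 2) + \<sigma> * lyb * X + lyc * B * W))"
    by (rule mult.assoc)
  also have "\<dots> \<le> lyb / 11000 * (3 * D0 + 5500 * (B\<^sup>2 * Z))"
    using ly_bounds by (intro mult_left_mono *) auto
  also have "\<dots> = lyb * D0 * (3 / 11000) + lyb / 2 * (B\<^sup>2 * Z)"
    by (simp add: distrib_left mult_ac)
  finally have "lyb / 11000 * B * (E0 + (lya / B) * (D0 / 2) + \<sigma> * lyb * X + lyc * B * W)
     \<le> lyb * D0 * (3 / 11000) + lyb / 2 * (B\<^sup>2 * Z)" .
  moreover have "lyb * D0 * (3 / 11000) \<le> D0 / 2"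
    using mult_right_mono[OF ly_bounds(5) D0] D0 by linarith
  ultimately show ?thesis by (rule order_trans[OF _ add_right_mono])
qed

end

lemma lyapunov_dataI:
  fixes u :: rseq
  assumes l: "l \<noteq> 0" and b: "\<bar>b\<bar> \<ge> 1" and \<tau>: "0 \<le> \<tau>" "\<tau> \<le> 1"
  defines "v \<equiv> opH l u"
  shows "lyapunov_data ((real_of_int l)\<^sup>2) (sqrt \<bar>b\<bar>) (norm (opC v)) (norm (opD v)) (norm (opC (opD v)))
    (norm (opD (opD v))) (D0f l u) (D1f l u) (Zf l v) (Xf v) (Wf l u) (E0f l u)
    (dXf v (opH l (flow l b u))) (dWf l u (flow l b u)) (dD0 l u (flow l b u) / 2) (inner v v) (sgn b) \<tau> b"
proof
  let ?L = "(real_of_int l)\<^sup>2"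
  show "?L \<ge> 1" by (rule nn_cases[OF l])
  show "sqrt \<bar>b\<bar> \<ge> 1" using b by simp
  show "\<bar>sgn b\<bar> = 1" "sgn b * b = (sqrt \<bar>b\<bar>)\<^sup>2" using b by (auto simp: sgn_if)
  show "(norm (opC v))\<^sup>2 \<le> 1100 * Zf l v" "(norm (opC v))\<^sup>2 \<le> Wf l u" "Wf l u \<le> 1100 * Zf l v"
    using Wf_bounds[OF l, of u] by (simp_all add: power2_norm_eq_inner v_def)
  show "(norm (opD v))\<^sup>2 \<le> D0f l u"
    using D0f_ge[OF l, of u] inner_ge_zero[of v]
    by (smt (verit) power2_norm_eq_inner v_def mult_nonneg_nonneg zero_le_power2)
  show "\<bar>Xf v\<bar> \<le> norm (opC v) * norm (opD v)"
    unfolding Xf_def using Cauchy_Schwarz_ineq2[of "opJ (opC v)" "opD v"]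
    by (simp add: norm_eq_sqrt_inner opJ_isometry)
  show "(norm (opD (opD v)))\<^sup>2 + ?L * (norm (opD v))\<^sup>2 \<le> D1f l u"
    using D1f_ge[OF l, of u] by (simp add: power2_norm_eq_inner v_def)
  show "inner v v \<le> 2 * (norm (opC v))\<^sup>2 + 2 * norm (opC v) * norm (opD v)"
    using norm_le_cos_deriv[of v] by (simp add: power2_norm_eq_inner)
  have "\<bar>inner (opD (opD v)) (opJ (opC (opD v)))\<bar> \<le> norm (opD (opD v)) * norm (opC (opD v))"
    using Cauchy_Schwarz_ineq2[of "opD (opD v)" "opJ (opC (opD v))"]
    by (simp add: norm_eq_sqrt_inner opJ_isometry)
  moreover have "\<bar>(2 * ?L + 1) * Xf v\<bar> = (2 * ?L + 1) * \<bar>Xf v\<bar>" by (simp add: abs_mult)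
  ultimately show "\<bar>dXf v (opH l (flow l b u)) + b * Zf l v\<bar>
    \<le> 2 * norm (opD (opD v)) * norm (opC (opD v)) + (2 * ?L + 1) * \<bar>Xf v\<bar>"
    unfolding v_def dXf_flow[OF l] by linarith
  show "dWf l u (flow l b u) \<le> - (norm (opC (opD v)))\<^sup>2 - 2 * ?L * (norm (opC v))\<^sup>2 + 4 * inner v v"
    using dWf_flow[OF l, of u b] by (simp add: power2_norm_eq_inner v_def)
  show "dD0 l u (flow l b u) / 2 = - D1f l u - b * Xf v" unfolding v_def by (rule dD0_flow[OF l])
  show "E0f l u \<le> inner v v" unfolding v_def by (rule E0f_bounds[OF l])
qed (use \<tau> in auto)

section \<open>Decay along differentiable solutions\<close>

lemma nonincreasing_from_derivative:
  fixes f :: "real \<Rightarrow> real"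
  assumes "a \<le> b" "a \<ge> 0"
    and "\<And>x. x \<ge> 0 \<Longrightarrow> (f has_real_derivative f' x) (at x within {0..})"
    and "\<And>x. a \<le> x \<Longrightarrow> x \<le> b \<Longrightarrow> f' x \<le> 0"
  shows "f b \<le> f a"
proof (rule DERIV_nonpos_imp_decreasing_open[OF assms(1)])
    fix x assume x: "a < x" "x < b"
    have "(f has_real_derivative f' x) (at x within {0..})"
      using assms(2) x by (intro assms(3)) linarith
    moreover have "at x within {0..} = at x"
      using assms(2) x by (intro at_within_interior) simp
    ultimately show "\<exists>y. (f has_real_derivative y) (at x) \<and> y \<le> 0"
      using assms(4)[of x] x by (intro exI[of _ "f' x"] conjI) simp_all
  next
    have "continuous_on {0..} f"
      by (rule DERIV_continuous_on, rule assms(3)) simp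
    then show "continuous_on {a..b} f"
      by (rule continuous_on_subset) (use assms(2) in auto)
qed

lemma exponential_decay:
  fixes f :: "real \<Rightarrow> real"
  assumes "a \<le> t" "a \<ge> 0"
    and d: "\<And>x. x \<ge> 0 \<Longrightarrow> (f has_real_derivative f' x) (at x within {0..})"
    and le: "\<And>x. x \<ge> a \<Longrightarrow> f' x \<le> - \<kappa> * f x"
  shows "f t \<le> exp (- \<kappa> * (t - a)) * f a"
proof -
  have "exp (\<kappa> * t) * f t \<le> exp (\<kappa> * a) * f a"
  proof (rule nonincreasing_from_derivative[OF assms(1,2)])
    fix x :: real assume "x \<ge> 0"
    show "((\<lambda>x. exp (\<kappa> * x) * f x) has_real_derivative exp (\<kappa> * x) * (\<kappa> * f x + f' x)) (at x within {0..})"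
      using d[OF \<open>x \<ge> 0\<close>] by (auto intro!: derivative_eq_intros simp: algebra_simps)
  next
    fix x assume "a \<le> x"
    then show "exp (\<kappa> * x) * (\<kappa> * f x + f' x) \<le> 0"
      using le[of x] by (intro mult_nonneg_nonpos) auto
  qed
  then have "exp (- \<kappa> * t) * (exp (\<kappa> * t) * f t) \<le> exp (- \<kappa> * t) * (exp (\<kappa> * a) * f a)"
    by (intro mult_left_mono) auto
  then show ?thesis by (simp add: exp_add[symmetric] algebra_simps flip: mult.assoc)
qed

text \<open>The second condition does not follow from the first, since \<open>opD\<close> is
  unbounded for the norm of \<open>rseq\<close>; the derivatives of \<open>D0f\<close> and
  \<open>Xf\<close> require it.\<close>

definition rsolution :: "int \<Rightarrow> real \<Rightarrow> (real \<Rightarrow> rseq) \<Rightarrow> bool" where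
  "rsolution l b u \<longleftrightarrow> (\<forall>t\<ge>0.
     (u has_vector_derivative flow l b (u t)) (at t within {0..}) \<and>
     ((\<lambda>t. opD (u t)) has_vector_derivative opD (flow l b (u t))) (at t within {0..}))"

lemma op_norms: "norm (opJ u) = norm u" "norm (opC u) \<le> norm u" "norm (opS u) \<le> norm u"
  "l \<noteq> 0 \<Longrightarrow> norm (opG l u) \<le> norm u"
proof -
  show "norm (opJ u) = norm u" by (simp add: norm_eq_sqrt_inner opJ_isometry)
  show "norm (opC u) \<le> norm u" "norm (opS u) \<le> norm u"
    unfolding norm_eq_sqrt_inner
    using pythagoras_inner[of u] inner_ge_zero[of "opC u"] inner_ge_zero[of "opS u"]
    by (auto intro!: real_sqrt_le_mono simp del: inner_ge_zero)
  show "l \<noteq> 0 \<Longrightarrow> norm (opG l u) \<le> norm u"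
    unfolding norm_eq_sqrt_inner by (intro real_sqrt_le_mono opG_le)
qed

lemma op_bounded_linear: "bounded_linear opJ" "bounded_linear opC" "bounded_linear opS"
  "l \<noteq> 0 \<Longrightarrow> bounded_linear (opG l)" "l \<noteq> 0 \<Longrightarrow> bounded_linear (opH l)"
proof -
  have *: "bounded_linear f" if "linear f" "\<And>u. norm (f u) \<le> norm u" for f :: "rseq \<Rightarrow> rseq"
    using that by (intro bounded_linear.intro) (auto simp: bounded_linear_axioms_def linear_iff
      linear_def intro!: exI[of _ 1])
  show "bounded_linear opJ" "bounded_linear opC" "bounded_linear opS"
    by (rule *; simp add: op_linear op_norms)+
  show g: "bounded_linear (opG l)" if "l \<noteq> 0"
    by (rule *) (simp_all add: op_linear op_norms that)
  show "bounded_linear (opH l)" if "l \<noteq> 0"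
    unfolding opH_def[abs_def] using g[OF that] by (intro bounded_linear_sub bounded_linear_ident)
qed

lemma has_real_derivative_inner:
  fixes f g :: "real \<Rightarrow> 'a :: real_inner"
  assumes "(f has_vector_derivative f') (at t within S)" "(g has_vector_derivative g') (at t within S)"
  shows "((\<lambda>t. inner (f t) (g t)) has_real_derivative (inner f' (g t) + inner (f t) g')) (at t within S)"
proof -
  have "((\<lambda>t. inner (f t) (g t)) has_derivative (\<lambda>h. inner (f t) (h *\<^sub>R g') + inner (h *\<^sub>R f') (g t))) (at t within S)"
    using assms unfolding has_vector_derivative_def by (intro has_derivative_inner)
  then show ?thesis
    unfolding has_field_derivative_def by (rule has_derivative_eq_rhs) (auto simp: algebra_simps)
qed

context
  fixes l :: int and b :: real and u :: "real \<Rightarrow> rseq"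
  assumes l: "l \<noteq> 0" and sol: "rsolution l b u"
begin

lemma rsolution_derivs:
  assumes "t \<ge> 0"
  shows "((\<lambda>t. E0f l (u t)) has_real_derivative - D0f l (u t)) (at t within {0..})"
    and "((\<lambda>t. D0f l (u t)) has_real_derivative dD0 l (u t) (flow l b (u t))) (at t within {0..})"
    and "((\<lambda>t. Xf (opH l (u t))) has_real_derivative dXf (opH l (u t)) (opH l (flow l b (u t)))) (at t within {0..})"
    and "((\<lambda>t. Wf l (u t)) has_real_derivative dWf l (u t) (flow l b (u t))) (at t within {0..})"
proof -
  let ?w = "flow l b (u t)"
  have d0: "(u has_vector_derivative ?w) (at t within {0..})"
    and d1: "((\<lambda>t. opD (u t)) has_vector_derivative opD ?w) (at t within {0..})"
    using sol assms by (auto simp: rsolution_def)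
  note BL = bounded_linear.has_vector_derivative
  note H = op_bounded_linear(5)[OF l]
  have v: "((\<lambda>t. opH l (u t)) has_vector_derivative opH l ?w) (at t within {0..})"
    by (rule BL[OF H d0])
  have Dv: "((\<lambda>t. opD (opH l (u t))) has_vector_derivative opD (opH l ?w)) (at t within {0..})"
    using BL[OF H d1] by (simp add: opH_commute)
  have JC: "((\<lambda>t. opJ (opC (opH l (u t)))) has_vector_derivative opJ (opC (opH l ?w))) (at t within {0..})"
    by (intro BL[OF op_bounded_linear(1)] BL[OF op_bounded_linear(2)] v)
  have S: "((\<lambda>t. opS (opH l (u t))) has_vector_derivative opS (opH l ?w)) (at t within {0..})"
    by (intro BL[OF op_bounded_linear(3)] v)
  have HS: "((\<lambda>t. opH l (opS (opH l (u t)))) has_vector_derivative opH l (opS (opH l ?w))) (at t within {0..})"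
    by (intro BL[OF H] S)
  have "((\<lambda>t. E0f l (u t)) has_real_derivative (inner ?w (opH l (u t)) + inner (u t) (opH l ?w)) / 2) (at t within {0..})"
    unfolding E0f_def by (intro DERIV_cdivide has_real_derivative_inner d0 v)
  then show "((\<lambda>t. E0f l (u t)) has_real_derivative - D0f l (u t)) (at t within {0..})"
    using dE0_flow[OF l, of "u t" b] by (simp add: dE0_def inner_commute flip: opH_adjoint)
  have "((\<lambda>t. D0f l (u t)) has_real_derivative (inner (opD ?w) (opD (u t)) + inner (opD (u t)) (opD ?w))
     + ((real_of_int l)\<^sup>2 - 1) * (inner ?w (u t) + inner (u t) ?w)) (at t within {0..})"
    unfolding D0f_def by (intro DERIV_add DERIV_cmult has_real_derivative_inner d0 d1)
  then show "((\<lambda>t. D0f l (u t)) has_real_derivative dD0 l (u t) ?w) (at t within {0..})"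
    by (rule DERIV_cong) (simp add: dD0_def inner_commute algebra_simps)
  show "((\<lambda>t. Xf (opH l (u t))) has_real_derivative dXf (opH l (u t)) (opH l ?w)) (at t within {0..})"
    unfolding Xf_def dXf_def by (intro has_real_derivative_inner JC Dv)
  have "((\<lambda>t. Wf l (u t)) has_real_derivative (inner ?w (opH l (u t)) + inner (u t) (opH l ?w))
     - (inner (opH l (opS (opH l ?w))) (opS (opH l (u t))) + inner (opH l (opS (opH l (u t)))) (opS (opH l ?w))))
     (at t within {0..})"
    unfolding Wf_def by (intro DERIV_diff has_real_derivative_inner d0 v S HS)
  then show "((\<lambda>t. Wf l (u t)) has_real_derivative dWf l (u t) ?w) (at t within {0..})"
    by (rule DERIV_cong) (metis (no_types, lifting) dWf_def opH_adjoint inner_commute mult_2)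
qed

lemma rsolution_heat_decay:
  assumes "t \<ge> 0"
  shows "E0f l (u t) \<le> exp (- 2 * (real_of_int l)\<^sup>2 * t) * E0f l (u 0)"
proof -
  have "E0f l (u t) \<le> exp (- (2 * (real_of_int l)\<^sup>2) * (t - 0)) * E0f l (u 0)"
    by (rule exponential_decay[where f' = "\<lambda>t. - D0f l (u t)"])
      (use assms rsolution_derivs(1) E0f_bounds(3)[OF l] in auto)
  then show ?thesis by simp
qed

text \<open>Two functionals are used. Up to time 1/B the weights grow from zero, so that
  \<open>F\<close> starts at \<open>E0f\<close> alone and does not increase. From then on the
  weights are frozen, and the functional \<open>G\<close>, equal to \<open>F\<close> at time 1/B,
  decays exponentially.\<close>

lemma rsolution_enhanced_decay:
  assumes b: "\<bar>b\<bar> \<ge> 1" and t: "t \<ge> 1 / sqrt \<bar>b\<bar>"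
  shows "E0f l (u t) \<le> exp (- (lyb / 11000 * sqrt \<bar>b\<bar>) * (t - 1 / sqrt \<bar>b\<bar>)) * E0f l (u 0)"
proof -
  define B where "B = sqrt \<bar>b\<bar>"
  have B: "B \<ge> 1" using b by (simp add: B_def)
  let ?E = "\<lambda>t. E0f l (u t)" and ?D = "\<lambda>t. D0f l (u t)" and ?X = "\<lambda>t. Xf (opH l (u t))"
    and ?W = "\<lambda>t. Wf l (u t)" and ?Z = "\<lambda>t. Zf l (opH l (u t))"
  let ?dD = "\<lambda>t. dD0 l (u t) (flow l b (u t))"
    and ?dX = "\<lambda>t. dXf (opH l (u t)) (opH l (flow l b (u t)))"
    and ?dW = "\<lambda>t. dWf l (u t) (flow l b (u t))"
  note I = lyapunov_dataI[OF l b, folded B_def]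
  note dis = lyapunov_data.dissipation[OF I] and grow = lyapunov_data.weight_growth[OF I]
    and pos = lyapunov_data.positivity[OF I] and ctl = lyapunov_data.energy_control[OF I]
  \<comment> \<open>The factor \<open>sgn b\<close> gives the term \<open>- b * Zf\<close> in the
    derivative of the cross term the sign of a dissipation, whatever the sign of \<open>b\<close>.
    The first weight is \<tau>/B = t.\<close>
  define F where "F t = ?E t + (lya * t) * (?D t / 2) + sgn b * (lyb * (B * t)\<^sup>2) * ?X t
    + lyc * ((B * t) ^ 3 * B) * ?W t" for t
  define F' where "F' t = - ?D t + (lya * (?D t / 2) + (lya * t) * (?dD t / 2))
    + (sgn b * (2 * lyb * (B * t) * B) * ?X t + sgn b * (lyb * (B * t)\<^sup>2) * ?dX t)
    + (3 * lyc * ((B * t)\<^sup>2 * B\<^sup>2) * ?W t + lyc * ((B * t) ^ 3 * B) * ?dW t)" for t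
  have F: "(F has_real_derivative F' t) (at t within {0..})" if "t \<ge> 0" for t
  proof -
    note d = rsolution_derivs[OF that]
    have "((\<lambda>t. lya * t) has_real_derivative lya) (at t within {0..})"
      "((\<lambda>t. sgn b * (lyb * (B * t)\<^sup>2)) has_real_derivative sgn b * (2 * lyb * (B * t) * B)) (at t within {0..})"
      "((\<lambda>t. lyc * ((B * t) ^ 3 * B)) has_real_derivative 3 * lyc * ((B * t)\<^sup>2 * B\<^sup>2)) (at t within {0..})"
      by (auto intro!: derivative_eq_intros simp: power2_eq_square)
    from DERIV_add[OF DERIV_add[OF DERIV_add[OF d(1) DERIV_mult'[OF this(1) DERIV_cdivide[OF d(2), of 2]]]
        DERIV_mult'[OF this(2) d(3)]] DERIV_mult'[OF this(3) d(4)]]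
    show ?thesis unfolding F_def by (rule DERIV_cong) (simp add: F'_def)
  qed
  have "F (1 / B) \<le> F 0"
  proof (rule nonincreasing_from_derivative[OF _ _ F])
    fix t assume t: "0 \<le> t" "t \<le> 1 / B"
    then have \<tau>: "0 \<le> B * t" "B * t \<le> 1" using B by (simp_all add: field_simps)
    have "lya * (B * t) / B = lya * t" using B by simp
    then show "F' t \<le> 0"
      using dis[OF \<tau>, of "u t"] grow[OF \<tau>, of "u t"] unfolding F'_def by simp
  qed (use B in auto)
  then have 1: "F (1 / B) \<le> ?E 0" by (simp add: F_def)
  define G where "G t = ?E t + (lya / B) * (?D t / 2) + sgn b * lyb * ?X t + lyc * B * ?W t" for t
  define G' where "G' t = - ?D t + (lya / B) * (?dD t / 2) + sgn b * lyb * ?dX t + lyc * B * ?dW t" for t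
  have G: "(G has_real_derivative G' t) (at t within {0..})" if "t \<ge> 0" for t
    unfolding G_def G'_def
    by (intro DERIV_add DERIV_cmult DERIV_cdivide rsolution_derivs[OF that])
  have GF: "F (1 / B) = G (1 / B)" using B by (simp add: G_def F_def)
  have "G t \<le> exp (- (lyb / 11000 * B) * (t - 1 / B)) * F (1 / B)"
    unfolding GF
  proof (rule exponential_decay[OF _ _ G])
    fix s
    have "G' s \<le> - ?D s / 2 - lyb / 2 * (B\<^sup>2 * ?Z s)"
      using dis[of 1 "u s"] by (simp add: G'_def)
    moreover have "lyb / 11000 * B * G s \<le> ?D s / 2 + lyb / 2 * (B\<^sup>2 * ?Z s)"
      unfolding G_def by (rule ctl[of 1]) simp_all
    ultimately have "G' s \<le> - (lyb / 11000 * B * G s)" by linarith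
    then show "G' s \<le> - (lyb / 11000 * B) * G s" by simp
  qed (use B t in \<open>auto simp: B_def\<close>)
  moreover have "?E t \<le> G t"
    using pos[of 1 "u t"] unfolding G_def by simp
  moreover have "exp (- (lyb / 11000 * B) * (t - 1 / B)) * F (1 / B) \<le> exp (- (lyb / 11000 * B) * (t - 1 / B)) * ?E 0"
    by (intro mult_left_mono 1) auto
  ultimately show ?thesis unfolding B_def by linarith
qed

end

section \<open>The tridiagonal system: Picard series and uniqueness\<close>

definition bm :: "int \<Rightarrow> int \<Rightarrow> real" where "bm l k = 1 - 1 / nn l k"
text \<open>Minus i b sin y times I + A^{-1}, in coordinates: the imaginary unit cancels against the
  one in the denominator of the sine. Unlike \<open>flow\<close> it is defined for arbitrary
  sequences, in particular for bounded ones.\<close>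

definition bop :: "int \<Rightarrow> real \<Rightarrow> (int \<Rightarrow> complex) \<Rightarrow> int \<Rightarrow> complex" where
  "bop l b x k = - of_real (b / 2) * (of_real (bm l (k - 1)) * x (k - 1)
     - of_real (bm l (k + 1)) * x (k + 1))"
definition lat :: "int \<Rightarrow> real \<Rightarrow> (int \<Rightarrow> complex) \<Rightarrow> int \<Rightarrow> complex" where
  "lat l b x k = - of_real (nn l k) * x k + bop l b x k"

abbreviation wt :: "nat \<Rightarrow> int \<Rightarrow> real" where
  "wt p k \<equiv> (1 + \<bar>real_of_int k\<bar>) ^ p"

lemma cf_flow: "cf (flow l b u) k = lat l b (cf u) k"
  by (simp only: flow_def lat_def bop_def cf_simps cf_op cf_opS cf_opLap cf_opH flip: bm_def) (simp add: field_simps)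

lemma bop_diff: "bop l b (\<lambda>k. x k - y k) k = bop l b x k - bop l b y k"
  by (simp add: bop_def algebra_simps)

lemma bop_combination: "bop l b (\<lambda>k. a * x k + c * y k) k = a * bop l b x k + c * bop l b y k"
  by (simp add: bop_def algebra_simps)

lemma lat_diff: "lat l b (\<lambda>k. x k - y k) k = lat l b x k - lat l b y k"
  by (simp add: lat_def bop_diff algebra_simps)

lemma lat_combination: "lat l b (\<lambda>k. a * x k + c * y k) k = a * lat l b x k + c * lat l b y k"
  by (simp add: lat_def bop_combination algebra_simps)

lemma wt_shift: assumes "\<bar>j\<bar> = 1" shows "wt p k \<le> 2 ^ p * wt p (k + j)"
proof -
  have "1 + \<bar>real_of_int k\<bar> \<le> 2 * (1 + \<bar>real_of_int (k + j)\<bar>)"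
    using assms by (auto simp: abs_if split: if_splits)
  then have "wt p k \<le> (2 * (1 + \<bar>real_of_int (k + j)\<bar>)) ^ p" by (intro power_mono) auto
  then show ?thesis by (simp only: power_mult_distrib)
qed

lemma at_within_half_line: "0 < s \<Longrightarrow> at s within {0..} = at (s :: real)"
  by (rule at_within_interior) simp

text \<open>Duhamel's formula with the damping discarded. That the bound does not depend on \<nu> is
  what makes it usable for the unbounded diagonal. After multiplication by the integrating factor,
  the derivative of \<open>\<phi>\<close> exceeds what is required by the nonnegative amount
  \<open>\<nu> * \<phi> s\<close>.\<close>

lemma forced_decay_bound:
  fixes y g :: "real \<Rightarrow> complex"
  assumes "t \<ge> 0" "\<nu> \<ge> 0" "C \<ge> 0" "y 0 = 0"
    and d: "\<And>s. 0 \<le> s \<Longrightarrow> s \<le> t \<Longrightarrow> (y has_vector_derivative (- \<nu> *\<^sub>R y s + g s)) (at s within {0..})"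
    and g: "\<And>s. 0 \<le> s \<Longrightarrow> s \<le> t \<Longrightarrow> cmod (g s) \<le> C * s ^ j"
  shows "cmod (y t) \<le> C * t ^ Suc j / Suc j"
proof (cases "t = 0")
  case False
  define f where "f s = exp (\<nu> * s) *\<^sub>R y s" for s
  define \<phi> where "\<phi> s = exp (\<nu> * s) * (C * s ^ Suc j / Suc j)" for s
  have f: "(f has_vector_derivative exp (\<nu> * s) *\<^sub>R g s) (at s within {0..})" if "0 \<le> s" "s \<le> t" for s
  proof -
    have e: "((\<lambda>s. exp (\<nu> * s)) has_real_derivative \<nu> * exp (\<nu> * s)) (at s within {0..})"
      by (auto intro!: derivative_eq_intros)
    show ?thesis unfolding f_def
      by (rule has_vector_derivative_eq_rhs[OF has_vector_derivative_scaleR[OF e d[OF that]]])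
        (simp add: algebra_simps)
  qed
  have p: "(\<phi> has_real_derivative (\<nu> * \<phi> s + exp (\<nu> * s) * (C * s ^ j))) (at s)" for s
  proof -
    have "((\<lambda>s. C * s ^ Suc j / Suc j) has_real_derivative C * s ^ j) (at s)"
    proof -
      have "((\<lambda>s. C / Suc j * s ^ Suc j) has_real_derivative C / Suc j * (real (Suc j) * s ^ (Suc j - Suc 0))) (at s)"
        by (rule DERIV_cmult[OF DERIV_pow])
      then show ?thesis by (simp del: power_Suc of_nat_Suc)
    qed
    moreover have "((\<lambda>s. exp (\<nu> * s)) has_real_derivative \<nu> * exp (\<nu> * s)) (at s)"
      by (auto intro!: derivative_eq_intros)
    ultimately show ?thesis unfolding \<phi>_def
      by (rule DERIV_cong[OF DERIV_mult'[rotated]]) (simp add: mult_ac)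
  qed
  have "norm (f t - f 0) \<le> \<phi> t - \<phi> 0"
  proof (rule differentiable_bound_general)
    show "0 < t" using False assms by simp
    show "continuous_on {0..t} f"
      unfolding continuous_on_eq_continuous_within
      by (intro ballI continuous_within_subset[OF has_vector_derivative_continuous[OF f]]) auto
    show "continuous_on {0..t} \<phi>"
      using p by (meson DERIV_isCont continuous_at_imp_continuous_on)
    show "(f has_vector_derivative exp (\<nu> * s) *\<^sub>R g s) (at s)" if "0 < s" "s < t" for s
      using f[of s] that by (simp add: at_within_half_line)
    show "(\<phi> has_vector_derivative (\<nu> * \<phi> s + exp (\<nu> * s) * (C * s ^ j))) (at s)" for s
      using p[of s] by (simp add: has_real_derivative_iff_has_vector_derivative)
    show "norm (exp (\<nu> * s) *\<^sub>R g s) \<le> \<nu> * \<phi> s + exp (\<nu> * s) * (C * s ^ j)" if "0 < s" "s < t" for s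
    proof -
      have "norm (exp (\<nu> * s) *\<^sub>R g s) \<le> exp (\<nu> * s) * (C * s ^ j)"
        using g[of s] that by simp
      moreover have "0 \<le> \<nu> * \<phi> s" using assms that by (simp add: \<phi>_def)
      ultimately show ?thesis by linarith
    qed
  qed
  then have "exp (\<nu> * t) * cmod (y t) \<le> exp (\<nu> * t) * (C * t ^ Suc j / Suc j)"
    using assms by (simp add: f_def \<phi>_def)
  then show ?thesis by (rule mult_left_le_imp_le) simp
qed (use assms in simp)

lemma exp_sums_real: "(\<lambda>j. x ^ j / fact j) sums exp (x :: real)"
  using exp_converges[of x] by (simp add: divide_inverse mult.commute)

lemma exp_has_derivative: "((\<lambda>t. exp (c * t)) has_real_derivative c * exp (c * t)) (at t within S)" for c t :: real
  by (auto intro!: derivative_eq_intros)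

context
  fixes l :: int and b :: real
  assumes l: "l \<noteq> 0"
begin

lemma bop_bound:
  assumes M: "\<And>k. wt p k * cmod (x k) \<le> M"
  shows "wt p k * cmod (bop l b x k) \<le> \<bar>b\<bar> * 2 ^ p * M"
proof -
  have m: "\<bar>bm l j\<bar> \<le> 1" for j
    using nn_cases(2)[OF l, of j] by (simp add: abs_le_iff bm_def)
  have *: "wt p k * cmod (of_real (bm l (k + j)) * x (k + j)) \<le> 2 ^ p * M" if "\<bar>j\<bar> = 1" for j
  proof -
    have "cmod (of_real (bm l (k + j)) * x (k + j)) \<le> 1 * cmod (x (k + j))"
      unfolding norm_mult norm_of_real by (intro mult_right_mono m) auto
    then have "wt p k * cmod (of_real (bm l (k + j)) * x (k + j)) \<le> wt p k * cmod (x (k + j))"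
      by (intro mult_left_mono) auto
    also have "\<dots> \<le> 2 ^ p * wt p (k + j) * cmod (x (k + j))"
      by (intro mult_right_mono wt_shift that) auto
    also have "\<dots> \<le> 2 ^ p * M" using mult_left_mono[OF M[of "k + j"], of "2 ^ p"] by (simp add: mult_ac)
    finally show ?thesis .
  qed
  define A B where "A = of_real (bm l (k - 1)) * x (k - 1)" and "B = of_real (bm l (k + 1)) * x (k + 1)"
  have A: "wt p k * cmod A \<le> 2 ^ p * M" using *[of "-1"] by (simp add: A_def)
  have B: "wt p k * cmod B \<le> 2 ^ p * M" using *[of 1] by (simp add: B_def)
  have "cmod (bop l b x k) = \<bar>b\<bar> / 2 * cmod (A - B)"
    by (simp add: bop_def A_def B_def norm_mult norm_divide)
  also have "\<dots> \<le> \<bar>b\<bar> / 2 * (cmod A + cmod B)" by (intro mult_left_mono norm_triangle_ineq4) auto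
  finally have "wt p k * cmod (bop l b x k) \<le> wt p k * (\<bar>b\<bar> / 2 * (cmod A + cmod B))"
    by (intro mult_left_mono) auto
  also have "\<dots> = \<bar>b\<bar> / 2 * (wt p k * cmod A + wt p k * cmod B)" by (simp add: algebra_simps)
  also have "\<dots> \<le> \<bar>b\<bar> / 2 * (2 ^ p * M + 2 ^ p * M)" using A B by (intro mult_left_mono add_mono) auto
  finally show ?thesis by (simp add: mult_ac)
qed

text \<open>The diagonal grows like k^2, so \<open>lat\<close> costs two powers of the weight; the
  off-diagonal part only costs a constant.\<close>

lemma lat_bound:
  assumes M: "\<And>k. wt (p + 2) k * cmod (x k) \<le> M"
  shows "wt p k * cmod (lat l b x k) \<le> ((real_of_int l)\<^sup>2 + 1 + \<bar>b\<bar> * 2 ^ p) * M"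
proof -
  have w: "1 \<le> wt 2 k" for k :: int by (intro one_le_power) simp
  have M0: "wt p k * cmod (x k) \<le> M" for k
  proof -
    have "wt p k * cmod (x k) * 1 \<le> wt p k * cmod (x k) * wt 2 k" by (intro mult_left_mono w) auto
    also have "wt p k * cmod (x k) * wt 2 k = wt (p + 2) k * cmod (x k)"
      by (simp only: power_add mult_ac)
    finally have "wt p k * cmod (x k) * 1 \<le> wt (p + 2) k * cmod (x k)" .
    with M[of k] show ?thesis by linarith
  qed
  have "nn l k \<le> ((real_of_int l)\<^sup>2 + 1) * wt 2 k"
  proof -
    have "nn l k \<le> (real_of_int l)\<^sup>2 * 1 + 1 * wt 2 k"
      by (simp add: power2_eq_square algebra_simps)
    also have "\<dots> \<le> (real_of_int l)\<^sup>2 * wt 2 k + 1 * wt 2 k" using w[of k] by (intro add_mono mult_left_mono) auto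
    finally show ?thesis by (simp add: distrib_right)
  qed
  then have "nn l k * (wt p k * cmod (x k)) \<le> ((real_of_int l)\<^sup>2 + 1) * wt 2 k * (wt p k * cmod (x k))"
    by (intro mult_right_mono) auto
  also have "\<dots> = ((real_of_int l)\<^sup>2 + 1) * (wt (p + 2) k * cmod (x k))"
    by (simp only: power_add mult_ac)
  also have "\<dots> \<le> ((real_of_int l)\<^sup>2 + 1) * M" by (intro mult_left_mono M) auto
  finally have 1: "nn l k * (wt p k * cmod (x k)) \<le> ((real_of_int l)\<^sup>2 + 1) * M" .
  have "cmod (lat l b x k) \<le> nn l k * cmod (x k) + cmod (bop l b x k)"
    using norm_triangle_ineq[of "- of_real (nn l k) * x k" "bop l b x k"] nn_cases(3)[OF l, of k]
    unfolding lat_def norm_mult norm_minus_cancel norm_of_real by simp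
  then have "wt p k * cmod (lat l b x k) \<le> wt p k * (nn l k * cmod (x k) + cmod (bop l b x k))"
    by (intro mult_left_mono) auto
  then show ?thesis
    using 1 bop_bound[OF M0, of k] by (simp add: algebra_simps)
qed

lemma factorial_step:
  "\<bar>b\<bar> * 2 ^ p * (M * (\<bar>b\<bar> * 2 ^ p) ^ j / fact j) * t ^ Suc j / Suc j
    = M * (\<bar>b\<bar> * 2 ^ p * t) ^ Suc j / fact (Suc j)"
  by (simp add: power_mult_distrib field_simps)

text \<open>With zero data the diagonal can be treated as damping, and the off-diagonal part is
  bounded on bounded sequences. Iterating \<open>forced_decay_bound\<close> improves the bound
  \<open>M\<close> by the terms of an exponential series, which tend to zero.\<close>

lemma lat_unique:
  assumes "T \<ge> 0"
    and d: "\<And>k t. 0 \<le> t \<Longrightarrow> t \<le> T \<Longrightarrow> ((\<lambda>t. x t k) has_vector_derivative lat l b (x t) k) (at t within {0..})"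
    and M: "\<And>k t. 0 \<le> t \<Longrightarrow> t \<le> T \<Longrightarrow> cmod (x t k) \<le> M" and z: "\<And>k. x 0 k = 0"
  shows "x T k = 0"
proof -
  have *: "cmod (x t k) \<le> M * (\<bar>b\<bar> * 2 ^ 0 * t) ^ j / fact j" if "0 \<le> t" "t \<le> T" for t j k
    using that
  proof (induction j arbitrary: t k)
    case (Suc j)
    define C where "C = \<bar>b\<bar> * 2 ^ 0 * (M * (\<bar>b\<bar> * 2 ^ 0) ^ j / fact j)"
    have "0 \<le> cmod (x 0 k)" by simp
    also have "\<dots> \<le> M" using M[of 0 k] assms(1) by simp
    finally have "C \<ge> 0" by (simp add: C_def)
    have "cmod (x t k) \<le> C * t ^ Suc j / Suc j"
    proof (rule forced_decay_bound[where \<nu> = "nn l k" and g = "\<lambda>t. bop l b (x t) k"])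
      show "nn l k \<ge> 0" using nn_cases(3)[OF l, of k] by simp
      fix s assume s: "0 \<le> s" "s \<le> t"
      show "((\<lambda>t. x t k) has_vector_derivative - nn l k *\<^sub>R x s k + bop l b (x s) k) (at s within {0..})"
        using d[of s k] s Suc.prems by (simp add: lat_def scaleR_conv_of_real)
      have "wt 0 k * cmod (x s k) \<le> M * (\<bar>b\<bar> * 2 ^ 0 * s) ^ j / fact j" for k
        using Suc.IH[of s k] s Suc.prems by simp
      from bop_bound[OF this, of k] show "cmod (bop l b (x s) k) \<le> C * s ^ j"
        by (simp add: C_def power_mult_distrib mult_ac)
    qed (use Suc.prems z \<open>C \<ge> 0\<close> in auto)
    then show ?case unfolding C_def factorial_step .
  qed (use M in auto)
  have "(\<lambda>j. M * ((\<bar>b\<bar> * 2 ^ 0 * T) ^ j / fact j)) \<longlonglongrightarrow> M * 0"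
    by (intro tendsto_mult tendsto_const summable_LIMSEQ_zero sums_summable[OF exp_sums_real])
  then have "cmod (x T k) \<le> M * 0"
    by (rule tendsto_lowerbound) (use *[of T k] assms(1) in auto)
  then show ?thesis by simp
qed

text \<open>The terms of the Dyson series: the diagonal is integrated exactly by exponentials and
  each further term feeds the previous one through \<open>bop\<close>.\<close>

primrec pic :: "(int \<Rightarrow> complex) \<Rightarrow> nat \<Rightarrow> real \<Rightarrow> int \<Rightarrow> complex" where
  "pic f 0 t k = exp (- nn l k * t) *\<^sub>R f k"
| "pic f (Suc j) t k = exp (- nn l k * t) *\<^sub>R integral {0..t} (\<lambda>s. exp (nn l k * s) *\<^sub>R bop l b (pic f j s) k)"

definition pic_rhs :: "(int \<Rightarrow> complex) \<Rightarrow> nat \<Rightarrow> real \<Rightarrow> int \<Rightarrow> complex" where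
  "pic_rhs f j t k = (case j of 0 \<Rightarrow> 0 | Suc i \<Rightarrow> bop l b (pic f i t) k)"

lemma pic_deriv:
  "t \<ge> 0 \<Longrightarrow> ((\<lambda>t. pic f j t k) has_vector_derivative (- nn l k *\<^sub>R pic f j t k + pic_rhs f j t k)) (at t within {0..})"
proof (induction j arbitrary: t k)
  case 0
  show ?case
    using has_vector_derivative_scaleR[OF exp_has_derivative[of "- nn l k"] has_vector_derivative_const]
    by (simp add: pic_rhs_def)
next
  case (Suc j)
  have c: "continuous_on {0..} (\<lambda>t. pic f j t k)" for k
    unfolding continuous_on_eq_continuous_within
    by (intro ballI has_vector_derivative_continuous[OF Suc.IH]) auto
  have g: "continuous_on {0..} (\<lambda>s. exp (nn l k * s) *\<^sub>R bop l b (pic f j s) k)"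
    unfolding bop_def by (intro continuous_intros c)
  have "((\<lambda>u. integral {0..u} (\<lambda>s. exp (nn l k * s) *\<^sub>R bop l b (pic f j s) k)) has_vector_derivative
    exp (nn l k * t) *\<^sub>R bop l b (pic f j t) k) (at t within {0..t+1})"
    by (rule integral_has_vector_derivative) (use Suc.prems in \<open>auto intro: continuous_on_subset[OF g]\<close>)
  moreover have "at t within {0..t+1} = at t within {0..}"
    by (rule at_within_nhd[of _ "{..<t+1}"]) auto
  ultimately have "((\<lambda>u. integral {0..u} (\<lambda>s. exp (nn l k * s) *\<^sub>R bop l b (pic f j s) k)) has_vector_derivative
    exp (nn l k * t) *\<^sub>R bop l b (pic f j t) k) (at t within {0..})" by simp
  from has_vector_derivative_scaleR[OF exp_has_derivative[of "- nn l k"] this]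
  have *: "((\<lambda>t. pic f (Suc j) t k) has_vector_derivative exp (- nn l k * t) *\<^sub>R (exp (nn l k * t) *\<^sub>R bop l b (pic f j t) k)
    + (- nn l k * exp (- nn l k * t)) *\<^sub>R integral {0..t} (\<lambda>s. exp (nn l k * s) *\<^sub>R bop l b (pic f j s) k))
    (at t within {0..})" by (simp only: pic.simps)
  have cancel: "exp (- c * t) *\<^sub>R (exp (c * t) *\<^sub>R z) = z" for c and z :: complex
    by (simp add: exp_minus)
  show ?case using *[unfolded cancel]
    by (simp only: pic.simps pic_rhs_def nat.case add.commute scaleR_scaleR)
qed

lemma pic_bound:
  assumes M: "\<And>k. wt p k * cmod (f k) \<le> M" and "t \<ge> 0"
  shows "wt p k * cmod (pic f j t k) \<le> M * (\<bar>b\<bar> * 2 ^ p * t) ^ j / fact j"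
  using \<open>t \<ge> 0\<close>
proof (induction j arbitrary: t k)
  case 0
  have "0 \<le> nn l k * t" using nn_cases(3)[OF l, of k] 0 by (intro mult_nonneg_nonneg) auto
  then have "- nn l k * t \<le> 0" by linarith
  then have "exp (- nn l k * t) \<le> 1" by (simp only: exp_le_one_iff)
  then have "exp (- nn l k * t) * (wt p k * cmod (f k)) \<le> 1 * (wt p k * cmod (f k))"
    by (intro mult_right_mono) auto
  also have "\<dots> \<le> M" using M by simp
  finally have "exp (- nn l k * t) * (wt p k * cmod (f k)) \<le> M" .
  moreover have "wt p k * cmod (pic f 0 t k) = exp (- nn l k * t) * (wt p k * cmod (f k))"
    by (simp only: pic.simps norm_scaleR abs_exp_cancel mult_ac)
  ultimately have "wt p k * cmod (pic f 0 t k) \<le> M" by (simp only:)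
  then show ?case by (simp del: pic.simps)
next
  case (Suc j)
  define C where "C = \<bar>b\<bar> * 2 ^ p * (M * (\<bar>b\<bar> * 2 ^ p) ^ j / fact j)"
  have w: "wt p k > 0" by (intro zero_less_power) simp
  have "0 \<le> wt p k * cmod (f k)" by simp
  also have "\<dots> \<le> M" by (rule M)
  finally have "C \<ge> 0" by (simp add: C_def)
  have "cmod (pic f (Suc j) t k) \<le> C / wt p k * t ^ Suc j / Suc j"
  proof (rule forced_decay_bound[where \<nu> = "nn l k" and g = "\<lambda>t. bop l b (pic f j t) k"])
    show "nn l k \<ge> 0" using nn_cases(3)[OF l, of k] by simp
    fix s assume s: "0 \<le> s" "s \<le> t"
    show "((\<lambda>t. pic f (Suc j) t k) has_vector_derivative - nn l k *\<^sub>R pic f (Suc j) s k + bop l b (pic f j s) k) (at s within {0..})"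
      using pic_deriv[OF s(1), of f "Suc j" k] by (simp add: pic_rhs_def)
    have "wt p k * cmod (pic f j s k) \<le> M * (\<bar>b\<bar> * 2 ^ p * s) ^ j / fact j" for k
      using Suc.IH[of s k] s by simp
    from bop_bound[OF this, of k] have "wt p k * cmod (bop l b (pic f j s) k) \<le> C * s ^ j"
      by (simp add: C_def power_mult_distrib mult_ac)
    then show "cmod (bop l b (pic f j s) k) \<le> C / wt p k * s ^ j"
      using w by (simp add: field_simps)
  qed (use Suc.prems \<open>C \<ge> 0\<close> w in auto)
  then have "wt p k * cmod (pic f (Suc j) t k) \<le> wt p k * (C / wt p k * t ^ Suc j / Suc j)"
    using w by (intro mult_left_mono) auto
  also have "\<dots> = C * t ^ Suc j / Suc j"
  proof -
    have "w * (C / w * t ^ Suc j / Suc j) = C * t ^ Suc j / Suc j" if "w > 0" for w :: real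
      using that by simp
    from this[OF w] show ?thesis .
  qed
  finally show ?case unfolding C_def factorial_step .
qed

definition sol :: "(int \<Rightarrow> complex) \<Rightarrow> real \<Rightarrow> int \<Rightarrow> complex" where
  "sol f t k = (\<Sum>j. pic f j t k)"

lemma pic_summable:
  assumes "bounded (range f)" "t \<ge> 0"
  shows "summable (\<lambda>j. pic f j t k)"
proof -
  obtain M where M: "\<And>k. cmod (f k) \<le> M" using assms(1) by (auto simp: bounded_iff)
  have bd: "norm (pic f j t k) \<le> M * ((\<bar>b\<bar> * t) ^ j / fact j)" for j
    using pic_bound[of 0 f M t k j] M assms(2) by simp
  have "summable (\<lambda>j. M * ((\<bar>b\<bar> * t) ^ j / fact j))"
    by (intro summable_mult sums_summable[OF exp_sums_real])
  then show ?thesis by (rule summable_comparison_test'[where N = 0]) (rule bd)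
qed

lemma sol_bound:
  assumes M: "\<And>k. wt p k * cmod (f k) \<le> M" and "t \<ge> 0"
  shows "wt p k * cmod (sol f t k) \<le> M * exp (\<bar>b\<bar> * 2 ^ p * t)"
proof -
  have w: "wt p k > 0" by (intro zero_less_power) simp
  have s: "(\<lambda>j. M / wt p k * ((\<bar>b\<bar> * 2 ^ p * t) ^ j / fact j)) sums (M / wt p k * exp (\<bar>b\<bar> * 2 ^ p * t))"
    by (intro sums_mult exp_sums_real)
  have "norm (sol f t k) \<le> (\<Sum>j. M / wt p k * ((\<bar>b\<bar> * 2 ^ p * t) ^ j / fact j))"
    unfolding sol_def
  proof (rule norm_suminf_le)
    show "norm (pic f j t k) \<le> M / wt p k * ((\<bar>b\<bar> * 2 ^ p * t) ^ j / fact j)" for j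
      using pic_bound[OF M assms(2), of k j] w by (simp add: field_simps)
  qed (use s in \<open>auto simp: sums_iff\<close>)
  then have "norm (sol f t k) \<le> M / wt p k * exp (\<bar>b\<bar> * 2 ^ p * t)" using s by (simp only: sums_iff)
  then have "wt p k * norm (sol f t k) \<le> wt p k * (M / wt p k * exp (\<bar>b\<bar> * 2 ^ p * t))"
    using w by (intro mult_left_mono) auto
  then show ?thesis using w by simp
qed

lemma bop_sums:
  assumes "\<And>k. (\<lambda>j. x j k) sums y k" shows "(\<lambda>j. bop l b (x j) k) sums bop l b y k"
  unfolding bop_def by (intro sums_mult sums_diff assms)

text \<open>Termwise differentiation by the Weierstrass test. At a fixed \<open>k\<close> the
  diagonal entry is a constant, so the differentiated series is still dominated by an exponential
  series.\<close>

lemma sol_deriv: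
  assumes f: "bounded (range f)" and t: "t \<ge> 0"
  shows "((\<lambda>t. sol f t k) has_vector_derivative lat l b (sol f t) k) (at t within {0..})"
proof -
  obtain M where M: "\<And>k. cmod (f k) \<le> M" using f by (auto simp: bounded_iff)
  have M0: "M \<ge> 0" using norm_ge_zero order_trans M by blast
  \<comment> \<open>The interval reaches beyond \<open>t\<close>, so that at \<open>t\<close> the
    derivative within it is the derivative within the half-line.\<close>
  define T where "T = t + 1"
  have T: "T \<ge> 0" using t by (simp add: T_def)
  define D where "D j x = - nn l k *\<^sub>R pic f j x k + pic_rhs f j x k" for j x
  define P where "P j = M * (\<bar>b\<bar> * T) ^ j / fact j" for j
  define N where "N j = nn l k * P j + (case j of 0 \<Rightarrow> 0 | Suc i \<Rightarrow> \<bar>b\<bar> * P i)" for j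
  have P: "cmod (pic f j x k) \<le> P j" if "x \<in> {0..T}" for j x k
  proof -
    have "cmod (pic f j x k) \<le> M * (\<bar>b\<bar> * x) ^ j / fact j" 
      using pic_bound[of 0 f M x k j] M that by simp
    also have "\<dots> \<le> P j" unfolding P_def using that M0
      by (intro divide_right_mono mult_left_mono power_mono) auto
    finally show ?thesis .
  qed
  have sP: "summable P" unfolding P_def times_divide_eq_right[symmetric]
    by (intro summable_mult sums_summable[OF exp_sums_real])
  have "summable (\<lambda>j. case j of 0 \<Rightarrow> 0 | Suc i \<Rightarrow> \<bar>b\<bar> * P i)"
    by (subst summable_Suc_iff[symmetric]) (simp add: summable_mult sP)
  then have sN: "summable N" unfolding N_def by (intro summable_add summable_mult sP)
  have DN: "norm (D j x) \<le> N j" if x: "x \<in> {0..T}" for j x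
  proof -
    have "norm (D j x) \<le> norm (- nn l k *\<^sub>R pic f j x k) + norm (pic_rhs f j x k)"
      unfolding D_def by (rule norm_triangle_ineq)
    also have "norm (- nn l k *\<^sub>R pic f j x k) = nn l k * cmod (pic f j x k)"
      using nn_cases(3)[OF l, of k] unfolding norm_scaleR abs_minus_cancel by simp
    also have "nn l k * cmod (pic f j x k) \<le> nn l k * P j"
      using P[OF x] nn_cases(3)[OF l, of k] by (intro mult_left_mono) auto
    also have "cmod (pic_rhs f j x k) \<le> (case j of 0 \<Rightarrow> 0 | Suc i \<Rightarrow> \<bar>b\<bar> * P i)"
      using bop_bound[of 0 "pic f (j - 1) x" "P (j - 1)" k] P[OF x]
      by (cases j) (simp_all add: pic_rhs_def)
    finally show ?thesis unfolding N_def by simp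
  qed
  have u: "uniform_limit {0..T} (\<lambda>n x. \<Sum>i<n. D i x) (\<lambda>x. suminf (\<lambda>i. D i x)) sequentially"
    by (rule Weierstrass_m_test[OF DN sN])
  have "\<exists>g. \<forall>x\<in>{0..T}. (\<lambda>n. pic f n x k) sums g x \<and>
     (g has_derivative (\<lambda>h. h *\<^sub>R (\<Sum>i. D i x))) (at x within {0..T})"
  proof (rule has_derivative_series[where f' = "\<lambda>n x h. h *\<^sub>R D n x"])
    show "convex {0..T}" by simp
    fix n x assume x: "x \<in> {0..T}"
    show "((\<lambda>t. pic f n t k) has_derivative (\<lambda>h. h *\<^sub>R D n x)) (at x within {0..T})"
      using pic_deriv[of x f n k] x unfolding D_def has_vector_derivative_def
      by (auto intro: has_derivative_subset)
  next
    fix e :: real assume "e > 0"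
    from uniform_limitD[OF u this]
    show "\<forall>\<^sub>F n in sequentially. \<forall>x\<in>{0..T}. \<forall>h. norm ((\<Sum>i<n. h *\<^sub>R D i x) - h *\<^sub>R (\<Sum>i. D i x)) \<le> e * norm h"
    proof (rule eventually_mono, intro ballI allI)
      fix n x h assume *: "\<forall>x\<in>{0..T}. dist (\<Sum>i<n. D i x) (\<Sum>i. D i x) < e" "x \<in> {0..T}"
      have "norm ((\<Sum>i<n. h *\<^sub>R D i x) - h *\<^sub>R (\<Sum>i. D i x)) = norm h * dist (\<Sum>i<n. D i x) (\<Sum>i. D i x)"
        by (simp only: scaleR_sum_right[symmetric] scaleR_diff_right[symmetric] norm_scaleR dist_norm real_norm_def)
      also have "\<dots> \<le> norm h * e" using * by (intro mult_left_mono) (auto intro: less_imp_le)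
      finally show "norm ((\<Sum>i<n. h *\<^sub>R D i x) - h *\<^sub>R (\<Sum>i. D i x)) \<le> e * norm h" by (simp add: mult.commute)
    qed
  next
    show "t \<in> {0..T}" using t by (simp add: T_def)
    show "(\<lambda>n. pic f n t k) sums sol f t k"
      unfolding sol_def by (rule summable_sums[OF pic_summable[OF f t]])
  qed
  then obtain g where g: "\<And>x. x \<in> {0..T} \<Longrightarrow> (\<lambda>n. pic f n x k) sums g x"
    "\<And>x. x \<in> {0..T} \<Longrightarrow> (g has_vector_derivative (\<Sum>i. D i x)) (at x within {0..T})"
    unfolding has_vector_derivative_def by blast
  have "((\<lambda>t. sol f t k) has_vector_derivative (\<Sum>i. D i t)) (at t within {0..T})"
    by (rule has_vector_derivative_transform[OF _ _ g(2)])
      (use t g(1) in \<open>auto simp: T_def sol_def sums_iff\<close>)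
  moreover have "at t within {0..T} = at t within {0..}"
    by (rule at_within_nhd[of _ "{..<T}"]) (auto simp: T_def)
  moreover have "(\<Sum>i. D i t) = lat l b (sol f t) k"
  proof -
    have s: "(\<lambda>j. pic f j t k) sums sol f t k" for k
      unfolding sol_def by (rule summable_sums[OF pic_summable[OF f t]])
    have "(\<lambda>j. pic_rhs f (Suc j) t k) sums bop l b (sol f t) k"
      unfolding pic_rhs_def by (simp add: bop_sums s)
    then have "(\<lambda>j. pic_rhs f j t k) sums (bop l b (sol f t) k + pic_rhs f 0 t k)"
      by (rule sums_Suc)
    then have "(\<lambda>j. pic_rhs f j t k) sums bop l b (sol f t) k" by (simp add: pic_rhs_def)
    then have "(\<lambda>j. D j t) sums (- nn l k *\<^sub>R sol f t k + bop l b (sol f t) k)"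
      unfolding D_def by (intro sums_add sums_scaleR_right s)
    then show ?thesis by (simp add: sums_iff lat_def scaleR_conv_of_real)
  qed
  ultimately show ?thesis by simp
qed

lemma sol_0: "sol f 0 k = f k"
proof -
  have "(\<lambda>j. pic f j 0 k) sums (\<Sum>j\<in>{0}. pic f j 0 k)"
    by (rule sums_finite) (auto simp: gr0_conv_Suc)
  then show ?thesis by (simp add: sol_def sums_iff)
qed

lemma sol_unique:
  assumes "T \<ge> 0"
    and d: "\<And>k t. 0 \<le> t \<Longrightarrow> t \<le> T \<Longrightarrow> ((\<lambda>t. x t k) has_vector_derivative lat l b (x t) k) (at t within {0..})"
    and M: "\<And>k t. 0 \<le> t \<Longrightarrow> t \<le> T \<Longrightarrow> cmod (x t k) \<le> M"
  shows "x T k = sol (x 0) T k"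
proof -
  have M': "cmod (x 0 k) \<le> M" for k using M[of 0 k] assms(1) by simp
  have bd: "bounded (range (x 0))" using M' by (auto simp: bounded_iff)
  have M0: "M \<ge> 0" using norm_ge_zero order_trans M' by blast
  have "x T k - sol (x 0) T k = 0"
  proof (rule lat_unique[where x = "\<lambda>t k. x t k - sol (x 0) t k"])
    fix k t assume t: "0 \<le> t" "t \<le> T"
    show "((\<lambda>t. x t k - sol (x 0) t k) has_vector_derivative lat l b (\<lambda>k. x t k - sol (x 0) t k) k) (at t within {0..})"
      unfolding lat_diff by (intro has_vector_derivative_diff d sol_deriv bd t)
    have "cmod (sol (x 0) t k) \<le> M * exp (\<bar>b\<bar> * t)"
      using sol_bound[of 0 "x 0" M t k] M' t by simp
    also have "\<dots> \<le> M * exp (\<bar>b\<bar> * T)" using t M0 by (intro mult_left_mono) (auto intro: mult_left_mono)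
    finally show "cmod (x t k - sol (x 0) t k) \<le> M + M * exp (\<bar>b\<bar> * T)"
      using M[OF t, of k] norm_triangle_ineq4[of "x t k" "sol (x 0) t k"] by linarith
  qed (use assms(1) in \<open>auto simp: sol_0\<close>)
  then show ?thesis by simp
qed

lemma sol_combination:
  assumes f: "bounded (range f)" and g: "bounded (range g)" and "t \<ge> 0"
  shows "sol (\<lambda>k. a * f k + c * g k) t k = a * sol f t k + c * sol g t k"
proof -
  obtain F where F: "\<And>k. cmod (f k) \<le> F" using f by (auto simp: bounded_iff)
  obtain G where G: "\<And>k. cmod (g k) \<le> G" using g by (auto simp: bounded_iff)
  have FG: "F \<ge> 0" "G \<ge> 0" using norm_ge_zero order_trans F G by blast+
  have "a * sol f t k + c * sol g t k = sol (\<lambda>k. a * sol f 0 k + c * sol g 0 k) t k"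
  proof (rule sol_unique[where x = "\<lambda>t k. a * sol f t k + c * sol g t k"])
    fix k s assume s: "0 \<le> s" "s \<le> t"
    show "((\<lambda>t. a * sol f t k + c * sol g t k) has_vector_derivative
      lat l b (\<lambda>k. a * sol f s k + c * sol g s k) k) (at s within {0..})"
      unfolding lat_combination
      by (intro has_vector_derivative_add has_vector_derivative_mult_right sol_deriv f g s)
    have "cmod (sol f s k) \<le> F * exp (\<bar>b\<bar> * s)" "cmod (sol g s k) \<le> G * exp (\<bar>b\<bar> * s)"
      using sol_bound[of 0 f F s k] sol_bound[of 0 g G s k] F G s by simp_all
    moreover have "F * exp (\<bar>b\<bar> * s) \<le> F * exp (\<bar>b\<bar> * t)" "G * exp (\<bar>b\<bar> * s) \<le> G * exp (\<bar>b\<bar> * t)"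
      using s FG by (auto intro!: mult_left_mono)
    ultimately have "cmod (sol f s k) \<le> F * exp (\<bar>b\<bar> * t)" "cmod (sol g s k) \<le> G * exp (\<bar>b\<bar> * t)"
      by linarith+
    then have "cmod (a * sol f s k) + cmod (c * sol g s k) \<le> cmod a * (F * exp (\<bar>b\<bar> * t)) + cmod c * (G * exp (\<bar>b\<bar> * t))"
      unfolding norm_mult by (intro add_mono mult_left_mono) auto
    then show "cmod (a * sol f s k + c * sol g s k) \<le> cmod a * (F * exp (\<bar>b\<bar> * t)) + cmod c * (G * exp (\<bar>b\<bar> * t))"
      by (rule order_trans[OF norm_triangle_ineq])
  qed (rule assms)
  then show ?thesis by (simp add: sol_0)
qed

text \<open>The time-shifted solution solves the same system, is bounded on the interval, and starts
  from \<open>sol f t\<close>.\<close>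

lemma sol_semigroup:
  assumes f: "bounded (range f)" and "s \<ge> 0" "t \<ge> 0"
  shows "sol f (s + t) k = sol (sol f t) s k"
proof -
  obtain F where F: "\<And>k. cmod (f k) \<le> F" using f by (auto simp: bounded_iff)
  have FG: "F \<ge> 0" using norm_ge_zero order_trans F by blast
  have "sol f (s + t) k = sol (sol f (0 + t)) s k"
  proof (rule sol_unique[where x = "\<lambda>s k. sol f (s + t) k"])
    fix k r assume r: "0 \<le> r" "r \<le> s"
    have "((\<lambda>r. sol f r k) has_vector_derivative lat l b (sol f (r + t)) k) (at (r + t) within {0..})"
      using r assms by (intro sol_deriv f) auto
    moreover have "((\<lambda>r. r + t) has_vector_derivative 1) (at r within {0..})"
      by (auto intro!: derivative_eq_intros)
    moreover have "(\<lambda>r. r + t) ` {0..} \<subseteq> {0..}" using assms by auto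
    ultimately have "(((\<lambda>r. sol f r k) \<circ> (\<lambda>r. r + t)) has_vector_derivative 1 *\<^sub>R lat l b (sol f (r + t)) k) (at r within {0..})"
      unfolding has_vector_derivative_def[of "\<lambda>r. sol f r k"]
      by (intro vector_derivative_diff_chain_within) (auto intro: has_derivative_subset)
    then show "((\<lambda>s. sol f (s + t) k) has_vector_derivative lat l b (sol f (r + t)) k) (at r within {0..})"
      by (simp add: o_def)
    have "cmod (sol f (r + t) k) \<le> F * exp (\<bar>b\<bar> * (r + t))"
      using sol_bound[of 0 f F "r + t" k] F r assms by simp
    also have "\<dots> \<le> F * exp (\<bar>b\<bar> * (s + t))" using r FG by (auto intro!: mult_left_mono)
    finally show "cmod (sol f (r + t) k) \<le> F * exp (\<bar>b\<bar> * (s + t))" .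
  qed (rule assms)
  then show ?thesis by simp
qed

end

section \<open>Rapidly decreasing data give curves in the inner product space\<close>

lemma norm_rseq_le:
  assumes M: "\<And>k. wt 1 k * cmod (cf x k) \<le> M"
  shows "norm x \<le> sqrt (\<Sum>\<^sub>\<infinity>k::int. 1 / (1 + \<bar>real_of_int k\<bar>)\<^sup>2) * M"
proof -
  have M0: "M \<ge> 0" using order_trans[OF _ M[of 0]] by simp
  have "inner x x = (\<Sum>\<^sub>\<infinity>k. Re (cf x k * cnj (cf x k)))" by (simp add: inner_rseq_def)
  also have "\<dots> \<le> (\<Sum>\<^sub>\<infinity>k::int. M\<^sup>2 * (1 / (1 + \<bar>real_of_int k\<bar>)\<^sup>2))"
  proof (rule infsum_mono[OF rseq_summable])
    show "(\<lambda>k::int. M\<^sup>2 * (1 / (1 + \<bar>real_of_int k\<bar>)\<^sup>2)) summable_on UNIV"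
      by (intro summable_on_cmult_right summable_on_int_inverse_square)
    fix k
    have w: "(1 + \<bar>real_of_int k\<bar>) > 0" by simp
    have "((1 + \<bar>real_of_int k\<bar>) * cmod (cf x k))\<^sup>2 \<le> M\<^sup>2"
      using M[of k] by (intro power_mono) auto
    then have "(cmod (cf x k))\<^sup>2 \<le> M\<^sup>2 * (1 / (1 + \<bar>real_of_int k\<bar>)\<^sup>2)"
    proof -
      have "c \<le> M\<^sup>2 * (1 / w\<^sup>2)" if "w > 0" "w\<^sup>2 * c \<le> M\<^sup>2" for w c :: real
        using that by (simp add: pos_le_divide_eq mult.commute)
      from this[OF w] show ?thesis
        using \<open>((1 + \<bar>real_of_int k\<bar>) * cmod (cf x k))\<^sup>2 \<le> M\<^sup>2\<close> by (simp only: power_mult_distrib)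
    qed
    then show "Re (cf x k * cnj (cf x k)) \<le> M\<^sup>2 * (1 / (1 + \<bar>real_of_int k\<bar>)\<^sup>2)"
      by (simp add: complex_mult_cnj cmod_power2)
  qed
  also have "\<dots> = M\<^sup>2 * (\<Sum>\<^sub>\<infinity>k::int. 1 / (1 + \<bar>real_of_int k\<bar>)\<^sup>2)"
    by (rule infsum_cmult_right) (rule summable_on_int_inverse_square)
  finally have "norm x \<le> sqrt (M\<^sup>2 * (\<Sum>\<^sub>\<infinity>k::int. 1 / (1 + \<bar>real_of_int k\<bar>)\<^sup>2))"
    by (simp add: norm_eq_sqrt_inner)
  then show ?thesis using M0 by (simp add: real_sqrt_mult mult.commute)
qed

lemma quadratic_remainder_deriv:
  fixes x :: "real \<Rightarrow> 'a :: real_normed_vector"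
  assumes "t \<ge> 0" "K \<ge> 0"
    and "\<And>s. 0 \<le> s \<Longrightarrow> s \<le> t + 1 \<Longrightarrow> norm (x s - x t - (s - t) *\<^sub>R x') \<le> K * \<bar>s - t\<bar> * \<bar>s - t\<bar>"
  shows "(x has_vector_derivative x') (at t within {0..})"
  unfolding has_vector_derivative_def has_derivative_within_alt
proof (intro conjI allI impI)
  show "bounded_linear (\<lambda>h. h *\<^sub>R x')" by (rule bounded_linear_scaleR_left)
  fix e :: real assume e: "e > 0"
  define d where "d = min 1 (e / (K + 1))"
  have d: "d > 0" using e assms(2) by (simp add: d_def)
  show "\<exists>d>0. \<forall>y\<in>{0..}. norm (y - t) < d \<longrightarrow> norm (x y - x t - (y - t) *\<^sub>R x') \<le> e * norm (y - t)"
  proof (intro exI[of _ d] conjI ballI impI d)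
    fix y assume y: "y \<in> {0..}" "norm (y - t) < d"
    have "norm (x y - x t - (y - t) *\<^sub>R x') \<le> K * \<bar>y - t\<bar> * \<bar>y - t\<bar>"
      using y by (intro assms(3)) (auto simp: d_def)
    also have "K * \<bar>y - t\<bar> \<le> (K + 1) * (e / (K + 1))"
      using y assms(2) e by (intro mult_mono) (auto simp: d_def)
    also have "\<dots> = e" using assms(2) by simp
    finally show "norm (x y - x t - (y - t) *\<^sub>R x') \<le> e * norm (y - t)"
      by (simp add: mult_right_mono)
  qed
qed

context
  fixes l :: int and b :: real and f :: "int \<Rightarrow> complex"
  assumes l: "l \<noteq> 0" and f: "rapid f"
begin

lemma rapid_bounded: "bounded (range f)"
proof -
  obtain K where "\<And>k. (1 + \<bar>real_of_int k\<bar>) ^ 0 * cmod (f k) \<le> K" using rapidD[OF f] by metis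
  then show ?thesis by (auto simp: bounded_iff)
qed

lemma sol_wt_bound:
  assumes "T \<ge> 0"
  obtains M where "M \<ge> 0" "\<And>t k. 0 \<le> t \<Longrightarrow> t \<le> T \<Longrightarrow> wt p k * cmod (sol l b f t k) \<le> M"
proof -
  obtain K where K: "K \<ge> 0" "\<And>k. wt p k * cmod (f k) \<le> K" using rapidD[OF f] by metis
  show ?thesis
  proof (rule that[of "K * exp (\<bar>b\<bar> * 2 ^ p * T)"])
    fix t k assume t: "0 \<le> t" "t \<le> T"
    have "wt p k * cmod (sol l b f t k) \<le> K * exp (\<bar>b\<bar> * 2 ^ p * t)"
      by (rule sol_bound[OF l K(2) t(1)])
    also have "\<dots> \<le> K * exp (\<bar>b\<bar> * 2 ^ p * T)"
      using t K(1) by (intro mult_left_mono) (auto intro!: mult_left_mono)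
    finally show "wt p k * cmod (sol l b f t k) \<le> K * exp (\<bar>b\<bar> * 2 ^ p * T)" .
  qed (use K in simp)
qed

lemma sol_rapid: "t \<ge> 0 \<Longrightarrow> rapid (sol l b f t)"
  unfolding rapid_def using sol_wt_bound[of t] by (metis order_refl)

definition rsol :: "real \<Rightarrow> rseq" where "rsol t = Abs_rseq (sol l b f t)"

lemma cf_rsol: "t \<ge> 0 \<Longrightarrow> cf (rsol t) = sol l b f t"
  unfolding rsol_def using sol_rapid by (simp add: Abs_rseq_inverse)

text \<open>Coordinatewise derivatives alone do not give a derivative in norm; a weighted remainder
  uniform in \<open>k\<close> does. Estimating it applies \<open>lat\<close> twice, to the solution
  and then to its increment, at a cost of two powers of the weight each, whence
  \<open>p + 2 + 2\<close>.\<close>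

lemma sol_quadratic_remainder:
  assumes t: "t \<ge> 0"
  obtains K where "K \<ge> 0" "\<And>s k. 0 \<le> s \<Longrightarrow> s \<le> t + 1 \<Longrightarrow>
     wt p k * cmod (sol l b f s k - sol l b f t k - (s - t) *\<^sub>R lat l b (sol l b f t) k) \<le> K * \<bar>s - t\<bar> * \<bar>s - t\<bar>"
proof -
  let ?I = "{0..t+1}" and ?u = "sol l b f"
  define A where "A q = (real_of_int l)\<^sup>2 + 1 + \<bar>b\<bar> * 2 ^ q" for q :: nat
  have A: "A q \<ge> 0" for q by (simp add: A_def)
  obtain M where M: "M \<ge> 0" "\<And>s k. 0 \<le> s \<Longrightarrow> s \<le> t + 1 \<Longrightarrow> wt (p + 2 + 2) k * cmod (?u s k) \<le> M"
    using sol_wt_bound[of "t + 1" "p + 2 + 2"] t by auto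
  have w: "wt q k > 0" for q k by (intro zero_less_power) simp
  have d: "((\<lambda>s. ?u s k) has_vector_derivative lat l b (?u s) k) (at s within ?I)" if "s \<in> ?I" for s k
    using has_vector_derivative_within_subset[OF sol_deriv[OF l rapid_bounded, of s b k]] that by auto
  have lip: "wt (p + 2) k * cmod (?u s k - ?u t k) \<le> A (p + 2) * M * \<bar>s - t\<bar>" if s: "s \<in> ?I" for s k
  proof -
    have "norm (?u s k - ?u t k) \<le> (A (p + 2) * M / wt (p + 2) k) * norm (s - t)"
    proof (rule differentiable_bound[of ?I "\<lambda>s. ?u s k" "\<lambda>x h. h *\<^sub>R lat l b (?u x) k"])
      show "((\<lambda>s. ?u s k) has_derivative (\<lambda>h. h *\<^sub>R lat l b (?u x) k)) (at x within ?I)" if "x \<in> ?I" for x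
        using d[OF that] by (simp add: has_vector_derivative_def)
      show "onorm (\<lambda>h. h *\<^sub>R lat l b (?u x) k) \<le> A (p + 2) * M / wt (p + 2) k" if x: "x \<in> ?I" for x
      proof (rule onorm_le)
        fix h :: real
        have "wt (p + 2) k * cmod (lat l b (?u x) k) \<le> A (p + 2) * M"
          unfolding A_def using M(2)[of x] x by (intro lat_bound[OF l]) auto
        then have "cmod (lat l b (?u x) k) \<le> A (p + 2) * M / wt (p + 2) k"
          using w[of k "p + 2"] by (simp only: pos_le_divide_eq mult.commute)
        then have "\<bar>h\<bar> * cmod (lat l b (?u x) k) \<le> \<bar>h\<bar> * (A (p + 2) * M / wt (p + 2) k)"
          by (intro mult_left_mono) auto
        then show "norm (h *\<^sub>R lat l b (?u x) k) \<le> A (p + 2) * M / wt (p + 2) k * norm h"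
          by (simp only: norm_scaleR real_norm_def mult.commute)
      qed
    qed (use s t in auto)
    then have "wt (p + 2) k * norm (?u s k - ?u t k) \<le> wt (p + 2) k * ((A (p + 2) * M / wt (p + 2) k) * norm (s - t))"
      using w by (intro mult_left_mono) (auto intro: less_imp_le)
    also have "\<dots> = A (p + 2) * M * \<bar>s - t\<bar>"
    proof -
      have "w * (c / w * d) = c * d" if "w > 0" for w c d :: real using that by simp
      from this[OF w] show ?thesis by (simp only: real_norm_def)
    qed
    finally show ?thesis .
  qed
  show ?thesis
  proof (rule that[of "A p * (A (p + 2) * M)"])
    show "0 \<le> A p * (A (p + 2) * M)" using A M by simp
    fix s k assume s: "0 \<le> s" "s \<le> t + 1"
    have seg: "closed_segment t s \<subseteq> ?I" using s t by (simp add: closed_segment_eq_real_ivl)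
    have "norm (?u s k - ?u t k - (s - t) *\<^sub>R lat l b (?u t) k) \<le> norm (s - t) * (A p * (A (p + 2) * M * \<bar>s - t\<bar>) / wt p k)"
    proof (rule vector_differentiable_bound_linearization[where S = "closed_segment t s" and f' = "\<lambda>x. lat l b (?u x) k"])
      fix x assume x: "x \<in> closed_segment t s"
      then have xI: "x \<in> ?I" using seg by blast
      have xt: "\<bar>x - t\<bar> \<le> \<bar>s - t\<bar>" using x by (auto simp: closed_segment_eq_real_ivl split: if_splits)
      show "((\<lambda>s. ?u s k) has_vector_derivative lat l b (?u x) k) (at x within closed_segment t s)"
        by (rule has_vector_derivative_within_subset[OF d[OF xI] seg])
      have "wt p k * cmod (lat l b (\<lambda>k. ?u x k - ?u t k) k) \<le> A p * (A (p + 2) * M * \<bar>s - t\<bar>)"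
        unfolding A_def[of p]
      proof (rule lat_bound[OF l])
        show "wt (p + 2) k * cmod (?u x k - ?u t k) \<le> A (p + 2) * M * \<bar>s - t\<bar>" for k
          using lip[OF xI, of k] xt A M(1) by (meson mult_left_mono mult_nonneg_nonneg order_trans)
      qed
      then show "norm (lat l b (?u x) k - lat l b (?u t) k) \<le> A p * (A (p + 2) * M * \<bar>s - t\<bar>) / wt p k"
        using w[of k p] unfolding lat_diff by (simp only: pos_le_divide_eq mult.commute)
    qed auto
    then have "wt p k * norm (?u s k - ?u t k - (s - t) *\<^sub>R lat l b (?u t) k)
      \<le> wt p k * (norm (s - t) * (A p * (A (p + 2) * M * \<bar>s - t\<bar>) / wt p k))"
      using w by (intro mult_left_mono) (auto intro: less_imp_le)
    also have "\<dots> = A p * (A (p + 2) * M) * \<bar>s - t\<bar> * \<bar>s - t\<bar>"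
    proof -
      have "w * (d * (a * (c * d) / w)) = a * c * d * d" if "w > 0" for w a c d :: real using that by simp
      from this[OF w] show ?thesis by (simp only: real_norm_def)
    qed
    finally show "wt p k * norm (?u s k - ?u t k - (s - t) *\<^sub>R lat l b (?u t) k) \<le> A p * (A (p + 2) * M) * \<bar>s - t\<bar> * \<bar>s - t\<bar>" .
  qed
qed

text \<open>The remainder is used with weight 2: one power makes it summable in
  \<open>norm_rseq_le\<close>, the other pays for \<open>opD\<close>.\<close>

lemma rsolution_rsol: "rsolution l b rsol"
  unfolding rsolution_def
proof (intro allI impI conjI)
  fix t :: real assume t: "t \<ge> 0"
  define c where "c = sqrt (\<Sum>\<^sub>\<infinity>k::int. 1 / (1 + \<bar>real_of_int k\<bar>)\<^sup>2)"
  have c: "c \<ge> 0" unfolding c_def by (intro real_sqrt_ge_zero infsum_nonneg) simp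
  obtain K where K: "K \<ge> 0" "\<And>s k. 0 \<le> s \<Longrightarrow> s \<le> t + 1 \<Longrightarrow>
     wt 2 k * cmod (sol l b f s k - sol l b f t k - (s - t) *\<^sub>R lat l b (sol l b f t) k) \<le> K * \<bar>s - t\<bar> * \<bar>s - t\<bar>"
    using sol_quadratic_remainder[OF t, of 2] by metis
  define R where "R s = rsol s - rsol t - (s - t) *\<^sub>R flow l b (rsol t)" for s
  have R: "wt 2 k * cmod (cf (R s) k) \<le> K * \<bar>s - t\<bar> * \<bar>s - t\<bar>" if "0 \<le> s" "s \<le> t + 1" for s k
    using K(2)[OF that, of k] that t by (simp add: R_def cf_flow cf_rsol scaleR_conv_of_real)
  have R1: "wt 1 k * cmod (cf (R s) k) \<le> K * \<bar>s - t\<bar> * \<bar>s - t\<bar>" if s: "0 \<le> s" "s \<le> t + 1" for s k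
  proof -
    have "wt 1 k \<le> wt 2 k" by (rule power_increasing) auto
    then show ?thesis using R[OF s, of k] by (meson mult_right_mono norm_ge_zero order_trans)
  qed
  have R2: "wt 1 k * cmod (cf (opD (R s)) k) \<le> K * \<bar>s - t\<bar> * \<bar>s - t\<bar>" if s: "0 \<le> s" "s \<le> t + 1" for s k
  proof -
    have "wt 1 k * \<bar>real_of_int k\<bar> \<le> wt 1 k * wt 1 k" by (intro mult_left_mono) auto
    then have "wt 1 k * \<bar>real_of_int k\<bar> * cmod (cf (R s) k) \<le> wt 2 k * cmod (cf (R s) k)"
      by (intro mult_right_mono) (auto simp: power2_eq_square)
    then show ?thesis using R[OF s, of k] by (simp add: norm_mult mult.assoc)
  qed
  show "(rsol has_vector_derivative flow l b (rsol t)) (at t within {0..})"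
  proof (rule quadratic_remainder_deriv[OF t])
    show "norm (rsol s - rsol t - (s - t) *\<^sub>R flow l b (rsol t)) \<le> c * K * \<bar>s - t\<bar> * \<bar>s - t\<bar>"
      if "0 \<le> s" "s \<le> t + 1" for s
      using norm_rseq_le[OF R1[OF that]] by (simp add: R_def c_def mult.assoc)
  qed (use c K in simp)
  show "((\<lambda>t. opD (rsol t)) has_vector_derivative opD (flow l b (rsol t))) (at t within {0..})"
  proof (rule quadratic_remainder_deriv[OF t])
    show "norm (opD (rsol s) - opD (rsol t) - (s - t) *\<^sub>R opD (flow l b (rsol t))) \<le> c * K * \<bar>s - t\<bar> * \<bar>s - t\<bar>"
      if "0 \<le> s" "s \<le> t + 1" for s
      using norm_rseq_le[OF R2[OF that]] by (simp add: R_def c_def mult.assoc op_linear_simps)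
  qed (use c K in simp)
qed

end

section \<open>Decay for square summable data off the critical mode\<close>

definition qz :: "int \<Rightarrow> (int \<Rightarrow> complex) \<Rightarrow> int \<Rightarrow> complex" where
  "qz l x k = (if l\<^sup>2 + k\<^sup>2 = 1 then 0 else x k)"

lemma E0f_infsum:
  assumes l: "l \<noteq> 0"
  shows "E0f l u = (\<Sum>\<^sub>\<infinity>k. bm l k * (cmod (cf u k))\<^sup>2) / 2"
    and "(\<lambda>k. bm l k * (cmod (cf u k))\<^sup>2) summable_on UNIV"
    and "(\<lambda>k. (cmod (cf u k))\<^sup>2) summable_on UNIV"
proof -
  have e: "Re (cf u k * cnj (cf (opH l u) k)) = bm l k * (cmod (cf u k))\<^sup>2" for k
  proof -
    have "Re (z * cnj (complex_of_real m * z)) = m * (cmod z)\<^sup>2" for m z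
      by (subst cmod_power2) (simp add: power2_eq_square algebra_simps)
    then show ?thesis unfolding cf_opH bm_def by blast
  qed
  show "E0f l u = (\<Sum>\<^sub>\<infinity>k. bm l k * (cmod (cf u k))\<^sup>2) / 2"
    unfolding E0f_def inner_rseq_def e ..
  show "(\<lambda>k. bm l k * (cmod (cf u k))\<^sup>2) summable_on UNIV"
    using rseq_summable[of u "opH l u"] unfolding e .
  have "Re (cf u k * cnj (cf u k)) = (cmod (cf u k))\<^sup>2" for k
    by (simp add: complex_mult_cnj cmod_power2)
  then show "(\<lambda>k. (cmod (cf u k))\<^sup>2) summable_on UNIV"
    using rseq_summable[of u u] by simp
qed

text \<open>For l \<noteq> 0 the condition l^2 + k^2 = 1 marks the coefficient on which
  \<open>bm\<close> vanishes; elsewhere 1/2 \<le> \<open>bm\<close> \<le> 1. Hence twice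
  \<open>E0f\<close> and the squared norm of the remaining part agree up to a factor 2, the one that
  appears in the decay bounds.\<close>

lemma bm_qz:
  assumes l: "l \<noteq> 0"
  shows "bm l k * (cmod z)\<^sup>2 \<le> (cmod (if l\<^sup>2 + k\<^sup>2 = 1 then 0 else z))\<^sup>2"
    "(cmod (if l\<^sup>2 + k\<^sup>2 = 1 then 0 else z))\<^sup>2 \<le> 2 * (bm l k * (cmod z)\<^sup>2)"
proof -
  have e: "nn l k = real_of_int (l\<^sup>2 + k\<^sup>2)" by simp
  have "bm l k = 0 \<and> l\<^sup>2 + k\<^sup>2 = 1 \<or> l\<^sup>2 + k\<^sup>2 \<noteq> 1 \<and> 1/2 \<le> bm l k \<and> bm l k \<le> 1"
  proof (cases "l\<^sup>2 + k\<^sup>2 = 1")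
    case True
    then show ?thesis unfolding bm_def e by simp
  next
    case False
    then have "nn l k \<noteq> 1" unfolding e by linarith
    then have "nn l k \<ge> 2" using nn_cases(1)[OF l, of k] by auto
    then have "0 < 1 / nn l k" "1 / nn l k \<le> 1/2" by (simp_all add: field_simps)
    then show ?thesis using False by (simp add: bm_def)
  qed
  then show "bm l k * (cmod z)\<^sup>2 \<le> (cmod (if l\<^sup>2 + k\<^sup>2 = 1 then 0 else z))\<^sup>2"
    "(cmod (if l\<^sup>2 + k\<^sup>2 = 1 then 0 else z))\<^sup>2 \<le> 2 * (bm l k * (cmod z)\<^sup>2)"
    using mult_right_mono[of "bm l k" 1 "(cmod z)\<^sup>2"] mult_right_mono[of "1/2" "bm l k" "(cmod z)\<^sup>2"] by auto
qed

definition trunc :: "nat \<Rightarrow> (int \<Rightarrow> complex) \<Rightarrow> int \<Rightarrow> complex" where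
  "trunc N f k = (if \<bar>k\<bar> \<le> int N then f k else 0)"

definition ell2 :: "('a \<Rightarrow> complex) \<Rightarrow> bool" where
  "ell2 f \<longleftrightarrow> (\<lambda>k. (cmod (f k))\<^sup>2) summable_on UNIV"
definition sqn :: "('a \<Rightarrow> complex) \<Rightarrow> real" where
  "sqn f = (\<Sum>\<^sub>\<infinity>k. (cmod (f k))\<^sup>2)"

lemma ell2_finite_sum_le: "ell2 f \<Longrightarrow> finite F \<Longrightarrow> (\<Sum>k\<in>F. (cmod (f k))\<^sup>2) \<le> sqn f"
  unfolding ell2_def sqn_def by (intro finite_sum_le_infsum) auto

lemma ell2I:
  assumes "\<And>F. finite F \<Longrightarrow> (\<Sum>k\<in>F. (cmod (f k))\<^sup>2) \<le> C"
  shows "ell2 f" "sqn f \<le> C"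
proof -
  show "ell2 f" unfolding ell2_def
    by (rule nonneg_bdd_above_summable_on) (auto intro!: bdd_aboveI2[where M = C] assms)
  then show "sqn f \<le> C" unfolding ell2_def sqn_def
    by (rule infsum_le_finite_sums) (rule assms)
qed

lemma sqn_nonneg: "sqn f \<ge> 0"
  unfolding sqn_def by (rule infsum_nonneg) simp

lemma ell2_mono:
  assumes "ell2 f" "\<And>k. cmod (g k) \<le> cmod (f k)" shows "ell2 g" "sqn g \<le> sqn f"
proof -
  have "(\<Sum>k\<in>F. (cmod (g k))\<^sup>2) \<le> sqn f" if "finite F" for F
  proof -
    have "(\<Sum>k\<in>F. (cmod (g k))\<^sup>2) \<le> (\<Sum>k\<in>F. (cmod (f k))\<^sup>2)"
      by (intro sum_mono power_mono assms) auto
    also have "\<dots> \<le> sqn f" by (rule ell2_finite_sum_le[OF assms(1) that])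
    finally show ?thesis .
  qed
  from ell2I[OF this] show "ell2 g" "sqn g \<le> sqn f" by auto
qed

lemma ell2_bounded: "ell2 f \<Longrightarrow> cmod (f k) \<le> sqrt (sqn f)"
  using ell2_finite_sum_le[of f "{k}"] by (simp add: real_le_rsqrt)

lemma ell2_bounded_range: "ell2 f \<Longrightarrow> bounded (range f)"
  using ell2_bounded[of f] by (auto simp: bounded_iff)

lemma ell2_qz: "ell2 f \<Longrightarrow> ell2 (qz l f)" "ell2 f \<Longrightarrow> sqn (qz l f) \<le> sqn f"
  using ell2_mono[of f "qz l f"] by (auto simp: qz_def)

lemma rapid_trunc: "ell2 f \<Longrightarrow> rapid (trunc N f)"
  unfolding rapid_def
proof (intro allI exI)
  fix p k assume f: "ell2 f"
  show "wt p k * cmod (trunc N f k) \<le> (1 + real N) ^ p * sqrt (sqn f)"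
  proof (cases "\<bar>k\<bar> \<le> int N")
    case True
    then have "\<bar>real_of_int k\<bar> \<le> real N" by linarith
    then show ?thesis
      using True ell2_bounded[OF f, of k] by (auto simp: trunc_def intro!: mult_mono power_mono)
  qed (simp add: trunc_def sqn_nonneg)
qed

text \<open>Convergence uniform in \<open>k\<close> is what the solution operator can use:
  \<open>sol_bound\<close> with p = 0 is a bound in the supremum norm.\<close>

lemma trunc_uniform:
  assumes "ell2 f" "e > 0"
  shows "\<forall>\<^sub>F N in sequentially. \<forall>k. cmod (f k - trunc N f k) \<le> e"
proof -
  have "((\<lambda>F. \<Sum>k\<in>F. (cmod (f k))\<^sup>2) \<longlongrightarrow> sqn f) (finite_subsets_at_top UNIV)"
    using assms(1) unfolding ell2_def sqn_def by (rule infsum_tendsto)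
  then have "\<forall>\<^sub>F F in finite_subsets_at_top UNIV. dist (\<Sum>k\<in>F. (cmod (f k))\<^sup>2) (sqn f) < e\<^sup>2"
    by (rule tendstoD) (use assms in simp)
  then obtain F where F: "finite F" "dist (\<Sum>k\<in>F. (cmod (f k))\<^sup>2) (sqn f) < e\<^sup>2"
    unfolding eventually_finite_subsets_at_top by blast
  have far: "cmod (f k) \<le> e" if "k \<notin> F" for k
  proof -
    have "(\<Sum>k\<in>F. (cmod (f k))\<^sup>2) + (cmod (f k))\<^sup>2 \<le> sqn f"
      using ell2_finite_sum_le[OF assms(1), of "insert k F"] F(1) that by simp
    then have "(cmod (f k))\<^sup>2 \<le> e\<^sup>2" using F(2) unfolding dist_real_def by linarith
    then show ?thesis using assms(2) by (simp add: power2_le_iff_abs_le)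
  qed
  define a where "a = Max (insert 0 (abs ` F))"
  have a: "\<bar>k\<bar> \<le> a" if "k \<in> F" for k using F(1) that by (auto simp: a_def)
  show ?thesis
  proof (rule eventually_sequentiallyI[of "nat a"], intro allI)
    fix N k assume N: "nat a \<le> N"
    show "cmod (f k - trunc N f k) \<le> e"
    proof (cases "\<bar>k\<bar> \<le> int N")
      case False
      then have "k \<notin> F" using a[of k] N by linarith
      then show ?thesis using far[of k] False by (simp add: trunc_def)
    qed (use assms in \<open>simp add: trunc_def\<close>)
  qed
qed

abbreviation rate :: real where "rate \<equiv> lyb / 11000"

lemma rate_bounds: "rate > 0" "rate \<le> 1 / 11000"
  using ly_bounds by auto

context
  fixes l :: int and b :: real
  assumes l: "l \<noteq> 0"
begin

lemma sol_trunc_tendsto: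
  assumes f: "ell2 f" and t: "t \<ge> 0"
  shows "(\<lambda>N. sol l b (trunc N f) t k) \<longlonglongrightarrow> sol l b f t k"
proof (rule tendstoI)
  fix e :: real assume e: "e > 0"
  define d where "d = e / (2 * exp (\<bar>b\<bar> * t))"
  have d: "d > 0" using e by (simp add: d_def)
  show "\<forall>\<^sub>F N in sequentially. dist (sol l b (trunc N f) t k) (sol l b f t k) < e"
    using trunc_uniform[OF f d]
  proof eventually_elim
    case (elim N)
    have bt: "bounded (range (trunc N f))"
      using ell2_bounded[OF f] ell2_mono[OF f, of "trunc N f"] by (intro ell2_bounded_range) (auto simp: trunc_def)
    have "sol l b (\<lambda>k. 1 * f k + (- 1) * trunc N f k) t k = 1 * sol l b f t k + (- 1) * sol l b (trunc N f) t k"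
      by (rule sol_combination[OF l ell2_bounded_range[OF f] bt t])
    then have "sol l b f t k - sol l b (trunc N f) t k = sol l b (\<lambda>k. f k - trunc N f k) t k" by simp
    moreover have "cmod (sol l b (\<lambda>k. f k - trunc N f k) t k) \<le> d * exp (\<bar>b\<bar> * t)"
      using sol_bound[OF l, of 0 "\<lambda>k. f k - trunc N f k" d t k b] elim t by simp
    moreover have "d * exp (\<bar>b\<bar> * t) < e" using e by (simp add: d_def)
    ultimately show ?case by (simp add: dist_norm norm_minus_commute)
  qed
qed

lemma qz_energy:
  assumes g: "rapid g" and F: "finite F" and t: "t \<ge> 0"
    and R: "E0f l (rsol l b g t) \<le> R * E0f l (rsol l b g 0)" "R \<ge> 0"
  shows "(\<Sum>k\<in>F. (cmod (qz l (sol l b g t) k))\<^sup>2) \<le> 2 * R * sqn (qz l g)"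
proof -
  let ?u = "rsol l b g"
  have qb: "(cmod (qz l x k))\<^sup>2 \<le> 2 * (bm l k * (cmod (x k))\<^sup>2)" "bm l k * (cmod (x k))\<^sup>2 \<le> (cmod (qz l x k))\<^sup>2" for x k
    using bm_qz[OF l, of k "x k"] by (auto simp: qz_def)
  have nn: "0 \<le> bm l k * (cmod (x k))\<^sup>2" for x k
    using qb(1)[of x k] by (smt (verit) zero_le_power2)
  have "(\<Sum>k\<in>F. (cmod (qz l (sol l b g t) k))\<^sup>2) \<le> (\<Sum>k\<in>F. 2 * (bm l k * (cmod (cf (?u t) k))\<^sup>2))"
    unfolding cf_rsol[OF l g t] by (intro sum_mono qb)
  also have "\<dots> \<le> 2 * (2 * E0f l (?u t))"
    unfolding sum_distrib_left[symmetric] E0f_infsum(1)[OF l]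
    using finite_sum_le_infsum[OF E0f_infsum(2)[OF l] F, of "?u t"] nn by simp
  also have "\<dots> \<le> 2 * R * (2 * E0f l (?u 0))" using R by simp
  also have "2 * E0f l (?u 0) \<le> sqn (qz l g)"
  proof -
    have g0: "cf (?u 0) = g" using cf_rsol[OF l g, of 0] by (auto simp: sol_0[OF l])
    have s: "ell2 g" using E0f_infsum(3)[OF l, of "?u 0"] by (simp add: g0 ell2_def)
    have "2 * E0f l (?u 0) = (\<Sum>\<^sub>\<infinity>k. bm l k * (cmod (g k))\<^sup>2)"
      using E0f_infsum(1)[OF l, of "?u 0"] by (simp add: g0)
    also have "\<dots> \<le> sqn (qz l g)" unfolding sqn_def
      using E0f_infsum(2)[OF l, of "?u 0"] ell2_qz(1)[OF s, of l]
      by (intro infsum_mono qb) (simp_all add: g0 ell2_def)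
    finally show ?thesis .
  qed
  finally show ?thesis using R(2) by (simp add: mult_left_mono)
qed

text \<open>Truncated solutions are only known to converge coordinate by coordinate, and square
  summability of the limit is not yet available. The estimate is therefore stated on finite sets,
  where it passes to the limit; \<open>ell2I\<close> turns it into one for the full sum.\<close>

lemma qz_energy_ell2:
  assumes f: "ell2 f" and F: "finite F" and t: "t \<ge> 0" and R0: "R \<ge> 0"
    and R: "\<And>g. rapid g \<Longrightarrow> E0f l (rsol l b g t) \<le> R * E0f l (rsol l b g 0)"
  shows "(\<Sum>k\<in>F. (cmod (qz l (sol l b f t) k))\<^sup>2) \<le> 2 * R * sqn (qz l f)"
proof (rule tendsto_upperbound)
  have q: "(\<lambda>N. qz l (sol l b (trunc N f) t) k) \<longlonglongrightarrow> qz l (sol l b f t) k" for k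
    using sol_trunc_tendsto[OF f t, of k] by (simp add: qz_def)
  show "(\<lambda>N. \<Sum>k\<in>F. (cmod (qz l (sol l b (trunc N f) t) k))\<^sup>2) \<longlonglongrightarrow> (\<Sum>k\<in>F. (cmod (qz l (sol l b f t) k))\<^sup>2)"
    by (intro tendsto_sum tendsto_power tendsto_norm q)
  have "(\<Sum>k\<in>F. (cmod (qz l (sol l b (trunc N f) t) k))\<^sup>2) \<le> 2 * R * sqn (qz l f)" for N
  proof -
    have "(\<Sum>k\<in>F. (cmod (qz l (sol l b (trunc N f) t) k))\<^sup>2) \<le> 2 * R * sqn (qz l (trunc N f))"
      by (intro qz_energy F t rapid_trunc f R R0)
    also have "sqn (qz l (trunc N f)) \<le> sqn (qz l f)"
      by (rule ell2_mono(2)[OF ell2_qz(1)[OF f]]) (auto simp: qz_def trunc_def)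
    finally show ?thesis using R0 by (simp add: mult_left_mono)
  qed
  then show "\<forall>\<^sub>F N in sequentially. (\<Sum>k\<in>F. (cmod (qz l (sol l b (trunc N f) t) k))\<^sup>2) \<le> 2 * R * sqn (qz l f)"
    by simp
qed simp

lemma qz_heat_decay:
  assumes f: "ell2 f" and t: "t \<ge> 0"
  shows "ell2 (qz l (sol l b f t))"
    and "sqn (qz l (sol l b f t)) \<le> 2 * exp (- 2 * (real_of_int l)\<^sup>2 * t) * sqn (qz l f)"
proof -
  have "(\<Sum>k\<in>F. (cmod (qz l (sol l b f t) k))\<^sup>2) \<le> 2 * exp (- 2 * (real_of_int l)\<^sup>2 * t) * sqn (qz l f)"
    if "finite F" for F
    by (rule qz_energy_ell2[OF f that t])
      (use rsolution_heat_decay[OF l rsolution_rsol[OF l] t] in auto)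
  from ell2I[OF this] show "ell2 (qz l (sol l b f t))"
    "sqn (qz l (sol l b f t)) \<le> 2 * exp (- 2 * (real_of_int l)\<^sup>2 * t) * sqn (qz l f)" by auto
qed

text \<open>Valid from time zero on: before 1/B the claimed exponential has lost at most the factor
  exp \<open>rate\<close> \<le> 2, which is added to the bound from heat decay. So 4 = 2 *
  2.\<close>

lemma qz_enhanced_decay:
  assumes f: "ell2 f" and t: "t \<ge> 0" and b: "\<bar>b\<bar> \<ge> 1"
  shows "sqn (qz l (sol l b f t)) \<le> 4 * exp (- rate * sqrt \<bar>b\<bar> * t) * sqn (qz l f)"
proof -
  define B where "B = sqrt \<bar>b\<bar>"
  have B: "B \<ge> 1" using b by (simp add: B_def)
  have e2: "exp rate \<le> 2"
  proof -
    have "exp rate \<le> exp (1/2)" using rate_bounds by simp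
    also have "exp (1/2::real) \<le> 2"
      using exp_bound_half[of "1/2 :: real"] by simp
    finally show ?thesis .
  qed
  have "sqn (qz l (sol l b f t)) \<le> 2 * exp (rate - rate * B * t) * sqn (qz l f)"
  proof (cases "t \<ge> 1 / B")
    case True
    have "(\<Sum>k\<in>F. (cmod (qz l (sol l b f t) k))\<^sup>2) \<le> 2 * exp (- (rate * B) * (t - 1 / B)) * sqn (qz l f)"
      if "finite F" for F
      by (rule qz_energy_ell2[OF f that t])
        (use rsolution_enhanced_decay[OF l rsolution_rsol[OF l] b] True in \<open>auto simp: B_def\<close>)
    moreover have "- (c * B) * (t - 1 / B) = c - c * B * t" for c
      using B by (simp add: algebra_simps)
    ultimately show ?thesis by (intro ell2I(2)) (simp only:)
  next
    case False
    then have "rate * (B * t) \<le> rate * 1"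
      using B rate_bounds by (intro mult_left_mono) (auto simp: field_simps)
    then have "- 2 * (real_of_int l)\<^sup>2 * t \<le> rate - rate * B * t"
      using t mult_nonneg_nonneg[OF zero_le_power2[of "real_of_int l"] t] by linarith
    then have "2 * exp (- 2 * (real_of_int l)\<^sup>2 * t) * sqn (qz l f) \<le> 2 * exp (rate - rate * B * t) * sqn (qz l f)"
      by (intro mult_right_mono mult_left_mono sqn_nonneg) auto
    then show ?thesis using qz_heat_decay(2)[OF f t] by linarith
  qed
  also have "exp (rate - rate * B * t) = exp rate * exp (- rate * B * t)"
    by (simp add: exp_add[symmetric])
  also have "2 * (exp rate * exp (- rate * B * t)) * sqn (qz l f) \<le> 4 * exp (- rate * B * t) * sqn (qz l f)"
    using e2 by (intro mult_right_mono sqn_nonneg) auto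
  finally show ?thesis by (simp add: B_def)
qed

end

section \<open>The zero mode for |l| = 1\<close>

lemma sum_abs_le_sqrt:
  fixes x :: "'a \<Rightarrow> real"
  assumes "\<And>k. k \<in> I \<Longrightarrow> \<bar>c k\<bar> \<le> M" "M \<ge> 0" "(\<Sum>k\<in>I. (x k)\<^sup>2) \<le> W\<^sup>2" "W \<ge> 0" "real (card I) \<le> A\<^sup>2" "A \<ge> 0"
  shows "(\<Sum>k\<in>I. \<bar>c k\<bar> * \<bar>x k\<bar>) \<le> M * A * W"
proof -
  have "(\<Sum>k\<in>I. \<bar>c k\<bar> * \<bar>x k\<bar>) \<le> L2_set c I * L2_set x I" by (rule L2_set_mult_ineq)
  also have "L2_set c I \<le> M * A"
  proof -
    have "(\<Sum>k\<in>I. (c k)\<^sup>2) \<le> (\<Sum>k\<in>I. M\<^sup>2)"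
      by (intro sum_mono) (use assms(1,2) in \<open>simp add: abs_le_square_iff[symmetric]\<close>)
    also have "\<dots> \<le> A\<^sup>2 * M\<^sup>2" using assms(5) by (simp add: mult_right_mono)
    also have "\<dots> = (M * A)\<^sup>2" by (simp add: power_mult_distrib)
    finally show ?thesis unfolding L2_set_def using assms(2,6) by (intro real_le_lsqrt sum_nonneg) auto
  qed
  also have "L2_set x I \<le> W" unfolding L2_set_def using assms(3,4) by (intro real_le_lsqrt sum_nonneg) auto
  finally show ?thesis using assms(2,6) by (simp add: mult_left_mono mult_right_mono L2_set_nonneg)
qed

definition hat :: "nat \<Rightarrow> int \<Rightarrow> real" where
  "hat N k = max 0 (1 - \<bar>real_of_int k\<bar> / real N)"

lemma hat_simps:
  assumes "N \<ge> 1"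
  shows "0 \<le> hat N k" "hat N k \<le> 1" "hat N 0 = 1" "\<bar>k\<bar> \<ge> int N \<Longrightarrow> hat N k = 0"
    "\<bar>hat N (k + 1) - hat N (k - 1)\<bar> \<le> 2 / real N" "(real_of_int k)\<^sup>2 * hat N k \<le> (real N)\<^sup>2"
proof -
  have N: "real N > 0" using assms by simp
  show a: "0 \<le> hat N k" "hat N k \<le> 1" "hat N 0 = 1" using N by (auto simp: hat_def)
  show z: "\<bar>k\<bar> \<ge> int N \<Longrightarrow> hat N k = 0" using N by (simp add: hat_def field_simps)
  have "\<bar>1 - \<bar>real_of_int (k + 1)\<bar> / real N - (1 - \<bar>real_of_int (k - 1)\<bar> / real N)\<bar>
     = \<bar>\<bar>real_of_int (k - 1)\<bar> - \<bar>real_of_int (k + 1)\<bar>\<bar> / real N"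
    using N by (simp add: diff_divide_distrib[symmetric])
  also have "\<dots> \<le> 2 / real N" using N by (intro divide_right_mono) auto
  finally show "\<bar>hat N (k + 1) - hat N (k - 1)\<bar> \<le> 2 / real N"
    unfolding hat_def by linarith
  show "(real_of_int k)\<^sup>2 * hat N k \<le> (real N)\<^sup>2"
  proof (cases "\<bar>k\<bar> \<ge> int N")
    case False
    then have "\<bar>real_of_int k\<bar> \<le> real N" by linarith
    then have "(real_of_int k)\<^sup>2 \<le> (real N)\<^sup>2" by (simp add: abs_le_square_iff[symmetric])
    then show ?thesis using mult_mono[of "(real_of_int k)\<^sup>2" "(real N)\<^sup>2" "hat N k" 1] a by simp
  qed (simp add: z)
qed

text \<open>The window has one more index on either side than the support of \<open>g\<close> can
  reach, so shifting by one loses no term.\<close>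

lemma shifted_sum:
  fixes g :: "int \<Rightarrow> real" and x :: "int \<Rightarrow> complex"
  assumes g: "\<And>k. \<bar>k\<bar> \<ge> int N \<Longrightarrow> g k = 0" and j: "\<bar>j\<bar> = 1"
  shows "(\<Sum>k\<in>{- int N - 1..int N + 1}. of_real (g k) * x (k + j))
    = (\<Sum>k\<in>{- int N - 1..int N + 1}. of_real (g (k - j)) * x k)"
proof -
  let ?I = "{- int N - 1..int N + 1}" and ?J = "{- int N..int N}"
  have "(\<Sum>k\<in>?I. of_real (g k) * x (k + j)) = (\<Sum>k\<in>?J. of_real (g k) * x (k + j))"
    by (rule sum.mono_neutral_right) (auto intro!: g)
  also have "\<dots> = (\<Sum>k\<in>(\<lambda>k. k + j) ` ?J. of_real (g (k - j)) * x k)"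
    by (subst sum.reindex) (auto simp: inj_on_def)
  also have "\<dots> = (\<Sum>k\<in>?I. of_real (g (k - j)) * x k)"
  proof (rule sum.mono_neutral_left)
    show "(\<lambda>k. k + j) ` ?J \<subseteq> ?I" using j by auto
    show "\<forall>k\<in>?I - (\<lambda>k. k + j) ` ?J. of_real (g (k - j)) * x k = 0"
    proof
      fix k assume k: "k \<in> ?I - (\<lambda>k. k + j) ` ?J"
      have "k = (k - j) + j" by simp
      then have "k - j \<notin> ?J" using k by (metis DiffD2 image_eqI)
      then show "of_real (g (k - j)) * x k = 0" using g[of "k - j"] by auto
    qed
  qed simp
  finally show ?thesis .
qed

text \<open>The zero mode for \<open>|l| = 1\<close> is estimated through the functional \<open>\<Theta> = \<Sum> hat N k u\<^sub>k\<close> with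
  \<open>N\<close> of order \<open>|b|\<^sup>1\<^sup>/\<^sup>3\<close>: it agrees with \<open>u\<^sub>0\<close> up to the other modes, and its equation
  \<open>\<Theta>' = - \<Theta> + \<dots>\<close> has a forcing of order \<open>|b|\<^sup>5\<^sup>/\<^sup>6\<close> instead of \<open>|b|\<close>, since the Fejer-type kernel with
  coefficients \<open>hat N\<close> concentrates at \<open>y = 0\<close>, where \<open>sin y\<close> vanishes.\<close>

lemma zero_mode_bound:
  assumes l: "\<bar>l\<bar> = 1" and f: "ell2 f" and t: "t \<ge> 0" and b: "\<bar>b\<bar> \<ge> 1" and large: "rate * sqrt \<bar>b\<bar> \<ge> 4"
  shows "cmod (sol l b f t 0) \<le> exp (- t) * (cmod (f 0) + (128 / rate + 14) * (\<bar>b\<bar> powr (1/3)) * sqrt (sqn (qz l f)))"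
proof -
  have l0: "l \<noteq> 0" and l2: "l\<^sup>2 = 1" and l2r: "(real_of_int l)\<^sup>2 = 1" using l by (auto simp: abs_if split: if_splits)
  \<comment> \<open>The length \<open>N\<close> balances the two parts of the forcing: the Laplacian
    contributes N^2 and the transport |b|/N, and these are equal for N = |b|^{1/3}.\<close>
  define r B N W0 where "r = \<bar>b\<bar> powr (1/3)" and "B = sqrt \<bar>b\<bar>" and "N = nat \<lceil>r\<rceil>" and "W0 = sqrt (sqn (qz l f))"
  have r1: "r \<ge> 1" using b by (simp add: r_def ge_one_powr_ge_zero)
  have r3: "r ^ 3 = \<bar>b\<bar>" using b unfolding r_def by (simp add: powr_power)
  have N: "r \<le> real N" "real N \<le> 2 * r" "N \<ge> 1" using r1 unfolding N_def by linarith+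
  have B1: "B \<ge> 1" using b by (simp add: B_def)
  have "B = sqrt (r ^ 3)" by (simp add: B_def r3)
  then have B: "B = r * sqrt r" "B \<ge> 1" using r1 B1 by (simp_all add: power3_eq_cube real_sqrt_mult)
  have W0: "W0 \<ge> 0" by (simp add: W0_def sqn_nonneg)
  have rp: "rate > 0" by (rule rate_bounds)
  let ?I = "{- int N - 1..int N + 1}" and ?u = "sol l b f"
  define g where "g = hat N"
  note g = hat_simps[OF N(3), folded g_def]
  \<comment> \<open>The square root of the bound in \<open>qz_enhanced_decay\<close>: it dominates
    the norm of the noncritical part at time \<open>s\<close>.\<close>
  define W where "W s = 2 * exp (- (rate * B / 2) * s) * W0" for s
  have W: "W s \<ge> 0" for s using W0 by (simp add: W_def)
  have cardI: "real (card ?I) \<le> (sqrt (10 * r))\<^sup>2" using N r1 by simp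
  have qI: "(\<Sum>k\<in>?I. (cmod (qz l (?u s) k))\<^sup>2) \<le> (W s)\<^sup>2" if s: "s \<ge> 0" for s
  proof -
    have "(\<Sum>k\<in>?I. (cmod (qz l (?u s) k))\<^sup>2) \<le> sqn (qz l (?u s))"
      by (rule ell2_finite_sum_le[OF qz_heat_decay(1)[OF l0 f s]]) simp
    also have "\<dots> \<le> 4 * exp (- rate * B * s) * sqn (qz l f)"
      unfolding B_def by (rule qz_enhanced_decay[OF l0 f s b])
    also have "exp (- rate * B * s) = (exp (- (rate * B / 2) * s))\<^sup>2"
      by (simp add: power2_eq_square exp_add[symmetric])
    also have "sqn (qz l f) = W0\<^sup>2" by (simp add: W0_def sqn_nonneg)
    finally show ?thesis by (simp add: W_def power_mult_distrib)
  qed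
  have est: "cmod (\<Sum>k\<in>?I. of_real (c k) * qz l (?u s) k) \<le> M * sqrt (10 * r) * W s"
    if "\<And>k. k \<in> ?I \<Longrightarrow> \<bar>c k\<bar> \<le> M" "M \<ge> 0" "s \<ge> 0" for c M s
  proof -
    have "cmod (\<Sum>k\<in>?I. of_real (c k) * qz l (?u s) k) \<le> (\<Sum>k\<in>?I. \<bar>c k\<bar> * \<bar>cmod (qz l (?u s) k)\<bar>)"
      by (rule order_trans[OF norm_sum]) (simp add: norm_mult)
    also have "\<dots> \<le> M * sqrt (10 * r) * W s"
      by (rule sum_abs_le_sqrt) (use that qI[OF that(3)] W cardI r1 in auto)
    finally show ?thesis .
  qed
  define \<Theta> where "\<Theta> s = (\<Sum>k\<in>?I. of_real (g k) * ?u s k)" for s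
  \<comment> \<open>Used at time 0 and again at time \<open>t\<close>; this gives the summand 14 = 7
    + 7 in the constant.\<close>
  have \<Theta>0: "cmod (\<Theta> s - ?u s 0) \<le> 7 * r * exp (- s) * W0" if s: "s \<ge> 0" for s
  proof -
    have "\<Theta> s = of_real (g 0) * ?u s 0 + (\<Sum>k\<in>?I - {0}. of_real (g k) * ?u s k)"
      unfolding \<Theta>_def by (rule sum.remove) auto
    also have "(\<Sum>k\<in>?I - {0}. of_real (g k) * ?u s k) = (\<Sum>k\<in>?I - {0}. of_real (g k) * qz l (?u s) k)"
      using l2 by (intro sum.cong) (auto simp: qz_def)
    also have "\<dots> = (\<Sum>k\<in>?I. of_real (g k) * qz l (?u s) k)"
      using l2 by (intro sum.mono_neutral_left) (auto simp: qz_def)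
    finally have "cmod (\<Theta> s - ?u s 0) = cmod (\<Sum>k\<in>?I. of_real (g k) * qz l (?u s) k)" by (simp add: g)
    also have "\<dots> \<le> 1 * sqrt (10 * r) * W s" by (rule est) (use s g in auto)
    also have "\<dots> \<le> (7 / 2 * r) * W s"
    proof (intro mult_right_mono W)
      have "10 * r \<le> (7 / 2 * r)\<^sup>2" using r1 by (simp add: power2_eq_square)
      moreover have "0 \<le> 7 / 2 * r" using r1 by simp
      ultimately have "sqrt (10 * r) \<le> 7 / 2 * r" by (intro real_le_lsqrt)
      then show "1 * sqrt (10 * r) \<le> 7 / 2 * r" by (simp only: mult_1)
    qed
    also have "W s \<le> 2 * exp (- s) * W0"
    proof -
      have "rate * B / 2 * s \<ge> 1 * s" using large s by (intro mult_right_mono) (auto simp: B_def)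
      then show ?thesis unfolding W_def by (intro mult_right_mono W0) simp
    qed
    then have "(7 / 2 * r) * W s \<le> (7 / 2 * r) * (2 * exp (- s) * W0)" using r1 by (intro mult_left_mono) auto
    finally show ?thesis by (simp add: mult_ac)
  qed
  define \<Theta>' where "\<Theta>' s = (\<Sum>k\<in>?I. of_real (g k) * lat l b (?u s) k)" for s
  have d\<Theta>: "(\<Theta> has_vector_derivative \<Theta>' s) (at s within {0..})" if s: "s \<ge> 0" for s
    unfolding \<Theta>_def \<Theta>'_def
    by (intro has_vector_derivative_sum has_vector_derivative_mult_right sol_deriv[OF l0 ell2_bounded_range[OF f] s])
  \<comment> \<open>After summation by parts the transport acts on the slowly varying
    \<open>hat N\<close>. Since l^2 = 1, adding \<open>\<Theta>\<close> turns the diagonal factor -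
    (1 + k^2) into - k^2, and with \<open>bm l 0 = 0\<close> the coefficient at k = 0 vanishes: the
    forcing contains no critical mode.\<close>
  define c where "c k = - (real_of_int k)\<^sup>2 * g k - b / 2 * bm l k * (g (k + 1) - g (k - 1))" for k
  have \<Theta>': "\<Theta>' s + \<Theta> s = (\<Sum>k\<in>?I. of_real (c k) * qz l (?u s) k)" for s
  proof -
    define h where "h = b / 2"
    have A: "(\<Sum>k\<in>?I. of_real (g k) * (of_real (bm l (k - 1)) * ?u s (k - 1)))
        = (\<Sum>k\<in>?I. of_real (g (k + 1)) * (of_real (bm l k) * ?u s k))"
      using shifted_sum[where j = "-1" and g = g and N = N and x = "\<lambda>k. of_real (bm l k) * ?u s k"] g(4) by simp
    have A': "(\<Sum>k\<in>?I. of_real (g k) * (of_real (bm l (k + 1)) * ?u s (k + 1)))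
        = (\<Sum>k\<in>?I. of_real (g (k - 1)) * (of_real (bm l k) * ?u s k))"
      using shifted_sum[where j = 1 and g = g and N = N and x = "\<lambda>k. of_real (bm l k) * ?u s k"] g(4) by simp
    have 1: "\<Theta>' s = (\<Sum>k\<in>?I. of_real (- (nn l k) * g k) * ?u s k)
      - of_real (b / 2) * ((\<Sum>k\<in>?I. of_real (g k) * (of_real (bm l (k - 1)) * ?u s (k - 1)))
        - (\<Sum>k\<in>?I. of_real (g k) * (of_real (bm l (k + 1)) * ?u s (k + 1))))"
      unfolding \<Theta>'_def sum_distrib_left sum_subtractf[symmetric]
      by (rule sum.cong) (simp_all add: lat_def bop_def algebra_simps)
    have 2: "\<dots> + \<Theta> s = (\<Sum>k\<in>?I. of_real (c k) * ?u s k)"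
    proof -
      have e: "of_real (c k) * z = of_real (- (nn l k) * g k) * z - of_real h * (of_real (g (k + 1)) * (of_real (bm l k) * z)
         - of_real (g (k - 1)) * (of_real (bm l k) * z)) + of_real (g k) * z" for k and z :: complex
        unfolding c_def l2r h_def[symmetric] by (simp add: algebra_simps)
      show ?thesis
        unfolding A A' \<Theta>_def e sum.distrib sum_subtractf sum_distrib_left[symmetric] h_def[symmetric] ..
    qed
    have 3: "(\<Sum>k\<in>?I. of_real (c k) * ?u s k) = (\<Sum>k\<in>?I. of_real (c k) * qz l (?u s) k)"
    proof (rule sum.cong)
      fix k
      show "of_real (c k) * ?u s k = of_real (c k) * qz l (?u s) k"
      proof (cases "k = 0")
        case True
        have "bm l 0 = 0" unfolding bm_def l2r by simp
        then show ?thesis unfolding c_def True by simp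
      next
        case False
        then have "l\<^sup>2 + k\<^sup>2 \<noteq> 1" unfolding l2 by simp
        then show ?thesis by (simp add: qz_def)
      qed
    qed simp
    show ?thesis unfolding 1 2 3 ..
  qed
  have c: "\<bar>c k\<bar> \<le> 5 * r\<^sup>2" for k
  proof -
    have "\<bar>bm l k\<bar> \<le> 1" using nn_cases(2)[OF l0, of k] by (simp add: abs_le_iff bm_def)
    then have "\<bar>bm l k * (g (k + 1) - g (k - 1))\<bar> \<le> 1 * (2 / real N)"
      unfolding abs_mult by (intro mult_mono g) auto
    then have "\<bar>b\<bar> / 2 * \<bar>bm l k * (g (k + 1) - g (k - 1))\<bar> \<le> \<bar>b\<bar> / 2 * (2 / real N)"
      by (intro mult_left_mono) auto
    also have "\<dots> = r ^ 3 / real N" by (simp add: r3)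
    also have "\<dots> \<le> r ^ 3 / r" using N r1 by (intro divide_left_mono) auto
    also have "\<dots> = r\<^sup>2" using r1 by (simp add: power3_eq_cube power2_eq_square)
    finally have 1: "\<bar>b / 2 * bm l k * (g (k + 1) - g (k - 1))\<bar> \<le> r\<^sup>2" by (simp add: abs_mult mult_ac)
    have "(real_of_int k)\<^sup>2 * g k \<le> (real N)\<^sup>2" by (rule g)
    also have "\<dots> \<le> (2 * r)\<^sup>2" using N by (intro power_mono) auto
    finally have "\<bar>(real_of_int k)\<^sup>2 * g k\<bar> \<le> 4 * r\<^sup>2" using g by (simp add: power_mult_distrib)
    then show ?thesis unfolding c_def using 1 by linarith
  qed
  have force: "cmod (\<Theta>' s + \<Theta> s) \<le> 32 * r * B * exp (- (rate * B / 2) * s) * W0" if s: "s \<ge> 0" for s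
  proof -
    have "cmod (\<Theta>' s + \<Theta> s) \<le> 5 * r\<^sup>2 * sqrt (10 * r) * W s"
      unfolding \<Theta>' by (rule est) (use c s in auto)
    also have "5 * r\<^sup>2 * sqrt (10 * r) \<le> 16 * r * B"
    proof -
      have "sqrt 10 \<le> 16 / 5" by (rule real_le_lsqrt) (auto simp: power2_eq_square)
      then have "sqrt 10 * (5 * r\<^sup>2 * sqrt r) \<le> 16 / 5 * (5 * r\<^sup>2 * sqrt r)" using r1 by (intro mult_right_mono) auto
      then show ?thesis by (simp add: B(1) real_sqrt_mult power2_eq_square mult_ac)
    qed
    then have "5 * r\<^sup>2 * sqrt (10 * r) * W s \<le> 16 * r * B * W s" by (intro mult_right_mono W)
    finally show ?thesis by (simp add: W_def mult_ac)
  qed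
  \<comment> \<open>An antiderivative of the bound on the forcing multiplied by exp s. By
    \<open>large\<close> the growth exp s consumes at most half of the decay rate, leaving
    \<open>rate * B / 4\<close>; integration over time gains 1/B and gives 128 = 4 * 32.\<close>
  define \<phi> where "\<phi> s = - (128 * r / rate) * W0 * exp (- (rate * B / 4) * s)" for s
  define E where "E s = exp s *\<^sub>R \<Theta> s" for s
  have dE: "(E has_vector_derivative exp s *\<^sub>R (\<Theta>' s + \<Theta> s)) (at s within {0..})" if s: "s \<ge> 0" for s
  proof -
    have "((\<lambda>s. exp s) has_real_derivative exp s) (at s within {0..})" by (auto intro!: derivative_eq_intros)
    from has_vector_derivative_scaleR[OF this d\<Theta>[OF s]] show ?thesis
      unfolding E_def by (simp add: scaleR_add_right)
  qed
  have "norm (E t - E 0) \<le> \<phi> t - \<phi> 0"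
  proof (cases "t = 0")
    case False
    show ?thesis
    proof (rule differentiable_bound_general)
      show "0 < t" using False t by simp
      show "continuous_on {0..t} E"
        unfolding continuous_on_eq_continuous_within
        by (intro ballI continuous_within_subset[OF has_vector_derivative_continuous[OF dE]]) auto
      show "continuous_on {0..t} \<phi>" unfolding \<phi>_def by (intro continuous_intros)
      show "(E has_vector_derivative exp s *\<^sub>R (\<Theta>' s + \<Theta> s)) (at s)" if "0 < s" "s < t" for s
        using dE[of s] that at_within_half_line[of s] by simp
      show "(\<phi> has_vector_derivative (32 * r * B * W0 * exp (- (rate * B / 4) * s))) (at s)" for s
      proof -
        have "(\<phi> has_real_derivative - (128 * r / rate) * W0 * (- (rate * B / 4) * exp (- (rate * B / 4) * s))) (at s)"
          unfolding \<phi>_def by (intro DERIV_cmult exp_has_derivative)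
        then show ?thesis using rp by (simp add: has_real_derivative_iff_has_vector_derivative mult_ac)
      qed
      show "norm (exp s *\<^sub>R (\<Theta>' s + \<Theta> s)) \<le> 32 * r * B * W0 * exp (- (rate * B / 4) * s)" if "0 < s" "s < t" for s
      proof -
        have "norm (exp s *\<^sub>R (\<Theta>' s + \<Theta> s)) \<le> exp s * (32 * r * B * exp (- (rate * B / 2) * s) * W0)"
          using force[of s] that by (simp add: mult_left_mono)
        also have "\<dots> = 32 * r * B * W0 * exp (s - rate * B / 2 * s)"
        proof -
          have "exp (s - c * s) = exp s * exp (- c * s)" for c by (simp add: exp_add[symmetric])
          note e = this[of "rate * B / 2"]
          show ?thesis unfolding e by (simp only: mult_ac)
        qed
        also have "\<dots> \<le> 32 * r * B * W0 * exp (- (rate * B / 4) * s)"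
        proof -
          have "1 * s \<le> rate * B / 4 * s" using large that by (intro mult_right_mono) (auto simp: B_def)
          then have "s - rate * B / 2 * s \<le> - (rate * B / 4) * s" by (simp add: field_simps)
          then show ?thesis using r1 B W0 by (intro mult_left_mono) auto
        qed
        finally show ?thesis .
      qed
    qed
  qed simp
  also have "\<dots> \<le> 128 * r / rate * W0" using rp r1 W0 by (simp add: \<phi>_def)
  finally have "norm (E t) \<le> cmod (\<Theta> 0) + 128 * r / rate * W0"
    using norm_triangle_ineq2[of "E t" "E 0"] by (simp add: E_def)
  moreover have "cmod (\<Theta> 0) \<le> cmod (f 0) + 7 * r * W0"
    using \<Theta>0[of 0] norm_triangle_ineq2[of "\<Theta> 0" "?u 0 0"] by (simp add: sol_0[OF l0])
  ultimately have "exp t * cmod (\<Theta> t) \<le> cmod (f 0) + 7 * r * W0 + 128 * r / rate * W0"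
    by (simp add: E_def)
  then have "exp (- t) * (exp t * cmod (\<Theta> t)) \<le> exp (- t) * (cmod (f 0) + 7 * r * W0 + 128 * r / rate * W0)"
    by (intro mult_left_mono) auto
  moreover have "exp (- t) * (exp t * z) = z" for z :: real by (simp add: exp_minus)
  ultimately have "cmod (\<Theta> t) \<le> exp (- t) * (cmod (f 0) + 7 * r * W0 + 128 * r / rate * W0)"
    by (simp only:)
  moreover have "cmod (?u t 0) \<le> cmod (\<Theta> t) + 7 * r * exp (- t) * W0"
    using \<Theta>0[OF t] norm_triangle_ineq2[of "?u t 0" "\<Theta> t"] by (simp add: norm_minus_commute)
  ultimately have "cmod (?u t 0) \<le> exp (- t) * (cmod (f 0) + 7 * r * W0 + 128 * r / rate * W0) + 7 * r * exp (- t) * W0"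
    by linarith
  also have "\<dots> = exp (- t) * (cmod (f 0) + (128 / rate + 14) * r * W0)" by (simp add: algebra_simps)
  finally show ?thesis unfolding r_def W0_def .
qed

section \<open>Fourier uniqueness on the circle\<close>

lemma circle_basic: "space circle = {0..<2*pi}" "sets circle = sets (restrict_space borel {0..<2*pi})"
  "emeasure circle (space circle) = ennreal (2 * pi)" "measure circle (space circle) = 2 * pi"
  by (auto simp: circle_def space_restrict_space sets_restrict_space emeasure_restrict_space measure_def
      sets.Int)

lemma finite_measure_circle: "finite_measure circle"
  by (rule finite_measureI) (simp only: circle_basic(3), simp)

interpretation circle: finite_measure circle by (rule finite_measure_circle)
interpretation circle2: pair_sigma_finite circle circle ..
interpretation torus: finite_measure torus
  unfolding torus_def by (intro finite_measure_pair_measure finite_measure_circle)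

lemma borel_measurable_circleI: "f \<in> borel_measurable borel \<Longrightarrow> f \<in> borel_measurable circle"
  unfolding circle_def by (intro measurable_restrict_space1) simp

lemma continuous_measurable_circle [measurable]:
  "continuous_on UNIV f \<Longrightarrow> f \<in> borel_measurable circle"
  for f :: "real \<Rightarrow> 'a :: topological_space"
  by (intro borel_measurable_circleI borel_measurable_continuous_onI)

definition fmode :: "int \<Rightarrow> real \<Rightarrow> complex" where "fmode k x = exp (\<i> * of_int k * of_real x)"

lemma fmode_cis: "fmode k x = cis (of_int k * x)"
  by (simp add: fmode_def cis_conv_exp mult_ac)

lemma fmode_simps: "norm (fmode k x) = 1" "fmode k x * fmode j x = fmode (k + j) x" "fmode 0 x = 1"
  "cnj (fmode k x) = fmode (- k) x" "fmode k (x + 2 * pi) = fmode k x"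
proof -
  note c = fmode_cis
  show "norm (fmode k x) = 1" "fmode 0 x = 1" by (simp_all add: c)
  show "fmode k x * fmode j x = fmode (k + j) x" by (simp add: c cis_mult distrib_right)
  show "cnj (fmode k x) = fmode (- k) x" by (simp add: c cis_cnj)
  have "fmode k (x + 2 * pi) = cis (of_int k * x) * cis (2 * pi * of_int k)"
    by (simp add: c cis_mult algebra_simps)
  then show "fmode k (x + 2 * pi) = fmode k x" by (simp add: c cis_multiple_2pi)
qed

lemma fmode_continuous: "continuous_on S (fmode k)"
  unfolding fmode_def by (intro continuous_intros)

lemma fmode_measurable [measurable]: "fmode k \<in> borel_measurable circle"
  by (intro continuous_measurable_circle fmode_continuous)

lemma fmode_deriv: "(fmode k has_vector_derivative \<i> * of_int k * fmode k x) (at x within S)"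
proof -
  have "((\<lambda>x. of_real x :: complex) has_vector_derivative 1) (at x within S)"
    using has_vector_derivative_of_real[OF DERIV_ident] by simp
  then have "((\<lambda>x. \<i> * of_int k * of_real x) has_vector_derivative \<i> * of_int k) (at x within S)"
    using has_vector_derivative_mult_right by fastforce
  moreover have "(exp has_field_derivative fmode k x) (at (\<i> * of_int k * of_real x) within T)" for T
    unfolding fmode_def using DERIV_exp has_field_derivative_at_within by blast
  ultimately have "((exp \<circ> (\<lambda>x. \<i> * of_int k * of_real x)) has_vector_derivative (\<i> * of_int k) * fmode k x) (at x within S)"
    by (rule field_vector_diff_chain_within)
  then show ?thesis by (simp add: o_def fmode_def[abs_def])
qed

lemma circle_integral_hk:
  fixes f :: "real \<Rightarrow> complex"
  assumes "continuous_on UNIV f"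
  shows "(LINT x|circle. f x) = integral {0..2*pi} f"
proof -
  have c: "continuous_on {0..2*pi} f" using assms by (rule continuous_on_subset) simp
  have "(LINT x|circle. f x) = (LINT x|lborel. indicator {0..<2*pi} x *\<^sub>R f x)"
    unfolding circle_def by (rule integral_restrict_space) simp
  also have "\<dots> = (LINT x|lborel. indicator {0..2*pi} x *\<^sub>R f x)"
  proof (rule integral_cong_AE)
    show "(\<lambda>x. indicator {0..<2*pi} x *\<^sub>R f x) \<in> borel_measurable lborel"
      "(\<lambda>x. indicator {0..2*pi} x *\<^sub>R f x) \<in> borel_measurable lborel"
      using borel_measurable_continuous_onI[OF assms] by auto
    have "AE x in lborel. x \<noteq> 2 * pi" by (rule AE_lborel_singleton)
    then show "AE x in lborel. indicator {0..<2*pi} x *\<^sub>R f x = indicator {0..2*pi} x *\<^sub>R f x"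
      by eventually_elim (auto simp: indicator_def)
  qed
  also have "\<dots> = integral {0..2*pi} f"
    using set_borel_integral_eq_integral(2)[OF borel_integrable_atLeastAtMost'[OF c]]
    by (simp add: set_lebesgue_integral_def)
  finally show ?thesis .
qed

lemma circle_integral_derivative:
  assumes d: "\<And>x. (f has_vector_derivative f' x) (at x)" and c: "continuous_on UNIV f'"
    and p: "f (2 * pi) = f 0"
  shows "(LINT x|circle. f' x) = (0 :: complex)"
proof -
  have "(f' has_integral (f (2 * pi) - f 0)) {0..2*pi}"
    by (rule fundamental_theorem_of_calculus) (auto intro: has_vector_derivative_at_within d)
  then show ?thesis using p by (simp add: circle_integral_hk[OF c] integral_unique)
qed

lemma fmode_integral: "(LINT x|circle. fmode k x) = (if k = 0 then 2 * of_real pi else 0)"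
proof (cases "k = 0")
  case True
  then show ?thesis by (simp add: fmode_simps circle_basic(4) scaleR_conv_of_real)
next
  case False
  have "(LINT x|circle. \<i> * of_int k * fmode k x) = 0"
    by (rule circle_integral_derivative[OF fmode_deriv])
      (use fmode_simps(5)[of k 0] in \<open>auto intro!: continuous_intros fmode_continuous\<close>)
  then show ?thesis using False by simp
qed

inductive trig_poly :: "(real \<Rightarrow> complex) \<Rightarrow> bool" where
  mode: "trig_poly (fmode k)"
| add: "trig_poly f \<Longrightarrow> trig_poly g \<Longrightarrow> trig_poly (\<lambda>x. f x + g x)"
| scale: "trig_poly f \<Longrightarrow> trig_poly (\<lambda>x. c * f x)"

lemma trig_poly_mult:
  assumes "trig_poly f" "trig_poly g" shows "trig_poly (\<lambda>x. f x * g x)"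
  using assms(1)
proof induction
  case (mode k)
  show ?case using assms(2)
  proof induction
    case (mode j) show ?case using trig_poly.mode[of "k + j"] by (simp add: fmode_simps)
  next
    case (add f g) then show ?case using trig_poly.add[OF add(3,4)] by (simp add: distrib_left)
  next
    case (scale f c) then show ?case using trig_poly.scale[OF scale(2), of c] by (simp add: mult_ac)
  qed
next
  case (add f g) then show ?case using trig_poly.add[OF add(3,4)] by (simp add: distrib_right)
next
  case (scale f c) then show ?case using trig_poly.scale[OF scale(2), of c] by (simp add: mult_ac)
qed

text \<open>Real linear functionals of \<open>cis x\<close> are combinations of the modes 1 and -1,
  and the class is closed under products. This makes the Stone-Weierstrass theorem on the unit
  circle available.\<close>

lemma trig_poly_polynomial:
  assumes "real_polynomial_function (p :: complex \<Rightarrow> real)" shows "trig_poly (\<lambda>x. of_real (p (cis x)))"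
  using assms
proof induction
  case (linear f)
  interpret bounded_linear f by fact
  have cs: "cis x = cos x *\<^sub>R 1 + sin x *\<^sub>R \<i>" for x by (simp add: complex_eq_iff)
  have "of_real (f (cis x)) = (of_real (f 1) / 2 - of_real (f \<i>) / 2 * \<i>) * fmode 1 x
     + (of_real (f 1) / 2 + of_real (f \<i>) / 2 * \<i>) * fmode (-1) x" for x
    unfolding cs by (simp only: add scaleR) (simp add: fmode_cis complex_eq_iff)
  then show ?case
    by (simp only:) (intro trig_poly.intros)
next
  case (const c)
  show ?case using trig_poly.scale[OF trig_poly.mode[of 0], of "of_real c"] by (simp add: fmode_simps)
next
  case (add f g) then show ?case using trig_poly.add by fastforce
next
  case (mult f g) then show ?case using trig_poly_mult by fastforce
qed

lemma trig_poly_bounded: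
  assumes "trig_poly h" shows "h \<in> borel_measurable circle \<and> (\<exists>B. \<forall>x. norm (h x) \<le> B)"
  using assms
proof induction
  case (mode k) then show ?case by (auto simp: fmode_simps intro!: exI[of _ 1])
next
  case (add f g)
  then obtain B C where "\<forall>x. norm (f x) \<le> B" "\<forall>x. norm (g x) \<le> C" by blast
  then have "norm (f x + g x) \<le> B + C" for x by (meson add_mono norm_triangle_ineq order_trans)
  then show ?case using add by auto
next
  case (scale f c)
  then obtain B where "\<forall>x. norm (f x) \<le> B" by blast
  then have "norm (c * f x) \<le> norm c * B" for x by (simp add: norm_mult mult_left_mono)
  moreover have "(\<lambda>x. c * f x) \<in> borel_measurable circle"
    by (intro borel_measurable_times borel_measurable_const conjunct1[OF scale.IH])
  ultimately show ?case by blast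
qed

lemma integrable_mult_bounded:
  fixes g :: "'a \<Rightarrow> complex"
  assumes g: "integrable M g" and h: "h \<in> borel_measurable M" "\<And>x. norm (h x) \<le> B"
  shows "integrable M (\<lambda>x. g x * h x)"
proof (rule Bochner_Integration.integrable_bound)
  show "integrable M (\<lambda>x. B * norm (g x))" using g by simp
  show "(\<lambda>x. g x * h x) \<in> borel_measurable M" using g h by measurable
  show "AE x in M. norm (g x * h x) \<le> norm (B * norm (g x))"
  proof (rule AE_I2)
    fix x
    have "norm (g x * h x) \<le> norm (g x) * B" unfolding norm_mult by (intro mult_left_mono h) auto
    then show "norm (g x * h x) \<le> norm (B * norm (g x))" by (simp add: mult.commute)
  qed
qed

context
  fixes g :: "real \<Rightarrow> complex"
  assumes g: "integrable circle g" and c: "\<And>k. (LINT x|circle. g x * fmode k x) = 0"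
begin

lemma trig_poly_orthogonal:
  assumes "trig_poly h" shows "(LINT x|circle. g x * h x) = 0"
  using assms
proof induction
  case (add f h)
  have "integrable circle (\<lambda>x. g x * f x)" if "trig_poly f" for f
    using integrable_mult_bounded[OF g] trig_poly_bounded[OF that] by blast
  then show ?case using add by (simp add: distrib_left)
next
  case (scale f a)
  then show ?case by (simp add: mult.left_commute[of _ a])
qed (rule c)

text \<open>Taking \<open>h\<close> as a function on the unit circle builds in periodicity. A
  uniform approximation within \<open>e\<close> changes the integral by at most \<open>e\<close>
  times the integral of the norm of \<open>g\<close>.\<close>

lemma continuous_orthogonal:
  fixes h :: "complex \<Rightarrow> real"
  assumes h: "continuous_on (sphere 0 1) h"
  shows "(LINT x|circle. g x * of_real (h (cis x))) = 0"
proof -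
  have "norm (LINT x|circle. g x * of_real (h (cis x))) \<le> e * (LINT x|circle. norm (g x))" if e: "e > 0" for e
  proof -
    obtain p where p: "real_polynomial_function p" "\<And>z. z \<in> sphere 0 1 \<Longrightarrow> \<bar>h z - p z\<bar> < e"
      using Stone_Weierstrass_real_polynomial_function[OF compact_sphere h e] by metis
    have hm: "continuous_on UNIV (\<lambda>x. h (cis x))"
      by (rule continuous_on_compose2[OF h]) (auto intro!: continuous_intros)
    have tp: "trig_poly (\<lambda>x. of_real (p (cis x)))" by (rule trig_poly_polynomial[OF p(1)])
    obtain B where B: "\<And>x. norm (of_real (p (cis x)) :: complex) \<le> B"
      and pm: "(\<lambda>x. of_real (p (cis x)) :: complex) \<in> borel_measurable circle"
      using trig_poly_bounded[OF tp] by auto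
    have hb: "\<bar>h (cis x) - p (cis x)\<bar> \<le> e" for x using p(2)[of "cis x"] by simp
    have hmm: "(\<lambda>x. h (cis x)) \<in> borel_measurable circle" by (rule continuous_measurable_circle[OF hm])
    have dm: "(\<lambda>x. of_real (h (cis x)) - of_real (p (cis x)) :: complex) \<in> borel_measurable circle"
      using hmm pm by measurable
    have i1: "integrable circle (\<lambda>x. g x * of_real (p (cis x)))"
      by (rule integrable_mult_bounded[OF g pm B])
    have i2: "integrable circle (\<lambda>x. g x * (of_real (h (cis x)) - of_real (p (cis x))))"
      by (rule integrable_mult_bounded[OF g dm, of e]) (use hb in \<open>simp flip: of_real_diff\<close>)
    have "(LINT x|circle. g x * of_real (h (cis x)))
      = (LINT x|circle. g x * (of_real (h (cis x)) - of_real (p (cis x))) + g x * of_real (p (cis x)))"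
      by (simp add: algebra_simps)
    also have "\<dots> = (LINT x|circle. g x * (of_real (h (cis x)) - of_real (p (cis x))))"
      using i1 i2 trig_poly_orthogonal[OF tp] by simp
    also have "norm \<dots> \<le> (LINT x|circle. norm (g x * (of_real (h (cis x)) - of_real (p (cis x)))))"
      by (rule integral_norm_bound)
    also have "\<dots> \<le> (LINT x|circle. norm (g x) * e)"
    proof (rule Bochner_Integration.integral_mono)
      show "integrable circle (\<lambda>x. norm (g x * (of_real (h (cis x)) - of_real (p (cis x)))))" using i2 by simp
      show "integrable circle (\<lambda>x. norm (g x) * e)" using g by simp
      show "norm (g x * (of_real (h (cis x)) - of_real (p (cis x)))) \<le> norm (g x) * e" for x
        unfolding norm_mult using hb[of x] by (intro mult_left_mono) (simp_all flip: of_real_diff)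
    qed
    finally show ?thesis by (simp add: mult.commute)
  qed
  note bd = this
  have I0: "0 \<le> (LINT x|circle. norm (g x))" by simp
  have "norm (LINT x|circle. g x * of_real (h (cis x))) \<le> 0"
  proof (rule field_le_epsilon)
    fix d :: real assume d: "d > 0"
    have "norm (LINT x|circle. g x * of_real (h (cis x))) \<le> d / (1 + (LINT x|circle. norm (g x))) * (LINT x|circle. norm (g x))"
      by (rule bd, rule divide_pos_pos) (use d I0 in linarith)+
    also have "\<dots> \<le> 0 + d"
    proof -
      have "d / (1 + I) * I \<le> 0 + d" if "I \<ge> 0" for I using d that by (simp add: field_simps)
      then show ?thesis using I0 .
    qed
    finally show "norm (LINT x|circle. g x * of_real (h (cis x))) \<le> 0 + d" .
  qed
  then show ?thesis by simp
qed

text \<open>The indicator is the pointwise limit of min 1 (n d), where d is the distance of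
  \<open>cis x\<close> from the closed arc \<open>K\<close> over \<open>{0..a}\<close>. Dominated
  convergence transfers the orthogonality.\<close>

lemma arc_integral_zero:
  assumes a: "0 \<le> a" "a < 2 * pi"
  shows "(LINT x|circle. indicator {a<..} x *\<^sub>R g x) = 0"
proof -
  define K where "K = cis ` {0..a}"
  have K: "compact K" "K \<noteq> {}"
    using a unfolding K_def by (auto intro!: compact_continuous_image continuous_intros)
  have inK: "cis x \<in> K \<longleftrightarrow> x \<le> a" if "x \<in> {0..<2*pi}" for x
  proof
    assume "cis x \<in> K"
    then obtain y where y: "y \<in> {0..a}" "cis x = cis y" by (auto simp: K_def)
    obtain n :: int where "\<i> * of_real x = \<i> * of_real y + (of_int (2 * n) * pi) * \<i>"
      using y(2) unfolding cis_conv_exp exp_eq by blast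
    then have "\<i> * of_real x = \<i> * of_real (y + of_int (2 * n) * pi)" by (simp add: algebra_simps)
    then have n: "x = y + of_int (2 * n) * pi" by (simp only: mult_cancel_left of_real_eq_iff) simp
    have "\<bar>of_int n * (2 * pi)\<bar> < 1 * (2 * pi)" using n y that a by auto
    then have "\<bar>real_of_int n\<bar> < 1" unfolding abs_mult by simp
    then have "x = y" using n by simp
    then show "x \<le> a" using y by simp
  qed (use that in \<open>auto simp: K_def\<close>)
  define s where "s n x = g x * of_real (min 1 (real n * infdist (cis x) K))" for n x
  have "(\<lambda>n. LINT x|circle. s n x) \<longlonglongrightarrow> (LINT x|circle. indicator {a<..} x *\<^sub>R g x)"
  proof (rule integral_dominated_convergence[where w = "\<lambda>x. norm (g x)"])
    show "(\<lambda>x. indicator {a<..} x *\<^sub>R g x) \<in> borel_measurable circle"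
    proof (rule borel_measurable_scaleR)
      show "(indicator {a<..} :: real \<Rightarrow> real) \<in> borel_measurable circle"
        by (intro borel_measurable_circleI) simp
    qed (use g in simp)
    show "s n \<in> borel_measurable circle" for n
      unfolding s_def
    proof (rule borel_measurable_times)
      show "(\<lambda>x. of_real (min 1 (real n * infdist (cis x) K)) :: complex) \<in> borel_measurable circle"
        by (intro continuous_measurable_circle continuous_intros)
    qed (use g in simp)
    show "integrable circle (\<lambda>x. norm (g x))" using g by simp
    show "AE x in circle. norm (s n x) \<le> norm (g x)" for n
    proof (rule AE_I2)
      fix x
      have "\<bar>min 1 (real n * infdist (cis x) K)\<bar> \<le> 1" by (simp add: infdist_nonneg)
      then show "norm (s n x) \<le> norm (g x)"
        unfolding s_def norm_mult norm_of_real by (simp add: mult_left_le)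
    qed
    show "AE x in circle. (\<lambda>n. s n x) \<longlonglongrightarrow> indicator {a<..} x *\<^sub>R g x"
    proof (rule AE_I2)
      fix x assume "x \<in> space circle"
      then have x: "x \<in> {0..<2*pi}" by (simp add: circle_basic)
      show "(\<lambda>n. s n x) \<longlonglongrightarrow> indicator {a<..} x *\<^sub>R g x"
      proof (cases "x \<le> a")
        case True
        then show ?thesis using inK[OF x] by (simp add: s_def)
      next
        case False
        then have "infdist (cis x) K > 0"
          using inK[OF x] K by (simp add: infdist_pos_not_in_closed compact_imp_closed)
        then obtain n0 where n0: "1 < real n0 * infdist (cis x) K" using reals_Archimedean3 by blast
        have "s n x = g x" if "n \<ge> n0" for n
        proof -
          have "1 \<le> real n * infdist (cis x) K"
            using n0 that mult_right_mono[of "real n0" "real n" "infdist (cis x) K"] infdist_nonneg[of "cis x" K] by simp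
          then show ?thesis by (simp add: s_def)
        qed
        then have "\<forall>\<^sub>F n in sequentially. s n x = g x" using eventually_sequentially by blast
        then show ?thesis using False by (simp add: tendsto_eventually)
      qed
    qed
  qed
  moreover have "(LINT x|circle. s n x) = 0" for n
    unfolding s_def
    by (rule continuous_orthogonal[where h = "\<lambda>z. min 1 (real n * infdist z K)"]) (intro continuous_intros)
  ultimately show ?thesis by (simp add: LIMSEQ_const_iff)
qed

end

text \<open>Positive and negative part, taken as densities, define measures that agree on
  half-lines, hence everywhere.\<close>

lemma real_line_uniqueness:
  fixes u :: "real \<Rightarrow> real"
  assumes u: "integrable lborel u" and z: "\<And>a. (LINT x|lborel. indicator {a<..} x * u x) = 0"
  shows "AE x in lborel. u x = 0"
proof -
  have m [measurable]: "u \<in> borel_measurable lborel" using u by simp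
  let ?p = "\<lambda>x. max 0 (u x)" and ?n = "\<lambda>x. max 0 (- u x)"
  have i: "integrable lborel (\<lambda>x. indicator {a<..} x * ?p x)" "integrable lborel (\<lambda>x. indicator {a<..} x * ?n x)" for a
  proof -
    have "integrable lborel ?p" "integrable lborel ?n" using u by simp_all
    from integrable_mult_indicator[OF _ this(1), of "{a<..}"] integrable_mult_indicator[OF _ this(2), of "{a<..}"]
    show "integrable lborel (\<lambda>x. indicator {a<..} x * ?p x)" "integrable lborel (\<lambda>x. indicator {a<..} x * ?n x)"
      by simp_all
  qed
  have e: "emeasure (density lborel ?p) {a<..} = ennreal (LINT x|lborel. indicator {a<..} x * ?p x)"
    "emeasure (density lborel ?n) {a<..} = ennreal (LINT x|lborel. indicator {a<..} x * ?n x)" for a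
    using i[of a]
    by (auto simp: emeasure_density nn_integral_eq_integral[symmetric] mult.commute
        intro!: nn_integral_cong simp: indicator_def)
  have eq: "(LINT x|lborel. indicator {a<..} x * ?p x) = (LINT x|lborel. indicator {a<..} x * ?n x)" for a
  proof -
    have "(LINT x|lborel. indicator {a<..} x * ?p x) - (LINT x|lborel. indicator {a<..} x * ?n x)
      = (LINT x|lborel. indicator {a<..} x * ?p x - indicator {a<..} x * ?n x)"
      using i[of a] by simp
    also have "(\<lambda>x. indicator {a<..} x * ?p x - indicator {a<..} x * ?n x) = (\<lambda>x. indicator {a<..} x * u x)"
      by (rule ext) (simp add: indicator_def max_def)
    finally show ?thesis using z[of a] by simp
  qed
  have "density lborel ?p = density lborel ?n"
    by (rule measure_eqI_lessThan) (simp_all add: e eq)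
  then have "AE x in lborel. ennreal (?p x) = ennreal (?n x)"
    by (intro sigma_finite_measure.density_unique[OF sigma_finite_lborel]) auto
  then show ?thesis by eventually_elim (auto simp: max_def split: if_splits)
qed

text \<open>Stated for integrable functions rather than square integrable ones, because it is
  applied to slices and to partial Fourier coefficients of functions on the torus.\<close>

lemma circle_uniqueness:
  fixes g :: "real \<Rightarrow> complex"
  assumes g: "integrable circle g" and c: "\<And>k. (LINT x|circle. g x * fmode k x) = 0"
  shows "AE x in circle. g x = 0"
proof -
  define G where "G x = indicator {0..<2*pi} x *\<^sub>R g x" for x
  have G: "integrable lborel G"
    using g unfolding circle_def G_def by (subst (asm) integrable_restrict_space) auto
  have z: "(LINT x|lborel. indicator {a<..} x *\<^sub>R G x) = 0" for a
  proof -
    have "(LINT x|lborel. indicator {a<..} x *\<^sub>R G x) = (LINT x|lborel. indicator {0..<2*pi} x *\<^sub>R (indicator {a<..} x *\<^sub>R g x))"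
      by (simp add: G_def mult.commute)
    also have "\<dots> = (LINT x|circle. indicator {a<..} x *\<^sub>R g x)"
      unfolding circle_def by (rule integral_restrict_space[symmetric]) simp
    also have "\<dots> = 0"
    proof (cases "a < 0 \<or> a \<ge> 2 * pi")
      case True
      then show ?thesis
      proof
        assume "a < 0"
        then have "(LINT x|circle. indicator {a<..} x *\<^sub>R g x) = (LINT x|circle. g x * fmode 0 x)"
          by (intro Bochner_Integration.integral_cong) (auto simp: circle_basic fmode_simps)
        then show ?thesis by (simp only: c)
      next
        assume "a \<ge> 2 * pi"
        then have "(LINT x|circle. indicator {a<..} x *\<^sub>R g x) = (LINT x|circle. 0)"
          by (intro Bochner_Integration.integral_cong) (auto simp: circle_basic)
        then show ?thesis by simp
      qed
    qed (use arc_integral_zero[OF g c] in auto)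
    finally show ?thesis .
  qed
  have iG: "integrable lborel (\<lambda>x. indicator {a<..} x *\<^sub>R G x)" for a
    using G by (intro integrable_mult_indicator) auto
  have "AE x in lborel. Re (G x) = 0"
  proof (rule real_line_uniqueness)
    show "integrable lborel (\<lambda>x. Re (G x))" using G by simp
    show "(LINT x|lborel. indicator {a<..} x * Re (G x)) = 0" for a
      using integral_Re[OF iG[of a]] z[of a] by simp
  qed
  moreover have "AE x in lborel. Im (G x) = 0"
  proof (rule real_line_uniqueness)
    show "integrable lborel (\<lambda>x. Im (G x))" using G by simp
    show "(LINT x|lborel. indicator {a<..} x * Im (G x)) = 0" for a
      using integral_Im[OF iG[of a]] z[of a] by simp
  qed
  ultimately have "AE x in lborel. x \<in> {0..<2*pi} \<longrightarrow> g x = 0"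
    by eventually_elim (auto simp: G_def complex_eq_iff)
  then show ?thesis unfolding circle_def by (subst AE_restrict_space_iff) auto
qed

section \<open>Square integrable functions on the torus\<close>

lemma L2_simps: "f \<in> L2 \<longleftrightarrow> f \<in> borel_measurable torus \<and> integrable torus (\<lambda>p. (cmod (f p))\<^sup>2)"
  by (simp add: L2_def)

lemma L2_add: assumes "f \<in> L2" "g \<in> L2" shows "(\<lambda>p. f p + g p) \<in> L2"
  unfolding L2_simps
proof
  have [measurable]: "f \<in> borel_measurable torus" "g \<in> borel_measurable torus" using assms by (auto simp: L2_def)
  show "(\<lambda>p. f p + g p) \<in> borel_measurable torus" by measurable
  show "integrable torus (\<lambda>p. (cmod (f p + g p))\<^sup>2)"
  proof (rule Bochner_Integration.integrable_bound)
    show "integrable torus (\<lambda>p. 2 * (cmod (f p))\<^sup>2 + 2 * (cmod (g p))\<^sup>2)" using assms by (auto simp: L2_def)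
    show "AE p in torus. norm ((cmod (f p + g p))\<^sup>2) \<le> norm (2 * (cmod (f p))\<^sup>2 + 2 * (cmod (g p))\<^sup>2)"
    proof (rule AE_I2)
      fix p
      have "(cmod (f p + g p))\<^sup>2 \<le> (cmod (f p) + cmod (g p))\<^sup>2" by (intro power_mono norm_triangle_ineq) auto
      also have "\<dots> \<le> 2 * (cmod (f p))\<^sup>2 + 2 * (cmod (g p))\<^sup>2"
        using sum_squares_bound[of "cmod (f p)" "cmod (g p)"] by (simp add: power2_sum)
      finally show "norm ((cmod (f p + g p))\<^sup>2) \<le> norm (2 * (cmod (f p))\<^sup>2 + 2 * (cmod (g p))\<^sup>2)" by simp
    qed
  qed measurable
qed

lemma L2_cmult: assumes "f \<in> L2" shows "(\<lambda>p. c * f p) \<in> L2"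
  unfolding L2_simps
proof
  show "(\<lambda>p. c * f p) \<in> borel_measurable torus"
    using assms by (intro borel_measurable_times borel_measurable_const) (simp add: L2_def)
  have "integrable torus (\<lambda>p. (cmod c)\<^sup>2 * (cmod (f p))\<^sup>2)"
    using assms by (intro integrable_mult_right) (simp add: L2_def)
  then show "integrable torus (\<lambda>p. (cmod (c * f p))\<^sup>2)"
    by (simp only: norm_mult power_mult_distrib)
qed

lemma L2_bounded_mult:
  assumes f: "f \<in> L2" and h: "h \<in> borel_measurable torus" "\<And>p. cmod (h p) \<le> B"
  shows "(\<lambda>p. h p * f p) \<in> L2"
  unfolding L2_simps
proof
  have [measurable]: "f \<in> borel_measurable torus" using f by (auto simp: L2_def)
  note [measurable] = h(1)
  show "(\<lambda>p. h p * f p) \<in> borel_measurable torus" by measurable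
  show "integrable torus (\<lambda>p. (cmod (h p * f p))\<^sup>2)"
  proof (rule Bochner_Integration.integrable_bound)
    show "integrable torus (\<lambda>p. B\<^sup>2 * (cmod (f p))\<^sup>2)" using f by (auto simp: L2_def)
    show "AE p in torus. norm ((cmod (h p * f p))\<^sup>2) \<le> norm (B\<^sup>2 * (cmod (f p))\<^sup>2)"
    proof (rule AE_I2)
      fix p
      have "(cmod (h p))\<^sup>2 * (cmod (f p))\<^sup>2 \<le> B\<^sup>2 * (cmod (f p))\<^sup>2"
        by (intro mult_right_mono power_mono h) auto
      then show "norm ((cmod (h p * f p))\<^sup>2) \<le> norm (B\<^sup>2 * (cmod (f p))\<^sup>2)"
        by (simp add: norm_mult power_mult_distrib)
    qed
  qed measurable
qed

lemma L2_diff: "f \<in> L2 \<Longrightarrow> g \<in> L2 \<Longrightarrow> (\<lambda>p. f p - g p) \<in> L2"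
  using L2_add[OF _ L2_cmult[of g "-1"]] by simp

lemma L2_sum: "finite F \<Longrightarrow> (\<And>i. i \<in> F \<Longrightarrow> f i \<in> L2) \<Longrightarrow> (\<lambda>p. \<Sum>i\<in>F. f i p) \<in> L2"
proof (induction F rule: finite_induct)
  case empty show ?case by (simp add: L2_simps)
next
  case (insert i F)
  then show ?case using L2_add[of "f i" "\<lambda>p. \<Sum>i\<in>F. f i p"] by simp
qed

lemma L2_product_integrable: assumes "f \<in> L2" "g \<in> L2" shows "integrable torus (\<lambda>p. f p * g p)"
proof (rule Bochner_Integration.integrable_bound)
  have [measurable]: "f \<in> borel_measurable torus" "g \<in> borel_measurable torus" using assms by (auto simp: L2_def)
  show "(\<lambda>p. f p * g p) \<in> borel_measurable torus" by measurable
  show "integrable torus (\<lambda>p. (cmod (f p))\<^sup>2 + (cmod (g p))\<^sup>2)" using assms by (auto simp: L2_def)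
  show "AE p in torus. norm (f p * g p) \<le> norm ((cmod (f p))\<^sup>2 + (cmod (g p))\<^sup>2)"
  proof (rule AE_I2)
    fix p
    have "norm (f p * g p) \<le> (cmod (f p))\<^sup>2 + (cmod (g p))\<^sup>2"
      unfolding norm_mult using sum_squares_bound[of "cmod (f p)" "cmod (g p)"]
        mult_nonneg_nonneg[OF norm_ge_zero norm_ge_zero, of "f p" "g p"] by linarith
    then show "norm (f p * g p) \<le> norm ((cmod (f p))\<^sup>2 + (cmod (g p))\<^sup>2)" by simp
  qed
qed

lemma L2_const: "(\<lambda>p. c) \<in> L2"
  by (simp add: L2_simps)

lemma L2_integrable: "f \<in> L2 \<Longrightarrow> integrable torus f"
  using L2_product_integrable[OF _ L2_const[of 1]] by simp

lemma L2_cnj: "f \<in> L2 \<Longrightarrow> (\<lambda>p. cnj (f p)) \<in> L2"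
proof -
  assume f: "f \<in> L2"
  then have "(\<lambda>p. cnj (f p)) \<in> borel_measurable torus"
    by (intro borel_measurable_continuous_on[of cnj]) (auto intro: continuous_intros simp: L2_def)
  then show ?thesis using f by (simp add: L2_def)
qed

lemma L2_cong: assumes "f \<in> L2" "g \<in> borel_measurable torus" "ae_eq f g" shows "g \<in> L2"
proof -
  have "integrable torus (\<lambda>p. (cmod (g p))\<^sup>2) \<longleftrightarrow> integrable torus (\<lambda>p. (cmod (f p))\<^sup>2)"
    by (rule integrable_cong_AE) (use assms in \<open>auto simp: L2_def ae_eq_def\<close>)
  then show ?thesis using assms by (simp add: L2_def)
qed

lemma l2norm_nonneg: "l2norm f \<ge> 0"
  by (simp add: l2norm_def)

lemma l2norm_square: "(l2norm f)\<^sup>2 = (LINT p|torus. (cmod (f p))\<^sup>2)"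
  by (simp add: l2norm_def)

lemma l2norm_cong: assumes "ae_eq f g" "f \<in> borel_measurable torus" "g \<in> borel_measurable torus"
  shows "l2norm f = l2norm g"
  unfolding l2norm_def
  by (intro arg_cong[where f = sqrt] integral_cong_AE) (use assms in \<open>auto simp: ae_eq_def\<close>)

section \<open>Fourier series on the torus\<close>

definition tmode :: "int \<times> int \<Rightarrow> fn" where
  "tmode m = (\<lambda>(x, y). fmode (fst m) x * fmode (snd m) y)"

lemma tmode_measurable [measurable]: "tmode m \<in> borel_measurable torus"
  unfolding tmode_def torus_def by measurable

lemma tmode_simps: "cmod (tmode m p) = 1" "tmode m p * tmode n p = tmode (m + n) p" "tmode 0 p = 1"
  "cnj (tmode m p) = tmode (- m) p"
  by (auto simp: tmode_def fmode_simps norm_mult split: prod.split simp flip: fmode_simps(2))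

lemma tmode_L2: "tmode m \<in> L2"
  by (simp add: L2_simps tmode_simps)

lemma torus_integral:
  fixes f :: fn assumes "integrable torus f"
  shows "(LINT p|torus. f p) = (LINT y|circle. LINT x|circle. f (x, y))"
    "AE y in circle. integrable circle (\<lambda>x. f (x, y))" "integrable circle (\<lambda>y. LINT x|circle. f (x, y))"
  using assms circle2.integral_snd[of "\<lambda>x y. f (x, y)"] circle2.AE_integrable_snd[of "\<lambda>x y. f (x, y)"]
    circle2.integrable_snd[of "\<lambda>x y. f (x, y)"]
  by (simp_all add: torus_def)

lemma tmode_integral: "(LINT p|torus. tmode m p) = (if m = 0 then 4 * (of_real pi)\<^sup>2 else 0)"
  using torus_integral(1)[OF L2_integrable[OF tmode_L2[of m]]]
  by (auto simp: tmode_def fmode_integral prod_eq_iff power2_eq_square)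

definition fc :: "fn \<Rightarrow> int \<times> int \<Rightarrow> complex" where
  "fc f m = (LINT p|torus. f p * tmode (- m) p) / (4 * (of_real pi)\<^sup>2)"

lemma fc_tmode: "fc (tmode n) m = (if m = n then 1 else 0)"
  by (simp add: fc_def tmode_simps tmode_integral)

lemma fc_integrable: "f \<in> L2 \<Longrightarrow> integrable torus (\<lambda>p. f p * tmode m p)"
  by (intro L2_product_integrable tmode_L2)

lemma fc_add: "f \<in> L2 \<Longrightarrow> g \<in> L2 \<Longrightarrow> fc (\<lambda>p. f p + g p) m = fc f m + fc g m"
  by (simp add: fc_def distrib_right fc_integrable add_divide_distrib)

lemma fc_cmult: "fc (\<lambda>p. c * f p) m = c * fc f m"
  by (simp add: fc_def mult.assoc)

lemma fc_diff: "f \<in> L2 \<Longrightarrow> g \<in> L2 \<Longrightarrow> fc (\<lambda>p. f p - g p) m = fc f m - fc g m"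
  by (simp add: fc_def left_diff_distrib fc_integrable diff_divide_distrib)

lemma fc_sum: "finite F \<Longrightarrow> (\<And>i. i \<in> F \<Longrightarrow> f i \<in> L2) \<Longrightarrow> fc (\<lambda>p. \<Sum>i\<in>F. f i p) m = (\<Sum>i\<in>F. fc (f i) m)"
  by (simp add: fc_def sum_distrib_right fc_integrable sum_divide_distrib)

lemma fc_cong: assumes "ae_eq f g" "f \<in> L2" "g \<in> L2" shows "fc f m = fc g m"
proof -
  have "(LINT p|torus. f p * tmode (- m) p) = (LINT p|torus. g p * tmode (- m) p)"
    by (rule integral_cong_AE) (use assms in \<open>auto simp: ae_eq_def L2_def\<close>)
  then show ?thesis by (simp add: fc_def)
qed

text \<open>Uniqueness on the circle is applied in y to each partial coefficient and then in x on
  almost every slice. There are countably many modes, so one exceptional null set of y serves for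
  all of them.\<close>

lemma torus_uniqueness:
  assumes f: "integrable torus f" and z: "\<And>m. (LINT p|torus. f p * tmode m p) = 0"
  shows "ae_eq f (\<lambda>p. 0)"
proof -
  have fm: "f \<in> borel_measurable (circle \<Otimes>\<^sub>M circle)" using f by (simp add: torus_def)
  have i: "integrable torus (\<lambda>p. f p * tmode m p)" for m
    by (rule integrable_mult_bounded[OF f tmode_measurable, of _ 1]) (simp add: tmode_simps)
  define F where "F l y = (LINT x|circle. f (x, y) * fmode l x)" for l y
  have i0: "integrable torus (\<lambda>p. f p * tmode (l, 0) p)" for l by (rule i)
  have "AE y in circle. F l y = 0" for l
  proof (rule circle_uniqueness)
    show "integrable circle (F l)"
      using torus_integral(3)[OF i0[of l]] by (simp add: F_def[abs_def] tmode_def fmode_simps)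
    fix k
    have "(LINT y|circle. F l y * fmode k y) = (LINT y|circle. LINT x|circle. f (x, y) * tmode (l, k) (x, y))"
      unfolding F_def by (simp add: tmode_def mult.assoc[symmetric] flip: integral_mult_left_zero)
    also have "\<dots> = 0" using torus_integral(1)[OF i, of "(l, k)"] z by simp
    finally show "(LINT y|circle. F l y * fmode k y) = 0" .
  qed
  then have "AE y in circle. \<forall>l. F l y = 0" by (subst AE_all_countable) blast
  moreover have "AE y in circle. integrable circle (\<lambda>x. f (x, y))" by (rule torus_integral(2)[OF f])
  ultimately have "AE y in circle. AE x in circle. f (x, y) = 0"
  proof eventually_elim
    case (elim y)
    show ?case by (rule circle_uniqueness) (use elim in \<open>auto simp: F_def\<close>)
  qed
  then have "AE y in circle. AE x in circle. (\<lambda>x y. f (x, y) = 0) x y" .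
  moreover have "{p \<in> space (circle \<Otimes>\<^sub>M circle). (\<lambda>x y. f (x, y) = 0) (fst p) (snd p)} \<in> sets (circle \<Otimes>\<^sub>M circle)"
    using fm by simp
  ultimately have "AE x in circle. AE y in circle. f (x, y) = 0"
    using circle2.AE_commute[of "\<lambda>x y. f (x, y) = 0"] fm by simp
  then have "AE p in circle \<Otimes>\<^sub>M circle. f p = 0"
    by (intro circle2.AE_pair_measure) (use fm in auto)
  then show ?thesis unfolding ae_eq_def torus_def .
qed

text \<open>The optimal s is B/A; enlarging both numbers by \<open>e\<close> avoids a division by
  zero, and then \<open>e\<close> tends to zero.\<close>

lemma young_optimize:
  fixes x A B :: real
  assumes "A \<ge> 0" "B \<ge> 0" and y: "\<And>s. s > 0 \<Longrightarrow> 2 * x \<le> s * A\<^sup>2 + B\<^sup>2 / s"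
  shows "x \<le> A * B"
proof -
  have b: "x \<le> (A + e) * (B + e)" if e: "e > 0" for e
  proof -
    define s where "s = (B + e) / (A + e)"
    have s: "s > 0" using assms e by (simp add: s_def)
    have "s * A\<^sup>2 \<le> s * (A + e)\<^sup>2" using s assms e by (intro mult_left_mono power_mono) auto
    moreover have "s * (A + e)\<^sup>2 = (A + e) * (B + e)"
      using assms e by (simp add: s_def power2_eq_square)
    moreover have "B\<^sup>2 / s \<le> (B + e)\<^sup>2 / s" using s assms e by (intro divide_right_mono power_mono) auto
    moreover have "(B + e)\<^sup>2 / s = (A + e) * (B + e)"
      using assms e by (simp add: s_def power2_eq_square)
    ultimately show ?thesis using y[OF s] by linarith
  qed
  have "((\<lambda>e. (A + e) * (B + e)) \<longlongrightarrow> (A + 0) * (B + 0)) (at_right 0)"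
    by (intro tendsto_intros)
  then have "x \<le> (A + 0) * (B + 0)"
    by (rule tendsto_lowerbound) (auto simp: eventually_at_filter b)
  then show ?thesis by simp
qed

lemma L2_cauchy_schwarz:
  assumes f: "f \<in> L2" and g: "g \<in> L2"
  shows "(LINT p|torus. cmod (f p) * cmod (g p)) \<le> l2norm f * l2norm g"
proof (rule young_optimize[OF l2norm_nonneg l2norm_nonneg])
  fix s :: real assume s: "s > 0"
  have i: "integrable torus (\<lambda>p. cmod (f p) * cmod (g p))"
    using L2_product_integrable[OF f g, THEN integrable_norm] by (simp add: norm_mult)
  have "2 * (LINT p|torus. cmod (f p) * cmod (g p)) = (LINT p|torus. 2 * (cmod (f p) * cmod (g p)))" by simp
  also have "\<dots> \<le> (LINT p|torus. s * (cmod (f p))\<^sup>2 + (cmod (g p))\<^sup>2 / s)"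
  proof (rule Bochner_Integration.integral_mono)
    show "integrable torus (\<lambda>p. s * (cmod (f p))\<^sup>2 + (cmod (g p))\<^sup>2 / s)" using f g by (simp add: L2_def)
    show "2 * (cmod (f p) * cmod (g p)) \<le> s * (cmod (f p))\<^sup>2 + (cmod (g p))\<^sup>2 / s" for p
      using young_weighted[OF s, of 1 "cmod (f p)" "cmod (g p)"] by simp
  qed (use i in simp)
  also have "\<dots> = s * (l2norm f)\<^sup>2 + (l2norm g)\<^sup>2 / s"
    using f g by (simp add: L2_def l2norm_square)
  finally show "2 * (LINT p|torus. cmod (f p) * cmod (g p)) \<le> s * (l2norm f)\<^sup>2 + (l2norm g)\<^sup>2 / s" .
qed

lemma L2_integral_bound:
  assumes f: "f \<in> L2" and g: "g \<in> L2"
  shows "cmod (LINT p|torus. f p * g p) \<le> l2norm f * l2norm g"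
proof -
  have "cmod (LINT p|torus. f p * g p) \<le> (LINT p|torus. cmod (f p * g p))" by (rule integral_norm_bound)
  then show ?thesis using L2_cauchy_schwarz[OF f g] by (simp add: norm_mult)
qed

lemma l2norm_triangle:
  assumes f: "f \<in> L2" and g: "g \<in> L2"
  shows "l2norm (\<lambda>p. f p + g p) \<le> l2norm f + l2norm g"
proof (rule power2_le_imp_le)
  have i: "integrable torus (\<lambda>p. cmod (f p) * cmod (g p))"
    using L2_product_integrable[OF f g, THEN integrable_norm] by (simp add: norm_mult)
  have "(l2norm (\<lambda>p. f p + g p))\<^sup>2 \<le> (LINT p|torus. (cmod (f p))\<^sup>2 + 2 * (cmod (f p) * cmod (g p)) + (cmod (g p))\<^sup>2)"
    unfolding l2norm_square
  proof (rule Bochner_Integration.integral_mono)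
    show "integrable torus (\<lambda>p. (cmod (f p + g p))\<^sup>2)" using L2_add[OF f g] by (simp add: L2_def)
    show "integrable torus (\<lambda>p. (cmod (f p))\<^sup>2 + 2 * (cmod (f p) * cmod (g p)) + (cmod (g p))\<^sup>2)"
      using f g i by (simp add: L2_def)
    fix p
    have "(cmod (f p + g p))\<^sup>2 \<le> (cmod (f p) + cmod (g p))\<^sup>2" by (intro power_mono norm_triangle_ineq) auto
    then show "(cmod (f p + g p))\<^sup>2 \<le> (cmod (f p))\<^sup>2 + 2 * (cmod (f p) * cmod (g p)) + (cmod (g p))\<^sup>2"
      by (simp add: power2_sum)
  qed
  also have "\<dots> = (l2norm f)\<^sup>2 + 2 * (LINT p|torus. cmod (f p) * cmod (g p)) + (l2norm g)\<^sup>2"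
    using f g i by (simp add: L2_def l2norm_square)
  also have "\<dots> \<le> (l2norm f + l2norm g)\<^sup>2"
    using L2_cauchy_schwarz[OF f g] by (simp add: power2_sum)
  finally show "(l2norm (\<lambda>p. f p + g p))\<^sup>2 \<le> (l2norm f + l2norm g)\<^sup>2" .
qed (simp add: l2norm_nonneg add_nonneg_nonneg)

lemma l2norm_cmult: "l2norm (\<lambda>p. c * f p) = cmod c * l2norm f"
  unfolding l2norm_def norm_mult power_mult_distrib by (simp add: real_sqrt_mult)

lemma l2norm_minus: "l2norm (\<lambda>p. f p - g p) = l2norm (\<lambda>p. g p - f p)"
  unfolding l2norm_def by (simp add: norm_minus_commute)

lemma l2norm_diff_triangle:
  assumes "f \<in> L2" "g \<in> L2" "h \<in> L2"
  shows "l2norm (\<lambda>p. f p - h p) \<le> l2norm (\<lambda>p. f p - g p) + l2norm (\<lambda>p. g p - h p)"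
  using l2norm_triangle[OF L2_diff[OF assms(1,2)] L2_diff[OF assms(2,3)]] by simp

lemma L2_fatou:
  assumes f: "\<And>n. f n \<in> L2" and g: "g \<in> borel_measurable torus"
    and lim: "AE p in torus. (\<lambda>n. f n p) \<longlonglongrightarrow> g p" and b: "\<forall>\<^sub>F n in sequentially. l2norm (f n) \<le> C" and C: "C \<ge> 0"
  shows "g \<in> L2" "l2norm g \<le> C"
proof -
  have fm [measurable]: "f n \<in> borel_measurable torus" for n using f by (simp add: L2_def)
  note [measurable] = g
  have "(\<integral>\<^sup>+p. ennreal ((cmod (g p))\<^sup>2) \<partial>torus) = (\<integral>\<^sup>+p. liminf (\<lambda>n. ennreal ((cmod (f n p))\<^sup>2)) \<partial>torus)"
  proof (rule nn_integral_cong_AE)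
    show "AE p in torus. ennreal ((cmod (g p))\<^sup>2) = liminf (\<lambda>n. ennreal ((cmod (f n p))\<^sup>2))"
      using lim
    proof eventually_elim
      case (elim p)
      have "(\<lambda>n. ennreal ((cmod (f n p))\<^sup>2)) \<longlonglongrightarrow> ennreal ((cmod (g p))\<^sup>2)"
        by (intro tendsto_ennrealI tendsto_power tendsto_norm elim)
      from lim_imp_Liminf[OF sequentially_bot this] show ?case by (rule sym)
    qed
  qed
  also have "\<dots> \<le> liminf (\<lambda>n. \<integral>\<^sup>+p. ennreal ((cmod (f n p))\<^sup>2) \<partial>torus)"
    by (rule nn_integral_liminf) measurable
  also have "\<dots> \<le> liminf (\<lambda>n :: nat. ennreal (C\<^sup>2))"
  proof (rule Liminf_mono)
    show "\<forall>\<^sub>F n in sequentially. (\<integral>\<^sup>+p. ennreal ((cmod (f n p))\<^sup>2) \<partial>torus) \<le> ennreal (C\<^sup>2)"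
      using b
    proof eventually_elim
      case (elim n)
      have "(\<integral>\<^sup>+p. ennreal ((cmod (f n p))\<^sup>2) \<partial>torus) = ennreal ((l2norm (f n))\<^sup>2)"
        unfolding l2norm_square using f[of n] by (intro nn_integral_eq_integral) (auto simp: L2_def)
      also have "\<dots> \<le> ennreal (C\<^sup>2)" using elim by (intro ennreal_leI power_mono l2norm_nonneg)
      finally show ?case .
    qed
  qed
  also have "\<dots> = ennreal (C\<^sup>2)" by (rule Liminf_const) simp
  finally have le: "(\<integral>\<^sup>+p. ennreal ((cmod (g p))\<^sup>2) \<partial>torus) \<le> ennreal (C\<^sup>2)" .
  have i: "integrable torus (\<lambda>p. (cmod (g p))\<^sup>2)"
    by (rule integrableI_bounded) (use le in \<open>auto simp: le_less_trans[OF le]\<close>)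
  then show "g \<in> L2" using g by (simp add: L2_def)
  have "ennreal ((l2norm g)\<^sup>2) \<le> ennreal (C\<^sup>2)"
    using le nn_integral_eq_integral[OF i] by (simp add: l2norm_square)
  then have "(l2norm g)\<^sup>2 \<le> C\<^sup>2" by (simp add: ennreal_le_iff)
  then show "l2norm g \<le> C" using C by (rule power2_le_imp_le)
qed

text \<open>On a finite measure space the increments are summable in L^1 as well, so the sequence
  converges almost everywhere; Fatou's lemma bounds the distance to the limit by the tail of the
  geometric series.\<close>

lemma L2_complete:
  assumes f: "\<And>n. f n \<in> L2" and d: "\<And>n. l2norm (\<lambda>p. f (Suc n) p - f n p) \<le> (1/2) ^ n"
  obtains g where "g \<in> L2" "(\<lambda>n. l2norm (\<lambda>p. f n p - g p)) \<longlonglongrightarrow> 0"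
proof -
  have fm [measurable]: "f n \<in> borel_measurable torus" for n using f by (simp add: L2_def)
  define d where "d n p = cmod (f (Suc n) p - f n p)" for n p
  have dm [measurable]: "d n \<in> borel_measurable torus" for n unfolding d_def by measurable
  define K where "K = l2norm (\<lambda>p. 1)"
  have D: "(\<integral>\<^sup>+p. ennreal (d n p) \<partial>torus) \<le> ennreal ((1/2) ^ n * K)" for n
  proof -
    have i: "integrable torus (d n)"
      unfolding d_def using L2_integrable[OF L2_diff[OF f f]] by (rule integrable_norm)
    have "(LINT p|torus. d n p) \<le> l2norm (\<lambda>p. f (Suc n) p - f n p) * K"
      using L2_cauchy_schwarz[OF L2_diff[OF f f] L2_const[of 1], of "Suc n" n] by (simp add: d_def K_def)
    also have "\<dots> \<le> (1/2) ^ n * K" using assms(2)[of n] by (intro mult_right_mono) (auto simp: K_def l2norm_nonneg)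
    finally have "ennreal (LINT p|torus. d n p) \<le> ennreal ((1/2) ^ n * K)" by (rule ennreal_leI)
    moreover have "(\<integral>\<^sup>+p. ennreal (d n p) \<partial>torus) = ennreal (LINT p|torus. d n p)"
      by (rule nn_integral_eq_integral[OF i]) (simp add: d_def)
    ultimately show ?thesis by simp
  qed
  have "(\<integral>\<^sup>+p. (\<Sum>n. ennreal (d n p)) \<partial>torus) = (\<Sum>n. \<integral>\<^sup>+p. ennreal (d n p) \<partial>torus)"
    by (rule nn_integral_suminf) measurable
  also have "\<dots> \<le> (\<Sum>n. ennreal ((1/2) ^ n * K))" by (intro suminf_le D) auto
  also have "\<dots> = ennreal (\<Sum>n. (1/2) ^ n * K)"
    by (rule suminf_ennreal2) (auto simp: K_def l2norm_nonneg intro!: summable_mult2 summable_geometric)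
  finally have "(\<integral>\<^sup>+p. (\<Sum>n. ennreal (d n p)) \<partial>torus) \<noteq> \<infinity>" by (auto simp: top_unique)
  then have "AE p in torus. (\<Sum>n. ennreal (d n p)) \<noteq> \<infinity>" by (intro nn_integral_PInf_AE) measurable
  then have conv: "AE p in torus. convergent (\<lambda>n. f n p)"
  proof eventually_elim
    case (elim p)
    then have "summable (\<lambda>n. d n p)"
      by (intro summable_suminf_not_top) (auto simp: d_def)
    then have "summable (\<lambda>n. f (Suc n) p - f n p)" unfolding d_def by (rule summable_norm_cancel)
    then have "(\<lambda>n. \<Sum>i<n. f (Suc i) p - f i p) \<longlonglongrightarrow> (\<Sum>i. f (Suc i) p - f i p)" by (rule summable_LIMSEQ)
    then have "(\<lambda>n. (f n p - f 0 p) + f 0 p) \<longlonglongrightarrow> (\<Sum>i. f (Suc i) p - f i p) + f 0 p"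
      unfolding sum_lessThan_telescope[of "\<lambda>i. f i p"] by (intro tendsto_add tendsto_const)
    then show ?case by (auto intro: convergentI)
  qed
  define g where "g p = lim (\<lambda>n. f n p)" for p
  have gm [measurable]: "g \<in> borel_measurable torus" unfolding g_def by measurable
  have lim: "AE p in torus. (\<lambda>n. f n p) \<longlonglongrightarrow> g p"
    using conv by eventually_elim (simp add: g_def convergent_LIMSEQ_iff)
  have tail: "l2norm (\<lambda>p. f n p - f (n + m) p) \<le> 2 * (1/2) ^ n - 2 * (1/2) ^ (n + m)" for n m
  proof (induction m)
    case 0 show ?case by (simp add: l2norm_def)
  next
    case (Suc m)
    have "l2norm (\<lambda>p. f n p - f (n + Suc m) p) \<le> l2norm (\<lambda>p. f n p - f (n + m) p) + l2norm (\<lambda>p. f (n + m) p - f (n + Suc m) p)"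
      by (rule l2norm_diff_triangle[OF f f f])
    also have "l2norm (\<lambda>p. f (n + m) p - f (n + Suc m) p) \<le> (1/2) ^ (n + m)"
      using assms(2)[of "n + m"] by (simp add: l2norm_minus)
    finally show ?case using Suc by simp
  qed
  have est: "(\<lambda>p. f n p - g p) \<in> L2 \<and> l2norm (\<lambda>p. f n p - g p) \<le> 2 * (1/2) ^ n" for n
  proof -
    have 1: "(\<lambda>p. f n p - f m p) \<in> L2" for m by (intro L2_diff f)
    have 2: "AE p in torus. (\<lambda>m. f n p - f m p) \<longlonglongrightarrow> f n p - g p"
      using lim by eventually_elim (intro tendsto_diff tendsto_const)
    have 3: "\<forall>\<^sub>F m in sequentially. l2norm (\<lambda>p. f n p - f m p) \<le> 2 * (1/2) ^ n"
    proof (rule eventually_sequentiallyI[of n])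
      fix m assume "n \<le> m"
      then obtain j where m: "m = n + j" using le_Suc_ex by blast
      have "0 \<le> 2 * (1/2 :: real) ^ (n + j)" by simp
      then show "l2norm (\<lambda>p. f n p - f m p) \<le> 2 * (1/2) ^ n"
        unfolding m using tail[of n j] by linarith
    qed
    have 4: "(\<lambda>p. f n p - g p) \<in> borel_measurable torus" by measurable
    show ?thesis using L2_fatou[OF 1 4 2 3] by simp
  qed
  have "g \<in> L2" using L2_diff[OF f[of 0] conjunct1[OF est[of 0]]] by simp
  moreover have "(\<lambda>n. l2norm (\<lambda>p. f n p - g p)) \<longlonglongrightarrow> 0"
  proof (rule tendsto_sandwich[of "\<lambda>_. 0" _ _ "\<lambda>n. 2 * (1/2) ^ n"])
    show "(\<lambda>n. 2 * (1/2::real) ^ n) \<longlonglongrightarrow> 0"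
      by (intro tendsto_mult_right_zero LIMSEQ_realpow_zero) auto
    show "\<forall>\<^sub>F n in sequentially. l2norm (\<lambda>p. f n p - g p) \<le> 2 * (1/2) ^ n" using est by simp
  qed (auto simp: l2norm_nonneg)
  ultimately show ?thesis by (rule that)
qed

definition ibox :: "nat \<Rightarrow> (int \<times> int) set" where "ibox N = {- int N..int N} \<times> {- int N..int N}"
definition tsum :: "(int \<times> int \<Rightarrow> complex) \<Rightarrow> (int \<times> int) set \<Rightarrow> fn" where
  "tsum c F = (\<lambda>p. \<Sum>m\<in>F. c m * tmode m p)"

lemma finite_ibox: "finite (ibox N)"
  by (simp add: ibox_def)

lemma tsum_cong: "(\<And>m. m \<in> F \<Longrightarrow> c m = c' m) \<Longrightarrow> tsum c F = tsum c' F"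
  by (simp add: tsum_def)

lemma tsum_L2: "finite F \<Longrightarrow> tsum c F \<in> L2"
  unfolding tsum_def by (intro L2_sum L2_cmult tmode_L2)

lemma fc_tsum: "finite F \<Longrightarrow> fc (tsum c F) m = (if m \<in> F then c m else 0)"
  unfolding tsum_def by (simp add: fc_sum L2_cmult tmode_L2 fc_cmult fc_tmode if_distrib[of "\<lambda>x. _ * x"] sum.delta' cong: if_cong)

lemma pi_factor: "4 * (of_real pi)\<^sup>2 \<noteq> (0 :: complex)" "4 * pi\<^sup>2 > 0"
  by simp_all

lemma tsum_pairing:
  assumes f: "f \<in> L2" and F: "finite F"
  shows "(LINT p|torus. f p * cnj (tsum c F p)) = 4 * (of_real pi)\<^sup>2 * (\<Sum>m\<in>F. fc f m * cnj (c m))"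
proof -
  have "(LINT p|torus. f p * cnj (tsum c F p)) = (LINT p|torus. (\<Sum>m\<in>F. cnj (c m) * (f p * tmode (- m) p)))"
    by (simp add: tsum_def tmode_simps sum_distrib_left mult_ac)
  also have "\<dots> = (\<Sum>m\<in>F. LINT p|torus. cnj (c m) * (f p * tmode (- m) p))"
    by (rule Bochner_Integration.integral_sum) (intro integrable_mult_right fc_integrable f)
  also have "\<dots> = (\<Sum>m\<in>F. cnj (c m) * (4 * (of_real pi)\<^sup>2 * fc f m))"
    by (simp only: integral_mult_right_zero) (simp add: fc_def)
  also have "\<dots> = 4 * (of_real pi)\<^sup>2 * (\<Sum>m\<in>F. fc f m * cnj (c m))"
    by (simp add: sum_distrib_left mult_ac)
  finally show ?thesis .
qed

lemma tsum_distance: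
  assumes f: "f \<in> L2" and F: "finite F"
  shows "(l2norm (\<lambda>p. f p - tsum (fc f) F p))\<^sup>2 = (l2norm f)\<^sup>2 - 4 * pi\<^sup>2 * (\<Sum>m\<in>F. (cmod (fc f m))\<^sup>2)"
proof -
  let ?s = "tsum (fc f) F" and ?S = "\<Sum>m\<in>F. (cmod (fc f m))\<^sup>2"
  have s: "?s \<in> L2" by (rule tsum_L2[OF F])
  have c: "fc f m * cnj (fc f m) = of_real ((cmod (fc f m))\<^sup>2)" for m by (rule complex_norm_square[symmetric])
  have 1: "(LINT p|torus. f p * cnj (?s p)) = of_real (4 * pi\<^sup>2 * ?S)"
    unfolding tsum_pairing[OF f F] c by simp
  have "(LINT p|torus. ?s p * cnj (?s p)) = 4 * (of_real pi)\<^sup>2 * (\<Sum>m\<in>F. fc f m * cnj (fc f m))"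
    unfolding tsum_pairing[OF s F] fc_tsum[OF F] by (auto intro!: sum.cong arg_cong2[where f = "(*)"])
  then have 2: "(LINT p|torus. ?s p * cnj (?s p)) = of_real (4 * pi\<^sup>2 * ?S)"
    unfolding c by simp
  have i1: "integrable torus (\<lambda>p. f p * cnj (?s p))" "integrable torus (\<lambda>p. ?s p * cnj (?s p))"
    by (intro L2_product_integrable f s L2_cnj)+
  have i2: "integrable torus (\<lambda>p. (cmod (f p))\<^sup>2)" using f by (simp add: L2_def)
  have e: "(cmod (f p - ?s p))\<^sup>2 = (cmod (f p))\<^sup>2 - 2 * Re (f p * cnj (?s p)) + Re (?s p * cnj (?s p))" for p
    unfolding cmod_power2 by (simp add: power2_eq_square algebra_simps)
  have "(l2norm (\<lambda>p. f p - ?s p))\<^sup>2 = (l2norm f)\<^sup>2 - 2 * Re (LINT p|torus. f p * cnj (?s p)) + Re (LINT p|torus. ?s p * cnj (?s p))"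
  proof -
    have *: "(LINT p|torus. a p - 2 * R p + R' p) = (LINT p|torus. a p) - 2 * (LINT p|torus. R p) + (LINT p|torus. R' p)"
      if "integrable torus a" "integrable torus R" "integrable torus R'" for a R R' :: "real \<times> real \<Rightarrow> real"
      using that by simp
    show ?thesis
      unfolding l2norm_square e *[OF i2 integrable_Re[OF i1(1)] integrable_Re[OF i1(2)]]
        integral_Re[OF i1(1)] integral_Re[OF i1(2)] ..
  qed
  then show ?thesis unfolding 1 2 by simp
qed

lemma bessel:
  assumes f: "f \<in> L2"
  shows "ell2 (fc f)" "4 * pi\<^sup>2 * sqn (fc f) \<le> (l2norm f)\<^sup>2"
proof -
  have "(\<Sum>m\<in>F. (cmod (fc f m))\<^sup>2) \<le> (l2norm f)\<^sup>2 / (4 * pi\<^sup>2)" if "finite F" for F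
    using tsum_distance[OF f that] zero_le_power2[of "l2norm (\<lambda>p. f p - tsum (fc f) F p)"] pi_factor(2)
    by (simp add: pos_le_divide_eq mult.commute)
  from ell2I[OF this] show "ell2 (fc f)" "4 * pi\<^sup>2 * sqn (fc f) \<le> (l2norm f)\<^sup>2"
    using pi_factor(2) by (auto simp: pos_le_divide_eq mult.commute)
qed

lemma ibox_exhausts:
  assumes "((\<lambda>F. \<Sum>m\<in>F. g m) \<longlongrightarrow> S) (finite_subsets_at_top UNIV)"
  shows "(\<lambda>N. \<Sum>m\<in>ibox N. g m) \<longlonglongrightarrow> S"
proof -
  have "filterlim ibox (finite_subsets_at_top UNIV) sequentially"
    unfolding filterlim_finite_subsets_at_top
  proof (intro allI impI)
    fix X :: "(int \<times> int) set" assume X: "finite X \<and> X \<subseteq> UNIV"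
    define a where "a = Max (insert 0 ((\<lambda>m. \<bar>fst m\<bar>) ` X \<union> (\<lambda>m. \<bar>snd m\<bar>) ` X))"
    have a: "\<bar>fst m\<bar> \<le> a" "\<bar>snd m\<bar> \<le> a" if "m \<in> X" for m using X that by (auto simp: a_def)
    show "\<forall>\<^sub>F N in sequentially. finite (ibox N) \<and> X \<subseteq> ibox N \<and> ibox N \<subseteq> UNIV"
    proof (rule eventually_sequentiallyI[of "nat a"], intro conjI subsetI finite_ibox)
      fix N m assume "nat a \<le> N" "m \<in> X"
      then show "m \<in> ibox N" using a[of m] by (cases m) (auto simp: ibox_def)
    qed simp
  qed
  then show ?thesis by (rule filterlim_compose[OF assms])
qed

lemma ell2_ibox: "ell2 c \<Longrightarrow> (\<lambda>N. \<Sum>m\<in>ibox N. (cmod (c m))\<^sup>2) \<longlonglongrightarrow> sqn c"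
  unfolding ell2_def sqn_def by (intro ibox_exhausts infsum_tendsto)

text \<open>Square partial sums are thinned out until consecutive ones differ by at most a power of
  1/2, and \<open>L2_complete\<close> provides the limit. Coefficients and norm pass to the
  limit.\<close>

lemma riesz_fischer:
  assumes c: "ell2 c" obtains g where "g \<in> L2" "\<And>m. fc g m = c m" "(l2norm g)\<^sup>2 = 4 * pi\<^sup>2 * sqn c"
proof -
  have "\<exists>N. \<forall>n\<ge>N. 4 * pi\<^sup>2 * (sqn c - (\<Sum>m\<in>ibox n. (cmod (c m))\<^sup>2)) \<le> ((1/2) ^ j)\<^sup>2" for j :: nat
  proof -
    have "(\<lambda>N. 4 * pi\<^sup>2 * (sqn c - (\<Sum>m\<in>ibox N. (cmod (c m))\<^sup>2))) \<longlonglongrightarrow> 4 * pi\<^sup>2 * (sqn c - sqn c)"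
      by (intro tendsto_intros ell2_ibox c)
    then have "\<forall>\<^sub>F N in sequentially. 4 * pi\<^sup>2 * (sqn c - (\<Sum>m\<in>ibox N. (cmod (c m))\<^sup>2)) < ((1/2) ^ j)\<^sup>2"
      by (rule order_tendstoD) simp
    then show ?thesis unfolding eventually_sequentially by (meson less_imp_le)
  qed
  then obtain N where N: "\<And>j n. n \<ge> N j \<Longrightarrow> 4 * pi\<^sup>2 * (sqn c - (\<Sum>m\<in>ibox n. (cmod (c m))\<^sup>2)) \<le> ((1/2) ^ j)\<^sup>2"
    by metis
  \<comment> \<open>Summing up the thresholds makes \<open>r\<close> monotone and at least
    \<open>N j\<close>; the extra \<open>j\<close> lets the boxes exhaust all modes.\<close>
  define r where "r j = j + (\<Sum>i\<le>j. N i)" for j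
  have r: "r j \<ge> N j" "r j \<le> r (Suc j)" "r j \<ge> j" for j
    using member_le_sum[of j "{..j}" N] by (simp_all add: r_def)
  define f where "f j = tsum c (ibox (r j))" for j
  have f: "f j \<in> L2" for j unfolding f_def by (intro tsum_L2 finite_ibox)
  have "l2norm (\<lambda>p. f (Suc j) p - f j p) \<le> (1/2) ^ j" for j
  proof (rule power2_le_imp_le)
    have sub: "ibox (r j) \<subseteq> ibox (r (Suc j))" using r(2)[of j] by (auto simp: ibox_def)
    have fcS: "fc (f (Suc j)) m = c m" if "m \<in> ibox (r (Suc j))" for m
      using that by (simp add: f_def fc_tsum finite_ibox)
    have "f j = tsum (fc (f (Suc j))) (ibox (r j))"
      unfolding f_def[of j] using fcS sub by (intro tsum_cong) auto
    then have "(l2norm (\<lambda>p. f (Suc j) p - f j p))\<^sup>2 = (l2norm (f (Suc j)))\<^sup>2 - 4 * pi\<^sup>2 * (\<Sum>m\<in>ibox (r j). (cmod (fc (f (Suc j)) m))\<^sup>2)"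
      using tsum_distance[OF f finite_ibox, of "Suc j" "r j"] by simp
    also have "(\<Sum>m\<in>ibox (r j). (cmod (fc (f (Suc j)) m))\<^sup>2) = (\<Sum>m\<in>ibox (r j). (cmod (c m))\<^sup>2)"
      using sub fcS by (intro sum.cong) auto
    also have "(l2norm (f (Suc j)))\<^sup>2 = 4 * pi\<^sup>2 * (\<Sum>m\<in>ibox (r (Suc j)). (cmod (c m))\<^sup>2)"
    proof -
      have "f (Suc j) = tsum (fc (f (Suc j))) (ibox (r (Suc j)))"
        unfolding f_def[of "Suc j"] by (rule tsum_cong) (use fcS in \<open>simp add: f_def\<close>)
      moreover have "l2norm (\<lambda>p. f (Suc j) p - h p) = 0" if "f (Suc j) = h" for h
        using that by (simp add: l2norm_def)
      ultimately have "l2norm (\<lambda>p. f (Suc j) p - tsum (fc (f (Suc j))) (ibox (r (Suc j))) p) = 0" by blast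
      then have "0 = (l2norm (f (Suc j)))\<^sup>2 - 4 * pi\<^sup>2 * (\<Sum>m\<in>ibox (r (Suc j)). (cmod (fc (f (Suc j)) m))\<^sup>2)"
        using tsum_distance[OF f finite_ibox, of "Suc j" "r (Suc j)"] by simp
      also have "(\<Sum>m\<in>ibox (r (Suc j)). (cmod (fc (f (Suc j)) m))\<^sup>2) = (\<Sum>m\<in>ibox (r (Suc j)). (cmod (c m))\<^sup>2)"
        using fcS by (intro sum.cong) auto
      finally show ?thesis by simp
    qed
    also have "4 * pi\<^sup>2 * (\<Sum>m\<in>ibox (r (Suc j)). (cmod (c m))\<^sup>2) \<le> 4 * pi\<^sup>2 * sqn c"
      by (intro mult_left_mono ell2_finite_sum_le c finite_ibox) simp
    finally show "(l2norm (\<lambda>p. f (Suc j) p - f j p))\<^sup>2 \<le> ((1/2) ^ j)\<^sup>2"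
      using N[OF r(1), of j] by (simp add: right_diff_distrib)
  qed simp
  then obtain g where g: "g \<in> L2" "(\<lambda>j. l2norm (\<lambda>p. f j p - g p)) \<longlonglongrightarrow> 0"
    using L2_complete[of f] f by blast
  have fcg: "fc g m = c m" for m
  proof -
    have "(\<lambda>j. fc (f j) m - fc g m) \<longlonglongrightarrow> 0"
    proof (rule Lim_null_comparison)
      show "\<forall>\<^sub>F j in sequentially. norm (fc (f j) m - fc g m) \<le> l2norm (\<lambda>p. f j p - g p) * l2norm (tmode (- m)) / (4 * pi\<^sup>2)"
      proof (rule always_eventually, rule allI)
        fix j
        have "norm (fc (f j) m - fc g m) = cmod (LINT p|torus. (f j p - g p) * tmode (- m) p) / (4 * pi\<^sup>2)"
          unfolding fc_diff[OF f g(1), symmetric] by (simp add: fc_def norm_divide norm_mult norm_power)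
        also have "\<dots> \<le> l2norm (\<lambda>p. f j p - g p) * l2norm (tmode (- m)) / (4 * pi\<^sup>2)"
          by (intro divide_right_mono L2_integral_bound L2_diff f g tmode_L2) simp
        finally show "norm (fc (f j) m - fc g m) \<le> l2norm (\<lambda>p. f j p - g p) * l2norm (tmode (- m)) / (4 * pi\<^sup>2)" .
      qed
      show "(\<lambda>j. l2norm (\<lambda>p. f j p - g p) * l2norm (tmode (- m)) / (4 * pi\<^sup>2)) \<longlonglongrightarrow> 0"
        by (intro tendsto_divide_zero tendsto_mult_left_zero g)
    qed
    moreover have "\<forall>\<^sub>F j in sequentially. fc (f j) m = c m"
    proof -
      show ?thesis
      proof (rule eventually_sequentiallyI[of "nat (max \<bar>fst m\<bar> \<bar>snd m\<bar>)"])
        fix j assume "nat (max \<bar>fst m\<bar> \<bar>snd m\<bar>) \<le> j"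
        then have "m \<in> ibox (r j)" using r(3)[of j] by (cases m) (auto simp: ibox_def)
        then show "fc (f j) m = c m" by (simp add: f_def fc_tsum finite_ibox)
      qed
    qed
    then have "\<forall>\<^sub>F j in sequentially. fc (f j) m - fc g m = c m - fc g m" by eventually_elim simp
    ultimately have "(\<lambda>j. c m - fc g m) \<longlonglongrightarrow> 0" by (simp cong: tendsto_cong)
    then show ?thesis by (simp add: LIMSEQ_const_iff)
  qed
  then have fcg': "fc g = c" by blast
  have "(\<lambda>j. (l2norm (\<lambda>p. f j p - g p))\<^sup>2) \<longlonglongrightarrow> 0\<^sup>2" by (intro tendsto_power g)
  moreover have "(l2norm (\<lambda>p. f j p - g p))\<^sup>2 = (l2norm g)\<^sup>2 - 4 * pi\<^sup>2 * (\<Sum>m\<in>ibox (r j). (cmod (c m))\<^sup>2)" for j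
    using tsum_distance[OF g(1) finite_ibox, of "r j"] unfolding fcg' by (simp add: f_def l2norm_minus)
  moreover have "filterlim r at_top sequentially"
    by (rule filterlim_at_top_mono[OF filterlim_ident]) (use r in auto)
  then have "(\<lambda>j. (l2norm g)\<^sup>2 - 4 * pi\<^sup>2 * (\<Sum>m\<in>ibox (r j). (cmod (c m))\<^sup>2)) \<longlonglongrightarrow> (l2norm g)\<^sup>2 - 4 * pi\<^sup>2 * sqn c"
    by (intro tendsto_intros filterlim_compose[OF ell2_ibox[OF c]])
  ultimately have "(l2norm g)\<^sup>2 - 4 * pi\<^sup>2 * sqn c = 0\<^sup>2"
    by (simp only:) (rule LIMSEQ_unique)
  then have "(l2norm g)\<^sup>2 = 4 * pi\<^sup>2 * sqn c" by simp
  with g(1) fcg show ?thesis by (rule that)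
qed

lemma L2_uniqueness:
  assumes "f \<in> L2" "g \<in> L2" "\<And>m. fc f m = fc g m" shows "ae_eq f g"
proof -
  have "ae_eq (\<lambda>p. f p - g p) (\<lambda>p. 0)"
  proof (rule torus_uniqueness)
    show "integrable torus (\<lambda>p. f p - g p)" using assms by (intro L2_integrable L2_diff)
    fix m
    have "fc (\<lambda>p. f p - g p) (- m) = 0" using assms by (simp add: fc_diff)
    then show "(LINT p|torus. (f p - g p) * tmode m p) = 0" by (simp add: fc_def)
  qed
  then show ?thesis by (simp add: ae_eq_def)
qed

text \<open>Completeness of the modes: \<open>riesz_fischer\<close> produces a function with the
  same coefficients whose norm is given by Parseval's identity, and uniqueness identifies it with
  \<open>f\<close>.\<close>

lemma tsum_converges:
  assumes f: "f \<in> L2" shows "(\<lambda>N. l2norm (\<lambda>p. f p - tsum (fc f) (ibox N) p)) \<longlonglongrightarrow> 0"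
    and "(l2norm f)\<^sup>2 = 4 * pi\<^sup>2 * sqn (fc f)"
proof -
  let ?E = "\<lambda>N. (l2norm f)\<^sup>2 - 4 * pi\<^sup>2 * (\<Sum>m\<in>ibox N. (cmod (fc f m))\<^sup>2)"
  have lim: "?E \<longlonglongrightarrow> (l2norm f)\<^sup>2 - 4 * pi\<^sup>2 * sqn (fc f)"
    by (intro tendsto_intros ell2_ibox bessel(1)[OF f])
  show p: "(l2norm f)\<^sup>2 = 4 * pi\<^sup>2 * sqn (fc f)"
  proof -
    obtain g where g: "g \<in> L2" "\<And>m. fc g m = fc f m" "(l2norm g)\<^sup>2 = 4 * pi\<^sup>2 * sqn (fc f)"
      using riesz_fischer[OF bessel(1)[OF f]] by metis
    have "ae_eq f g" by (rule L2_uniqueness[OF f g(1)]) (simp add: g)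
    then have "l2norm f = l2norm g" by (rule l2norm_cong) (use f g in \<open>auto simp: L2_def\<close>)
    then show ?thesis using g(3) by simp
  qed
  have "(\<lambda>N. sqrt (?E N)) \<longlonglongrightarrow> sqrt 0"
    using tendsto_real_sqrt[OF lim] p by simp
  moreover have "sqrt (?E N) = l2norm (\<lambda>p. f p - tsum (fc f) (ibox N) p)" for N
    unfolding tsum_distance[OF f finite_ibox, symmetric] by (simp add: l2norm_nonneg)
  ultimately show "(\<lambda>N. l2norm (\<lambda>p. f p - tsum (fc f) (ibox N) p)) \<longlonglongrightarrow> 0" by simp
qed

section \<open>The spaces and projections in Fourier variables\<close>

definition xmode :: "fn \<Rightarrow> int \<Rightarrow> real \<Rightarrow> complex" where
  "xmode f l y = (LINT x|circle. f (x, y) * fmode (- l) x)"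

lemma xmode_measurable [measurable]:
  assumes "f \<in> borel_measurable torus" shows "xmode f l \<in> borel_measurable circle"
proof -
  have [measurable]: "f \<in> borel_measurable (circle \<Otimes>\<^sub>M circle)" using assms by (simp add: torus_def)
  show ?thesis unfolding xmode_def[abs_def] by measurable
qed

lemma xmode_fc:
  assumes f: "f \<in> L2"
  shows "integrable circle (xmode f l)"
    "(LINT y|circle. xmode f l y * fmode (- k) y) = 4 * (of_real pi)\<^sup>2 * fc f (l, k)"
proof -
  have i: "integrable torus (\<lambda>p. f p * tmode (- l, - k) p)" for k by (rule fc_integrable[OF f])
  show "integrable circle (xmode f l)"
    using torus_integral(3)[OF i[of 0]] by (simp add: xmode_def[abs_def] tmode_def fmode_simps)
  have "(LINT y|circle. xmode f l y * fmode (- k) y) = (LINT y|circle. LINT x|circle. f (x, y) * tmode (- l, - k) (x, y))"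
    unfolding xmode_def by (simp add: tmode_def mult.assoc[symmetric] flip: integral_mult_left_zero)
  also have "\<dots> = 4 * (of_real pi)\<^sup>2 * fc f (l, k)"
    using torus_integral(1)[OF i, of k] by (simp add: fc_def)
  finally show "(LINT y|circle. xmode f l y * fmode (- k) y) = 4 * (of_real pi)\<^sup>2 * fc f (l, k)" .
qed

lemma L20_iff: "f \<in> L20 \<longleftrightarrow> f \<in> L2 \<and> (\<forall>k. fc f (0, k) = 0)"
proof (cases "f \<in> L2")
  case True
  have x0: "xmode f 0 y = (LINT x|circle. f (x, y))" for y by (simp add: xmode_def fmode_simps)
  show ?thesis
  proof
    assume "f \<in> L20"
    then have ae: "AE y in circle. xmode f 0 y = 0" by (simp add: L20_def x0)
    have "fc f (0, k) = 0" for k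
    proof -
      have "(LINT y|circle. xmode f 0 y * fmode (- k) y) = (LINT y|circle. 0)"
        using ae True by (intro integral_cong_AE) (auto simp: L2_def)
      then show ?thesis using xmode_fc(2)[OF True, of 0 k] by simp
    qed
    then show "f \<in> L2 \<and> (\<forall>k. fc f (0, k) = 0)" using True by blast
  next
    assume z: "f \<in> L2 \<and> (\<forall>k. fc f (0, k) = 0)"
    have "AE y in circle. xmode f 0 y = 0"
    proof (rule circle_uniqueness)
      show "integrable circle (xmode f 0)" by (rule xmode_fc[OF True])
      show "(LINT y|circle. xmode f 0 y * fmode k y) = 0" for k
        using xmode_fc(2)[OF True, of 0 "- k"] z by simp
    qed
    then show "f \<in> L20" using True by (simp add: L20_def x0)
  qed
qed (simp add: L20_def)

lemma L20_L2: "f \<in> L20 \<Longrightarrow> f \<in> L2"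
  by (simp add: L20_def)

lemma L20_combination: "f \<in> L20 \<Longrightarrow> g \<in> L20 \<Longrightarrow> (\<lambda>p. a * f p + b * g p) \<in> L20"
  by (simp add: L20_iff L2_add L2_cmult fc_add fc_cmult)

lemma L20_diff: "f \<in> L20 \<Longrightarrow> g \<in> L20 \<Longrightarrow> (\<lambda>p. f p - g p) \<in> L20"
  by (simp add: L20_iff L2_diff fc_diff)

lemma P_xmode: "P l f (x, y) = xmode f l y * fmode l x / (2 * of_real pi)"
  by (simp add: P_def xmode_def fmode_def)

text \<open>Fubini directly gives only integrability of \<open>P l f\<close>. Square integrability
  comes from a function built by \<open>riesz_fischer\<close> with the expected coefficients, which
  uniqueness for integrable functions identifies with \<open>P l f\<close>.\<close>

lemma P_L2:
  assumes f: "f \<in> L2"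
  shows "P l f \<in> L2" "fc (P l f) (j, k) = (if j = l then fc f (l, k) else 0)"
proof -
  have [measurable]: "f \<in> borel_measurable torus" using f by (simp add: L2_def)
  have Pm: "P l f = (\<lambda>p. xmode f l (snd p) * fmode l (fst p) / (2 * of_real pi))"
    by (auto simp: P_xmode)
  have m: "P l f \<in> borel_measurable (circle \<Otimes>\<^sub>M circle)" unfolding Pm by measurable
  have iP: "integrable torus (P l f)"
    unfolding torus_def
  proof (rule circle2.Fubini_integrable[OF m])
    show "integrable circle (\<lambda>x. LINT y|circle. norm (P l f (x, y)))"
      by (simp add: P_xmode norm_divide norm_mult fmode_simps)
    show "AE x in circle. integrable circle (\<lambda>y. P l f (x, y))"
      unfolding P_xmode using xmode_fc(1)[OF f, of l] by simp
  qed
  have co: "(LINT p|torus. P l f p * tmode (- j, - k) p) = 4 * (of_real pi)\<^sup>2 * (if j = l then fc f (l, k) else 0)" for j k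
  proof -
    have i: "integrable torus (\<lambda>p. P l f p * tmode (- j, - k) p)"
      by (rule integrable_mult_bounded[OF iP tmode_measurable, of _ 1]) (simp add: tmode_simps)
    have "P l f (x, y) * tmode (- j, - k) (x, y) = (xmode f l y * fmode (- k) y / (2 * of_real pi)) * fmode (l - j) x" for x y
      using fmode_simps(2)[of l x "- j"] by (simp add: P_xmode tmode_def mult_ac)
    then have "(LINT p|torus. P l f p * tmode (- j, - k) p)
      = (LINT y|circle. (xmode f l y * fmode (- k) y / (2 * of_real pi)) * (LINT x|circle. fmode (l - j) x))"
      unfolding torus_integral(1)[OF i] by simp
    also have "\<dots> = (if j = l then 4 * (of_real pi)\<^sup>2 * fc f (l, k) else 0)"
      using xmode_fc(2)[OF f, of l k] by (simp add: fmode_integral)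
    finally show ?thesis by simp
  qed
  have e: "ell2 (\<lambda>m. if fst m = l then fc f m else 0)"
    by (rule ell2_mono(1)[OF bessel(1)[OF f]]) simp
  obtain g where g: "g \<in> L2" "\<And>m. fc g m = (if fst m = l then fc f m else 0)"
    using riesz_fischer[OF e] by metis
  have "ae_eq (\<lambda>p. g p - P l f p) (\<lambda>p. 0)"
  proof (rule torus_uniqueness)
    show "integrable torus (\<lambda>p. g p - P l f p)" using iP L2_integrable[OF g(1)] by simp
    fix m :: "int \<times> int"
    obtain j k where jk: "m = (- j, - k)" by (metis minus_minus surj_pair)
    have i: "integrable torus (\<lambda>p. P l f p * tmode m p)"
      by (rule integrable_mult_bounded[OF iP tmode_measurable, of _ 1]) (simp add: tmode_simps)
    have "(LINT p|torus. g p * tmode m p) = 4 * (of_real pi)\<^sup>2 * fc g (j, k)" by (simp add: fc_def jk)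
    then show "(LINT p|torus. (g p - P l f p) * tmode m p) = 0"
      using fc_integrable[OF g(1), of m] i co[of j k] by (simp add: left_diff_distrib g(2) jk)
  qed
  then have gP: "ae_eq g (P l f)" by (simp add: ae_eq_def)
  have "P l f \<in> borel_measurable torus" using m by (simp add: torus_def)
  from L2_cong[OF g(1) this gP] show "P l f \<in> L2" .
  show "fc (P l f) (j, k) = (if j = l then fc f (l, k) else 0)"
    using co[of j k] by (simp add: fc_def)
qed

lemma P_L20: "f \<in> L2 \<Longrightarrow> l \<noteq> 0 \<Longrightarrow> P l f \<in> L20"
  by (simp add: L20_iff P_L2)

definition crit :: "(int \<times> int) set" where "crit = {(1, 0), (-1, 0)}"

lemma Y_iff: "f \<in> Y \<longleftrightarrow> f \<in> L20 \<and> (\<forall>m\<in>crit. fc f m = 0)"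
proof (cases "f \<in> L20")
  case True
  have "(LINT y|circle. P l f (x, y)) = 2 * of_real pi * fmode l x * fc f (l, 0)" for l x
  proof -
    have "(LINT y|circle. P l f (x, y)) = (LINT y|circle. xmode f l y * fmode (- 0) y) * fmode l x / (2 * of_real pi)"
      unfolding P_xmode by (simp add: fmode_simps)
    then show ?thesis unfolding xmode_fc(2)[OF L20_L2[OF True]] by (simp add: power2_eq_square)
  qed
  moreover have "fmode l x \<noteq> 0" for l x by (metis fmode_simps(1) norm_zero zero_neq_one)
  ultimately have "f \<in> Y \<longleftrightarrow> (\<forall>l. \<bar>l\<bar> = 1 \<longrightarrow> fc f (l, 0) = 0)" using True by (simp add: Y_def)
  also have "\<dots> \<longleftrightarrow> (\<forall>m\<in>crit. fc f m = 0)"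
  proof -
    have "\<bar>l\<bar> = 1 \<longleftrightarrow> l = 1 \<or> l = - 1" for l :: int by linarith
    then show ?thesis unfolding crit_def by blast
  qed
  finally show ?thesis using True by simp
qed (simp add: Y_def)

lemma l2inner_self: "f \<in> L2 \<Longrightarrow> l2inner f f = of_real ((l2norm f)\<^sup>2)"
proof -
  assume f: "f \<in> L2"
  have "(LINT p|torus. f p * cnj (f p)) = (LINT p|torus. of_real ((cmod (f p))\<^sup>2))"
    by (simp only: complex_norm_square)
  then show ?thesis by (simp only: l2inner_def l2norm_square integral_complex_of_real)
qed

lemma l2norm_zero_ae: assumes "f \<in> L2" "l2norm f = 0" shows "ae_eq f (\<lambda>p. 0)"
proof -
  have "integrable torus (\<lambda>p. (cmod (f p))\<^sup>2)" using assms(1) by (simp add: L2_def)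
  moreover have "(LINT p|torus. (cmod (f p))\<^sup>2) = 0" using assms(2) l2norm_square[of f] by simp
  ultimately have "AE p in torus. (cmod (f p))\<^sup>2 = 0"
    by (subst integral_nonneg_eq_0_iff_AE[symmetric]) auto
  then show ?thesis by (simp add: ae_eq_def)
qed

text \<open>Deleting the two critical modes yields one admissible projection, so the choice in
  \<open>orth_proj\<close> is meaningful. Its difference from the chosen one lies in
  \<open>Y\<close> and is orthogonal to itself, so both have the same coefficients.\<close>

lemma Q_projection:
  assumes g: "g \<in> L20"
  shows "Q g \<in> L2" "fc (Q g) m = (if m \<in> crit then 0 else fc g m)"
proof -
  define q where "q = (\<lambda>p. g p - tsum (fc g) crit p)"
  have g2: "g \<in> L2" by (rule L20_L2[OF g])
  have fin: "finite crit" by (simp add: crit_def)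
  have ts: "tsum (fc g) crit \<in> L2" by (rule tsum_L2[OF fin])
  have q2: "q \<in> L2" unfolding q_def by (intro L2_diff g2 ts)
  have fq: "fc q m = (if m \<in> crit then 0 else fc g m)" for m
    unfolding q_def by (simp add: fc_diff g2 ts fc_tsum fin)
  have qY: "q \<in> Y" using g fq q2 by (simp add: Y_iff L20_iff)
  have Y2: "h \<in> Y \<Longrightarrow> h \<in> L2" for h by (simp add: Y_iff L20_L2)
  have orth: "l2inner (\<lambda>p. g p - q p) h = 0" if h: "h \<in> Y" for h
  proof -
    have "l2inner (\<lambda>p. g p - q p) h = (LINT p|torus. cnj (h p * cnj (tsum (fc g) crit p)))"
      by (simp add: l2inner_def q_def mult.commute)
    also have "\<dots> = cnj (LINT p|torus. h p * cnj (tsum (fc g) crit p))" by (rule Bochner_Integration.integral_cnj)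
    also have "\<dots> = 0" unfolding tsum_pairing[OF Y2[OF h] fin] using h by (simp add: Y_iff)
    finally show ?thesis .
  qed
  have "\<exists>q. q \<in> Y \<and> (\<forall>h\<in>Y. l2inner (\<lambda>p. g p - q p) h = 0)" using qY orth by blast
  from someI_ex[OF this] have Qs: "Q g \<in> Y \<and> (\<forall>h\<in>Y. l2inner (\<lambda>p. g p - Q g p) h = 0)"
    unfolding Q_def orth_proj_def .
  then have QY: "Q g \<in> Y" by (rule conjunct1)
  have Qo: "l2inner (\<lambda>p. g p - Q g p) h = 0" if "h \<in> Y" for h
    by (rule bspec[OF conjunct2[OF Qs] that])
  show Q2: "Q g \<in> L2" by (rule Y2[OF QY])
  let ?d = "\<lambda>p. q p - Q g p"
  have d2: "?d \<in> L2" by (intro L2_diff q2 Q2)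
  have dY: "?d \<in> Y" using qY QY q2 Q2 by (simp add: Y_iff L20_iff fc_diff L2_diff)
  have "l2inner ?d ?d = l2inner (\<lambda>p. g p - Q g p) ?d - l2inner (\<lambda>p. g p - q p) ?d"
  proof -
    have i: "integrable torus (\<lambda>p. (g p - Q g p) * cnj (?d p))" "integrable torus (\<lambda>p. (g p - q p) * cnj (?d p))"
      by (intro L2_product_integrable L2_diff L2_cnj g2 q2 Q2)+
    show ?thesis unfolding l2inner_def Bochner_Integration.integral_diff[OF i, symmetric]
      by (simp add: algebra_simps)
  qed
  then have "l2norm ?d = 0" using Qo[OF dY] orth[OF dY] l2inner_self[OF d2] by simp
  then have "ae_eq q (Q g)" using l2norm_zero_ae[OF d2] by (simp add: ae_eq_def)
  then show "fc (Q g) m = (if m \<in> crit then 0 else fc g m)"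
    using fc_cong[OF _ q2 Q2] fq by metis
qed

section \<open>Multiplication by sin y and weak derivatives in Fourier variables\<close>

lemma fc_tmode_mult: "fc (\<lambda>p. tmode a p * f p) m = fc f (m - a)"
  unfolding fc_def using tmode_simps(2)[of a _ "- m"]
  by (simp add: mult.commute[of "tmode a _"] mult.assoc)

lemma Msin_tmode: "Msin f p = (1 / (2 * \<i>)) * (tmode (0, 1) p * f p - tmode (0, - 1) p * f p)"
proof -
  have "of_real (sin y) = (fmode 1 y - fmode (- 1) y) / (2 * \<i>)" for y
    by (simp add: fmode_cis complex_eq_iff)
  moreover have "(a - b) / (2 * \<i>) * z = 1 / (2 * \<i>) * (a * z - b * z)" for a b z
    by (simp add: left_diff_distrib diff_divide_distrib)
  ultimately show ?thesis
    by (cases p) (simp add: Msin_def tmode_def fmode_simps)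
qed

lemma Msin_L2: assumes "f \<in> L2"
  shows "Msin f \<in> L2" "fc (Msin f) (l, k) = (fc f (l, k - 1) - fc f (l, k + 1)) / (2 * \<i>)"
proof -
  have t: "(\<lambda>p. tmode a p * f p) \<in> L2" for a
    by (rule L2_bounded_mult[OF assms tmode_measurable, of _ 1]) (simp add: tmode_simps)
  have e: "Msin f = (\<lambda>p. (1 / (2 * \<i>)) * (tmode (0, 1) p * f p - tmode (0, - 1) p * f p))"
    by (rule ext) (rule Msin_tmode)
  show "Msin f \<in> L2" unfolding e by (intro L2_cmult L2_diff t)
  show "fc (Msin f) (l, k) = (fc f (l, k - 1) - fc f (l, k + 1)) / (2 * \<i>)"
    unfolding e fc_cmult fc_diff[OF t t] fc_tmode_mult by simp
qed

text \<open>\<open>test_jet\<close> demands periodicity of \<open>D 0 0\<close> only, whereas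
  integration by parts uses it for every derivative.\<close>

lemma biperiodic_deriv:
  assumes p: "\<And>x y. E (x + 2 * pi, y) = E (x, y)" "\<And>x y. E (x, y + 2 * pi) = E (x, y)"
    and d: "\<And>x y. ((\<lambda>s. E (s, y)) has_vector_derivative E' x y) (at x)"
  shows "E' (x + 2 * pi) y = (E' x y :: complex)" "E' x (y + 2 * pi) = E' x y"
proof -
  have "((\<lambda>s. s + 2 * pi) has_vector_derivative 1) (at x)" by (auto intro!: derivative_eq_intros)
  from vector_diff_chain_at[OF this d[of y "x + 2 * pi"]]
  have "((\<lambda>s. E (s, y)) has_vector_derivative E' (x + 2 * pi) y) (at x)" by (simp add: o_def p)
  then show "E' (x + 2 * pi) y = E' x y" by (rule vector_derivative_unique_at[OF _ d])
  have "((\<lambda>s. E (s, y)) has_vector_derivative E' x (y + 2 * pi)) (at x)"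
    using d[of "y + 2 * pi" x] by (simp add: p)
  then show "E' x (y + 2 * pi) = E' x y" by (rule vector_derivative_unique_at[OF _ d])
qed

context
  fixes D :: "nat \<Rightarrow> nat \<Rightarrow> fn"
  assumes D: "test_jet D"
begin

lemma jet_continuous: "continuous_on UNIV (D m n)"
  using D unfolding test_jet_def by blast

lemma jet_deriv: "((\<lambda>s. D m n (s, y)) has_vector_derivative D (Suc m) n (x, y)) (at x)"
    "((\<lambda>s. D m n (x, s)) has_vector_derivative D m (Suc n) (x, y)) (at y)"
  using D unfolding test_jet_def by blast+

lemma jet_periodic: "D m n (x + 2 * pi, y) = D m n (x, y) \<and> D m n (x, y + 2 * pi) = D m n (x, y)"
proof (induction n arbitrary: x y)
  case 0
  show ?case
  proof (induction m arbitrary: x y)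
    case 0 show ?case using D unfolding test_jet_def by blast
  next
    case (Suc m)
    show ?case
      using biperiodic_deriv[of "D m 0" "\<lambda>x y. D (Suc m) 0 (x, y)"] Suc jet_deriv(1)[of m 0] by blast
  qed
next
  case (Suc n)
  show ?case
    using biperiodic_deriv[of "\<lambda>p. D m n (snd p, fst p)" "\<lambda>x y. D m (Suc n) (y, x)"] Suc jet_deriv(2)[of m n]
    by simp
qed

lemma jet_L2: "D m n \<in> L2"
proof -
  have id: "(\<lambda>p. (fst p, snd p)) \<in> torus \<rightarrow>\<^sub>M (borel :: (real \<times> real) measure)"
  proof -
    have c: "(\<lambda>x. x) \<in> borel_measurable circle" by (intro borel_measurable_circleI) simp
    have "(\<lambda>p. (fst p, snd p)) \<in> torus \<rightarrow>\<^sub>M (borel \<Otimes>\<^sub>M borel :: (real \<times> real) measure)"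
      unfolding torus_def
      by (rule measurable_Pair) (rule measurable_compose[OF measurable_fst c] measurable_compose[OF measurable_snd c])+
    then show ?thesis by (simp add: borel_prod)
  qed
  have "D m n \<in> borel_measurable borel" by (rule borel_measurable_continuous_onI[OF jet_continuous])
  from measurable_compose[OF id this] have meas [measurable]: "D m n \<in> borel_measurable torus" by simp
  have "compact (D m n ` ({0..2*pi} \<times> {0..2*pi}))"
    by (intro compact_continuous_image continuous_on_subset[OF jet_continuous] compact_Times) auto
  then have "bounded (D m n ` ({0..2*pi} \<times> {0..2*pi}))" by (rule compact_imp_bounded)
  then obtain B where "\<And>z. z \<in> D m n ` ({0..2*pi} \<times> {0..2*pi}) \<Longrightarrow> cmod z \<le> B" by (auto simp: bounded_iff)
  then have B: "cmod (D m n p) \<le> B" if "p \<in> {0..<2*pi} \<times> {0..<2*pi}" for p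
    using that by (auto intro!: imageI)
  have sp: "space torus = {0..<2*pi} \<times> {0..<2*pi}" by (simp add: torus_def space_pair_measure circle_basic)
  have "AE p in torus. norm ((cmod (D m n p))\<^sup>2) \<le> B\<^sup>2"
    by (rule AE_I2) (use B in \<open>auto simp: sp intro!: power_mono\<close>)
  then have "integrable torus (\<lambda>p. (cmod (D m n p))\<^sup>2)" by (rule torus.integrable_const_bound) measurable
  then show ?thesis by (simp add: L2_simps meas)
qed

lemma jet_parts_x: "(LINT p|torus. tmode (j, k) p * D (Suc m) n p) = - (\<i> * of_int j) * (LINT p|torus. tmode (j, k) p * D m n p)"
proof -
  let ?F = "\<lambda>p. \<i> * of_int j * (tmode (j, k) p * D m n p) + tmode (j, k) p * D (Suc m) n p"
  have i: "integrable torus (\<lambda>p. tmode (j, k) p * D m n p)" for m n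
    by (rule L2_product_integrable[OF tmode_L2 jet_L2])
  have iF: "integrable torus ?F" using i[of m n] i[of "Suc m" n] by simp
  have "(LINT p|torus. ?F p) = (LINT y|circle. LINT x|circle. ?F (x, y))" by (rule torus_integral(1)[OF iF])
  also have "\<dots> = (LINT y|circle. 0)"
  proof (rule Bochner_Integration.integral_cong[OF refl])
    fix y
    have "(LINT x|circle. fmode k y * (\<i> * of_int j * fmode j x * D m n (x, y) + fmode j x * D (Suc m) n (x, y))) = 0"
    proof (rule circle_integral_derivative)
      show "((\<lambda>x. fmode k y * (fmode j x * D m n (x, y))) has_vector_derivative
          fmode k y * (\<i> * of_int j * fmode j x * D m n (x, y) + fmode j x * D (Suc m) n (x, y))) (at x)" for x
        by (rule has_vector_derivative_mult_right)
          (rule has_vector_derivative_eq_rhs[OF has_vector_derivative_mult[OF fmode_deriv jet_deriv(1)]], simp)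
      have c: "continuous_on UNIV (\<lambda>x. D m n (x, y))" for m n
        by (rule continuous_on_compose2[OF jet_continuous]) (auto intro!: continuous_intros)
      show "continuous_on UNIV (\<lambda>x. fmode k y * (\<i> * of_int j * fmode j x * D m n (x, y) + fmode j x * D (Suc m) n (x, y)))"
        by (intro continuous_intros fmode_continuous c)
      show "fmode k y * (fmode j (2 * pi) * D m n (2 * pi, y)) = fmode k y * (fmode j 0 * D m n (0, y))"
        using jet_periodic[of m n 0 y] fmode_simps(5)[of j 0] by simp
    qed
    then show "(LINT x|circle. ?F (x, y)) = 0" by (simp add: tmode_def algebra_simps)
  qed
  finally have "(LINT p|torus. ?F p) = 0" by simp
  then show ?thesis using i[of m n] i[of "Suc m" n] by (simp add: add_eq_0_iff)
qed

lemma jet_parts_y: "(LINT p|torus. tmode (j, k) p * D m (Suc n) p) = - (\<i> * of_int k) * (LINT p|torus. tmode (j, k) p * D m n p)"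
proof -
  let ?F = "\<lambda>p. \<i> * of_int k * (tmode (j, k) p * D m n p) + tmode (j, k) p * D m (Suc n) p"
  have i: "integrable torus (\<lambda>p. tmode (j, k) p * D m n p)" for m n
    by (rule L2_product_integrable[OF tmode_L2 jet_L2])
  have iF: "integrable torus ?F" using i[of m n] i[of m "Suc n"] by simp
  have "(LINT p|torus. ?F p) = (LINT x|circle. LINT y|circle. ?F (x, y))"
    unfolding torus_def by (rule circle2.integral_fst'[symmetric]) (use iF in \<open>simp add: torus_def\<close>)
  also have "\<dots> = (LINT x|circle. 0)"
  proof (rule Bochner_Integration.integral_cong[OF refl])
    fix x
    have "(LINT y|circle. fmode j x * (\<i> * of_int k * fmode k y * D m n (x, y) + fmode k y * D m (Suc n) (x, y))) = 0"
    proof (rule circle_integral_derivative)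
      show "((\<lambda>y. fmode j x * (fmode k y * D m n (x, y))) has_vector_derivative
          fmode j x * (\<i> * of_int k * fmode k y * D m n (x, y) + fmode k y * D m (Suc n) (x, y))) (at y)" for y
        by (rule has_vector_derivative_mult_right)
          (rule has_vector_derivative_eq_rhs[OF has_vector_derivative_mult[OF fmode_deriv jet_deriv(2)]], simp)
      have c: "continuous_on UNIV (\<lambda>y. D m n (x, y))" for m n
        by (rule continuous_on_compose2[OF jet_continuous]) (auto intro!: continuous_intros)
      show "continuous_on UNIV (\<lambda>y. fmode j x * (\<i> * of_int k * fmode k y * D m n (x, y) + fmode k y * D m (Suc n) (x, y)))"
        by (intro continuous_intros fmode_continuous c)
      show "fmode j x * (fmode k (2 * pi) * D m n (x, 2 * pi)) = fmode j x * (fmode k 0 * D m n (x, 0))"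
        using jet_periodic[of m n x 0] fmode_simps(5)[of k 0] by simp
    qed
    then show "(LINT y|circle. ?F (x, y)) = 0" by (simp add: tmode_def algebra_simps)
  qed
  finally have "(LINT p|torus. ?F p) = 0" by simp
  then show ?thesis using i[of m n] i[of m "Suc n"] by (simp add: add_eq_0_iff)
qed

lemma jet_pairing: "(LINT p|torus. tmode (j, k) p * D m n p)
    = (-1) ^ (m + n) * ((\<i> * of_int j) ^ m * (\<i> * of_int k) ^ n) * (LINT p|torus. tmode (j, k) p * D 0 0 p)"
proof (induction n)
  case 0
  show ?case
  proof (induction m)
    case 0 show ?case by simp
  next
    case (Suc m) then show ?case unfolding jet_parts_x by simp
  qed
next
  case (Suc n) then show ?case unfolding jet_parts_y by (simp add: algebra_simps)
qed

text \<open>Pairing with a fixed jet is continuous in the norm of L^2, so it may be evaluated on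
  partial sums; this extends \<open>jet_pairing\<close> from single modes to arbitrary
  functions.\<close>

lemma jet_limit:
  assumes f: "f \<in> L2"
  shows "(\<lambda>N. \<Sum>a\<in>ibox N. fc f a * (LINT p|torus. tmode a p * D m n p)) \<longlonglongrightarrow> (LINT p|torus. f p * D m n p)"
proof -
  let ?T = "\<lambda>N. tsum (fc f) (ibox N)"
  have T2: "?T N \<in> L2" for N by (rule tsum_L2[OF finite_ibox])
  have i: "integrable torus (\<lambda>p. h p * D m n p)" if "h \<in> L2" for h by (rule L2_product_integrable[OF that jet_L2])
  have e: "(\<Sum>a\<in>ibox N. fc f a * (LINT p|torus. tmode a p * D m n p)) = (LINT p|torus. ?T N p * D m n p)" for N
  proof -
    have "(LINT p|torus. ?T N p * D m n p) = (LINT p|torus. (\<Sum>a\<in>ibox N. fc f a * (tmode a p * D m n p)))"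
      by (simp add: tsum_def sum_distrib_right mult.assoc)
    also have "\<dots> = (\<Sum>a\<in>ibox N. LINT p|torus. fc f a * (tmode a p * D m n p))"
      by (rule Bochner_Integration.integral_sum) (intro integrable_mult_right i tmode_L2)
    finally show ?thesis by simp
  qed
  have b: "norm ((LINT p|torus. ?T N p * D m n p) - (LINT p|torus. f p * D m n p))
      \<le> l2norm (\<lambda>p. f p - ?T N p) * l2norm (D m n)" for N
  proof -
    have "(LINT p|torus. ?T N p * D m n p) - (LINT p|torus. f p * D m n p) = - (LINT p|torus. (f p - ?T N p) * D m n p)"
      by (simp add: left_diff_distrib Bochner_Integration.integral_diff[OF i[OF f] i[OF T2]])
    then show ?thesis using L2_integral_bound[OF L2_diff[OF f T2] jet_L2, of N m n] by simp
  qed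
  have "(\<lambda>N. l2norm (\<lambda>p. f p - ?T N p) * l2norm (D m n)) \<longlonglongrightarrow> 0"
    using tendsto_mult_right[OF tsum_converges(1)[OF f], of "l2norm (D m n)"] by simp
  then have "(\<lambda>N. (LINT p|torus. ?T N p * D m n p) - (LINT p|torus. f p * D m n p)) \<longlonglongrightarrow> 0"
    by (rule Lim_null_comparison[OF always_eventually[OF allI[OF b]]])
  then show ?thesis unfolding e by (rule LIM_zero_cancel)
qed

end

lemma tmode_jet: "test_jet (\<lambda>a b p. (\<i> * of_int j) ^ a * (\<i> * of_int k) ^ b * tmode (j, k) p)"
  unfolding test_jet_def
proof (intro conjI allI)
  fix x y and m n :: nat
  show "(\<i> * of_int j) ^ 0 * (\<i> * of_int k) ^ 0 * tmode (j, k) (x + 2 * pi, y) = (\<i> * of_int j) ^ 0 * (\<i> * of_int k) ^ 0 * tmode (j, k) (x, y)"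
    "(\<i> * of_int j) ^ 0 * (\<i> * of_int k) ^ 0 * tmode (j, k) (x, y + 2 * pi) = (\<i> * of_int j) ^ 0 * (\<i> * of_int k) ^ 0 * tmode (j, k) (x, y)"
    by (simp_all add: tmode_def fmode_simps)
  have "continuous_on UNIV (\<lambda>p. fmode j (fst p) * fmode k (snd p))"
    by (intro continuous_intros continuous_on_compose2[OF fmode_continuous[of UNIV]]) auto
  then have "continuous_on UNIV (tmode (j, k))" by (simp add: tmode_def case_prod_beta')
  then show "continuous_on UNIV (\<lambda>p. (\<i> * of_int j) ^ m * (\<i> * of_int k) ^ n * tmode (j, k) p)"
    by (intro continuous_intros)
  show "((\<lambda>s. (\<i> * of_int j) ^ m * (\<i> * of_int k) ^ n * tmode (j, k) (s, y)) has_vector_derivative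
      (\<i> * of_int j) ^ Suc m * (\<i> * of_int k) ^ n * tmode (j, k) (x, y)) (at x)"
  proof -
    have "((\<lambda>s. (\<i> * of_int j) ^ m * (\<i> * of_int k) ^ n * (fmode j s * fmode k y)) has_vector_derivative
      (\<i> * of_int j) ^ m * (\<i> * of_int k) ^ n * (\<i> * of_int j * fmode j x * fmode k y)) (at x)"
      by (intro has_vector_derivative_mult_right has_vector_derivative_mult_left fmode_deriv)
    then show ?thesis by (simp add: tmode_def algebra_simps)
  qed
  show "((\<lambda>s. (\<i> * of_int j) ^ m * (\<i> * of_int k) ^ n * tmode (j, k) (x, s)) has_vector_derivative
      (\<i> * of_int j) ^ m * (\<i> * of_int k) ^ Suc n * tmode (j, k) (x, y)) (at y)"
  proof -
    have "((\<lambda>s. (\<i> * of_int j) ^ m * (\<i> * of_int k) ^ n * (fmode j x * fmode k s)) has_vector_derivative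
      (\<i> * of_int j) ^ m * (\<i> * of_int k) ^ n * (fmode j x * (\<i> * of_int k * fmode k y))) (at y)"
      by (intro has_vector_derivative_mult_right fmode_deriv)
    then show ?thesis by (simp add: tmode_def algebra_simps)
  qed
qed

text \<open>In one direction the conjugate mode is the test function. In the other, both pairings
  agree mode by mode by \<open>jet_pairing\<close>, and \<open>jet_limit\<close> sums up.\<close>

lemma weak_deriv_iff:
  "weak_deriv m n f g \<longleftrightarrow> f \<in> L2 \<and> g \<in> L2 \<and>
     (\<forall>j k. fc g (j, k) = (\<i> * of_int j) ^ m * (\<i> * of_int k) ^ n * fc f (j, k))"
proof (intro iffI conjI allI)
  assume w: "weak_deriv m n f g"
  then show "f \<in> L2" "g \<in> L2" by (simp_all add: weak_deriv_def)
  fix j k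
  let ?c = "(- \<i> * of_int j) ^ m * (- \<i> * of_int k) ^ n :: complex"
  have "(LINT p|torus. f p * ((\<i> * of_int (- j)) ^ m * (\<i> * of_int (- k)) ^ n * tmode (- j, - k) p))
      = (-1) ^ (m + n) * (LINT p|torus. g p * ((\<i> * of_int (- j)) ^ 0 * (\<i> * of_int (- k)) ^ 0 * tmode (- j, - k) p))"
    using w tmode_jet[of "- j" "- k"] unfolding weak_deriv_def by blast
  also have "(LINT p|torus. f p * ((\<i> * of_int (- j)) ^ m * (\<i> * of_int (- k)) ^ n * tmode (- j, - k) p))
      = (LINT p|torus. ?c * (f p * tmode (- j, - k) p))"
    by (rule Bochner_Integration.integral_cong[OF refl]) (simp add: mult_ac)
  also have "\<dots> = ?c * (LINT p|torus. f p * tmode (- j, - k) p)" by simp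
  finally have e: "?c * (LINT p|torus. f p * tmode (- j, - k) p) = (-1) ^ (m + n) * (LINT p|torus. g p * tmode (- j, - k) p)"
    by simp
  have s: "(-1) ^ (m + n) * ?c = (\<i> * of_int j) ^ m * (\<i> * of_int k) ^ n"
  proof -
    have p: "(- \<i> * of_int j :: complex) ^ m = (-1) ^ m * (\<i> * of_int j) ^ m" for j m
      using power_minus[of "\<i> * of_int j :: complex" m] by simp
    have "a * b * (a * c * (b * d)) = (a * a) * (b * b) * (c * d)" for a b c d :: complex by (simp only: mult_ac)
    then show ?thesis unfolding p power_add by (simp only: minus_one_mult_self mult_1)
  qed
  have "(LINT p|torus. g p * tmode (- j, - k) p) = (-1) ^ (m + n) * ((-1) ^ (m + n) * (LINT p|torus. g p * tmode (- j, - k) p))"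
    by (simp only: mult.assoc[symmetric] minus_one_mult_self mult_1)
  also have "\<dots> = ((-1) ^ (m + n) * ?c) * (LINT p|torus. f p * tmode (- j, - k) p)" by (simp only: e[symmetric] mult.assoc)
  finally show "fc g (j, k) = (\<i> * of_int j) ^ m * (\<i> * of_int k) ^ n * fc f (j, k)"
    unfolding s by (simp add: fc_def)
next
  assume "f \<in> L2 \<and> g \<in> L2 \<and> (\<forall>j k. fc g (j, k) = (\<i> * of_int j) ^ m * (\<i> * of_int k) ^ n * fc f (j, k))"
  then have f: "f \<in> L2" and g: "g \<in> L2" and c: "\<And>j k. fc g (j, k) = (\<i> * of_int j) ^ m * (\<i> * of_int k) ^ n * fc f (j, k)"
    by auto
  have "(LINT p|torus. f p * D m n p) = (-1) ^ (m + n) * (LINT p|torus. g p * D 0 0 p)" if D: "test_jet D" for D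
  proof -
    have "fc f a * (LINT p|torus. tmode a p * D m n p) = (-1) ^ (m + n) * (fc g a * (LINT p|torus. tmode a p * D 0 0 p))" for a
      using jet_pairing[OF D, of "fst a" "snd a" m n] c[of "fst a" "snd a"] by (simp add: mult_ac)
    then have "(\<lambda>N. (-1) ^ (m + n) * (\<Sum>a\<in>ibox N. fc g a * (LINT p|torus. tmode a p * D 0 0 p)))
        \<longlonglongrightarrow> (LINT p|torus. f p * D m n p)"
      using jet_limit[OF D f, of m n] by (simp add: sum_distrib_left)
    moreover have "(\<lambda>N. (-1) ^ (m + n) * (\<Sum>a\<in>ibox N. fc g a * (LINT p|torus. tmode a p * D 0 0 p)))
        \<longlonglongrightarrow> (-1) ^ (m + n) * (LINT p|torus. g p * D 0 0 p)"
      by (intro tendsto_mult_left jet_limit[OF D g])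
    ultimately show ?thesis by (rule LIMSEQ_unique)
  qed
  then show "weak_deriv m n f g" using f g by (simp add: weak_deriv_def)
qed

section \<open>The operators and their domains in Fourier variables\<close>

lemma riesz_fischer_below:
  assumes g: "g \<in> L2" and c: "\<And>m. cmod (c m) \<le> K * cmod (fc g m)"
  obtains h where "h \<in> L2" "\<And>m. fc h m = c m"
proof -
  have "fc (\<lambda>p. of_real K * g p) m = of_real K * fc g m" for m by (rule fc_cmult)
  moreover have "ell2 (fc (\<lambda>p. of_real K * g p))" by (intro bessel(1) L2_cmult g)
  moreover have "cmod (c m) \<le> cmod (of_real K * fc g m)" for m
    using c[of m] mult_right_mono[OF abs_ge_self[of K], of "cmod (fc g m)"] by (simp add: norm_mult)
  ultimately have "ell2 c" by (intro ell2_mono(1)[of "fc (\<lambda>p. of_real K * g p)" c]) simp_all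
  then show thesis using that by (rule riesz_fischer)
qed

lemma abs_int_ge_1: "l \<noteq> 0 \<Longrightarrow> 1 \<le> \<bar>real_of_int l\<bar>"
proof -
  assume "l \<noteq> 0"
  then have "1 \<le> \<bar>l\<bar>" by simp
  then show "1 \<le> \<bar>real_of_int l\<bar>" by (metis of_int_1_le_iff of_int_abs)
qed

lemma abs_int_bound: "l \<noteq> 0 \<Longrightarrow> \<bar>real_of_int l\<bar> \<le> nn l k"
proof -
  assume "l \<noteq> 0"
  then have "\<bar>real_of_int l\<bar> * 1 \<le> \<bar>real_of_int l\<bar> * \<bar>real_of_int l\<bar>" by (intro mult_left_mono abs_int_ge_1) auto
  then have "\<bar>real_of_int l\<bar> \<le> (real_of_int l)\<^sup>2" by (simp add: power2_eq_square)
  then show ?thesis using zero_le_power2[of "real_of_int k"] by linarith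
qed

lemma derivative_symbol_bound:
  assumes l: "l \<noteq> 0" and mn: "m + n \<le> 2"
  shows "\<bar>real_of_int l\<bar> ^ m * \<bar>real_of_int k\<bar> ^ n \<le> nn l k"
proof -
  have nn1: "1 \<le> nn l k" using nn_cases(2)[OF l, of k] .
  have k: "\<bar>real_of_int k\<bar> \<le> nn l k"
  proof -
    have "0 \<le> (\<bar>real_of_int k\<bar> - 1)\<^sup>2" by simp
    then have "2 * \<bar>real_of_int k\<bar> \<le> 1 + (real_of_int k)\<^sup>2" by (simp add: power2_diff)
    then show ?thesis using nn_cases(4)[OF l, of k] abs_ge_zero[of "real_of_int k"] by linarith
  qed
  have lk: "\<bar>real_of_int l\<bar> * \<bar>real_of_int k\<bar> \<le> nn l k"
  proof -
    have "0 \<le> (\<bar>real_of_int l\<bar> - \<bar>real_of_int k\<bar>)\<^sup>2" by simp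
    then have "2 * (\<bar>real_of_int l\<bar> * \<bar>real_of_int k\<bar>) \<le> nn l k" by (simp add: power2_diff algebra_simps)
    moreover have "0 \<le> \<bar>real_of_int l\<bar> * \<bar>real_of_int k\<bar>" by simp
    ultimately show ?thesis by linarith
  qed
  consider "m = 0" "n = 0" | "m = 1" "n = 0" | "m = 2" "n = 0" | "m = 0" "n = 1" | "m = 0" "n = 2" | "m = 1" "n = 1"
    using mn by linarith
  then show ?thesis
    by cases (use nn1 k lk abs_int_bound[OF l, of k] in simp_all)
qed

lemma nn_symbol: "(\<i> * of_int l)\<^sup>2 + (\<i> * of_int k)\<^sup>2 = - complex_of_real (nn l k)"
  by (simp add: power_mult_distrib)

text \<open>Membership in \<open>W22\<close> needs no separate check: derivatives of order at most 2
  have symbols bounded by l^2 + k^2 when l \<noteq> 0, and the coefficients with l = 0 vanish, so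
  each is dominated by the coefficients of \<open>g\<close>.\<close>

lemma opA_iff: "(f, g) \<in> opA \<longleftrightarrow> f \<in> L20 \<and> g \<in> L20 \<and> (\<forall>l k. fc g (l, k) = - of_real (nn l k) * fc f (l, k))"
proof (intro iffI conjI allI)
  assume fg: "(f, g) \<in> opA"
  then show "f \<in> L20" "g \<in> L20" by (auto simp: opA_def)
  fix l k
  obtain u v where uv: "weak_deriv 2 0 f u" "weak_deriv 0 2 f v" "ae_eq g (\<lambda>p. u p + v p)"
    using fg by (auto simp: opA_def)
  have "fc g (l, k) = fc (\<lambda>p. u p + v p) (l, k)"
    using uv L20_L2[OF \<open>g \<in> L20\<close>] by (intro fc_cong L2_add) (simp_all add: weak_deriv_iff)
  also have "\<dots> = fc u (l, k) + fc v (l, k)" using uv by (intro fc_add) (simp_all add: weak_deriv_iff)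
  also have "\<dots> = ((\<i> * of_int l)\<^sup>2 + (\<i> * of_int k)\<^sup>2) * fc f (l, k)"
    using uv by (simp add: weak_deriv_iff distrib_right)
  finally show "fc g (l, k) = - of_real (nn l k) * fc f (l, k)" unfolding nn_symbol .
next
  assume "f \<in> L20 \<and> g \<in> L20 \<and> (\<forall>l k. fc g (l, k) = - of_real (nn l k) * fc f (l, k))"
  then have f: "f \<in> L20" and g: "g \<in> L20" and c: "\<And>l k. fc g (l, k) = - of_real (nn l k) * fc f (l, k)" by auto
  note f2 = L20_L2[OF f] and g2 = L20_L2[OF g]
  have w: "\<exists>h. weak_deriv m n f h" if mn: "m + n \<le> 2" for m n
  proof -
    define d where "d = (\<lambda>(l, k). (\<i> * of_int l) ^ m * (\<i> * of_int k) ^ n * fc f (l, k))"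
    have "cmod (d (l, k)) \<le> 1 * cmod (fc g (l, k))" for l k
    proof (cases "l = 0")
      case True then show ?thesis using f by (simp add: L20_iff d_def)
    next
      case False
      have "cmod (d (l, k)) = (\<bar>real_of_int l\<bar> ^ m * \<bar>real_of_int k\<bar> ^ n) * cmod (fc f (l, k))"
        by (simp add: d_def norm_mult norm_power power_mult_distrib)
      also have "\<dots> \<le> nn l k * cmod (fc f (l, k))"
        by (intro mult_right_mono derivative_symbol_bound[OF False mn]) simp
      also have "\<dots> = 1 * cmod (fc g (l, k))"
        using nn_cases(3)[OF False, of k] unfolding c by (simp only: norm_mult norm_minus_cancel norm_of_real)
      finally show ?thesis .
    qed
    then have "cmod (d a) \<le> 1 * cmod (fc g a)" for a by (cases a) simp
    from riesz_fischer_below[OF g2 this] obtain h where "h \<in> L2" "\<And>a. fc h a = d a" by blast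
    then have "weak_deriv m n f h" unfolding weak_deriv_iff using f2 by (simp add: d_def)
    then show ?thesis by blast
  qed
  have W: "f \<in> W22" using f2 w by (simp add: W22_def)
  obtain u v where uv: "weak_deriv 2 0 f u" "weak_deriv 0 2 f v" using w[of 2 0] w[of 0 2] by auto
  have "ae_eq g (\<lambda>p. u p + v p)"
  proof (rule L2_uniqueness[OF g2])
    show "(\<lambda>p. u p + v p) \<in> L2" using uv by (intro L2_add) (simp_all add: weak_deriv_iff)
    show "fc g a = fc (\<lambda>p. u p + v p) a" for a
    proof (cases a)
      case (Pair l k)
      have "fc (\<lambda>p. u p + v p) (l, k) = fc u (l, k) + fc v (l, k)"
        using uv by (intro fc_add) (simp_all add: weak_deriv_iff)
      also have "\<dots> = ((\<i> * of_int l)\<^sup>2 + (\<i> * of_int k)\<^sup>2) * fc f (l, k)"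
        using uv by (simp add: weak_deriv_iff distrib_right)
      finally show ?thesis unfolding nn_symbol Pair c ..
    qed
  qed
  then show "(f, g) \<in> opA" using W f g uv by (auto simp: opA_def)
qed

lemma Msin_L20: "f \<in> L20 \<Longrightarrow> Msin f \<in> L20"
  by (simp add: L20_iff Msin_L2)

lemma weak_dx_Msin:
  assumes f: "f \<in> L20" and F: "F \<in> L20" "\<And>l k. fc F (l, k) = \<i> * of_int l * fc f (l, k)"
  shows "weak_deriv 1 0 (Msin f) (Msin F)"
  unfolding weak_deriv_iff using L20_L2[OF f] L20_L2[OF F(1)]
  by (simp add: Msin_L2 F(2) right_diff_distrib diff_divide_distrib mult_ac)

text \<open>The transport part has order one in x and |l| \<le> l^2 + k^2 for l \<noteq> 0, so it
  imposes no further condition on the domain. What remains is square summability of the coefficients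
  of A f and the tridiagonal relation.\<close>

lemma opL_iff:
  "(f, g) \<in> opL \<alpha> \<longleftrightarrow> f \<in> L20 \<and> g \<in> L20 \<and> ell2 (\<lambda>(l, k). of_real (nn l k) * fc f (l, k)) \<and>
     (\<forall>l k. l \<noteq> 0 \<longrightarrow> fc g (l, k) = lat l (\<alpha> * of_int l) (\<lambda>k. fc f (l, k)) k)"
proof
  assume "(f, g) \<in> opL \<alpha>"
  then obtain a b where g: "g \<in> L20" and A: "(f, a) \<in> opA" and B: "(f, b) \<in> opLambda"
    and ga: "ae_eq g (\<lambda>p. a p - \<i> * of_real \<alpha> * b p)" by (auto simp: opL_def)
  from B obtain \<psi> h where b: "b \<in> L20" and psi: "(\<psi>, f) \<in> opA" and h: "weak_deriv 1 0 (Msin (\<lambda>p. f p + \<psi> p)) h"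
    and bh: "ae_eq b (\<lambda>p. - \<i> * h p)" by (auto simp: opLambda_def)
  from A have f: "f \<in> L20" and a: "a \<in> L20" and fa: "\<And>l k. fc a (l, k) = - of_real (nn l k) * fc f (l, k)"
    by (auto simp: opA_iff)
  from psi have p: "\<psi> \<in> L20" and fp: "\<And>l k. fc f (l, k) = - of_real (nn l k) * fc \<psi> (l, k)"
    by (auto simp: opA_iff)
  have h2: "h \<in> L2" using h by (simp add: weak_deriv_def)
  note l2 = L20_L2[OF f] L20_L2[OF a] L20_L2[OF b] L20_L2[OF g] L20_L2[OF p]
  have "ell2 (\<lambda>(l, k). of_real (nn l k) * fc f (l, k))"
    by (rule ell2_mono(1)[OF bessel(1)[OF l2(2)]]) (simp only: split_paired_all prod.case fa norm_mult norm_minus_cancel order_refl)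
  moreover have "fc g (l, k) = lat l (\<alpha> * of_int l) (\<lambda>k. fc f (l, k)) k" if l: "l \<noteq> 0" for l k
  proof -
    \<comment> \<open>Here \<open>\<psi>\<close> is A^{-1} f, so the sum has the symbol 1 - 1/(l^2 +
      k^2).\<close>
    have u: "fc f (l, k) + fc \<psi> (l, k) = of_real (bm l k) * fc f (l, k)" for k
    proof -
      have "nn l k \<noteq> 0" using nn_cases(3)[OF l, of k] by (rule less_imp_neq[THEN not_sym])
      then have "complex_of_real (1 / nn l k) * of_real (nn l k) = 1"
        by (simp only: of_real_mult[symmetric] of_real_eq_1_iff nonzero_divide_eq_eq[symmetric]) (use l in simp)
      then have "complex_of_real (1 / nn l k) * fc f (l, k) = - fc \<psi> (l, k)"
        unfolding fp[of l k] by (metis mult.assoc mult_1 mult_minus_left mult_minus_right)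
      then show ?thesis by (simp only: bm_def of_real_diff left_diff_distrib of_real_1 mult_1) simp
    qed
    have hl: "fc h (l, k) = of_int l / 2 * (of_real (bm l (k - 1)) * fc f (l, k - 1) - of_real (bm l (k + 1)) * fc f (l, k + 1))"
    proof -
      have "fc h (l, k) = \<i> * of_int l * fc (Msin (\<lambda>p. f p + \<psi> p)) (l, k)" using h by (simp add: weak_deriv_iff)
      moreover have "\<i> * x * (z / (2 * \<i>)) = x / 2 * z" for x z by (simp add: mult.assoc mult.left_commute[of x])
      ultimately show ?thesis by (simp only: Msin_L2(2)[OF L2_add[OF l2(1) l2(5)]] fc_add[OF l2(1) l2(5)] u)
    qed
    have "fc b (l, k) = - \<i> * fc h (l, k)"
      using fc_cong[OF bh l2(3) L2_cmult[OF h2]] by (simp only: fc_cmult)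
    moreover have "fc g (l, k) = fc a (l, k) - \<i> * of_real \<alpha> * fc b (l, k)"
      using fc_cong[OF ga l2(4) L2_diff[OF l2(2) L2_cmult[OF l2(3)]]]
      by (simp add: fc_cmult fc_diff[OF l2(2) L2_cmult[OF l2(3)]])
    ultimately have "fc g (l, k) = fc a (l, k) - of_real \<alpha> * fc h (l, k)"
      by (simp add: mult.assoc mult.left_commute[of "complex_of_real \<alpha>"])
    then show ?thesis unfolding hl fa lat_def bop_def by simp
  qed
  ultimately show "f \<in> L20 \<and> g \<in> L20 \<and> ell2 (\<lambda>(l, k). of_real (nn l k) * fc f (l, k)) \<and>
     (\<forall>l k. l \<noteq> 0 \<longrightarrow> fc g (l, k) = lat l (\<alpha> * of_int l) (\<lambda>k. fc f (l, k)) k)" using f g by blast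
next
  assume "f \<in> L20 \<and> g \<in> L20 \<and> ell2 (\<lambda>(l, k). of_real (nn l k) * fc f (l, k)) \<and>
     (\<forall>l k. l \<noteq> 0 \<longrightarrow> fc g (l, k) = lat l (\<alpha> * of_int l) (\<lambda>k. fc f (l, k)) k)"
  then have f: "f \<in> L20" and g: "g \<in> L20" and e: "ell2 (\<lambda>(l, k). of_real (nn l k) * fc f (l, k))"
    and fg: "\<And>l k. l \<noteq> 0 \<Longrightarrow> fc g (l, k) = lat l (\<alpha> * of_int l) (\<lambda>k. fc f (l, k)) k" by auto
  note f2 = L20_L2[OF f] and g2 = L20_L2[OF g]
  have f0: "fc f (0, k) = 0" for k using f by (simp add: L20_iff)
  obtain a' where a': "a' \<in> L2" "\<And>m. fc a' m = (\<lambda>(l, k). of_real (nn l k) * fc f (l, k)) m"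
    using riesz_fischer[OF e] by blast
  define a where "a = (\<lambda>p. (-1) * a' p)"
  have a2: "a \<in> L2" unfolding a_def by (rule L2_cmult[OF a'(1)])
  have fa: "fc a (l, k) = - of_real (nn l k) * fc f (l, k)" for l k
    unfolding a_def fc_cmult a'(2) by (simp only: prod.case mult_minus_left mult_1)
  have A: "(f, a) \<in> opA" using f a2 fa f0 by (simp add: opA_iff L20_iff)
  have na: "nn l k * cmod (fc f (l, k)) = cmod (fc a (l, k))" for l k
    unfolding fa by (simp only: norm_mult norm_minus_cancel norm_of_real abs_of_nonneg[OF sum_power2_ge_zero])
  define c where "c = (\<lambda>(l, k). - fc f (l, k) / of_real (nn l k))"
  have cb: "cmod (c m) \<le> 1 * cmod (fc f m)" for m
  proof (cases m)
    case (Pair l k)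
    show ?thesis
    proof (cases "l = 0")
      case True then show ?thesis by (simp add: Pair c_def f0)
    next
      case False
      have n: "1 \<le> nn l k" by (rule nn_cases(2)[OF False])
      have "cmod (fc f (l, k)) / nn l k \<le> cmod (fc f (l, k)) / 1" by (rule divide_left_mono[OF n]) (use n in simp_all)
      moreover have "cmod (c (l, k)) = cmod (fc f (l, k)) / nn l k"
        using n by (simp only: c_def prod.case norm_divide norm_minus_cancel norm_of_real)
      ultimately show ?thesis unfolding Pair by simp
    qed
  qed
  obtain \<psi> where p: "\<psi> \<in> L2" "\<And>m. fc \<psi> m = c m" using riesz_fischer_below[OF f2 cb] by blast
  have p0: "\<psi> \<in> L20" using p by (simp add: L20_iff c_def f0)
  have fp: "fc f (l, k) = - of_real (nn l k) * fc \<psi> (l, k)" for l k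
  proof (cases "l = 0")
    case True then show ?thesis by (simp add: p c_def f0)
  next
    case False
    then have "complex_of_real (nn l k) \<noteq> 0" using nn_cases(3)[OF False, of k] by (simp only: of_real_eq_0_iff)
    then show ?thesis unfolding p c_def by (simp only: prod.case) (simp only: times_divide_eq_right minus_mult_minus, erule nonzero_mult_div_cancel_left[symmetric])
  qed
  have PS: "(\<psi>, f) \<in> opA" using f p0 fp by (simp add: opA_iff)
  \<comment> \<open>The x-derivative of anything dominated by \<open>f\<close> is dominated by
    \<open>a\<close>, that is by A f, and therefore belongs to the space.\<close>
  have ex: "\<exists>F. F \<in> L20 \<and> (\<forall>l k. fc F (l, k) = \<i> * of_int l * fc u (l, k))"
    if u: "\<And>m. cmod (fc u m) \<le> 2 * cmod (fc f m)" for u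
  proof -
    define d where "d = (\<lambda>(l, k). \<i> * of_int l * fc u (l, k))"
    have "cmod (d m) \<le> 2 * cmod (fc a m)" for m
    proof (cases m)
      case (Pair l k)
      show ?thesis
      proof (cases "l = 0")
        case True then show ?thesis by (simp add: Pair d_def)
      next
        case False
        have "cmod (d (l, k)) = \<bar>real_of_int l\<bar> * cmod (fc u (l, k))" by (simp add: d_def norm_mult)
        also have "\<dots> \<le> nn l k * (2 * cmod (fc f (l, k)))"
          by (intro mult_mono abs_int_bound[OF False] u) auto
        also have "\<dots> = 2 * cmod (fc a (l, k))" using na[of l k] by simp
        finally show ?thesis by (simp add: Pair)
      qed
    qed
    from riesz_fischer_below[OF a2 this] obtain F where "F \<in> L2" "\<And>m. fc F m = d m" by blast
    then show ?thesis by (intro exI[of _ F]) (simp add: L20_iff d_def)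
  qed
  obtain F where F: "F \<in> L20" "\<And>l k. fc F (l, k) = \<i> * of_int l * fc f (l, k)" using ex[of f] by auto
  have "cmod (fc (\<lambda>p. f p + \<psi> p) m) \<le> 2 * cmod (fc f m)" for m
    using norm_triangle_ineq[of "fc f m" "c m"] cb[of m] by (simp add: fc_add[OF f2 p(1)] p(2))
  from ex[OF this] obtain G where G: "G \<in> L20" "\<And>l k. fc G (l, k) = \<i> * of_int l * fc (\<lambda>p. f p + \<psi> p) (l, k)" by auto
  have fps: "(\<lambda>p. f p + \<psi> p) \<in> L20" using L20_combination[OF f p0, of 1 1] by simp
  have h: "weak_deriv 1 0 (Msin (\<lambda>p. f p + \<psi> p)) (Msin G)" by (rule weak_dx_Msin[OF fps G])
  define b where "b = (\<lambda>p. - \<i> * Msin G p)"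
  have b0: "b \<in> L20" using L20_combination[OF Msin_L20[OF G(1)] Msin_L20[OF G(1)], of "- \<i>" 0] by (simp add: b_def)
  have D: "f \<in> dom_Lambda" unfolding dom_Lambda_def using f weak_dx_Msin[OF f F] Msin_L20[OF F(1)] by blast
  have B: "(f, b) \<in> opLambda" unfolding opLambda_def using D b0 PS h by (auto simp: b_def ae_eq_def)
  have ab: "(\<lambda>p. a p - \<i> * of_real \<alpha> * b p) \<in> L2" by (intro L2_diff a2 L2_cmult L20_L2[OF b0])
  have ga: "ae_eq g (\<lambda>p. a p - \<i> * of_real \<alpha> * b p)"
  proof (rule L2_uniqueness[OF g2 ab])
    fix m :: "int \<times> int" obtain l k where m: "m = (l, k)" by (cases m)
    have ga2: "(\<lambda>p. a p - \<i> * of_real \<alpha> * b p) \<in> L20"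
      using L20_combination[of a b 1 "- \<i> * of_real \<alpha>"] A b0 by (simp add: opA_iff)
    show "fc g m = fc (\<lambda>p. a p - \<i> * of_real \<alpha> * b p) m"
    proof (cases "l = 0")
      case True then show ?thesis using g ga2 by (simp add: m L20_iff)
    next
      case False
      have u: "fc (\<lambda>p. f p + \<psi> p) (l, k) = of_real (bm l k) * fc f (l, k)" for k
        unfolding fc_add[OF f2 p(1)] p(2) c_def bm_def
        by (simp only: prod.case of_real_diff left_diff_distrib of_real_1 mult_1 of_real_divide) simp
      have "fc (\<lambda>p. a p - \<i> * of_real \<alpha> * b p) (l, k) = fc a (l, k) - of_real \<alpha> * fc (Msin G) (l, k)"
      proof -
        have "fc b (l, k) = - \<i> * fc (Msin G) (l, k)" unfolding b_def by (rule fc_cmult)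
        then show ?thesis unfolding fc_diff[OF a2 L2_cmult[OF L20_L2[OF b0]]] fc_cmult
          by (simp add: mult.assoc mult.left_commute[of "complex_of_real \<alpha>"])
      qed
      also have "\<dots> = lat l (\<alpha> * of_int l) (\<lambda>k. fc f (l, k)) k"
        unfolding Msin_L2(2)[OF L20_L2[OF G(1)]] G(2) u fa lat_def bop_def
        by (simp add: right_diff_distrib diff_divide_distrib mult.assoc)
      finally show ?thesis using fg[OF False] by (simp add: m)
    qed
  qed
  show "(f, g) \<in> opL \<alpha>" unfolding opL_def using g A B ga by auto
qed

lemma ell2_cmult: "ell2 c \<Longrightarrow> ell2 (\<lambda>m. a * c m)"
  unfolding ell2_def by (simp add: norm_mult power_mult_distrib summable_on_cmult_right)

text \<open>Square summable families are realized as functions by \<open>riesz_fischer\<close>,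
  where sums stay in L^2; in \<open>ell2_shift\<close> a translation of the index becomes
  multiplication by a mode.\<close>

lemma ell2_add: assumes "ell2 c" "ell2 d" shows "ell2 (\<lambda>m :: int \<times> int. c m + d m)"
proof -
  obtain f g where "f \<in> L2" "\<And>m. fc f m = c m" "g \<in> L2" "\<And>m. fc g m = d m"
    using riesz_fischer[OF assms(1)] riesz_fischer[OF assms(2)] by metis
  note fg = this
  have "fc (\<lambda>p. f p + g p) = (\<lambda>m. c m + d m)" by (rule ext) (simp add: fc_add fg)
  with bessel(1)[OF L2_add[OF fg(1,3)]] show ?thesis by (simp only:)
qed

lemma ell2_shift: assumes "ell2 c" shows "ell2 (\<lambda>m :: int \<times> int. c (m - a))"
proof -
  obtain f where f: "f \<in> L2" "\<And>m. fc f m = c m" using riesz_fischer[OF assms] by blast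
  have "(\<lambda>p. tmode a p * f p) \<in> L2"
    by (rule L2_bounded_mult[OF f(1) tmode_measurable, of _ 1]) (simp add: tmode_simps)
  moreover have "fc (\<lambda>p. tmode a p * f p) = (\<lambda>m. c (m - a))" by (rule ext) (simp only: fc_tmode_mult f)
  ultimately show ?thesis using bessel(1)[of "\<lambda>p. tmode a p * f p"] by (simp only:)
qed

lemma ell2_neighbours:
  fixes g v u :: "int \<times> int \<Rightarrow> complex"
  assumes "ell2 g" "ell2 v"
    and "\<And>l k. cmod (u (l, k)) \<le> cmod (g (l, k)) + A * (cmod (v (l, k - 1)) + cmod (v (l, k + 1)))"
  shows "ell2 u"
proof -
  have e: "ell2 (\<lambda>m. of_real (cmod (c m)))" if "ell2 c" for c :: "int \<times> int \<Rightarrow> complex"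
    using that by (simp add: ell2_def)
  have "ell2 (\<lambda>m. of_real (cmod (g m)) + of_real A * (of_real (cmod (v (m - (0, 1)))) + of_real (cmod (v (m - (0, -1))))))"
    by (intro ell2_add ell2_cmult ell2_shift e assms(1) e[OF ell2_shift[OF assms(2)]])
  then show ?thesis
  proof (rule ell2_mono(1))
    fix m :: "int \<times> int" obtain l k where m: "m = (l, k)" by (cases m)
    have "cmod (u m) \<le> cmod (g m) + A * (cmod (v (m - (0, 1))) + cmod (v (m - (0, -1))))"
      using assms(3)[of l k] by (simp add: m)
    also have "\<dots> \<le> \<bar>cmod (g m) + A * (cmod (v (m - (0, 1))) + cmod (v (m - (0, -1))))\<bar>" by (rule abs_ge_self)
    also have "\<dots> = cmod (of_real (cmod (g m)) + of_real A * (of_real (cmod (v (m - (0, 1)))) + of_real (cmod (v (m - (0, -1))))))"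
      by (simp only: of_real_add[symmetric] of_real_mult[symmetric] norm_of_real)
    finally show "cmod (u m) \<le> \<dots>" .
  qed
qed

lemma bop_neighbours: assumes "l \<noteq> 0" shows "cmod (bop l b x k) \<le> \<bar>b\<bar> / 2 * (cmod (x (k - 1)) + cmod (x (k + 1)))"
proof -
  have m: "\<bar>bm l j\<bar> \<le> 1" for j
    using nn_cases(2)[OF assms, of j] by (simp add: abs_le_iff bm_def)
  have "cmod (of_real (bm l j) * x j) \<le> cmod (x j)" for j
    using mult_right_mono[OF m[of j], of "cmod (x j)"] by (simp only: norm_mult norm_of_real) simp
  then have "cmod (of_real (bm l (k - 1)) * x (k - 1) - of_real (bm l (k + 1)) * x (k + 1)) \<le> cmod (x (k - 1)) + cmod (x (k + 1))"
    using norm_triangle_ineq4[of "of_real (bm l (k - 1)) * x (k - 1)" "of_real (bm l (k + 1)) * x (k + 1)"]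
    by (meson add_mono order_trans)
  from mult_left_mono[OF this, of "\<bar>b\<bar> / 2"] show ?thesis
    unfolding bop_def by (simp only: norm_mult norm_minus_cancel norm_of_real) simp
qed

text \<open>Elliptic regularity needs two steps: dividing by \<open>l\<close> first gains the factor \<open>l\<close> that the
  coefficient \<open>\<alpha> l\<close> of the off-diagonal part costs.\<close>

lemma elliptic_regularity:
  assumes c: "ell2 c" "\<And>k. c (0, k) = 0" and g: "ell2 g"
    and e: "\<And>l k. l \<noteq> 0 \<Longrightarrow> g (l, k) = lat l (\<alpha> * of_int l) (\<lambda>k. c (l, k)) k"
  shows "ell2 (\<lambda>(l, k). of_real (nn l k) * c (l, k))"
proof -
  define v where "v = (\<lambda>(l, k). of_int l * c (l, k))"
  have nb: "nn l k * cmod (c (l, k)) \<le> cmod (g (l, k)) + \<bar>\<alpha>\<bar> / 2 * (\<bar>real_of_int l\<bar> * cmod (c (l, k - 1)) + \<bar>real_of_int l\<bar> * cmod (c (l, k + 1)))"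
    if l: "l \<noteq> 0" for l k
  proof -
    have "of_real (nn l k) * c (l, k) = bop l (\<alpha> * of_int l) (\<lambda>k. c (l, k)) k - g (l, k)"
    proof -
      have "X = B - (- X + B)" for X B :: complex by simp
      then show ?thesis unfolding e[OF l] lat_def mult_minus_left .
    qed
    then have "cmod (of_real (nn l k) * c (l, k)) \<le> cmod (bop l (\<alpha> * of_int l) (\<lambda>k. c (l, k)) k) + cmod (g (l, k))"
      using norm_triangle_ineq4 by metis
    moreover have "cmod (of_real (nn l k) * c (l, k)) = nn l k * cmod (c (l, k))"
      using nn_cases(3)[OF l, of k] by (simp only: norm_mult norm_of_real)
    moreover note bop_neighbours[OF l, of "\<alpha> * of_int l" "\<lambda>k. c (l, k)" k]
    ultimately show ?thesis by (simp add: abs_mult algebra_simps)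
  qed
  have "ell2 v"
  proof (rule ell2_neighbours[OF g c(1), of _ "\<bar>\<alpha>\<bar> / 2"])
    fix l k
    show "cmod (v (l, k)) \<le> cmod (g (l, k)) + \<bar>\<alpha>\<bar> / 2 * (cmod (c (l, k - 1)) + cmod (c (l, k + 1)))"
    proof (cases "l = 0")
      case True then show ?thesis by (simp add: v_def)
    next
      case False
      let ?L = "\<bar>real_of_int l\<bar>"
      have L1: "1 \<le> ?L" by (rule abs_int_ge_1[OF False])
      have "?L * (?L * cmod (c (l, k))) \<le> nn l k * cmod (c (l, k))"
        using nn_cases(5)[OF False, of k] mult_right_mono[of "?L * ?L" "nn l k" "cmod (c (l, k))"]
        by (simp add: power2_eq_square mult.assoc)
      also note nb[OF False, of k]
      also have "cmod (g (l, k)) + \<bar>\<alpha>\<bar> / 2 * (?L * cmod (c (l, k - 1)) + ?L * cmod (c (l, k + 1)))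
          \<le> ?L * (cmod (g (l, k)) + \<bar>\<alpha>\<bar> / 2 * (cmod (c (l, k - 1)) + cmod (c (l, k + 1))))"
        using mult_right_mono[OF L1, of "cmod (g (l, k))"] by (simp add: algebra_simps)
      finally have "?L * cmod (c (l, k)) \<le> cmod (g (l, k)) + \<bar>\<alpha>\<bar> / 2 * (cmod (c (l, k - 1)) + cmod (c (l, k + 1)))"
        by (rule mult_left_le_imp_le) (use L1 in simp)
      then show ?thesis by (simp add: v_def norm_mult)
    qed
  qed
  show ?thesis
  proof (rule ell2_neighbours[OF g \<open>ell2 v\<close>, of _ "\<bar>\<alpha>\<bar> / 2"])
    fix l k
    show "cmod ((\<lambda>(l, k). of_real (nn l k) * c (l, k)) (l, k)) \<le> cmod (g (l, k)) + \<bar>\<alpha>\<bar> / 2 * (cmod (v (l, k - 1)) + cmod (v (l, k + 1)))"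
    proof (cases "l = 0")
      case True then show ?thesis by (simp add: v_def c)
    next
      case False
      have "cmod (of_real (nn l k) * c (l, k)) = nn l k * cmod (c (l, k))"
        using nn_cases(3)[OF False, of k] by (simp only: norm_mult norm_of_real)
      then show ?thesis using nb[OF False, of k] by (simp only: prod.case v_def norm_mult norm_of_int)
    qed
  qed
qed

text \<open>The candidate image is bounded by neighbouring values of the coefficients of A f, the
  factor |l| in the off-diagonal part being absorbed by l^2 + k^2.\<close>

lemma opL_domain:
  assumes f: "f \<in> L20" and e: "ell2 (\<lambda>(l, k). of_real (nn l k) * fc f (l, k))"
  obtains g where "(f, g) \<in> opL \<alpha>"
proof -
  define d where "d = (\<lambda>(l, k). if l = 0 then 0 else lat l (\<alpha> * of_int l) (\<lambda>k. fc f (l, k)) k)"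
  let ?N = "\<lambda>(l, k). of_real (nn l k) * fc f (l, k)"
  have nN: "cmod (?N (l, k)) = nn l k * cmod (fc f (l, k))" for l k by (simp only: prod.case norm_mult norm_of_real) simp
  have "ell2 d"
  proof (rule ell2_neighbours[OF e e, of _ "\<bar>\<alpha>\<bar> / 2"])
    fix l k
    show "cmod (d (l, k)) \<le> cmod (?N (l, k)) + \<bar>\<alpha>\<bar> / 2 * (cmod (?N (l, k - 1)) + cmod (?N (l, k + 1)))"
    proof (cases "l = 0")
      case True then show ?thesis by (simp add: d_def)
    next
      case False
      have m: "\<bar>real_of_int l\<bar> * cmod (fc f (l, j)) \<le> nn l j * cmod (fc f (l, j))" for j
        by (intro mult_right_mono abs_int_bound[OF False]) simp
      have "cmod (d (l, k)) \<le> cmod (?N (l, k)) + cmod (bop l (\<alpha> * of_int l) (\<lambda>k. fc f (l, k)) k)"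
        using norm_triangle_ineq[of "- ?N (l, k)" "bop l (\<alpha> * of_int l) (\<lambda>k. fc f (l, k)) k"] False
        by (simp only: d_def lat_def prod.case if_False norm_minus_cancel mult_minus_left)
      also have "\<dots> \<le> cmod (?N (l, k)) + \<bar>\<alpha> * of_int l\<bar> / 2 * (cmod (fc f (l, k - 1)) + cmod (fc f (l, k + 1)))"
        by (intro add_left_mono bop_neighbours[OF False])
      also have "\<dots> = cmod (?N (l, k)) + \<bar>\<alpha>\<bar> / 2 * (\<bar>real_of_int l\<bar> * cmod (fc f (l, k - 1)) + \<bar>real_of_int l\<bar> * cmod (fc f (l, k + 1)))"
        by (simp add: abs_mult algebra_simps)
      also have "\<dots> \<le> cmod (?N (l, k)) + \<bar>\<alpha>\<bar> / 2 * (cmod (?N (l, k - 1)) + cmod (?N (l, k + 1)))"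
        unfolding nN by (intro add_left_mono mult_left_mono add_mono m) auto
      finally show ?thesis .
    qed
  qed
  then obtain g where g: "g \<in> L2" "\<And>m. fc g m = d m" using riesz_fischer by blast
  have "(f, g) \<in> opL \<alpha>" unfolding opL_iff using f g e by (simp add: L20_iff d_def)
  then show thesis by (rule that)
qed

section \<open>The semigroup assembled from the modes\<close>

lemma weight_symbol: "l \<noteq> 0 \<Longrightarrow> wt 2 k \<le> 2 * nn l k"
proof -
  assume l: "l \<noteq> 0"
  have "0 \<le> (1 - \<bar>real_of_int k\<bar>)\<^sup>2" by simp
  then have "wt 2 k \<le> 2 * (1 + (real_of_int k)\<^sup>2)" by (simp add: power2_eq_square algebra_simps)
  also have "\<dots> \<le> 2 * nn l k" by (rule mult_left_mono[OF nn_cases(4)[OF l]]) simp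
  finally show ?thesis .
qed

text \<open>Applying \<open>lat\<close> to a solution gives again a solution, with data
  \<open>lat l b c\<close>. Weight 2 on the data makes it bounded, so that uniqueness
  applies.\<close>

lemma lat_sol:
  assumes l: "l \<noteq> 0" and M: "\<And>k. wt 2 k * cmod (c k) \<le> M" and t: "t \<ge> 0"
  shows "lat l b (sol l b c t) k = sol l b (lat l b c) t k"
proof -
  have w1: "1 \<le> wt 2 k" for k :: int by (intro one_le_power) simp
  have M0: "cmod (c k) \<le> M" for k
    using order_trans[OF mult_right_mono[OF w1[of k], of "cmod (c k)"] M[of k]] by simp
  then have bc: "bounded (range c)" by (auto simp: bounded_iff)
  have Mp: "M \<ge> 0" using M0[of 0] norm_ge_zero order_trans by blast
  have dl: "((\<lambda>s. lat l b (sol l b c s) k) has_vector_derivative lat l b (\<lambda>k. lat l b (sol l b c s) k) k) (at s within {0..})"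
    if s: "s \<ge> 0" for s k
    unfolding lat_def[of l b _ k] bop_def[of l b _ k]
    by (intro has_vector_derivative_add has_vector_derivative_mult_right has_vector_derivative_diff sol_deriv[OF l bc s]
      sol_deriv[OF l bc s, of b k, unfolded lat_def[of l b _ k] bop_def[of l b _ k]])
  have bd: "cmod (lat l b (sol l b c s) k) \<le> ((real_of_int l)\<^sup>2 + 1 + \<bar>b\<bar>) * (M * exp (\<bar>b\<bar> * 4 * t))"
    if s: "0 \<le> s" "s \<le> t" for s k
  proof -
    have "wt (0 + 2) k * cmod (sol l b c s k) \<le> M * exp (\<bar>b\<bar> * 4 * t)" for k
    proof -
      have "wt 2 k * cmod (sol l b c s k) \<le> M * exp (\<bar>b\<bar> * 2 ^ 2 * s)" by (rule sol_bound[OF l M s(1)])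
      also have "\<dots> \<le> M * exp (\<bar>b\<bar> * 4 * t)" using s Mp by (intro mult_left_mono) (auto intro!: mult_left_mono mult_right_mono)
      finally show ?thesis by (simp only: add_0)
    qed
    from lat_bound[OF l this, of k b] show ?thesis by simp
  qed
  have "lat l b (sol l b c t) k = sol l b (\<lambda>k. lat l b (sol l b c 0) k) t k"
    by (rule sol_unique[OF l t, where x = "\<lambda>s k. lat l b (sol l b c s) k"]) (rule dl, assumption, rule bd)
  moreover have "sol l b c 0 = c" by (rule ext) (rule sol_0[OF l])
  ultimately show ?thesis by simp
qed

text \<open>The increment is paired with its own conjugate \<open>z\<close>, which reduces the mean
  value inequality to a scalar function; Cauchy-Schwarz gives S \<le> sqrt S * t B for the squared
  length S, and one factor is cancelled.\<close>

lemma mean_value_sum: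
  fixes x y :: "real \<Rightarrow> 'a \<Rightarrow> complex"
  assumes t: "t \<ge> 0" and F: "finite F"
    and d: "\<And>m s. m \<in> F \<Longrightarrow> 0 \<le> s \<Longrightarrow> s \<le> t \<Longrightarrow> ((\<lambda>s. x s m) has_vector_derivative y s m) (at s within {0..})"
    and B: "\<And>s. 0 \<le> s \<Longrightarrow> s \<le> t \<Longrightarrow> (\<Sum>m\<in>F. (cmod (y s m))\<^sup>2) \<le> B\<^sup>2" and "B \<ge> 0"
  shows "(\<Sum>m\<in>F. (cmod (x t m - x 0 m))\<^sup>2) \<le> (t * B)\<^sup>2"
proof -
  define z where "z m = cnj (x t m - x 0 m)" for m
  define S where "S = (\<Sum>m\<in>F. (cmod (x t m - x 0 m))\<^sup>2)"
  have S0: "S \<ge> 0" unfolding S_def by (intro sum_nonneg) simp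
  let ?h = "\<lambda>s. \<Sum>m\<in>F. z m * x s m"
  have hd: "(?h has_derivative (\<lambda>u. u *\<^sub>R (\<Sum>m\<in>F. z m * y s m))) (at s within {0..t})" if s: "s \<in> {0..t}" for s
  proof -
    have "(?h has_vector_derivative (\<Sum>m\<in>F. z m * y s m)) (at s within {0..})"
      by (intro has_vector_derivative_sum has_vector_derivative_mult_right d) (use s in auto)
    then have "(?h has_vector_derivative (\<Sum>m\<in>F. z m * y s m)) (at s within {0..t})"
      by (rule has_vector_derivative_within_subset) simp
    then show ?thesis by (simp add: has_vector_derivative_def)
  qed
  have "norm (?h t - ?h 0) \<le> (sqrt S * B) * norm (t - 0)"
  proof (rule differentiable_bound[OF convex_real_interval(5) hd])
    fix s assume s: "s \<in> {0..t}"
    have "cmod (\<Sum>m\<in>F. z m * y s m) \<le> (\<Sum>m\<in>F. \<bar>cmod (z m)\<bar> * \<bar>cmod (y s m)\<bar>)"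
      by (rule order_trans[OF norm_sum]) (simp add: norm_mult)
    also have "\<dots> \<le> L2_set (\<lambda>m. cmod (z m)) F * L2_set (\<lambda>m. cmod (y s m)) F" by (rule L2_set_mult_ineq)
    also have "L2_set (\<lambda>m. cmod (z m)) F = sqrt S" unfolding z_def complex_mod_cnj by (simp add: L2_set_def S_def)
    also have "sqrt S * L2_set (\<lambda>m. cmod (y s m)) F \<le> sqrt S * B"
    proof (rule mult_left_mono)
      show "L2_set (\<lambda>m. cmod (y s m)) F \<le> B" unfolding L2_set_def
        by (rule real_le_lsqrt) (use B[of s] s \<open>B \<ge> 0\<close> in \<open>auto intro!: sum_nonneg\<close>)
    qed (use S0 in simp)
    finally have "cmod (\<Sum>m\<in>F. z m * y s m) \<le> sqrt S * B" .
    from onorm_bound[of "sqrt S * B" "\<lambda>u. u *\<^sub>R (\<Sum>m\<in>F. z m * y s m)"] mult_right_mono[OF this, of "\<bar>_\<bar>"]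
    show "onorm (\<lambda>u. u *\<^sub>R (\<Sum>m\<in>F. z m * y s m)) \<le> sqrt S * B"
      using S0 \<open>B \<ge> 0\<close> by (simp add: mult.commute)
  qed (use t in auto)
  moreover have "?h t - ?h 0 = of_real S"
  proof -
    have "?h t - ?h 0 = (\<Sum>m\<in>F. z m * (x t m - x 0 m))" by (simp only: sum_subtractf right_diff_distrib)
    also have "\<dots> = of_real S" unfolding S_def z_def of_real_sum
      by (rule sum.cong[OF refl]) (simp only: complex_norm_square mult.commute)
    finally show ?thesis .
  qed
  ultimately have "S \<le> sqrt S * (t * B)" using S0 t by (simp add: mult_ac)
  then have q: "sqrt S * sqrt S \<le> sqrt S * (t * B)" using S0 by simp
  have "sqrt S \<le> t * B"
  proof (cases "S = 0")
    case True then show ?thesis using t \<open>B \<ge> 0\<close> by simp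
  next
    case False
    then have "sqrt S > 0" using S0 by simp
    then show ?thesis by (rule mult_left_le_imp_le[OF q])
  qed
  then have "(sqrt S)\<^sup>2 \<le> (t * B)\<^sup>2" using S0 by (intro power_mono) auto
  then show ?thesis using S0 by (simp add: S_def)
qed

lemma sqn_slices:
  fixes c :: "int \<times> int \<Rightarrow> complex"
  assumes c: "ell2 c"
  shows "ell2 (\<lambda>k. c (l, k))" and "finite A \<Longrightarrow> (\<Sum>l\<in>A. sqn (\<lambda>k. c (l, k))) \<le> sqn c"
proof -
  have s: "(\<Sum>l\<in>A. \<Sum>k\<in>F. (cmod (c (l, k)))\<^sup>2) \<le> sqn c" if "finite A" "finite F" for A F
    using ell2_finite_sum_le[OF c, of "A \<times> F"] that by (simp add: sum.cartesian_product case_prod_beta')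
  show e: "ell2 (\<lambda>k. c (l, k))" for l
  proof (rule ell2I(1))
    show "(\<Sum>k\<in>F. (cmod (c (l, k)))\<^sup>2) \<le> sqn c" if "finite F" for F using s[of "{l}" F] that by simp
  qed
  assume A: "finite A"
  have "((\<lambda>F. \<Sum>l\<in>A. \<Sum>k\<in>F. (cmod (c (l, k)))\<^sup>2) \<longlongrightarrow> (\<Sum>l\<in>A. sqn (\<lambda>k. c (l, k)))) (finite_subsets_at_top UNIV)"
    unfolding sqn_def by (intro tendsto_sum infsum_tendsto e[unfolded ell2_def])
  then show "(\<Sum>l\<in>A. sqn (\<lambda>k. c (l, k))) \<le> sqn c"
    by (rule tendsto_upperbound) (auto intro!: eventually_finite_subsets_at_top_weakI s A)
qed

lemma ell2_of_slices:
  fixes c d :: "int \<times> int \<Rightarrow> complex"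
  assumes c: "ell2 c" and K: "K \<ge> 0" and d: "\<And>l. ell2 (\<lambda>k. d (l, k))" "\<And>l. sqn (\<lambda>k. d (l, k)) \<le> K * sqn (\<lambda>k. c (l, k))"
  shows "ell2 d" "sqn d \<le> K * sqn c"
proof -
  have "(\<Sum>m\<in>F. (cmod (d m))\<^sup>2) \<le> K * sqn c" if F: "finite F" for F
  proof -
    have "(\<Sum>m\<in>F. (cmod (d m))\<^sup>2) \<le> (\<Sum>m\<in>fst ` F \<times> snd ` F. (cmod (d m))\<^sup>2)"
      by (rule sum_mono2) (use F subset_fst_snd[of F] in auto)
    also have "\<dots> = (\<Sum>l\<in>fst ` F. \<Sum>k\<in>snd ` F. (cmod (d (l, k)))\<^sup>2)"
      by (simp add: sum.cartesian_product case_prod_beta')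
    also have "\<dots> \<le> (\<Sum>l\<in>fst ` F. K * sqn (\<lambda>k. c (l, k)))"
      using F by (intro sum_mono order_trans[OF ell2_finite_sum_le[OF d(1)] d(2)]) simp
    also have "\<dots> \<le> K * sqn c"
      unfolding sum_distrib_left[symmetric] using F by (intro mult_left_mono sqn_slices(2)[OF c] K) simp
    finally show ?thesis .
  qed
  note s = this
  show "ell2 d" by (rule ell2I(1)[OF s])
  show "sqn d \<le> K * sqn c" by (rule ell2I(2)[OF s])
qed

text \<open>All modes at once. The mode l = 0 is set to zero, in accordance with \<open>L20\<close>;
  the results on \<open>sol\<close> concern l \<noteq> 0.\<close>

definition ev :: "real \<Rightarrow> real \<Rightarrow> (int \<times> int \<Rightarrow> complex) \<Rightarrow> int \<times> int \<Rightarrow> complex" where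
  "ev \<alpha> t c = (\<lambda>(l, k). if l = 0 then 0 else sol l (\<alpha> * of_int l) (\<lambda>k. c (l, k)) t k)"

text \<open>A bound for the squared norm of the evolution, uniform in time and in l: 2 from heat
  decay of the noncritical part, the square from \<open>zero_mode_bound\<close> for |l| = 1.\<close>

definition growth :: "real \<Rightarrow> real" where
  "growth \<alpha> = 2 + (1 + (128 / rate + 14) * (\<bar>\<alpha>\<bar> powr (1/3)))\<^sup>2"

lemma growth_ge: "growth \<alpha> \<ge> 2"
  by (simp add: growth_def)

lemma sol_growth:
  assumes l: "l \<noteq> 0" and a: "\<bar>\<alpha>\<bar> \<ge> 1" "rate * sqrt \<bar>\<alpha>\<bar> \<ge> 4" and f: "ell2 f" and t: "t \<ge> 0"
  shows "ell2 (sol l (\<alpha> * of_int l) f t)" "sqn (sol l (\<alpha> * of_int l) f t) \<le> growth \<alpha> * sqn f"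
proof -
  let ?x = "sol l (\<alpha> * of_int l) f t" and ?Z = "(128 / rate + 14) * (\<bar>\<alpha>\<bar> powr (1/3))"
  have Z0: "?Z \<ge> 0" using rate_bounds(1) by (intro mult_nonneg_nonneg) auto
  have q: "sqn (qz l ?x) \<le> 2 * sqn f"
  proof -
    have "sqn (qz l ?x) \<le> 2 * exp (- 2 * (real_of_int l)\<^sup>2 * t) * sqn (qz l f)" by (rule qz_heat_decay(2)[OF l f t])
    also have "\<dots> \<le> 2 * 1 * sqn f"
      using t by (intro mult_mono ell2_qz(2)[OF f] mult_nonneg_nonneg sqn_nonneg) auto
    finally show ?thesis by simp
  qed
  have z: "(cmod (?x 0))\<^sup>2 \<le> (1 + ?Z)\<^sup>2 * sqn f" if l1: "\<bar>l\<bar> = 1"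
  proof -
    have al: "\<bar>\<alpha> * of_int l\<bar> = \<bar>\<alpha>\<bar>" using l1 by (auto simp: abs_if split: if_splits)
    have "cmod (?x 0) \<le> exp (- t) * (cmod (f 0) + ?Z * sqrt (sqn (qz l f)))"
      using zero_mode_bound[OF l1 f t, of "\<alpha> * of_int l"] a unfolding al by blast
    also have "\<dots> \<le> 1 * (sqrt (sqn f) + ?Z * sqrt (sqn f))"
      using t by (intro mult_mono add_mono ell2_bounded[OF f] real_sqrt_le_mono ell2_qz(2)[OF f] Z0 order_refl
        add_nonneg_nonneg mult_nonneg_nonneg) (auto intro: sqn_nonneg)
    finally have "cmod (?x 0) \<le> (1 + ?Z) * sqrt (sqn f)" by (simp add: distrib_right)
    then have "(cmod (?x 0))\<^sup>2 \<le> ((1 + ?Z) * sqrt (sqn f))\<^sup>2" by (rule power_mono) simp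
    then show ?thesis by (simp add: power_mult_distrib sqn_nonneg)
  qed
  have "(\<Sum>k\<in>F. (cmod (?x k))\<^sup>2) \<le> growth \<alpha> * sqn f" if F: "finite F" for F
  proof -
    have p: "(cmod (?x k))\<^sup>2 \<le> (cmod (qz l ?x k))\<^sup>2 + (if k = 0 then (1 + ?Z)\<^sup>2 * sqn f else 0)" for k
    proof (cases "l\<^sup>2 + k\<^sup>2 = 1")
      case True
      have "l\<^sup>2 \<ge> 1" using nn_cases(6)[OF l] by (metis of_int_1_le_iff of_int_power)
      then have "k = 0" "l\<^sup>2 = 1" using True zero_le_power2[of k] by (smt (verit) zero_eq_power2)+
      then have "\<bar>l\<bar> = 1" by (simp add: abs_square_eq_1)
      then show ?thesis using z \<open>k = 0\<close> True by (simp add: qz_def)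
    next
      case False then show ?thesis by (simp add: qz_def sqn_nonneg)
    qed
    have "(\<Sum>k\<in>F. (cmod (?x k))\<^sup>2) \<le> (\<Sum>k\<in>F. (cmod (qz l ?x k))\<^sup>2) + (\<Sum>k\<in>F. if k = 0 then (1 + ?Z)\<^sup>2 * sqn f else 0)"
      unfolding sum.distrib[symmetric] by (intro sum_mono p)
    also have "\<dots> \<le> sqn (qz l ?x) + (1 + ?Z)\<^sup>2 * sqn f"
      by (intro add_mono ell2_finite_sum_le[OF qz_heat_decay(1)[OF l f t] F]) (use F in \<open>simp add: sqn_nonneg\<close>)
    also have "\<dots> \<le> growth \<alpha> * sqn f" using q by (simp add: growth_def distrib_right)
    finally show ?thesis .
  qed
  note s = this
  show "ell2 ?x" by (rule ell2I(1)[OF s])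
  show "sqn ?x \<le> growth \<alpha> * sqn f" by (rule ell2I(2)[OF s])
qed

lemma ev_growth:
  assumes a: "\<bar>\<alpha>\<bar> \<ge> 1" "rate * sqrt \<bar>\<alpha>\<bar> \<ge> 4" and c: "ell2 c" and t: "t \<ge> 0"
  shows "ell2 (ev \<alpha> t c)" "sqn (ev \<alpha> t c) \<le> growth \<alpha> * sqn c"
proof -
  have z: "ell2 (\<lambda>k. 0 :: complex)" "sqn (\<lambda>k :: int. 0 :: complex) = 0" by (simp_all add: ell2_def sqn_def)
  have e: "ell2 (\<lambda>k. ev \<alpha> t c (l, k))" for l
    using sol_growth(1)[OF _ a sqn_slices(1)[OF c] t, of l l] z(1) by (cases "l = 0") (simp_all add: ev_def)
  have s: "sqn (\<lambda>k. ev \<alpha> t c (l, k)) \<le> growth \<alpha> * sqn (\<lambda>k. c (l, k))" for l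
    using sol_growth(2)[OF _ a sqn_slices(1)[OF c] t, of l l] growth_ge[of \<alpha>] z(2)
    by (cases "l = 0") (simp_all add: ev_def sqn_nonneg)
  have g: "growth \<alpha> \<ge> 0" using growth_ge[of \<alpha>] by linarith
  show "ell2 (ev \<alpha> t c)" "sqn (ev \<alpha> t c) \<le> growth \<alpha> * sqn c"
    by (rule ell2_of_slices[OF c g e s])+
qed

lemma l2norm_sqn: assumes "f \<in> L2" shows "l2norm f = 2 * pi * sqrt (sqn (fc f))"
proof -
  have "l2norm f = sqrt ((l2norm f)\<^sup>2)" by (simp add: l2norm_nonneg)
  also have "\<dots> = sqrt ((2 * pi)\<^sup>2 * sqn (fc f))" unfolding tsum_converges(2)[OF assms] by (simp add: power_mult_distrib)
  finally show ?thesis by (simp only: real_sqrt_mult real_sqrt_abs) simp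
qed

lemma l2norm_fc_cong: assumes "f \<in> L2" "g \<in> L2" "\<And>m. fc f m = fc g m" shows "l2norm f = l2norm g"
proof -
  have "fc f = fc g" by (rule ext) (rule assms(3))
  then show ?thesis by (simp only: l2norm_sqn[OF assms(1)] l2norm_sqn[OF assms(2)])
qed

lemma fc_le_l2norm: assumes "f \<in> L2" shows "cmod (fc f m) \<le> l2norm f"
proof -
  have "cmod (fc f m) \<le> 1 * sqrt (sqn (fc f))" using ell2_bounded[OF bessel(1)[OF assms]] by simp
  also have "\<dots> \<le> 2 * pi * sqrt (sqn (fc f))"
    using pi_gt3 by (intro mult_right_mono) (auto intro: sqn_nonneg)
  finally show ?thesis by (simp add: l2norm_sqn[OF assms])
qed

lemma at_right_zero_limit:
  "(X \<longlongrightarrow> (0 :: real)) (at_right (0 :: real)) \<longleftrightarrow> (\<forall>e>0. \<exists>d>0. \<forall>t. 0 < t \<longrightarrow> t < d \<longrightarrow> \<bar>X t\<bar> < e)"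
  unfolding tendsto_iff eventually_at_right_field dist_real_def by simp

lemma generator_iff:
  "(f, g) \<in> generator S \<longleftrightarrow> f \<in> L20 \<and> g \<in> L20 \<and>
     (\<forall>e>0. \<exists>d>0. \<forall>t. 0 < t \<longrightarrow> t < d \<longrightarrow> l2norm (\<lambda>p. S t f p - f p - of_real t * g p) \<le> e * t)"
proof -
  have q: "l2norm (\<lambda>p. (S t f p - f p) / of_real t - g p) = l2norm (\<lambda>p. S t f p - f p - of_real t * g p) / t" if "t > 0" for t
  proof -
    have "(\<lambda>p. (S t f p - f p) / of_real t - g p) = (\<lambda>p. of_real (1 / t) * (S t f p - f p - of_real t * g p))"
      using that by (simp add: field_simps)
    note e = this
    show ?thesis using that unfolding e l2norm_cmult norm_of_real by simp
  qed
  have "((\<lambda>t. l2norm (\<lambda>p. (S t f p - f p) / of_real t - g p)) \<longlongrightarrow> 0) (at_right 0) \<longleftrightarrow>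
     (\<forall>e>0. \<exists>d>0. \<forall>t. 0 < t \<longrightarrow> t < d \<longrightarrow> l2norm (\<lambda>p. S t f p - f p - of_real t * g p) \<le> e * t)" (is "?A \<longleftrightarrow> ?B")
  proof
    assume A: ?A
    show ?B
    proof (intro allI impI)
      fix e :: real assume "e > 0"
      then obtain d where d: "d > 0" "\<And>t. 0 < t \<Longrightarrow> t < d \<Longrightarrow> \<bar>l2norm (\<lambda>p. (S t f p - f p) / of_real t - g p)\<bar> < e"
        using A unfolding at_right_zero_limit by blast
      have "l2norm (\<lambda>p. S t f p - f p - of_real t * g p) \<le> e * t" if t: "0 < t" "t < d" for t
        using d(2)[OF t] t(1) unfolding q[OF t(1)] by (simp add: l2norm_nonneg divide_less_eq)
      then show "\<exists>d>0. \<forall>t. 0 < t \<longrightarrow> t < d \<longrightarrow> l2norm (\<lambda>p. S t f p - f p - of_real t * g p) \<le> e * t"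
        using d(1) by blast
    qed
  next
    assume B: ?B
    show ?A unfolding at_right_zero_limit
    proof (intro allI impI)
      fix e :: real assume e: "e > 0"
      then have "e / 2 > 0" by simp
      then obtain d where d: "d > 0" "\<And>t. 0 < t \<Longrightarrow> t < d \<Longrightarrow> l2norm (\<lambda>p. S t f p - f p - of_real t * g p) \<le> e / 2 * t"
        using B by blast
      have "\<bar>l2norm (\<lambda>p. (S t f p - f p) / of_real t - g p)\<bar> < e" if t: "0 < t" "t < d" for t
      proof -
        have "l2norm (\<lambda>p. S t f p - f p - of_real t * g p) / t \<le> e / 2" using d(2)[OF t] t(1) by (simp add: divide_le_eq)
        moreover have "l2norm (\<lambda>p. S t f p - f p - of_real t * g p) / t \<ge> 0" using t(1) l2norm_nonneg by simp
        ultimately show ?thesis unfolding q[OF t(1)] using e by linarith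
      qed
      then show "\<exists>d>0. \<forall>t. 0 < t \<longrightarrow> t < d \<longrightarrow> \<bar>l2norm (\<lambda>p. (S t f p - f p) / of_real t - g p)\<bar> < e"
        using d(1) by blast
    qed
  qed
  then show ?thesis by (simp add: generator_def)
qed

lemma ev_slice: "l \<noteq> 0 \<Longrightarrow> (\<lambda>k. ev \<alpha> t c (l, k)) = sol l (\<alpha> * of_int l) (\<lambda>k. c (l, k)) t"
  by (rule ext) (simp add: ev_def)

lemma ev_combination:
  assumes "ell2 c" "ell2 d" "t \<ge> 0"
  shows "ev \<alpha> t (\<lambda>m. a * c m + b * d m) m = a * ev \<alpha> t c m + b * ev \<alpha> t d m"
proof (cases m)
  case (Pair l k)
  show ?thesis
    using sol_combination[OF _ ell2_bounded_range[OF sqn_slices(1)[OF assms(1)]] ell2_bounded_range[OF sqn_slices(1)[OF assms(2)]] assms(3),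
        of l "\<alpha> * of_int l" a l b l k]
    by (cases "l = 0") (simp_all add: Pair ev_def)
qed

lemma ev_0: "ev \<alpha> 0 c (l, k) = (if l = 0 then 0 else c (l, k))"
  by (simp add: ev_def sol_0)

lemma ev_add:
  assumes "ell2 c" "s \<ge> 0" "t \<ge> 0" shows "ev \<alpha> (s + t) c m = ev \<alpha> s (ev \<alpha> t c) m"
proof (cases m)
  case (Pair l k)
  show ?thesis
  proof (cases "l = 0")
    case True then show ?thesis by (simp add: Pair ev_def)
  next
    case False
    have "ev \<alpha> s (ev \<alpha> t c) (l, k) = sol l (\<alpha> * of_int l) (\<lambda>k. ev \<alpha> t c (l, k)) s k"
      using False by (simp only: ev_def[of \<alpha> s] prod.case if_False)
    also have "\<dots> = sol l (\<alpha> * of_int l) (\<lambda>k. c (l, k)) (s + t) k"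
      unfolding ev_slice[OF False]
      by (rule sol_semigroup[OF False ell2_bounded_range[OF sqn_slices(1)[OF assms(1)]] assms(2,3), symmetric])
    finally show ?thesis using False by (simp add: Pair ev_def)
  qed
qed

text \<open>On the domain, weight 2 is available for the coefficients of each mode, so
  \<open>lat_sol\<close> moves the generator inside the evolution.\<close>

lemma ev_deriv:
  assumes fg: "(f, g) \<in> opL \<alpha>" and t: "t \<ge> 0"
  shows "((\<lambda>s. ev \<alpha> s (fc f) m) has_vector_derivative ev \<alpha> t (fc g) m) (at t within {0..})"
proof (cases m)
  case (Pair l k)
  have f2: "f \<in> L2" and e: "ell2 (\<lambda>(l, k). of_real (nn l k) * fc f (l, k))"
    and lt: "\<And>l k. l \<noteq> 0 \<Longrightarrow> fc g (l, k) = lat l (\<alpha> * of_int l) (\<lambda>k. fc f (l, k)) k"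
    using fg unfolding opL_iff by (auto simp: L20_iff)
  show ?thesis
  proof (cases "l = 0")
    case True then show ?thesis by (simp add: Pair ev_def)
  next
    case False
    let ?b = "\<alpha> * of_int l" and ?c = "\<lambda>k. fc f (l, k)"
    let ?M = "2 * sqrt (sqn (\<lambda>(l, k). of_real (nn l k) * fc f (l, k)))"
    have M: "wt 2 k * cmod (?c k) \<le> ?M" for k
    proof -
      have "wt 2 k * cmod (?c k) \<le> 2 * nn l k * cmod (?c k)" by (rule mult_right_mono[OF weight_symbol[OF False]]) simp
      also have "\<dots> = 2 * cmod ((\<lambda>(l, k). of_real (nn l k) * fc f (l, k)) (l, k))"
        by (simp only: prod.case norm_mult norm_of_real) simp
      also have "\<dots> \<le> ?M" by (intro mult_left_mono ell2_bounded[OF e]) simp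
      finally show ?thesis .
    qed
    have g: "lat l ?b ?c = (\<lambda>k. fc g (l, k))" by (rule ext) (rule lt[OF False, symmetric])
    have "((\<lambda>s. sol l ?b ?c s k) has_vector_derivative lat l ?b (sol l ?b ?c t) k) (at t within {0..})"
      by (rule sol_deriv[OF False ell2_bounded_range[OF sqn_slices(1)[OF bessel(1)[OF f2]]] t])
    then show ?thesis unfolding lat_sol[OF False M t] g using False by (simp add: Pair ev_def)
  qed
qed

definition sg :: "real \<Rightarrow> real \<Rightarrow> fn \<Rightarrow> fn" where
  "sg \<alpha> t f = (SOME g. g \<in> L2 \<and> (\<forall>m. fc g m = ev \<alpha> t (fc f) m))"

context
  fixes \<alpha> :: real
  assumes a: "\<bar>\<alpha>\<bar> \<ge> 1" "rate * sqrt \<bar>\<alpha>\<bar> \<ge> 4"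
begin

lemma sg_coefficients:
  assumes f: "f \<in> L2" and t: "t \<ge> 0"
  shows "sg \<alpha> t f \<in> L2" "fc (sg \<alpha> t f) m = ev \<alpha> t (fc f) m" "l2norm (sg \<alpha> t f) \<le> sqrt (growth \<alpha>) * l2norm f"
proof -
  have "\<exists>g. g \<in> L2 \<and> (\<forall>m. fc g m = ev \<alpha> t (fc f) m)"
    using riesz_fischer[OF ev_growth(1)[OF a bessel(1)[OF f] t]] by metis
  from someI_ex[OF this] have s: "sg \<alpha> t f \<in> L2 \<and> (\<forall>m. fc (sg \<alpha> t f) m = ev \<alpha> t (fc f) m)"
    unfolding sg_def .
  then show s2: "sg \<alpha> t f \<in> L2" and c: "fc (sg \<alpha> t f) m = ev \<alpha> t (fc f) m" for m by blast+
  have e: "fc (sg \<alpha> t f) = ev \<alpha> t (fc f)" by (rule ext) (rule c)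
  have "sqrt (sqn (ev \<alpha> t (fc f))) \<le> sqrt (growth \<alpha> * sqn (fc f))"
    by (rule real_sqrt_le_mono) (rule ev_growth(2)[OF a bessel(1)[OF f] t])
  then show "l2norm (sg \<alpha> t f) \<le> sqrt (growth \<alpha>) * l2norm f"
    unfolding l2norm_sqn[OF s2] l2norm_sqn[OF f] e by (simp add: real_sqrt_mult mult_ac)
qed

lemma sg_L20: "f \<in> L2 \<Longrightarrow> t \<ge> 0 \<Longrightarrow> sg \<alpha> t f \<in> L20"
  by (simp add: L20_iff sg_coefficients ev_def)

text \<open>With r = 0 this is the Lipschitz bound behind strong continuity, with r = 1 the
  remainder in the definition of the generator. The mean value inequality is applied on finite sets
  of modes with constants independent of the set.\<close>

lemma sg_increment:
  assumes fg: "(f, g) \<in> opL \<alpha>" and t: "t \<ge> 0"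
    and B: "\<And>s. 0 \<le> s \<Longrightarrow> s \<le> t \<Longrightarrow> l2norm (\<lambda>p. sg \<alpha> s g p - r * g p) \<le> B"
  shows "l2norm (\<lambda>p. sg \<alpha> t f p - f p - of_real t * (r * g p)) \<le> B * t"
proof -
  have f: "f \<in> L20" and f2: "f \<in> L2" and g2: "g \<in> L2" using fg by (auto simp: opL_iff L20_iff)
  have B0: "B \<ge> 0" using B[of 0] t l2norm_nonneg order_trans by blast
  let ?y = "\<lambda>s m. ev \<alpha> s (fc g) m - r * fc g m"
  let ?x = "\<lambda>s m. ev \<alpha> s (fc f) m - of_real s * (r * fc g m)"
  have w: "(\<lambda>p. sg \<alpha> s g p - r * g p) \<in> L2" if "s \<ge> 0" for s
    by (intro L2_diff sg_coefficients(1) L2_cmult g2 that)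
  have wc: "fc (\<lambda>p. sg \<alpha> s g p - r * g p) = ?y s" if "s \<ge> 0" for s
    by (rule ext) (simp only: fc_diff[OF sg_coefficients(1)[OF g2 that] L2_cmult[OF g2]] fc_cmult sg_coefficients(2)[OF g2 that])
  have v: "(\<lambda>p. sg \<alpha> t f p - f p - of_real t * (r * g p)) \<in> L2"
    by (intro L2_diff sg_coefficients(1) L2_cmult g2 f2 t)
  have vc: "fc (\<lambda>p. sg \<alpha> t f p - f p - of_real t * (r * g p)) m = ?x t m - ?x 0 m" for m
  proof -
    have "fc (\<lambda>p. sg \<alpha> t f p - f p - of_real t * (r * g p)) m = ev \<alpha> t (fc f) m - fc f m - of_real t * (r * fc g m)"
      by (simp only: fc_diff[OF L2_diff[OF sg_coefficients(1)[OF f2 t] f2] L2_cmult[OF L2_cmult[OF g2]]]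
        fc_diff[OF sg_coefficients(1)[OF f2 t] f2] fc_cmult sg_coefficients(2)[OF f2 t])
    moreover have "ev \<alpha> 0 (fc f) m = fc f m" using f by (cases m) (simp add: ev_0 L20_iff)
    ultimately show ?thesis by simp
  qed
  have "(\<Sum>m\<in>F. (cmod (fc (\<lambda>p. sg \<alpha> t f p - f p - of_real t * (r * g p)) m))\<^sup>2) \<le> (t * (B / (2 * pi)))\<^sup>2" if F: "finite F" for F
    unfolding vc
  proof (rule mean_value_sum[OF t F, where y = ?y])
    fix m s assume s: "0 \<le> s" "s \<le> t"
    have "((\<lambda>s. of_real s * (r * fc g m)) has_vector_derivative r * fc g m) (at s within {0..})"
      by (auto intro!: derivative_eq_intros)
    then show "((\<lambda>s. ?x s m) has_vector_derivative ?y s m) (at s within {0..})"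
      by (intro has_vector_derivative_diff ev_deriv[OF fg s(1)])
  next
    fix s assume s: "0 \<le> s" "s \<le> t"
    have "(\<Sum>m\<in>F. (cmod (?y s m))\<^sup>2) \<le> sqn (?y s)"
      using ell2_finite_sum_le[OF bessel(1)[OF w[OF s(1)]] F] unfolding wc[OF s(1)] .
    also have "\<dots> = (sqrt (sqn (?y s)))\<^sup>2" by (simp add: sqn_nonneg)
    also have "\<dots> \<le> (B / (2 * pi))\<^sup>2"
    proof (rule power_mono)
      have "2 * pi * sqrt (sqn (?y s)) \<le> B" using B[OF s] unfolding l2norm_sqn[OF w[OF s(1)]] wc[OF s(1)] .
      then show "sqrt (sqn (?y s)) \<le> B / (2 * pi)" by (simp add: field_simps)
    qed (simp add: sqn_nonneg)
    finally show "(\<Sum>m\<in>F. (cmod (?y s m))\<^sup>2) \<le> (B / (2 * pi))\<^sup>2" .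
  qed (use B0 in simp)
  then have "sqn (fc (\<lambda>p. sg \<alpha> t f p - f p - of_real t * (r * g p))) \<le> (t * (B / (2 * pi)))\<^sup>2"
    by (rule ell2I(2))
  then have "sqrt (sqn (fc (\<lambda>p. sg \<alpha> t f p - f p - of_real t * (r * g p)))) \<le> t * (B / (2 * pi))"
    by (intro real_le_lsqrt) (use t B0 in \<open>auto intro: sqn_nonneg\<close>)
  then show ?thesis unfolding l2norm_sqn[OF v] by (simp add: field_simps)
qed

lemma sg_diff:
  assumes "f \<in> L2" "g \<in> L2" "t \<ge> 0"
  shows "l2norm (\<lambda>p. sg \<alpha> t f p - sg \<alpha> t g p) \<le> sqrt (growth \<alpha>) * l2norm (\<lambda>p. f p - g p)"
proof -
  have c: "fc (\<lambda>p. f p - g p) = (\<lambda>m. 1 * fc f m + (- 1) * fc g m)" by (rule ext) (simp add: fc_diff assms)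
  have "l2norm (\<lambda>p. sg \<alpha> t f p - sg \<alpha> t g p) = l2norm (sg \<alpha> t (\<lambda>p. f p - g p))"
  proof (rule l2norm_fc_cong)
    show "(\<lambda>p. sg \<alpha> t f p - sg \<alpha> t g p) \<in> L2" "sg \<alpha> t (\<lambda>p. f p - g p) \<in> L2"
      by (intro L2_diff sg_coefficients(1) assms)+
    show "fc (\<lambda>p. sg \<alpha> t f p - sg \<alpha> t g p) m = fc (sg \<alpha> t (\<lambda>p. f p - g p)) m" for m
      unfolding sg_coefficients(2)[OF L2_diff[OF assms(1,2)] assms(3)] c
        ev_combination[OF bessel(1)[OF assms(1)] bessel(1)[OF assms(2)] assms(3)]
        fc_diff[OF sg_coefficients(1)[OF assms(1,3)] sg_coefficients(1)[OF assms(2,3)]]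
      by (simp add: sg_coefficients(2) assms)
  qed
  also have "\<dots> \<le> sqrt (growth \<alpha>) * l2norm (\<lambda>p. f p - g p)" by (rule sg_coefficients(3)[OF L2_diff[OF assms(1,2)] assms(3)])
  finally show ?thesis .
qed

end

text \<open>Square partial sums have finitely many modes and therefore lie in the domain for every
  \<alpha>.\<close>

lemma dense_domain:
  assumes f: "f \<in> L20" and e: "e > 0"
  obtains h g where "(h, g) \<in> opL \<alpha>" "l2norm (\<lambda>p. f p - h p) < e"
proof -
  have "\<forall>\<^sub>F N in sequentially. l2norm (\<lambda>p. f p - tsum (fc f) (ibox N) p) < e"
    using order_tendstoD(2)[OF tsum_converges(1)[OF L20_L2[OF f]] e] .
  then obtain N where N: "l2norm (\<lambda>p. f p - tsum (fc f) (ibox N) p) < e"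
    using eventually_happens'[OF sequentially_bot] by blast
  let ?h = "tsum (fc f) (ibox N)"
  have h: "?h \<in> L20" using f by (simp add: L20_iff tsum_L2 finite_ibox fc_tsum)
  have "(\<lambda>m. (cmod ((\<lambda>(l, k). of_real (nn l k) * fc ?h (l, k)) m))\<^sup>2) summable_on ibox N"
    by (rule summable_on_finite[OF finite_ibox])
  then have "ell2 (\<lambda>(l, k). of_real (nn l k) * fc ?h (l, k))"
    unfolding ell2_def by (rule summable_on_cong_neutral[THEN iffD1, rotated 3]) (auto simp: fc_tsum finite_ibox)
  then obtain g where "(?h, g) \<in> opL \<alpha>" using opL_domain[OF h] by blast
  then show thesis using N by (rule that)
qed

context
  fixes \<alpha> :: real
  assumes a: "\<bar>\<alpha>\<bar> \<ge> 1" "rate * sqrt \<bar>\<alpha>\<bar> \<ge> 4"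
begin

lemma sg_continuous:
  assumes f: "f \<in> L20" and e: "e > 0"
  obtains d where "d > 0" "\<And>t. 0 \<le> t \<Longrightarrow> t < d \<Longrightarrow> l2norm (\<lambda>p. sg \<alpha> t f p - f p) < e"
proof -
  define G where "G = sqrt (growth \<alpha>)"
  have G: "G \<ge> 0" using growth_ge[of \<alpha>] by (simp add: G_def)
  have "e / (2 * (G + 1)) > 0" using e G by simp
  then obtain h g where hg: "(h, g) \<in> opL \<alpha>" and fh: "l2norm (\<lambda>p. f p - h p) < e / (2 * (G + 1))"
    using dense_domain[OF f] by metis
  define d where "d = e / (2 * (G * l2norm g + 1))"
  have Gg: "0 \<le> G * l2norm g" using G l2norm_nonneg by simp
  have d0: "d > 0" using e Gg by (simp add: d_def)
  have f2: "f \<in> L2" and h2: "h \<in> L2" and g2: "g \<in> L2" using f hg by (auto simp: opL_iff L20_iff)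
  show thesis
  proof (rule that[OF d0])
    fix t assume t: "0 \<le> t" "t < d"
    have "l2norm (\<lambda>p. sg \<alpha> t h p - h p - of_real t * (0 * g p)) \<le> G * l2norm g * t"
      unfolding G_def
      by (rule sg_increment[OF a hg t(1)]) (simp add: sg_coefficients(3)[OF a g2])
    then have i: "l2norm (\<lambda>p. sg \<alpha> t h p - h p) \<le> G * l2norm g * t" by simp
    have s2: "sg \<alpha> t f \<in> L2" "sg \<alpha> t h \<in> L2" using sg_coefficients(1)[OF a] f2 h2 t by auto
    have "l2norm (\<lambda>p. sg \<alpha> t f p - f p) \<le> l2norm (\<lambda>p. sg \<alpha> t f p - sg \<alpha> t h p) + l2norm (\<lambda>p. sg \<alpha> t h p - f p)"
      by (rule l2norm_diff_triangle[OF s2 f2])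
    also have "\<dots> \<le> l2norm (\<lambda>p. sg \<alpha> t f p - sg \<alpha> t h p) + (l2norm (\<lambda>p. sg \<alpha> t h p - h p) + l2norm (\<lambda>p. h p - f p))"
      by (intro add_left_mono l2norm_diff_triangle s2 f2 h2)
    also have "\<dots> \<le> G * l2norm (\<lambda>p. f p - h p) + (G * l2norm g * t + l2norm (\<lambda>p. f p - h p))"
      using sg_diff[OF a f2 h2 t(1)] i l2norm_minus[of h f] by (simp add: G_def)
    also have "\<dots> = (G + 1) * l2norm (\<lambda>p. f p - h p) + G * l2norm g * t" by (simp add: algebra_simps)
    also have "(G + 1) * l2norm (\<lambda>p. f p - h p) \<le> e / 2"
    proof -
      have "l2norm (\<lambda>p. f p - h p) * (2 * (G + 1)) < e" using fh G by (simp add: less_divide_eq)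
      then show ?thesis by (simp add: algebra_simps)
    qed
    also have "G * l2norm g * t < e / 2"
    proof -
      have "G * l2norm g * t \<le> (G * l2norm g + 1) * t" using t by (simp add: algebra_simps)
      also have "\<dots> < (G * l2norm g + 1) * d" using t Gg by (intro mult_strict_left_mono) auto
      also have "\<dots> = e / 2" using Gg by (simp add: d_def field_simps)
      finally show ?thesis .
    qed
    finally show "l2norm (\<lambda>p. sg \<alpha> t f p - f p) < e" by simp
  qed
qed

lemma sg_C0: "C0_semigroup (sg \<alpha>)"
  unfolding C0_semigroup_def
proof (intro conjI allI impI ballI)
  fix t :: real and f assume t: "t \<ge> 0" and f: "f \<in> L20"
  show "sg \<alpha> t f \<in> L20" by (rule sg_L20[OF a L20_L2[OF f] t])
  fix g b c assume g: "g \<in> L20"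
  note f2 = L20_L2[OF f] and g2 = L20_L2[OF g]
  have fg2: "(\<lambda>p. b * f p + c * g p) \<in> L2" by (intro L2_add L2_cmult f2 g2)
  have cc: "fc (\<lambda>p. b * f p + c * g p) = (\<lambda>m. b * fc f m + c * fc g m)"
    by (rule ext) (simp only: fc_add[OF L2_cmult[OF f2] L2_cmult[OF g2]] fc_cmult)
  show "ae_eq (sg \<alpha> t (\<lambda>p. b * f p + c * g p)) (\<lambda>p. b * sg \<alpha> t f p + c * sg \<alpha> t g p)"
  proof (rule L2_uniqueness)
    show "sg \<alpha> t (\<lambda>p. b * f p + c * g p) \<in> L2" by (rule sg_coefficients(1)[OF a fg2 t])
    show "(\<lambda>p. b * sg \<alpha> t f p + c * sg \<alpha> t g p) \<in> L2"
      by (intro L2_add L2_cmult sg_coefficients(1)[OF a] f2 g2 t)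
    show "fc (sg \<alpha> t (\<lambda>p. b * f p + c * g p)) m = fc (\<lambda>p. b * sg \<alpha> t f p + c * sg \<alpha> t g p) m" for m
      unfolding sg_coefficients(2)[OF a fg2 t] cc ev_combination[OF bessel(1)[OF f2] bessel(1)[OF g2] t]
        fc_add[OF L2_cmult[OF sg_coefficients(1)[OF a f2 t]] L2_cmult[OF sg_coefficients(1)[OF a g2 t]]] fc_cmult
        sg_coefficients(2)[OF a f2 t] sg_coefficients(2)[OF a g2 t] ..
  qed
next
  fix t :: real assume t: "t \<ge> 0"
  show "\<exists>K. \<forall>f\<in>L20. l2norm (sg \<alpha> t f) \<le> K * l2norm f"
    using sg_coefficients(3)[OF a L20_L2 t] by blast
next
  fix f assume f: "f \<in> L20"
  show "ae_eq (sg \<alpha> 0 f) f"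
  proof (rule L2_uniqueness[OF sg_coefficients(1)[OF a L20_L2[OF f]] L20_L2[OF f]])
    show "fc (sg \<alpha> 0 f) m = fc f m" for m
      using f by (cases m) (simp add: sg_coefficients(2)[OF a] L20_iff ev_0)
  qed simp
  show "((\<lambda>t. l2norm (\<lambda>p. sg \<alpha> t f p - f p)) \<longlongrightarrow> 0) (at_right 0)"
    unfolding at_right_zero_limit
  proof (intro allI impI)
    fix e :: real assume "e > 0"
    then obtain d where "d > 0" "\<And>t. 0 \<le> t \<Longrightarrow> t < d \<Longrightarrow> l2norm (\<lambda>p. sg \<alpha> t f p - f p) < e"
      using sg_continuous[OF f] by metis
    then show "\<exists>d>0. \<forall>t. 0 < t \<longrightarrow> t < d \<longrightarrow> \<bar>l2norm (\<lambda>p. sg \<alpha> t f p - f p)\<bar> < e"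
      by (intro exI[of _ d]) (simp add: l2norm_nonneg)
  qed
next
  fix s t :: real and f assume st: "s \<ge> 0" "t \<ge> 0" and f: "f \<in> L20"
  note f2 = L20_L2[OF f]
  have s2: "sg \<alpha> t f \<in> L2" by (rule sg_coefficients(1)[OF a f2 st(2)])
  have e: "fc (sg \<alpha> t f) = ev \<alpha> t (fc f)" by (rule ext) (rule sg_coefficients(2)[OF a f2 st(2)])
  have st2: "s + t \<ge> 0" using st by simp
  show "ae_eq (sg \<alpha> (s + t) f) (sg \<alpha> s (sg \<alpha> t f))"
  proof (rule L2_uniqueness[OF sg_coefficients(1)[OF a f2 st2] sg_coefficients(1)[OF a s2 st(1)]])
    show "fc (sg \<alpha> (s + t) f) m = fc (sg \<alpha> s (sg \<alpha> t f)) m" for m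
      unfolding sg_coefficients(2)[OF a f2 st2] sg_coefficients(2)[OF a s2 st(1)] e
      by (rule ev_add[OF bessel(1)[OF f2] st])
  qed
qed

text \<open>If the difference quotient converges, comparing coordinates with the derivative of
  \<open>sol\<close> at time 0 forces the tridiagonal relation, and
  \<open>elliptic_regularity\<close> puts \<open>f\<close> into the domain. Conversely,
  \<open>sg_increment\<close> bounds the remainder through strong continuity at
  \<open>g\<close>.\<close>

lemma sg_generator: "generator (sg \<alpha>) = opL \<alpha>"
proof (intro set_eqI iffI)
  fix fg assume G: "fg \<in> generator (sg \<alpha>)"
  obtain f g where fg: "fg = (f, g)" by (cases fg)
  have f: "f \<in> L20" and g: "g \<in> L20"
    and lim: "\<And>e. e > 0 \<Longrightarrow> \<exists>d>0. \<forall>t. 0 < t \<longrightarrow> t < d \<longrightarrow> l2norm (\<lambda>p. sg \<alpha> t f p - f p - of_real t * g p) \<le> e * t"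
    using G unfolding fg generator_iff by blast+
  note f2 = L20_L2[OF f] and g2 = L20_L2[OF g]
  have lt: "fc g (l, k) = lat l (\<alpha> * of_int l) (\<lambda>k. fc f (l, k)) k" if l: "l \<noteq> 0" for l k
  proof -
    let ?b = "\<alpha> * of_int l" and ?c = "\<lambda>k. fc f (l, k)"
    let ?D = "lat l ?b ?c k"
    have c0: "sol l ?b ?c 0 = ?c" by (rule ext) (rule sol_0[OF l])
    have "((\<lambda>s. sol l ?b ?c s k) has_vector_derivative ?D) (at 0 within {0..})"
      using sol_deriv[OF l ell2_bounded_range[OF sqn_slices(1)[OF bessel(1)[OF f2]]], of 0 ?b l k] by (simp add: c0)
    then have der: "\<forall>e>0. \<exists>d>0. \<forall>y\<in>{0..}. norm (y - 0) < d \<longrightarrow> norm (sol l ?b ?c y k - sol l ?b ?c 0 k - (y - 0) *\<^sub>R ?D) \<le> e * norm (y - 0)"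
      unfolding has_vector_derivative_def has_derivative_within_alt by blast
    have "cmod (fc g (l, k) - ?D) \<le> 0 + e" if "e > 0" for e
    proof -
      have e2: "e / 2 > 0" using that by simp
      from mp[OF spec[OF der, of "e / 2"] e2] obtain d where d0: "d > 0"
        and dd: "\<forall>y\<in>{0..}. norm (y - 0) < d \<longrightarrow> norm (sol l ?b ?c y k - sol l ?b ?c 0 k - (y - 0) *\<^sub>R ?D) \<le> e / 2 * norm (y - 0)"
        by (elim exE conjE)
      have dy: "norm (sol l ?b ?c y k - ?c k - y *\<^sub>R ?D) \<le> e / 2 * y" if "y \<ge> 0" "y < d" for y
        using dd[rule_format, of y] that by (simp add: c0)
      note d = d0 dy
      obtain d' where d': "d' > 0" "\<And>t. 0 < t \<Longrightarrow> t < d' \<Longrightarrow> l2norm (\<lambda>p. sg \<alpha> t f p - f p - of_real t * g p) \<le> e / 2 * t"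
        using lim[OF e2] by blast
      define t where "t = min d d' / 2"
      have t: "0 < t" "t < d" "t < d'" using d(1) d'(1) by (auto simp: t_def min_def)
      let ?w = "\<lambda>p. sg \<alpha> t f p - f p - of_real t * g p"
      have s2: "sg \<alpha> t f \<in> L2" using sg_coefficients(1)[OF a f2] t by simp
      have w: "?w \<in> L2" by (intro L2_diff s2 f2 L2_cmult g2)
      have "fc ?w (l, k) = sol l ?b ?c t k - ?c k - of_real t * fc g (l, k)"
        using t l by (simp only: fc_diff[OF L2_diff[OF s2 f2] L2_cmult[OF g2]] fc_diff[OF s2 f2] fc_cmult
          sg_coefficients(2)[OF a f2 less_imp_le[OF t(1)]] ev_def prod.case if_False)
      then have eq: "of_real t * (fc g (l, k) - ?D) = (sol l ?b ?c t k - ?c k - t *\<^sub>R ?D) - fc ?w (l, k)"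
        by (simp add: scaleR_conv_of_real algebra_simps)
      have "cmod (of_real t * (fc g (l, k) - ?D)) \<le> e / 2 * t + e / 2 * t"
        unfolding eq
        by (rule order_trans[OF norm_triangle_ineq4 add_mono[OF d(2)[OF less_imp_le[OF t(1)] t(2)]
          order_trans[OF fc_le_l2norm[OF w] d'(2)[OF t(1,3)]]]])
      moreover have "cmod (of_real t * (fc g (l, k) - ?D)) = t * cmod (fc g (l, k) - ?D)"
        using t(1) by (simp only: norm_mult norm_of_real abs_of_pos)
      moreover have "e / 2 * t + e / 2 * t = t * e" by simp
      ultimately have "t * cmod (fc g (l, k) - ?D) \<le> t * e" by (simp only:)
      then show ?thesis using t by simp
    qed
    then have "cmod (fc g (l, k) - ?D) \<le> 0" by (rule field_le_epsilon)
    then show ?thesis by simp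
  qed
  have f0: "fc f (0, k) = 0" for k using f by (simp add: L20_iff)
  have "ell2 (\<lambda>(l, k). of_real (nn l k) * fc f (l, k))"
    by (rule elliptic_regularity[OF bessel(1)[OF f2] f0 bessel(1)[OF g2] lt])
  then show "fg \<in> opL \<alpha>" unfolding fg opL_iff using f g lt by blast
next
  fix fg assume G: "fg \<in> opL \<alpha>"
  obtain f g where fg: "fg = (f, g)" by (cases fg)
  have o: "(f, g) \<in> opL \<alpha>" using G fg by simp
  then have f: "f \<in> L20" and g: "g \<in> L20" by (auto simp: opL_iff)
  show "fg \<in> generator (sg \<alpha>)" unfolding fg generator_iff
  proof (intro conjI f g allI impI)
    fix e :: real assume "e > 0"
    then obtain d where d: "d > 0" "\<And>t. 0 \<le> t \<Longrightarrow> t < d \<Longrightarrow> l2norm (\<lambda>p. sg \<alpha> t g p - g p) < e"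
      using sg_continuous[OF g] by metis
    have "l2norm (\<lambda>p. sg \<alpha> t f p - f p - of_real t * g p) \<le> e * t" if t: "0 < t" "t < d" for t
      using sg_increment[OF a o, of t 1 e] d(2) t by (simp add: less_imp_le)
    then show "\<exists>d>0. \<forall>t. 0 < t \<longrightarrow> t < d \<longrightarrow> l2norm (\<lambda>p. sg \<alpha> t f p - f p - of_real t * g p) \<le> e * t"
      using d(1) by blast
  qed
qed

end

section \<open>Arbitrary strongly continuous semigroups and uniqueness\<close>

context
  fixes S :: "real \<Rightarrow> fn \<Rightarrow> fn"
  assumes C: "C0_semigroup S"
begin

lemma C0_L20: "t \<ge> 0 \<Longrightarrow> f \<in> L20 \<Longrightarrow> S t f \<in> L20"
  using C unfolding C0_semigroup_def by blast

lemma C0_L2: "t \<ge> 0 \<Longrightarrow> f \<in> L20 \<Longrightarrow> S t f \<in> L2"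
  by (rule L20_L2[OF C0_L20])

lemma C0_linear:
  assumes "t \<ge> 0" "f \<in> L20" "g \<in> L20"
  shows "fc (S t (\<lambda>p. a * f p + b * g p)) m = a * fc (S t f) m + b * fc (S t g) m"
proof -
  have e: "ae_eq (S t (\<lambda>p. a * f p + b * g p)) (\<lambda>p. a * S t f p + b * S t g p)"
    using C assms unfolding C0_semigroup_def by blast
  note f = C0_L2[OF assms(1,2)] and g = C0_L2[OF assms(1,3)]
  have "fc (S t (\<lambda>p. a * f p + b * g p)) m = fc (\<lambda>p. a * S t f p + b * S t g p) m"
    by (rule fc_cong[OF e C0_L2[OF assms(1) L20_combination[OF assms(2,3)]] L2_add[OF L2_cmult[OF f] L2_cmult[OF g]]])
  then show ?thesis by (simp only: fc_add[OF L2_cmult[OF f] L2_cmult[OF g]] fc_cmult)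
qed

lemma C0_zero: "f \<in> L20 \<Longrightarrow> fc (S 0 f) m = fc f m"
  by (rule fc_cong) (use C C0_L2[of 0 f] L20_L2[of f] in \<open>auto simp: C0_semigroup_def\<close>)

lemma C0_add: "s \<ge> 0 \<Longrightarrow> t \<ge> 0 \<Longrightarrow> f \<in> L20 \<Longrightarrow> fc (S (s + t) f) m = fc (S s (S t f)) m"
  by (rule fc_cong) (use C C0_L2[of "s + t" f] C0_L2[of s "S t f"] C0_L20[of t f] in \<open>auto simp: C0_semigroup_def\<close>)

lemma C0_bounded: "t \<ge> 0 \<Longrightarrow> \<exists>K. \<forall>f\<in>L20. l2norm (S t f) \<le> K * l2norm f"
  using C by (simp add: C0_semigroup_def)

lemma C0_continuous:
  assumes "f \<in> L20" "e > 0" obtains d where "d > 0" "\<And>t. 0 < t \<Longrightarrow> t < d \<Longrightarrow> l2norm (\<lambda>p. S t f p - f p) < e"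
proof -
  have "((\<lambda>t. l2norm (\<lambda>p. S t f p - f p)) \<longlongrightarrow> 0) (at_right 0)" using C assms unfolding C0_semigroup_def by blast
  then obtain d where "d > 0" "\<And>t. 0 < t \<Longrightarrow> t < d \<Longrightarrow> \<bar>l2norm (\<lambda>p. S t f p - f p)\<bar> < e"
    unfolding at_right_zero_limit using assms(2) by blast
  then show thesis using that by (simp add: l2norm_nonneg)
qed

lemma C0_norm_diff:
  assumes t: "t \<ge> 0" and f: "f \<in> L20" and g: "g \<in> L20"
  shows "l2norm (\<lambda>p. S t f p - S t g p) = l2norm (S t (\<lambda>p. f p - g p))"
proof (rule l2norm_fc_cong)
  show "(\<lambda>p. S t f p - S t g p) \<in> L2" by (intro L2_diff C0_L2 assms)
  show "S t (\<lambda>p. f p - g p) \<in> L2" by (intro C0_L2 L20_diff assms)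
  show "fc (\<lambda>p. S t f p - S t g p) m = fc (S t (\<lambda>p. f p - g p)) m" for m
    using C0_linear[OF t f g, of 1 "- 1" m] by (simp add: fc_diff C0_L2 assms)
qed

text \<open>Uniform boundedness near \<open>t = 0\<close> by a gliding hump: if it failed, a vector \<open>F n\<close> with large
  image under \<open>S (T n)\<close>, \<open>T n < 1/(n+1)\<close>, could be perturbed by so little that the images under all
  earlier \<open>S (T j)\<close> stay large; the limit then contradicts strong continuity.\<close>

lemma C0_hump:
  assumes unb: "\<And>M d. M \<ge> 1 \<Longrightarrow> d > 0 \<Longrightarrow> \<exists>t h. 0 < t \<and> t < d \<and> h \<in> L20 \<and> \<not> l2norm (S t h) \<le> M * l2norm h"
    and f: "f \<in> L20" and e: "e > 0" and d: "d > 0"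
  obtains t f' where "0 < t" "t < d" "f' \<in> L20" "l2norm (\<lambda>p. f' p - f p) \<le> e" "R \<le> l2norm (S t f')"
proof -
  obtain t h where t: "0 < t" "t < d" and h: "h \<in> L20" and big: "\<not> l2norm (S t h) \<le> max 1 (R / e) * l2norm h"
    using unb[of "max 1 (R / e)" d] d by auto
  have t0: "t \<ge> 0" using t by simp
  obtain K where K: "\<And>f. f \<in> L20 \<Longrightarrow> l2norm (S t f) \<le> K * l2norm f"
    using C0_bounded[OF t0] by blast
  have hp: "l2norm h > 0"
  proof (rule ccontr)
    assume "\<not> l2norm h > 0"
    then have "l2norm h = 0" using l2norm_nonneg[of h] by linarith
    then show False using K[OF h] big by simp
  qed
  define c where "c = complex_of_real (e / l2norm h)"
  define z where "z = (\<lambda>p. c * h p)"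
  have z: "z \<in> L20" using L20_combination[OF h h, of c 0] by (simp add: z_def)
  have nz: "l2norm z = e" unfolding z_def l2norm_cmult c_def norm_of_real using hp e by simp
  have "l2norm (S t z) = l2norm (\<lambda>p. c * S t h p)"
    by (rule l2norm_fc_cong[OF C0_L2[OF t0 z] L2_cmult[OF C0_L2[OF t0 h]]])
      (use C0_linear[OF t0 h h, of c 0] in \<open>simp add: z_def fc_cmult\<close>)
  also have "\<dots> = e / l2norm h * l2norm (S t h)" unfolding l2norm_cmult c_def norm_of_real using hp e by simp
  also have "\<dots> \<ge> e / l2norm h * (R / e * l2norm h)"
  proof (rule mult_left_mono)
    have "R / e * l2norm h \<le> max 1 (R / e) * l2norm h" using hp by (intro mult_right_mono) auto
    then show "R / e * l2norm h \<le> l2norm (S t h)" using big by linarith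
  qed (use hp e in simp)
  also have "e / l2norm h * (R / e * l2norm h) = R" using hp e by simp
  finally have Sz: "R \<le> l2norm (S t z)" .
  \<comment> \<open>Twice the image of \<open>z\<close> is the difference of the images of f + z and
    f - z, so one of the two images is at least \<open>R\<close>, however large the image of
    \<open>f\<close> may be.\<close>
  let ?f1 = "\<lambda>p. f p + z p" and ?f2 = "\<lambda>p. f p - z p"
  have f12: "?f1 \<in> L20" "?f2 \<in> L20" using L20_combination[OF f z, of 1 1] L20_diff[OF f z] by simp_all
  have "2 * l2norm (S t z) = l2norm (\<lambda>p. S t ?f1 p + (- 1) * S t ?f2 p)"
  proof -
    have "2 * l2norm (S t z) = l2norm (\<lambda>p. 2 * S t z p)" by (simp add: l2norm_cmult)
    also have "\<dots> = l2norm (\<lambda>p. S t ?f1 p + (- 1) * S t ?f2 p)"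
    proof (rule l2norm_fc_cong)
      show "(\<lambda>p. 2 * S t z p) \<in> L2" "(\<lambda>p. S t ?f1 p + (- 1) * S t ?f2 p) \<in> L2"
        by (intro L2_add L2_cmult C0_L2 t0 z f12)+
      show "fc (\<lambda>p. 2 * S t z p) m = fc (\<lambda>p. S t ?f1 p + (- 1) * S t ?f2 p) m" for m
        unfolding fc_add[OF C0_L2[OF t0 f12(1)] L2_cmult[OF C0_L2[OF t0 f12(2)]]] fc_cmult
        using C0_linear[OF t0 f z, of 1 1 m] C0_linear[OF t0 f z, of 1 "- 1" m] by simp
    qed
    finally show ?thesis .
  qed
  also have "\<dots> \<le> l2norm (S t ?f1) + l2norm (\<lambda>p. (- 1) * S t ?f2 p)"
    by (intro l2norm_triangle L2_cmult C0_L2 t0 f12)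
  also have "\<dots> = l2norm (S t ?f1) + l2norm (S t ?f2)" unfolding l2norm_cmult by simp
  finally have "R \<le> l2norm (S t ?f1) \<or> R \<le> l2norm (S t ?f2)" using Sz by linarith
  moreover have "l2norm (\<lambda>p. ?f1 p - f p) = e" "l2norm (\<lambda>p. ?f2 p - f p) = e"
    using nz l2norm_cmult[of "- 1" z] by simp_all
  ultimately show thesis using that[OF t f12(1)] that[OF t f12(2)] by fastforce
qed

lemma C0_bounded_near_0:
  "\<exists>M\<ge>1. \<exists>d>0. \<forall>t. 0 < t \<longrightarrow> t < d \<longrightarrow> (\<forall>h\<in>L20. l2norm (S t h) \<le> M * l2norm h)"
proof (rule ccontr)
  assume "\<not> ?thesis"
  then have unb: "\<exists>t h. 0 < t \<and> t < d \<and> h \<in> L20 \<and> \<not> l2norm (S t h) \<le> M * l2norm h" if "M \<ge> 1" "d > 0" for M d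
    using that by meson
  \<comment> \<open>A state consists of a vector, a bound for \<open>S t\<close> and the time
    \<open>t\<close>.\<close>
  define A where "A = (\<lambda>(n :: nat) (f, B, t). f \<in> L20 \<and> 1 \<le> B \<and> 0 < t \<and> t \<le> 1 / (real n + 1)
    \<and> (\<forall>h\<in>L20. l2norm (S t h) \<le> B * l2norm h) \<and> real n \<le> l2norm (S t f))"
  \<comment> \<open>Later perturbations are scaled by the current bound \<open>B\<close>: all of
    them together move the vector by at most 1/B, and its image under the current \<open>S t\<close>
    by at most 1. The bounds are kept nondecreasing so that this holds for every earlier
    stage.\<close>
  define Z where "Z = (\<lambda>(n :: nat) (f, B :: real, t :: real) (f', B', t' :: real). l2norm (\<lambda>p. f' p - f p) \<le> (1/2) ^ Suc n / B \<and> B \<le> B')"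
  have ex: "\<exists>B. b \<le> B \<and> (\<forall>h\<in>L20. l2norm (S t h) \<le> B * l2norm h)" if t: "t > 0" for t b
  proof -
    obtain K where K: "\<forall>f\<in>L20. l2norm (S t f) \<le> K * l2norm f" using C0_bounded[OF less_imp_le[OF t]] by blast
    have "l2norm (S t h) \<le> max b K * l2norm h" if "h \<in> L20" for h
      using K that mult_right_mono[OF max.cobounded2[of K b] l2norm_nonneg[of h]] by fastforce
    then show ?thesis by (intro exI[of _ "max b K"]) simp
  qed
  have z0: "(\<lambda>p. 0) \<in> L20" using L2_const[of 0] by (simp add: L20_iff fc_def)
  have "\<exists>s. \<forall>n. A n (s n) \<and> Z n (s n) (s (Suc n))"
  proof (rule dependent_nat_choice)
    obtain B where "1 \<le> B" "\<forall>h\<in>L20. l2norm (S 1 h) \<le> B * l2norm h" using ex[of 1 1] by auto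
    then have "A 0 (\<lambda>p. 0, B, 1)" using z0 by (simp add: A_def l2norm_nonneg)
    then show "\<exists>s. A 0 s" ..
  next
    fix s n assume s: "A n s"
    obtain f B t where st: "s = (f, B, t)" by (cases s)
    have f: "f \<in> L20" and B: "1 \<le> B" using s by (auto simp: A_def st)
    have e: "(1/2) ^ Suc n / B > 0" using B by simp
    obtain t' f' where n: "0 < t'" "t' < 1 / (real (Suc n) + 1)" "f' \<in> L20" "l2norm (\<lambda>p. f' p - f p) \<le> (1/2) ^ Suc n / B"
      "real (Suc n) \<le> l2norm (S t' f')"
      by (rule C0_hump[OF unb f e, of "1 / (real (Suc n) + 1)" "real (Suc n)"]) auto
    obtain B' where B': "B \<le> B'" "\<forall>h\<in>L20. l2norm (S t' h) \<le> B' * l2norm h" using ex[OF n(1), of B] by auto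
    have "1 \<le> B'" using B B'(1) by linarith
    then have "A (Suc n) (f', B', t')" unfolding A_def prod.case using n B' by (intro conjI) auto
    moreover have "Z n s (f', B', t')" unfolding Z_def st prod.case using n(4) B'(1) by blast
    ultimately show "\<exists>s'. A (Suc n) s' \<and> Z n s s'" by blast
  qed
  then obtain s where s: "\<And>n. A n (s n)" "\<And>n. Z n (s n) (s (Suc n))" by blast
  define F where "F n = fst (s n)" for n
  define B where "B n = fst (snd (s n))" for n
  define T where "T n = snd (snd (s n))" for n
  have sn: "s n = (F n, B n, T n)" for n by (simp add: F_def B_def T_def)
  have F: "F n \<in> L20" and B1: "1 \<le> B n" and T: "0 < T n" "T n \<le> 1 / (real n + 1)"
    and Bd: "\<And>h. h \<in> L20 \<Longrightarrow> l2norm (S (T n) h) \<le> B n * l2norm h" and big: "real n \<le> l2norm (S (T n) (F n))" for n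
    using s(1)[of n] unfolding sn A_def by auto
  have st: "l2norm (\<lambda>p. F (Suc n) p - F n p) \<le> (1/2) ^ Suc n / B n" and Bm: "B n \<le> B (Suc n)" for n
    using s(2)[of n] unfolding sn Z_def by auto
  note F2 = L20_L2[OF F]
  have Bmono: "B n \<le> B (n + j)" for n j by (induction j) (use Bm order_trans in \<open>force+\<close>)
  have "l2norm (\<lambda>p. F (Suc n) p - F n p) \<le> (1/2) ^ n" for n
  proof -
    have "(1/2) ^ Suc n / B n \<le> (1/2) ^ Suc n / 1" by (rule divide_left_mono) (use B1[of n] in auto)
    also have "\<dots> \<le> (1/2 :: real) ^ n" by simp
    finally show ?thesis using st[of n] by linarith
  qed
  from L2_complete[OF F2 this] obtain g where g2: "g \<in> L2" and lim: "(\<lambda>n. l2norm (\<lambda>p. F n p - g p)) \<longlonglongrightarrow> 0" by blast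
  have g: "g \<in> L20" unfolding L20_iff
  proof (intro conjI g2 allI)
    fix k
    have "cmod (fc g (0, k)) \<le> l2norm (\<lambda>p. F n p - g p)" for n
      using fc_le_l2norm[OF L2_diff[OF F2 g2], of n "(0, k)"] F[of n] by (simp add: fc_diff[OF F2 g2] L20_iff)
    then have "cmod (fc g (0, k)) \<le> 0" by (intro LIMSEQ_le_const[OF lim]) blast
    then show "fc g (0, k) = 0" by simp
  qed
  have near: "l2norm (\<lambda>p. F (n + j) p - F n p) \<le> (1 - (1/2) ^ j) / B n" for n j
  proof (induction j)
    case 0 show ?case by (simp add: l2norm_def)
  next
    case (Suc j)
    have "l2norm (\<lambda>p. F (n + Suc j) p - F n p) \<le> l2norm (\<lambda>p. F (n + Suc j) p - F (n + j) p) + l2norm (\<lambda>p. F (n + j) p - F n p)"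
      by (rule l2norm_diff_triangle[OF F2 F2 F2])
    also have "l2norm (\<lambda>p. F (n + Suc j) p - F (n + j) p) \<le> (1/2) ^ Suc j / B n"
    proof -
      have "l2norm (\<lambda>p. F (n + Suc j) p - F (n + j) p) \<le> (1/2) ^ Suc (n + j) / B (n + j)" using st[of "n + j"] by simp
      also have "\<dots> \<le> (1/2) ^ Suc j / B n"
        using Bmono[of n j] B1[of n] by (intro frac_le power_decreasing) auto
      finally show ?thesis .
    qed
    also note Suc.IH
    also have "(1/2) ^ Suc j / B n + (1 - (1/2) ^ j) / B n = (1 - (1/2) ^ Suc j) / B n"
    proof -
      have h: "1 / 2 * x + (1 - x) = 1 - 1 / 2 * x" for x :: real by simp
      show ?thesis by (simp only: add_divide_distrib[symmetric] power_Suc h)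
    qed
    finally show ?case by simp
  qed
  have tail: "l2norm (\<lambda>p. F n p - g p) \<le> 1 / B n" for n
  proof -
    have b: "l2norm (\<lambda>p. F n p - g p) \<le> 1 / B n + l2norm (\<lambda>p. F (j + n) p - g p)" for j
    proof -
      have "l2norm (\<lambda>p. F n p - g p) \<le> l2norm (\<lambda>p. F n p - F (n + j) p) + l2norm (\<lambda>p. F (n + j) p - g p)"
        by (rule l2norm_diff_triangle[OF F2 F2 g2])
      also have "l2norm (\<lambda>p. F n p - F (n + j) p) \<le> (1 - (1/2) ^ j) / B n"
        unfolding l2norm_minus[of "F n"] by (rule near)
      also have "\<dots> \<le> 1 / B n" using B1[of n] by (intro divide_right_mono) auto
      finally show ?thesis by (simp add: add.commute)
    qed
    have "(\<lambda>j. 1 / B n + l2norm (\<lambda>p. F (j + n) p - g p)) \<longlonglongrightarrow> 1 / B n + 0"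
      by (intro tendsto_add tendsto_const LIMSEQ_ignore_initial_segment[OF lim])
    from LIMSEQ_le_const[OF this] b show ?thesis by auto
  qed
  obtain d where d: "d > 0" "\<And>t. 0 < t \<Longrightarrow> t < d \<Longrightarrow> l2norm (\<lambda>p. S t g p - g p) < 1" using C0_continuous[OF g, of 1] by auto
  \<comment> \<open>The first entry contradicts the final estimate n \<le> 1 + 1 +
    \<open>l2norm g\<close>; the second brings \<open>T n\<close> below \<open>d\<close>.\<close>
  obtain n :: nat where n: "real n > max (2 + l2norm g) (1 / d)" using reals_Archimedean2 by blast
  have "T n < d"
  proof -
    have "1 / d < real n + 1" using n by simp
    then have "1 / (real n + 1) < d" using d(1) by (simp add: field_simps)
    then show ?thesis using T(2)[of n] by linarith
  qed
  have T0: "T n \<ge> 0" using T(1)[of n] by simp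
  note SF = C0_L2[OF T0 F[of n]] and Sg = C0_L2[OF T0 g]
  have "real n \<le> l2norm (S (T n) (F n))" by (rule big)
  also have "\<dots> \<le> l2norm (\<lambda>p. S (T n) (F n) p - S (T n) g p) + l2norm (S (T n) g)"
    using l2norm_triangle[OF L2_diff[OF SF Sg] Sg] by simp
  also have "l2norm (\<lambda>p. S (T n) (F n) p - S (T n) g p) \<le> B n * (1 / B n)"
    unfolding C0_norm_diff[OF T0 F g]
    using Bd[OF L20_diff[OF F[of n] g]] mult_left_mono[OF tail[of n], of "B n"] B1[of n] order_trans by fastforce
  also have "B n * (1 / B n) = 1" using B1[of n] by simp
  also have "l2norm (S (T n) g) \<le> l2norm (\<lambda>p. S (T n) g p - g p) + l2norm g"
    using l2norm_triangle[OF L2_diff[OF Sg g2] g2] by simp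
  also have "l2norm (\<lambda>p. S (T n) g p - g p) \<le> 1" using d(2)[OF T(1) \<open>T n < d\<close>] by simp
  finally show False using n by simp
qed

text \<open>Advance in steps of d/2, strictly shorter than the interval on which the bound near zero
  holds; each step costs one factor \<open>M\<close>.\<close>

lemma C0_locally_bounded:
  obtains M where "M \<ge> 1" "\<And>t h. 0 \<le> t \<Longrightarrow> t \<le> \<tau> \<Longrightarrow> h \<in> L20 \<Longrightarrow> l2norm (S t h) \<le> M * l2norm h"
proof -
  obtain M d where M: "M \<ge> 1" and d: "d > 0" and Md: "\<And>t h. 0 < t \<Longrightarrow> t < d \<Longrightarrow> h \<in> L20 \<Longrightarrow> l2norm (S t h) \<le> M * l2norm h"
    using C0_bounded_near_0 by blast
  have b: "l2norm (S t h) \<le> M ^ Suc n * l2norm h" if "0 \<le> t" "t \<le> real n * (d / 2)" "h \<in> L20" for n t h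
    using that
  proof (induction n arbitrary: t h)
    case 0
    then have "l2norm (S t h) = 1 * l2norm h"
      using l2norm_fc_cong[OF C0_L2[of 0 h] L20_L2[of h] C0_zero[of h]] by simp
    also have "\<dots> \<le> M ^ Suc 0 * l2norm h" using M by (intro mult_right_mono l2norm_nonneg) simp
    finally show ?case .
  next
    case (Suc n)
    show ?case
    proof (cases "t \<le> real n * (d / 2)")
      case True
      have "l2norm (S t h) \<le> M ^ Suc n * l2norm h" by (rule Suc.IH[OF Suc.prems(1) True Suc.prems(3)])
      also have "\<dots> \<le> M ^ Suc (Suc n) * l2norm h" using M by (intro mult_right_mono l2norm_nonneg power_increasing) auto
      finally show ?thesis .
    next
      case False
      define r where "r = t - real n * (d / 2)"
      have r: "0 < r" "r < d" using False Suc.prems(2) d by (auto simp: r_def algebra_simps)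
      have n0: "0 \<le> real n * (d / 2)" using d by simp
      have "l2norm (S t h) = l2norm (S r (S (real n * (d / 2)) h))"
        using l2norm_fc_cong[OF C0_L2[OF Suc.prems(1,3)] C0_L2[OF less_imp_le[OF r(1)] C0_L20[OF n0 Suc.prems(3)]]]
          C0_add[OF less_imp_le[OF r(1)] n0 Suc.prems(3)] by (simp add: r_def)
      also have "\<dots> \<le> M * l2norm (S (real n * (d / 2)) h)" by (rule Md[OF r C0_L20[OF n0 Suc.prems(3)]])
      also have "\<dots> \<le> M * (M ^ Suc n * l2norm h)" using M by (intro mult_left_mono Suc.IH[OF n0 order_refl Suc.prems(3)]) simp
      finally show ?thesis by (simp add: mult.assoc)
    qed
  qed
  obtain n :: nat where "\<tau> / (d / 2) < real n" using reals_Archimedean2 by blast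
  then have n: "\<tau> \<le> real n * (d / 2)" using d by (simp add: field_simps)
  show thesis
    by (rule that[of "M ^ Suc n"]) (use M n in \<open>auto intro!: one_le_power b simp del: power_Suc\<close>)
qed

lemma C0_increment:
  assumes s: "0 \<le> s" and h: "0 \<le> h" and f: "f \<in> L20" and g: "g \<in> L20"
  shows "l2norm (\<lambda>p. S (s + h) f p - S s f p - of_real h * S s g p) = l2norm (S s (\<lambda>p. S h f p - f p - of_real h * g p))"
proof (rule l2norm_fc_cong)
  let ?u = "\<lambda>p. 1 * S h f p + (- 1) * f p"
  have u: "?u \<in> L20" by (intro L20_combination C0_L20 h f)
  have sh: "s + h \<ge> 0" using s h by simp
  show "(\<lambda>p. S (s + h) f p - S s f p - of_real h * S s g p) \<in> L2" by (intro L2_diff L2_cmult C0_L2 sh s f g)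
  have eq: "(\<lambda>p. S h f p - f p - of_real h * g p) = (\<lambda>p. 1 * ?u p + (- of_real h) * g p)" by simp
  show "S s (\<lambda>p. S h f p - f p - of_real h * g p) \<in> L2" unfolding eq by (intro C0_L2 s L20_combination[OF u g])
  show "fc (\<lambda>p. S (s + h) f p - S s f p - of_real h * S s g p) m = fc (S s (\<lambda>p. S h f p - f p - of_real h * g p)) m" for m
    unfolding eq C0_linear[OF s u g] C0_linear[OF s C0_L20[OF h f] f]
      fc_diff[OF L2_diff[OF C0_L2[OF sh f] C0_L2[OF s f]] L2_cmult[OF C0_L2[OF s g]]]
      fc_diff[OF C0_L2[OF sh f] C0_L2[OF s f]] fc_cmult C0_add[OF s h f] by simp
qed

text \<open>\<open>S s\<close> commutes with the difference quotient at 0 and is bounded on the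
  remainder.\<close>

lemma C0_generator_invariant:
  assumes fg: "(f, g) \<in> generator S" and s: "s \<ge> 0" shows "(S s f, S s g) \<in> generator S"
proof -
  have f: "f \<in> L20" and g: "g \<in> L20"
    and lim: "\<And>e. e > 0 \<Longrightarrow> \<exists>d>0. \<forall>t. 0 < t \<longrightarrow> t < d \<longrightarrow> l2norm (\<lambda>p. S t f p - f p - of_real t * g p) \<le> e * t"
    using fg unfolding generator_iff by blast+
  obtain M where M: "M \<ge> 1" "\<And>t h. 0 \<le> t \<Longrightarrow> t \<le> s \<Longrightarrow> h \<in> L20 \<Longrightarrow> l2norm (S t h) \<le> M * l2norm h"
    using C0_locally_bounded[of s] by blast
  show ?thesis unfolding generator_iff
  proof (intro conjI allI impI C0_L20[OF s] f g)
    fix e :: real assume e: "e > 0"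
    then have "e / M > 0" using M(1) by simp
    then obtain d where d: "d > 0" "\<And>t. 0 < t \<Longrightarrow> t < d \<Longrightarrow> l2norm (\<lambda>p. S t f p - f p - of_real t * g p) \<le> e / M * t"
      using lim by blast
    have "l2norm (\<lambda>p. S t (S s f) p - S s f p - of_real t * S s g p) \<le> e * t" if t: "0 < t" "t < d" for t
    proof -
      have t0: "t \<ge> 0" using t by simp
      have ts: "s + t \<ge> 0" "t + s = s + t" using s t0 by simp_all
      have w: "(\<lambda>p. S t f p - f p - of_real t * g p) \<in> L20"
        using L20_combination[OF L20_diff[OF C0_L20[OF t0 f] f] g, of 1 "- of_real t"] by simp
      have "l2norm (\<lambda>p. S t (S s f) p - S s f p - of_real t * S s g p) = l2norm (\<lambda>p. S (s + t) f p - S s f p - of_real t * S s g p)"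
      proof (rule l2norm_fc_cong)
        note A = C0_L2[OF t0 C0_L20[OF s f]] and B = C0_L2[OF s f] and D = L2_cmult[OF C0_L2[OF s g], of "of_real t"]
          and E = C0_L2[OF ts(1) f]
        show "(\<lambda>p. S t (S s f) p - S s f p - of_real t * S s g p) \<in> L2" "(\<lambda>p. S (s + t) f p - S s f p - of_real t * S s g p) \<in> L2"
          by (intro L2_diff A B D E)+
        show "fc (\<lambda>p. S t (S s f) p - S s f p - of_real t * S s g p) m = fc (\<lambda>p. S (s + t) f p - S s f p - of_real t * S s g p) m" for m
          unfolding fc_diff[OF L2_diff[OF A B] D] fc_diff[OF A B] fc_diff[OF L2_diff[OF E B] D] fc_diff[OF E B]
          using C0_add[OF t0 s f, of m] by (simp add: ts(2))
      qed
      also have "\<dots> = l2norm (S s (\<lambda>p. S t f p - f p - of_real t * g p))" by (rule C0_increment[OF s t0 f g])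
      also have "\<dots> \<le> M * l2norm (\<lambda>p. S t f p - f p - of_real t * g p)" by (rule M(2)[OF s order_refl w])
      also have "\<dots> \<le> M * (e / M * t)" using M(1) by (intro mult_left_mono d(2)[OF t]) simp
      also have "\<dots> = e * t" using M(1) by simp
      finally show ?thesis .
    qed
    then show "\<exists>d>0. \<forall>t. 0 < t \<longrightarrow> t < d \<longrightarrow> l2norm (\<lambda>p. S t (S s f) p - S s f p - of_real t * S s g p) \<le> e * t"
      using d(1) by blast
  qed
qed

text \<open>The generator only knows a right derivative at time 0. For y < t the increment is taken
  from \<open>y\<close> onwards, which puts \<open>S y g\<close> in place of \<open>S t g\<close>;
  the discrepancy is small by strong continuity at \<open>g\<close>, and the bound uniform on
  \<open>{0..t}\<close> makes both errors independent of \<open>y\<close>.\<close>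

lemma C0_coordinate_deriv:
  assumes fg: "(f, g) \<in> generator S" and t: "t \<ge> 0"
  shows "((\<lambda>s. fc (S s f) m) has_vector_derivative fc (S t g) m) (at t within {0..})"
proof -
  have f: "f \<in> L20" and g: "g \<in> L20"
    and lim: "\<And>e. e > 0 \<Longrightarrow> \<exists>d>0. \<forall>t. 0 < t \<longrightarrow> t < d \<longrightarrow> l2norm (\<lambda>p. S t f p - f p - of_real t * g p) \<le> e * t"
    using fg unfolding generator_iff by blast+
  obtain M where M: "M \<ge> 1" "\<And>s h. 0 \<le> s \<Longrightarrow> s \<le> t \<Longrightarrow> h \<in> L20 \<Longrightarrow> l2norm (S s h) \<le> M * l2norm h"
    using C0_locally_bounded[of t] by blast
  have step: "cmod (fc (S (s + h) f) m - fc (S s f) m - of_real h * fc (S s g) m) \<le> M * l2norm (\<lambda>p. S h f p - f p - of_real h * g p)"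
    if s: "0 \<le> s" "s \<le> t" "0 \<le> h" for s h
  proof -
    have sh: "s + h \<ge> 0" using s by simp
    note A = C0_L2[OF sh f] and B = C0_L2[OF s(1) f] and D = L2_cmult[OF C0_L2[OF s(1) g], of "of_real h"]
    have w: "(\<lambda>p. S h f p - f p - of_real h * g p) \<in> L20"
      using L20_combination[OF L20_diff[OF C0_L20[OF s(3) f] f] g, of 1 "- of_real h"] by simp
    have "cmod (fc (S (s + h) f) m - fc (S s f) m - of_real h * fc (S s g) m)
        = cmod (fc (\<lambda>p. S (s + h) f p - S s f p - of_real h * S s g p) m)"
      by (simp only: fc_diff[OF L2_diff[OF A B] D] fc_diff[OF A B] fc_cmult)
    also have "\<dots> \<le> l2norm (\<lambda>p. S (s + h) f p - S s f p - of_real h * S s g p)"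
      by (rule fc_le_l2norm[OF L2_diff[OF L2_diff[OF A B] D]])
    also have "\<dots> \<le> M * l2norm (\<lambda>p. S h f p - f p - of_real h * g p)"
      unfolding C0_increment[OF s(1,3) f g] by (rule M(2)[OF s(1,2) w])
    finally show ?thesis .
  qed
  show ?thesis unfolding has_vector_derivative_def has_derivative_within_alt
  proof (intro conjI allI impI bounded_linear_scaleR_left)
    fix e :: real assume e: "e > 0"
    define \<epsilon> where "\<epsilon> = e / (2 * M)"
    have ep: "\<epsilon> > 0" "M * \<epsilon> = e / 2" using e M(1) by (auto simp: \<epsilon>_def)
    obtain d1 where d1: "d1 > 0" "\<And>h. 0 < h \<Longrightarrow> h < d1 \<Longrightarrow> l2norm (\<lambda>p. S h f p - f p - of_real h * g p) \<le> \<epsilon> * h"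
      using lim[OF ep(1)] by blast
    obtain d2 where d2: "d2 > 0" "\<And>h. 0 < h \<Longrightarrow> h < d2 \<Longrightarrow> l2norm (\<lambda>p. S h g p - g p) < \<epsilon>"
      using C0_continuous[OF g ep(1)] by metis
    have "norm (fc (S y f) m - fc (S t f) m - (y - t) *\<^sub>R fc (S t g) m) \<le> e * norm (y - t)"
      if y: "y \<in> {0..}" "norm (y - t) < min d1 d2" for y
    proof (cases y t rule: linorder_cases)
      case equal then show ?thesis by simp
    next
      case greater
      have "cmod (fc (S (t + (y - t)) f) m - fc (S t f) m - of_real (y - t) * fc (S t g) m) \<le> M * (\<epsilon> * (y - t))"
        by (rule order_trans[OF step mult_left_mono[OF d1(2)]]) (use t greater y M(1) in auto)
      also have "\<dots> = e / 2 * (y - t)" using ep(2) by (simp add: mult.assoc[symmetric])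
      also have "\<dots> \<le> e * norm (y - t)" using e greater by simp
      finally show ?thesis by (simp add: scaleR_conv_of_real)
    next
      case less
      define h where "h = t - y"
      have h: "0 < h" "h < d1" "h < d2" "y + h = t" using less y by (auto simp: h_def)
      have y0: "0 \<le> y" "y \<le> t" using y less by auto
      have h0: "h \<ge> 0" using h by simp
      have a: "cmod (fc (S t f) m - fc (S y f) m - of_real h * fc (S y g) m) \<le> M * (\<epsilon> * h)"
        using order_trans[OF step[OF y0 h0] mult_left_mono[OF d1(2)[OF h(1,2)]]] M(1) by (simp add: h(4))
      have b: "cmod (fc (S t g) m - fc (S y g) m) \<le> M * \<epsilon>"
      proof -
        have "fc (S t g) m - fc (S y g) m = fc (\<lambda>p. S y (S h g) p - S y g p) m"
          unfolding fc_diff[OF C0_L2[OF y0(1) C0_L20[OF h0 g]] C0_L2[OF y0(1) g]]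
          using C0_add[OF y0(1) h0 g, of m] by (simp add: h(4))
        also have "cmod \<dots> \<le> l2norm (\<lambda>p. S y (S h g) p - S y g p)"
          by (intro fc_le_l2norm L2_diff C0_L2 C0_L20 y0 h0 g)
        also have "\<dots> \<le> M * l2norm (\<lambda>p. S h g p - g p)"
          unfolding C0_norm_diff[OF y0(1) C0_L20[OF h0 g] g] by (intro M(2) y0 L20_diff C0_L20 h0 g)
        also have "\<dots> \<le> M * \<epsilon>" using M(1) d2(2)[OF h(1,3)] by (intro mult_left_mono) auto
        finally show ?thesis .
      qed
      have "fc (S y f) m - fc (S t f) m - (y - t) *\<^sub>R fc (S t g) m
          = of_real h * (fc (S t g) m - fc (S y g) m) - (fc (S t f) m - fc (S y f) m - of_real h * fc (S y g) m)"
        by (simp add: h_def scaleR_conv_of_real algebra_simps)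
      also have "cmod \<dots> \<le> cmod (of_real h * (fc (S t g) m - fc (S y g) m)) + cmod (fc (S t f) m - fc (S y f) m - of_real h * fc (S y g) m)"
        by (rule norm_triangle_ineq4)
      also have "\<dots> \<le> h * (M * \<epsilon>) + M * (\<epsilon> * h)"
        by (rule add_mono[OF _ a]) (use mult_left_mono[OF b h0] h0 in \<open>simp add: norm_mult\<close>)
      also have "\<dots> = 2 * (M * \<epsilon>) * h" by simp
      also have "\<dots> = e * h" unfolding ep(2) by simp
      finally show ?thesis using h(1) by (simp add: h_def)
    qed
    then show "\<exists>d>0. \<forall>y\<in>{0..}. norm (y - t) < d \<longrightarrow> norm (fc (S y f) m - fc (S t f) m - (y - t) *\<^sub>R fc (S t g) m) \<le> e * norm (y - t)"
      using d1(1) d2(1) by (intro exI[of _ "min d1 d2"]) auto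
  qed
qed

end

text \<open>For domain elements the local bound on the semigroup supplies the boundedness that
  \<open>sol_unique\<close> asks for. The general case follows by density, since at the given time
  both evolutions are bounded in the norm of L^2.\<close>

lemma generated_coefficients:
  assumes a: "\<bar>\<alpha>\<bar> \<ge> 1" "rate * sqrt \<bar>\<alpha>\<bar> \<ge> 4"
    and S: "generates (opL \<alpha>) S" and f: "f \<in> L20" and t: "t \<ge> 0"
  shows "fc (S t f) m = ev \<alpha> t (fc f) m"
proof -
  have C: "C0_semigroup S" and G: "generator S = opL \<alpha>" using S by (auto simp: generates_def)
  obtain M where M: "M \<ge> 1" "\<And>s h. 0 \<le> s \<Longrightarrow> s \<le> t \<Longrightarrow> h \<in> L20 \<Longrightarrow> l2norm (S s h) \<le> M * l2norm h"
    using C0_locally_bounded[OF C, of t] by blast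
  have dom: "fc (S t h) m = ev \<alpha> t (fc h) m" if hg: "(h, g) \<in> opL \<alpha>" for h g
  proof (cases m)
    case (Pair l k)
    have h: "h \<in> L20" using hg by (simp add: opL_iff)
    show ?thesis
    proof (cases "l = 0")
      case True then show ?thesis using C0_L20[OF C t h] by (simp add: Pair L20_iff ev_def)
    next
      case False
      have "fc (S t h) (l, k) = sol l (\<alpha> * of_int l) (\<lambda>k. fc (S 0 h) (l, k)) t k"
      proof (rule sol_unique[OF False t, where x = "\<lambda>s k. fc (S s h) (l, k)"])
        fix k s assume s: "0 \<le> s" "s \<le> t"
        have "(S s h, S s g) \<in> opL \<alpha>" using C0_generator_invariant[OF C _ s(1), of h g] hg unfolding G by blast
        then have "fc (S s g) (l, k) = lat l (\<alpha> * of_int l) (\<lambda>k. fc (S s h) (l, k)) k" using False by (simp add: opL_iff)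
        then show "((\<lambda>s. fc (S s h) (l, k)) has_vector_derivative lat l (\<alpha> * of_int l) (\<lambda>k. fc (S s h) (l, k)) k) (at s within {0..})"
          using C0_coordinate_deriv[OF C _ s(1), of h g "(l, k)"] hg unfolding G by simp
        show "cmod (fc (S s h) (l, k)) \<le> M * l2norm h"
          using fc_le_l2norm[OF C0_L2[OF C s(1) h], of "(l, k)"] M(2)[OF s h] by linarith
      qed
      then show ?thesis using False by (simp add: Pair ev_def C0_zero[OF C h])
    qed
  qed
  define K where "K = M + sqrt (growth \<alpha>)"
  have K: "K > 0" using M(1) growth_ge[of \<alpha>] by (simp add: K_def add_pos_nonneg)
  have "cmod (fc (S t f) m - ev \<alpha> t (fc f) m) \<le> 0 + e" if e: "e > 0" for e
  proof -
    have "e / K > 0" using e K by simp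
    then obtain h g where hg: "(h, g) \<in> opL \<alpha>" and fh: "l2norm (\<lambda>p. f p - h p) < e / K" using dense_domain[OF f] by metis
    have h: "h \<in> L20" using hg by (simp add: opL_iff)
    note f2 = L20_L2[OF f] and h2 = L20_L2[OF h]
    have x: "cmod (fc (S t f) m - fc (S t h) m) \<le> M * l2norm (\<lambda>p. f p - h p)"
    proof -
      have "cmod (fc (S t f) m - fc (S t h) m) \<le> l2norm (\<lambda>p. S t f p - S t h p)"
        using fc_le_l2norm[OF L2_diff[OF C0_L2[OF C t f] C0_L2[OF C t h]], of m]
        by (simp only: fc_diff[OF C0_L2[OF C t f] C0_L2[OF C t h]])
      also have "\<dots> \<le> M * l2norm (\<lambda>p. f p - h p)"
        unfolding C0_norm_diff[OF C t f h] by (rule M(2)[OF t order_refl L20_diff[OF f h]])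
      finally show ?thesis .
    qed
    have y: "cmod (ev \<alpha> t (fc h) m - ev \<alpha> t (fc f) m) \<le> sqrt (growth \<alpha>) * l2norm (\<lambda>p. f p - h p)"
    proof -
      note A = sg_coefficients(1)[OF a f2 t] and B = sg_coefficients(1)[OF a h2 t]
      have "cmod (ev \<alpha> t (fc h) m - ev \<alpha> t (fc f) m) = cmod (fc (\<lambda>p. sg \<alpha> t f p - sg \<alpha> t h p) m)"
        by (simp only: fc_diff[OF A B] sg_coefficients(2)[OF a f2 t] sg_coefficients(2)[OF a h2 t] norm_minus_commute)
      also have "\<dots> \<le> l2norm (\<lambda>p. sg \<alpha> t f p - sg \<alpha> t h p)" by (rule fc_le_l2norm[OF L2_diff[OF A B]])
      also have "\<dots> \<le> sqrt (growth \<alpha>) * l2norm (\<lambda>p. f p - h p)" by (rule sg_diff[OF a f2 h2 t])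
      finally show ?thesis .
    qed
    have "cmod (fc (S t f) m - ev \<alpha> t (fc f) m) \<le> cmod (fc (S t f) m - fc (S t h) m) + cmod (ev \<alpha> t (fc h) m - ev \<alpha> t (fc f) m)"
      unfolding dom[OF hg] using norm_triangle_ineq[of "fc (S t f) m - ev \<alpha> t (fc h) m" "ev \<alpha> t (fc h) m - ev \<alpha> t (fc f) m"] by simp
    also have "\<dots> \<le> K * l2norm (\<lambda>p. f p - h p)" using x y by (simp add: K_def distrib_right)
    also have "\<dots> \<le> K * (e / K)" using K fh by (intro mult_left_mono) auto
    also have "\<dots> = 0 + e" using K by simp
    finally show ?thesis .
  qed
  then have "cmod (fc (S t f) m - ev \<alpha> t (fc f) m) \<le> 0" by (rule field_le_epsilon)
  then show ?thesis by simp
qed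

section \<open>Norms of the projected parts and the final estimates\<close>

lemma sqn_slice:
  fixes u :: "int \<Rightarrow> complex"
  shows "sqn (\<lambda>(j, k). if j = l then u k else 0) = sqn u"
proof -
  let ?g = "\<lambda>(j, k). if j = l then u k else 0"
  have "sqn ?g = (\<Sum>\<^sub>\<infinity>m\<in>range (Pair l). (cmod (?g m))\<^sup>2)"
    unfolding sqn_def by (rule infsum_cong_neutral) auto
  also have "\<dots> = (\<Sum>\<^sub>\<infinity>k. (cmod (u k))\<^sup>2)"
    by (subst infsum_reindex) (auto simp: inj_on_def o_def)
  finally show ?thesis by (simp add: sqn_def)
qed

lemma sqn_single: "sqn (\<lambda>k :: int. if k = 0 then z else 0) = (cmod z)\<^sup>2"
proof -
  have "sqn (\<lambda>k :: int. if k = 0 then z else 0) = (\<Sum>\<^sub>\<infinity>k\<in>{0 :: int}. (cmod (if k = 0 then z else 0))\<^sup>2)"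
    unfolding sqn_def by (rule infsum_cong_neutral) auto
  then show ?thesis by simp
qed

text \<open>Links the two descriptions of the critical mode: the zero of the energy weight and the
  modes deleted by the projection Q.\<close>

lemma square_sum_one: "(l :: int) \<noteq> 0 \<Longrightarrow> l\<^sup>2 + k\<^sup>2 = 1 \<longleftrightarrow> (l, k) \<in> crit"
proof -
  assume l: "l \<noteq> 0"
  have "k = 0 \<and> l\<^sup>2 = 1" if "l\<^sup>2 + k\<^sup>2 = 1"
  proof -
    have "l\<^sup>2 > 0" using l by simp
    then have "k\<^sup>2 \<le> 0" using that by linarith
    then show ?thesis using that by simp
  qed
  then show ?thesis by (auto simp: crit_def power2_eq_1_iff)
qed

lemma QP_norm:
  assumes h: "h \<in> L20" and l: "l \<noteq> 0"
  shows "l2norm (Q (P l h)) = 2 * pi * sqrt (sqn (qz l (\<lambda>k. fc h (l, k))))"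
proof -
  note P = P_L20[OF L20_L2[OF h] l]
  have "fc (Q (P l h)) = (\<lambda>(j, k). if j = l then qz l (\<lambda>k. fc h (l, k)) k else 0)"
  proof (rule ext)
    fix m :: "int \<times> int" obtain j k where m: "m = (j, k)" by (cases m)
    show "fc (Q (P l h)) m = (\<lambda>(j, k). if j = l then qz l (\<lambda>k. fc h (l, k)) k else 0) m"
      unfolding m Q_projection(2)[OF P] P_L2(2)[OF L20_L2[OF h]] by (simp add: qz_def square_sum_one[OF l])
  qed
  then show ?thesis unfolding l2norm_sqn[OF Q_projection(1)[OF P]] by (simp only: sqn_slice)
qed

lemma PQ_norm:
  assumes h: "h \<in> L20" and l: "\<bar>l\<bar> = 1"
  shows "l2norm (\<lambda>p. P l h p - Q (P l h) p) = 2 * pi * cmod (fc h (l, 0))"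
proof -
  have l0: "l \<noteq> 0" using l by auto
  note P = P_L20[OF L20_L2[OF h] l0]
  have lc: "(l, k) \<in> crit \<longleftrightarrow> k = 0" for k using l by (auto simp: crit_def abs_if split: if_splits)
  have "fc (\<lambda>p. P l h p - Q (P l h) p) = (\<lambda>(j, k). if j = l then (if k = 0 then fc h (l, 0) else 0) else 0)"
  proof (rule ext)
    fix m :: "int \<times> int" obtain j k where m: "m = (j, k)" by (cases m)
    show "fc (\<lambda>p. P l h p - Q (P l h) p) m = (\<lambda>(j, k). if j = l then (if k = 0 then fc h (l, 0) else 0) else 0) m"
      unfolding m fc_diff[OF L20_L2[OF P] Q_projection(1)[OF P]] Q_projection(2)[OF P] P_L2(2)[OF L20_L2[OF h]]
      using lc by auto
  qed
  then show ?thesis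
    unfolding l2norm_sqn[OF L2_diff[OF L20_L2[OF P] Q_projection(1)[OF P]]] by (simp add: sqn_slice[of l "\<lambda>k. if k = 0 then fc h (l, 0) else 0"] sqn_single)
qed

lemma scaled_sqrt_bound:
  assumes "x \<le> K * y" "K \<le> E\<^sup>2" "E \<ge> 0" "y \<ge> 0"
  shows "2 * pi * sqrt x \<le> E * (2 * pi * sqrt y)"
proof -
  have "x \<le> E\<^sup>2 * y" using assms(1) mult_right_mono[OF assms(2,4)] by linarith
  then have "sqrt x \<le> sqrt (E\<^sup>2 * y)" by (rule real_sqrt_le_mono)
  also have "\<dots> = E * sqrt y" using assms(3) by (simp add: real_sqrt_mult)
  finally have "2 * pi * sqrt x \<le> 2 * pi * (E * sqrt y)" by (rule mult_left_mono) simp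
  then show ?thesis by (simp add: mult_ac)
qed

theorem theorem3p12:
  "\<exists>C c \<alpha>0 :: real. C > 0 \<and> c > 0 \<and> \<alpha>0 > 0 \<and>
     (\<forall>\<alpha>::real. \<bar>\<alpha>\<bar> \<ge> \<alpha>0 \<longrightarrow>
        (\<exists>S. generates (opL \<alpha>) S) \<and>
        (\<forall>S. generates (opL \<alpha>) S \<longrightarrow>
           (\<forall>l::int. \<forall>f\<in>L20. l \<noteq> 0 \<longrightarrow>
              (\<forall>t>0. l2norm (Q (P l (S t f)))
                 \<le> 2 * exp (- (1/2) * (2 * (real_of_int l)\<^sup>2 - 1) * t) * l2norm (Q (P l f))) \<and>
              (\<forall>t\<ge>\<bar>\<alpha> * real_of_int l\<bar> powr (- (1/2)). l2norm (Q (P l (S t f)))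
                 \<le> C * exp (- c * \<bar>\<alpha> * real_of_int l\<bar> powr (1/2) * t) * l2norm (Q (P l f))) \<and>
              (\<bar>l\<bar> = 1 \<longrightarrow>
                 (\<forall>t>0. l2norm (\<lambda>p. P l (S t f) p - Q (P l (S t f)) p)
                    \<le> C * \<bar>\<alpha>\<bar> powr (1/3) * \<bar>ln \<bar>\<alpha>\<bar>\<bar> * exp (- t / 2) * l2norm (Q (P l f))
                      + exp (- t) * l2norm (\<lambda>p. P l f p - Q (P l f) p))))))"
proof -
  define C where "C = 128 / rate + 14"
  \<comment> \<open>The bound 3 exceeds e, which gives
    \<open>ln \<bar>\<alpha>\<bar> \<ge> 1\<close>; the other entry gives
    \<open>rate * sqrt \<bar>\<alpha>\<bar> \<ge> 4\<close>, the largeness condition in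
    \<open>zero_mode_bound\<close>.\<close>
  define \<alpha>0 where "\<alpha>0 = max 3 ((4 / rate)\<^sup>2)"
  have C2: "C \<ge> 2" using rate_bounds(1) by (simp add: C_def)
  have main: "(\<exists>S. generates (opL \<alpha>) S) \<and>
        (\<forall>S. generates (opL \<alpha>) S \<longrightarrow>
           (\<forall>l::int. \<forall>f\<in>L20. l \<noteq> 0 \<longrightarrow>
              (\<forall>t>0. l2norm (Q (P l (S t f)))
                 \<le> 2 * exp (- (1/2) * (2 * (real_of_int l)\<^sup>2 - 1) * t) * l2norm (Q (P l f))) \<and>
              (\<forall>t\<ge>\<bar>\<alpha> * real_of_int l\<bar> powr (- (1/2)). l2norm (Q (P l (S t f)))
                 \<le> C * exp (- (rate / 2) * \<bar>\<alpha> * real_of_int l\<bar> powr (1/2) * t) * l2norm (Q (P l f))) \<and>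
              (\<bar>l\<bar> = 1 \<longrightarrow>
                 (\<forall>t>0. l2norm (\<lambda>p. P l (S t f) p - Q (P l (S t f)) p)
                    \<le> C * \<bar>\<alpha>\<bar> powr (1/3) * \<bar>ln \<bar>\<alpha>\<bar>\<bar> * exp (- t / 2) * l2norm (Q (P l f))
                      + exp (- t) * l2norm (\<lambda>p. P l f p - Q (P l f) p)))))"
    if al: "\<bar>\<alpha>\<bar> \<ge> \<alpha>0" for \<alpha>
  proof (intro conjI allI ballI impI)
    have a3: "\<bar>\<alpha>\<bar> \<ge> 3" and ar: "\<bar>\<alpha>\<bar> \<ge> (4 / rate)\<^sup>2" using al by (auto simp: \<alpha>0_def)
    have a1: "\<bar>\<alpha>\<bar> \<ge> 1" using a3 by simp
    have a2: "rate * sqrt \<bar>\<alpha>\<bar> \<ge> 4"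
    proof -
      have "4 / rate \<le> sqrt \<bar>\<alpha>\<bar>" by (rule real_le_rsqrt[OF ar])
      from mult_left_mono[OF this, of rate] show ?thesis using rate_bounds(1) by simp
    qed
    have ln1: "\<bar>ln \<bar>\<alpha>\<bar>\<bar> \<ge> 1"
    proof -
      have "exp 1 \<le> \<bar>\<alpha>\<bar>" using exp_le a3 by linarith
      then have "1 \<le> ln \<bar>\<alpha>\<bar>" using a3 by (subst ln_ge_iff) auto
      then show ?thesis by simp
    qed
    show "\<exists>S. generates (opL \<alpha>) S"
      using sg_C0[OF a1 a2] sg_generator[OF a1 a2] by (intro exI[of _ "sg \<alpha>"]) (simp add: generates_def)
    fix S and l :: int and f
    assume S: "generates (opL \<alpha>) S" and f: "f \<in> L20" and l: "l \<noteq> 0"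
    let ?b = "\<alpha> * real_of_int l" and ?c = "\<lambda>k. fc f (l, k)"
    have e: "ell2 ?c" by (rule sqn_slices(1)[OF bessel(1)[OF L20_L2[OF f]]])
    have b1: "\<bar>?b\<bar> \<ge> 1"
      using mult_mono[OF a1 abs_int_ge_1[OF l]] by (simp add: abs_mult)
    have CS: "C0_semigroup S" using S by (simp add: generates_def)
    have St: "(\<lambda>k. fc (S t f) (l, k)) = sol l ?b ?c t" "S t f \<in> L20" if "t \<ge> 0" for t
      using generated_coefficients[OF a1 a2 S f that] ev_slice[OF l, of \<alpha> t "fc f"] C0_L20[OF CS that f] by simp_all
    have QS: "l2norm (Q (P l (S t f))) = 2 * pi * sqrt (sqn (qz l (sol l ?b ?c t)))" if "t \<ge> 0" for t
      unfolding QP_norm[OF St(2)[OF that] l] St(1)[OF that] ..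
    note QF = QP_norm[OF f l]
    {
      fix t :: real assume "t > 0"
      then have t: "t \<ge> 0" by simp
      show "l2norm (Q (P l (S t f))) \<le> 2 * exp (- (1/2) * (2 * (real_of_int l)\<^sup>2 - 1) * t) * l2norm (Q (P l f))"
        unfolding QS[OF t] QF
      proof (rule scaled_sqrt_bound[OF qz_heat_decay(2)[OF l e t]])
        have "(2 * exp (- (1/2) * (2 * (real_of_int l)\<^sup>2 - 1) * t))\<^sup>2 = 4 * exp (- 2 * (real_of_int l)\<^sup>2 * t + t)"
          unfolding power_mult_distrib exp_double[symmetric] by (simp add: algebra_simps)
        moreover have "exp (- 2 * (real_of_int l)\<^sup>2 * t) \<le> exp (- 2 * (real_of_int l)\<^sup>2 * t + t)" using t by simp
        moreover have "exp (- 2 * (real_of_int l)\<^sup>2 * t) \<ge> 0" by simp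
        ultimately show "2 * exp (- 2 * (real_of_int l)\<^sup>2 * t) \<le> (2 * exp (- (1/2) * (2 * (real_of_int l)\<^sup>2 - 1) * t))\<^sup>2"
          by linarith
      qed (simp_all add: sqn_nonneg)
    next
      fix t assume "\<bar>\<alpha> * real_of_int l\<bar> powr (- (1/2)) \<le> t"
      then have t: "t \<ge> 0" using powr_ge_zero order_trans by blast
      \<comment> \<open>Taking square roots halves the exponent and turns 4 into 2, whence the final
        constant c = \<open>rate / 2\<close>; the 2 is absorbed into \<open>C\<close>.\<close>
      have "2 * pi * sqrt (sqn (qz l (sol l ?b ?c t))) \<le> 2 * exp (- (rate / 2) * sqrt \<bar>?b\<bar> * t) * (2 * pi * sqrt (sqn (qz l ?c)))"
      proof (rule scaled_sqrt_bound[OF qz_enhanced_decay[OF l e t b1]])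
        show "4 * exp (- rate * sqrt \<bar>?b\<bar> * t) \<le> (2 * exp (- (rate / 2) * sqrt \<bar>?b\<bar> * t))\<^sup>2"
          unfolding power_mult_distrib exp_double[symmetric] by simp
      qed (simp_all add: sqn_nonneg)
      also have "\<dots> \<le> C * exp (- (rate / 2) * sqrt \<bar>?b\<bar> * t) * (2 * pi * sqrt (sqn (qz l ?c)))"
        using C2 by (intro mult_right_mono) (simp_all add: sqn_nonneg)
      finally show "l2norm (Q (P l (S t f))) \<le> C * exp (- (rate / 2) * \<bar>\<alpha> * real_of_int l\<bar> powr (1/2) * t) * l2norm (Q (P l f))"
        unfolding QS[OF t] QF by (simp only: powr_half_sqrt[OF abs_ge_zero])
    next
      fix t :: real assume l1: "\<bar>l\<bar> = 1" and "t > 0"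
      then have t: "t \<ge> 0" by simp
      have bl: "\<bar>?b\<bar> = \<bar>\<alpha>\<bar>" using l1 by (auto simp: abs_if split: if_splits)
      have z: "cmod (sol l ?b ?c t 0) \<le> exp (- t) * (cmod (?c 0) + C * (\<bar>\<alpha>\<bar> powr (1/3)) * sqrt (sqn (qz l ?c)))"
        using zero_mode_bound[OF l1 e t, of ?b] a1 a2 unfolding bl C_def by blast
      have L: "l2norm (\<lambda>p. P l (S t f) p - Q (P l (S t f)) p) = 2 * pi * cmod (sol l ?b ?c t 0)"
        unfolding PQ_norm[OF St(2)[OF t] l1] using fun_cong[OF St(1)[OF t], of 0] by simp
      let ?A = "C * \<bar>\<alpha>\<bar> powr (1/3)" and ?Y = "2 * pi * sqrt (sqn (qz l ?c))"
      have AY: "?A \<ge> 0" "?Y \<ge> 0" using C2 by (simp_all add: sqn_nonneg)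
      have "2 * pi * cmod (sol l ?b ?c t 0) \<le> 2 * pi * (exp (- t) * (cmod (?c 0) + ?A * sqrt (sqn (qz l ?c))))"
        by (rule mult_left_mono[OF z]) simp
      also have "\<dots> = ?A * 1 * exp (- t) * ?Y + exp (- t) * (2 * pi * cmod (?c 0))" by (simp add: algebra_simps)
      also have "\<dots> \<le> ?A * \<bar>ln \<bar>\<alpha>\<bar>\<bar> * exp (- t / 2) * ?Y + exp (- t) * (2 * pi * cmod (?c 0))"
      proof -
        have ex: "exp (- t) \<le> exp (- t / 2)" using t by simp
        have A1: "?A * 1 \<le> ?A * \<bar>ln \<bar>\<alpha>\<bar>\<bar>" by (rule mult_left_mono[OF ln1 AY(1)])
        have "?A * 1 * exp (- t) \<le> ?A * \<bar>ln \<bar>\<alpha>\<bar>\<bar> * exp (- t / 2)"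
          by (rule mult_mono[OF A1 ex mult_nonneg_nonneg[OF AY(1) abs_ge_zero] exp_ge_zero])
        from mult_right_mono[OF this AY(2)] show ?thesis by (rule add_right_mono)
      qed
      finally show "l2norm (\<lambda>p. P l (S t f) p - Q (P l (S t f)) p)
          \<le> C * \<bar>\<alpha>\<bar> powr (1/3) * \<bar>ln \<bar>\<alpha>\<bar>\<bar> * exp (- t / 2) * l2norm (Q (P l f))
            + exp (- t) * l2norm (\<lambda>p. P l f p - Q (P l f) p)"
        unfolding L QF PQ_norm[OF f l1] .
    }
  qed
  have pos: "C > 0" "rate / 2 > 0" "\<alpha>0 > 0" using C2 rate_bounds(1) by (auto simp: \<alpha>0_def)
  show ?thesis
    by (rule exI[of _ C], rule exI[of _ "rate / 2"], rule exI[of _ \<alpha>0], rule conjI[OF pos(1)],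
      rule conjI[OF pos(2)], rule conjI[OF pos(3)], rule allI, rule impI, erule main)
qed

end
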